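(* Let $p$ take values in an infinite set of primes of the form $p=x^2+27y^2$ for $x,y\in\mathbb{Z}$ (depending on $p$) such that $y^2(\log p)^3/p\to0$ as $p\to\infty$. For each $p$, let $D$ be the union of three (distinct) cyclotomic classes of $\mathbb{F}_p$ of order six, let $f$ be a characteristic polynomial of $D$, and let $r,t$ be integers with $t\ge0$ (depending on $p$). Let $R$ and $T>0$ be real. If $r/p\to R$ and $t/p\to T$, then the following hold as $p\to\infty$: (i) If, for each $p$, $D$ is of Paley type or $\frac{p-1}{6}$ is even, then $F(f_{r,t})\to\varphi_1(R,T)$. (ii) If, for each $p$, $D$ is of Hall type and $\frac{p-1}{6}$ is odd, then $F(f_{r,t})\to\varphi_{1/9}(R,T)$.
   Context: Merit factor: for $f\in\mathbb{C}[z]$ and $1\le\alpha<\infty$ put $\|f\|_\alpha=\left(\frac{1}{2\pi}\int_0^{2\pi}|f(e^{i\phi})|^\alpha\,d\phi\right)^{1/\alpha}$. The merit factor of $f$ is $F(f)=\frac{\|f\|_2^4}{\|f\|_4^4-\|f\|_2^4}$, provided that the denominator is nonzero. Cyclotomic classes: for a positive integer $m$ and a prime $p\equiv1\pmod m$, fix a primitive element $\omega$ of $\mathbb{F}_p$. Let $C_0$ be the set of $m$-th powers in $\mathbb{F}_p^*$ and $C_s=\omega^sC_0$ for $s\in\mathbb{Z}$. The sets $C_0,\dots,C_{m-1}$ partition $\mathbb{F}_p^*$ and are called the cyclotomic classes of $\mathbb{F}_p$ of order $m$. (Primes of the form $x^2+27y^2$ are congruent to $1$ modulo $6$.) Types: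 let $D$ be a union of three cyclotomic classes of order six. If there is a $\gamma\in\mathbb{F}_p^*$ such that $\gamma D$ equals $C_0\cup C_2\cup C_4$ or $C_0\cup C_1\cup C_2$, then $D$ is said to be of Paley type. Otherwise, $D$ is said to be of Hall type. Characteristic polynomials: for $D\subseteq\mathbb{F}_p$ put $\mathbf{1}_D(y)=1$ for $y\in D$ and $\mathbf{1}_D(y)=-1$ for $y\in\mathbb{F}_p\setminus D$. Fix a generator $v\in\mathbb{F}_p^*$ of the additive group of $\mathbb{F}_p$. For integers $r,t$ with $t\ge0$, put $f_{r,t}(z)=\sum_{j=0}^{t-1}\mathbf{1}_D((j+r)v)z^j$. The polynomial $f=f_{0,p}$ is called a characteristic polynomial of $D$ (it depends on the choice of $v$), and $f_{r,t}$ denotes the associated polynomial formed with the same $v$. The function $\varphi_\nu$: for real $\nu$, $R\in\mathbb{R}$ and $T>0$, $$\frac{1}{\varphi_\nu(R,T)}=1-\frac{2(1+\nu)T}{3}+4\sum_{m=1}^{\infty}\max\Big(0,1-\frac{m}{T}\Big)^2+\nu\sum_{m\in\mathbb{Z}}\max\Big(0,1-\Big|1+\frac{2R-m}{T}\Big|\Big)^2$$ (here $m$ is a summation index). *)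

theory Defs
  imports
    "HOL-Analysis.Analysis"
    "HOL-Number_Theory.Residues"
    "HOL-Algebra.Generated_Groups"
    "HOL-Computational_Algebra.Polynomial"
begin

text \<open>
  The field with \<open>p\<close> elements is \<^const>\<open>residue_ring\<close>, with carrier \<open>{0..p-1}\<close> of type \<^typ>\<open>int\<close>;
  \<^const>\<open>mult_of\<close> of it is its group of nonzero elements under multiplication.
\<close>

abbreviation Fp :: "nat \<Rightarrow> int ring" where
  "Fp p \<equiv> residue_ring (int p)"

abbreviation Fp_star :: "nat \<Rightarrow> int monoid" where
  "Fp_star p \<equiv> mult_of (Fp p)"

definition primitive_element :: "nat \<Rightarrow> int \<Rightarrow> bool" where
  "primitive_element p \<omega> \<longleftrightarrow>
     \<omega> \<in> carrier (Fp_star p) \<and> generate (Fp_star p) {\<omega>} = carrier (Fp_star p)"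

definition additive_generator :: "nat \<Rightarrow> int \<Rightarrow> bool" where
  "additive_generator p v \<longleftrightarrow>
     v \<in> carrier (Fp_star p) \<and> generate (add_monoid (Fp p)) {v} = carrier (Fp p)"


definition cyclotomic_class :: "nat \<Rightarrow> nat \<Rightarrow> int \<Rightarrow> int \<Rightarrow> int set" where
  "cyclotomic_class p m \<omega> s =
     {(\<omega> [^]\<^bsub>Fp_star p\<^esub> s) \<otimes>\<^bsub>Fp_star p\<^esub> (x [^]\<^bsub>Fp_star p\<^esub> m) | x. x \<in> carrier (Fp_star p)}"

definition union_of_three_sextic_classes :: "nat \<Rightarrow> int \<Rightarrow> int set \<Rightarrow> bool" where
  "union_of_three_sextic_classes p \<omega> D \<longleftrightarrow>
     (\<exists>\<C> \<subseteq> range (cyclotomic_class p 6 \<omega>). card \<C> = 3 \<and> D = \<Union>\<C>)"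

definition paley_type :: "nat \<Rightarrow> int \<Rightarrow> int set \<Rightarrow> bool" where
  "paley_type p \<omega> D \<longleftrightarrow>
     union_of_three_sextic_classes p \<omega> D \<and>
     (let C = cyclotomic_class p 6 \<omega> in
       \<exists>\<gamma> \<in> carrier (Fp_star p).
         (\<lambda>d. \<gamma> \<otimes>\<^bsub>Fp p\<^esub> d) ` D = C 0 \<union> C 2 \<union> C 4 \<or>
         (\<lambda>d. \<gamma> \<otimes>\<^bsub>Fp p\<^esub> d) ` D = C 0 \<union> C 1 \<union> C 2)"

definition hall_type :: "nat \<Rightarrow> int \<Rightarrow> int set \<Rightarrow> bool" where
  "hall_type p \<omega> D \<longleftrightarrow> union_of_three_sextic_classes p \<omega> D \<and> \<not> paley_type p \<omega> D"


definition sign_indicator :: "int set \<Rightarrow> int \<Rightarrow> complex" where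
  "sign_indicator D y = (if y \<in> D then 1 else -1)"

text \<open>
  The polynomial \<open>f\<^sub>r\<^sub>,\<^sub>t\<close> associated with \<open>D\<close> and \<open>v\<close>; the characteristic polynomial of \<open>D\<close> with
  respect to \<open>v\<close> is the case \<open>r = 0\<close>, \<open>t = p\<close>.
\<close>

definition shifted_char_poly :: "nat \<Rightarrow> int set \<Rightarrow> int \<Rightarrow> int \<Rightarrow> nat \<Rightarrow> complex poly" where
  "shifted_char_poly p D v r t =
     (\<Sum>j<t. Polynomial.monom (sign_indicator D (((int j + r) * v) mod int p)) j)"


definition L_norm :: "real \<Rightarrow> complex poly \<Rightarrow> real" where
  "L_norm \<alpha> f =
     (1 / (2 * pi) * integral {0..2 * pi} (\<lambda>\<theta>. cmod (poly f (cis \<theta>)) powr \<alpha>)) powr (1 / \<alpha>)"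

text \<open>
  The merit factor is only meaningful when the denominator is nonzero; otherwise the value here
  is \<open>0\<close>. Convergence to a nonzero limit forces the denominator to be eventually nonzero.
\<close>

definition merit_factor :: "complex poly \<Rightarrow> real" where
  "merit_factor f = L_norm 2 f ^ 4 / (L_norm 4 f ^ 4 - L_norm 2 f ^ 4)"

text \<open>For \<open>T > 0\<close> both sums below have only finitely many nonzero terms.\<close>

definition phi_nu :: "real \<Rightarrow> real \<Rightarrow> real \<Rightarrow> real" where
  "phi_nu \<nu> R T =
     1 / (1 - 2 * (1 + \<nu>) * T / 3
          + 4 * (\<Sum>\<^sub>\<infinity>m\<in>{1::nat..}. (max 0 (1 - real m / T))\<^sup>2)
          + \<nu> * (\<Sum>\<^sub>\<infinity>m\<in>(UNIV :: int set). (max 0 (1 - \<bar>1 + (2 * R - real_of_int m) / T\<bar>))\<^sup>2))"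

end

(*
  Parseval turns the fourth norm of the polynomial into a sum over triples of frequencies of
  correlations of the finite Fourier transform of the sign sequence, weighted by a kernel of total
  mass O(p^3 (log p)^4). Up to O(p^2 sqrt p) a correlation depends only on how its four frequencies
  coincide: expressing the transform through Gauss sums, this is the joint equidistribution of the
  classes of k + a for distinct shifts a, a Weil-type bound obtained by Stepanov's method. The
  Jacobi sums of order six show that the transform has modulus sqrt p + O(|y|), and the coincidences
  contribute Riemann sums that converge to the two series in 1/phi; the coefficient nu is the squared
  correlation of the set of classes with its image under multiplication by -1.
*)

theory Submission
  imports Defs "HOL-Real_Asymp.Real_Asymp"
begin

hide_const (open) up_ring.coeff up_ring.monom Module.smult

text \<open>The averages of V, |V|^2 and V^2 over the six classes (V the transform on nonzero
  frequencies) are exact: they follow from Parseval for the sign sequence, without Gauss sums. They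
  settle every triple of frequency differences except (0,0,0), where the fourth moment of |V|
  appears and a flat spectrum is required; the size of y enters there, multiplied by the number of
  additive quadruples, about 2 t^3 / 3. Off the origin, an error p^2 sqrt p against the kernel mass,
  divided by p^4, gives p^(3/2) (log p)^4, small beside t^2, so square-root cancellation with any
  constant is enough. Stepanov's method provides only upper bounds for level sets; as the level sets
  of a character exhaust nearly all residues, upper bounds for all of them yield lower bounds. The
  obstacle is order six: the powers F^(gi) must be independent over polynomials sparse in base p.
  This is read off from orders of vanishing, but F may have no root of multiplicity coprime to 6.
  Polynomials over the field are represented by integer polynomials up to
  \<open>pzero\<close>.\<close>

section \<open>Integer polynomials modulo p: orders of vanishing and sparse polynomials\<close>

definition pzero :: "nat \<Rightarrow> int poly \<Rightarrow> bool" where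
  "pzero p F \<longleftrightarrow> (\<forall>n. int p dvd coeff F n)"

lemma pzero_iff_dvd: "pzero p F \<longleftrightarrow> [:int p:] dvd F"
  by (simp add: pzero_def const_poly_dvd_iff)

lemma pzero_0 [simp]: "pzero p 0"
  by (simp add: pzero_def)

lemma pzero_add: "pzero p F \<Longrightarrow> pzero p G \<Longrightarrow> pzero p (F + G)"
  by (simp add: pzero_def)

lemma pzero_diff: "pzero p F \<Longrightarrow> pzero p G \<Longrightarrow> pzero p (F - G)"
  by (simp add: pzero_def)

lemma pzero_uminus: "pzero p (- F) \<longleftrightarrow> pzero p F"
  by (simp add: pzero_def)

lemma pzero_mult: "pzero p F \<Longrightarrow> pzero p (G * F)"
  by (simp add: pzero_iff_dvd)

lemma pzero_sum: "(\<And>i. i \<in> I \<Longrightarrow> pzero p (F i)) \<Longrightarrow> pzero p (\<Sum>i\<in>I. F i)"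
  by (auto simp: pzero_def coeff_sum intro!: dvd_sum)

text \<open>Gauss's lemma: a prime number stays a prime element of Z[x].\<close>

lemma pzero_mult_iff:
  assumes "prime p" shows "pzero p (F * G) \<longleftrightarrow> pzero p F \<or> pzero p G"
proof -
  have "prime_elem [:int p:]"
    using assms by (intro lift_prime_elem_poly) simp
  thus ?thesis by (simp add: pzero_iff_dvd prime_elem_dvd_mult_iff)
qed

lemma pzero_power_iff:
  assumes "prime p" shows "pzero p (F ^ n) \<longleftrightarrow> pzero p F \<and> n > 0"
proof (induction n)
  case 0
  have "\<not> pzero p 1" using prime_gt_1_nat[OF assms]
    by (auto simp: pzero_def intro!: exI[of _ 0])
  thus ?case by simp
next
  case (Suc n)
  thus ?case by (auto simp: pzero_mult_iff[OF assms])
qed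

lemma pzero_pcompose: "pzero p F \<Longrightarrow> pzero p (F \<circ>\<^sub>p G)"
  unfolding pzero_iff_dvd by (auto simp: dvd_def pcompose_smult)

lemma pzero_poly: "pzero p F \<Longrightarrow> int p dvd poly F x"
  unfolding pzero_iff_dvd by (auto simp: dvd_def)

definition shift :: "int \<Rightarrow> int poly \<Rightarrow> int poly" where
  "shift a F = F \<circ>\<^sub>p [:a, 1:]"

lemma shift_simps [simp]:
  "shift a (F + G) = shift a F + shift a G" "shift a (F - G) = shift a F - shift a G"
  "shift a (F * G) = shift a F * shift a G" "shift a (F ^ n) = shift a F ^ n"
  "shift a (- F) = - shift a F" "shift a 0 = 0" "shift a 1 = 1"
  "shift a (smult c F) = smult c (shift a F)" "shift a [:c:] = [:c:]"
proof -
  show "shift a (F ^ n) = shift a F ^ n"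
    by (induction n) (simp_all add: shift_def pcompose_mult pcompose_1)
qed (simp_all add: shift_def pcompose_add pcompose_diff pcompose_mult
      pcompose_uminus pcompose_smult pcompose_1)

lemma shift_sum: "shift a (\<Sum>i\<in>I. F i) = (\<Sum>i\<in>I. shift a (F i))"
  by (simp add: shift_def pcompose_sum)

lemma shift_shift: "shift a (shift b F) = shift (a + b) F"
  by (simp add: shift_def pcompose_assoc[symmetric] pcompose_pCons add.commute)

lemma shift_0 [simp]: "shift 0 F = F"
  by (simp add: shift_def)

lemma shift_linear: "shift a [:c, 1:] = [:a + c, 1:]"
  by (simp add: shift_def pcompose_pCons add.commute)

lemma poly_shift: "poly (shift a F) x = poly F (a + x)"
  by (simp add: shift_def poly_pcompose add.commute)

lemma degree_shift [simp]: "degree (shift a F) = degree F"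
  by (simp add: shift_def degree_pcompose)

lemma pzero_shift [simp]: "pzero p (shift a F) \<longleftrightarrow> pzero p F"
  using pzero_pcompose[of p F "[:a,1:]"] pzero_pcompose[of p "shift a F" "[:-a,1:]"]
    shift_shift[of "-a" a F] by (auto simp: shift_def)

lemma pderiv_shift: "pderiv (shift a F) = shift a (pderiv F)"
  by (simp add: shift_def pderiv_pcompose pderiv_pCons)

text \<open>The order of vanishing at the residue \<open>a\<close> of the reduction of \<open>F\<close> modulo \<open>p\<close>
  (junk if that reduction is zero).\<close>

definition pord :: "nat \<Rightarrow> int \<Rightarrow> int poly \<Rightarrow> nat" where
  "pord p a F = (LEAST n. \<not> int p dvd coeff (shift a F) n)"

lemma pord_coeff: "\<not> pzero p F \<Longrightarrow> \<not> int p dvd coeff (shift a F) (pord p a F)"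
  unfolding pord_def using pzero_shift[of p a F] by (metis LeastI pzero_def)

lemma pord_below: "n < pord p a F \<Longrightarrow> int p dvd coeff (shift a F) n"
  unfolding pord_def using not_less_Least by blast

lemma pord_eqI:
  assumes "\<not> int p dvd coeff (shift a F) n" "\<And>k. k < n \<Longrightarrow> int p dvd coeff (shift a F) k"
  shows "pord p a F = n"
  unfolding pord_def by (rule Least_equality) (use assms in \<open>auto simp: not_less[symmetric]\<close>)

text \<open>The lowest coefficient of a product is the product of the lowest coefficients, and
  primality of p keeps it from vanishing; so \<open>pord\<close> behaves as a valuation.\<close>

lemma pord_mult:
  assumes "prime p" "\<not> pzero p F" "\<not> pzero p G"
  shows "pord p a (F * G) = pord p a F + pord p a G"
proof (rule pord_eqI)
  let ?m = "pord p a F" and ?n = "pord p a G"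
  let ?f = "coeff (shift a F)" and ?g = "coeff (shift a G)"
  have *: "int p dvd ?f i * ?g (k - i)" if "i \<le> k" "k \<le> ?m + ?n" "\<not> (i = ?m \<and> k = ?m + ?n)" for i k
  proof (cases "i < ?m")
    case False
    hence "k - i < ?n" using that by auto
    thus ?thesis using pord_below by auto
  qed (use pord_below in auto)
  show "int p dvd coeff (shift a (F * G)) k" if "k < ?m + ?n" for k
    unfolding shift_simps coeff_mult by (rule dvd_sum) (use * that in auto)
  show "\<not> int p dvd coeff (shift a (F * G)) (?m + ?n)"
  proof
    assume A: "int p dvd coeff (shift a (F * G)) (?m + ?n)"
    have "coeff (shift a (F * G)) (?m + ?n) = (\<Sum>i\<le>?m+?n. ?f i * ?g (?m + ?n - i))"
      by (simp add: coeff_mult)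
    also have "\<dots> = ?f ?m * ?g ?n + (\<Sum>i\<in>{..?m+?n}-{?m}. ?f i * ?g (?m + ?n - i))"
      by (subst sum.remove[of _ ?m]) auto
    finally have "int p dvd ?f ?m * ?g ?n"
      using A * by (metis (no_types, lifting) DiffD1 DiffD2 atMost_iff dvd_add_left_iff dvd_sum order_refl singletonI)
    thus False using pord_coeff assms by (metis prime_dvd_mult_iff prime_nat_int_transfer)
  qed
qed

lemma pord_power:
  assumes "prime p" "\<not> pzero p F"
  shows "pord p a (F ^ n) = n * pord p a F"
proof (induction n)
  case 0
  show ?case using prime_gt_1_nat[OF assms(1)] by (intro pord_eqI) auto
next
  case (Suc n)
  have "\<not> pzero p (F ^ n)" using assms by (simp add: pzero_power_iff)
  thus ?case using Suc by (simp add: pord_mult[OF assms])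
qed

lemma pord_add_distinct:
  assumes "\<not> pzero p F" "pord p a F < pord p a G"
  shows "pord p a (F + G) = pord p a F"
proof (rule pord_eqI)
  show "\<not> int p dvd coeff (shift a (F + G)) (pord p a F)"
    using pord_coeff[OF assms(1)] pord_below[OF assms(2)] by (simp add: dvd_add_left_iff)
  show "int p dvd coeff (shift a (F + G)) k" if "k < pord p a F" for k
    using that assms(2) by (auto intro!: dvd_add pord_below)
qed

lemma pord_cong:
  assumes "pzero p (F - G)" shows "pord p a F = pord p a G"
proof -
  have "pzero p (shift a F - shift a G)" using assms by (metis pzero_shift shift_simps(2))
  hence "int p dvd coeff (shift a F) n \<longleftrightarrow> int p dvd coeff (shift a G) n" for n
    unfolding pzero_def by (metis coeff_diff dvd_diff_commute dvd_diff_left_iff dvd_minus_iff dvd_diff_right_iff)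
  thus ?thesis by (simp add: pord_def)
qed

text \<open>At the smallest order that occurs, exactly one term has a coefficient not divisible by
  p, and nothing can cancel it. The independence proofs below rest on this.\<close>

lemma sum_distinct_pord_nonzero:
  assumes "finite I" "i0 \<in> I" "\<not> pzero p (G i0)"
    and inj: "\<And>i j. i \<in> I \<Longrightarrow> j \<in> I \<Longrightarrow> i \<noteq> j \<Longrightarrow> \<not> pzero p (G i) \<Longrightarrow> \<not> pzero p (G j) \<Longrightarrow>
        pord p a (G i) \<noteq> pord p a (G j)"
  shows "\<not> pzero p (\<Sum>i\<in>I. G i)"
proof -
  let ?I = "{i\<in>I. \<not> pzero p (G i)}"
  have "finite ?I" "?I \<noteq> {}" using assms by auto
  then obtain i where i: "i \<in> ?I" "\<And>j. j \<in> ?I \<Longrightarrow> pord p a (G i) \<le> pord p a (G j)"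
    using ex_is_arg_min_if_finite[of ?I "\<lambda>i. pord p a (G i)"] unfolding is_arg_min_def
    by (metis linorder_not_less)
  let ?n = "pord p a (G i)"
  have *: "int p dvd coeff (shift a (G j)) ?n" if "j \<in> I - {i}" for j
  proof (cases "pzero p (G j)")
    case True thus ?thesis by (metis pzero_def pzero_shift)
  next
    case False
    hence "?n < pord p a (G j)" using i(2)[of j] inj[of i j] i(1) that by force
    thus ?thesis by (rule pord_below)
  qed
  have "coeff (shift a (\<Sum>i\<in>I. G i)) ?n = coeff (shift a (G i)) ?n + (\<Sum>j\<in>I-{i}. coeff (shift a (G j)) ?n)"
    unfolding shift_sum coeff_sum using i(1) assms(1) by (intro sum.remove) auto
  moreover have "int p dvd (\<Sum>j\<in>I-{i}. coeff (shift a (G j)) ?n)" by (intro dvd_sum *)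
  ultimately have "\<not> int p dvd coeff (shift a (\<Sum>i\<in>I. G i)) ?n"
    using pord_coeff[of p "G i" a] i(1) by (simp add: dvd_add_left_iff)
  thus ?thesis by (metis pzero_def pzero_shift)
qed

text \<open>Modulo \<open>p\<close>, the elements of \<open>sparse_polys p A\<close> are the polynomials
  \<open>\<Sum>\<^sub>j h\<^sub>j x\<^bsup>pj\<^esup>\<close> with \<open>degree h\<^sub>j < A\<close>; this description makes the closure under
  translation part of the definition.\<close>

definition sparse_polys :: "nat \<Rightarrow> nat \<Rightarrow> int poly set" where
  "sparse_polys p A = {F. \<forall>a n. A \<le> n mod p \<longrightarrow> int p dvd coeff (shift a F) n}"

lemma sparse_diff: "F \<in> sparse_polys p A \<Longrightarrow> G \<in> sparse_polys p A \<Longrightarrow> F - G \<in> sparse_polys p A"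
  by (auto simp: sparse_polys_def)

lemma sparse_smult: "F \<in> sparse_polys p A \<Longrightarrow> smult c F \<in> sparse_polys p A"
  by (auto simp: sparse_polys_def)

lemma sparse_sum: "(\<And>i. i \<in> I \<Longrightarrow> F i \<in> sparse_polys p A) \<Longrightarrow> (\<Sum>i\<in>I. F i) \<in> sparse_polys p A"
  by (auto simp: sparse_polys_def shift_sum coeff_sum intro!: dvd_sum)

lemma sparse_mono: "A \<le> B \<Longrightarrow> sparse_polys p A \<subseteq> sparse_polys p B"
  by (auto simp: sparse_polys_def)

lemma sparse_degree: "p > 0 \<Longrightarrow> degree F < A \<Longrightarrow> F \<in> sparse_polys p A"
proof -
  assume *: "p > 0" "degree F < A"
  { fix a n assume "A \<le> n mod p"
    hence "degree (shift a F) < n" using * mod_less_eq_dividend[of n p] by (metis degree_shift order_less_le_trans)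
    hence "coeff (shift a F) n = 0" by (rule coeff_eq_0) }
  thus ?thesis by (auto simp: sparse_polys_def)
qed

text \<open>Exponents are added in base p: when A + B - 1 <= p, the lowest digits add without a
  carry, so their sum stays below A + B - 1.\<close>

lemma sparse_mult:
  assumes "F \<in> sparse_polys p A" "G \<in> sparse_polys p B" "A + B \<le> Suc p" "A > 0" "B > 0" "p > 0"
  shows "F * G \<in> sparse_polys p (A + B - 1)"
  unfolding sparse_polys_def mem_Collect_eq
proof (intro allI impI)
  fix a n assume n: "A + B - 1 \<le> n mod p"
  have "int p dvd coeff (shift a F) i * coeff (shift a G) (n - i)" if "i \<le> n" for i
  proof (rule ccontr)
    assume "\<not> ?thesis"
    hence "\<not> int p dvd coeff (shift a F) i" "\<not> int p dvd coeff (shift a G) (n - i)" by auto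
    hence "i mod p < A" "(n - i) mod p < B" using assms(1,2) by (auto simp: sparse_polys_def not_le[symmetric])
    hence "i mod p + (n - i) mod p < A + B - 1" "i mod p + (n - i) mod p < p" using assms by auto
    moreover have "n mod p = (i mod p + (n - i) mod p) mod p" using that by (simp add: mod_add_eq)
    ultimately show False using n by simp
  qed
  thus "int p dvd coeff (shift a (F * G)) n" by (auto simp: coeff_mult intro!: dvd_sum)
qed

text \<open>Frobenius: (x + c)^p = x^p + c^p in characteristic p, and every translate has the same
  shape.\<close>

lemma sparse_linear_power_p:
  assumes "prime p" shows "[:c, 1:] ^ p \<in> sparse_polys p 1"
  unfolding sparse_polys_def mem_Collect_eq
proof (intro allI impI)
  fix a n assume n: "1 \<le> n mod p"
  let ?b = "a + c"
  have "coeff (shift a ([:c, 1:] ^ p)) n = coeff ([:?b, 1:] ^ p) n"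
    by (simp add: shift_linear)
  also have "\<dots> = (if n \<le> p then of_nat (p choose n) * ?b ^ (p - n) else 0)"
    by (auto simp: coeff_linear_poly_power intro!: coeff_eq_0 le_less_trans[OF degree_linear_power[THEN eq_refl]])
  finally have *: "coeff (shift a ([:c, 1:] ^ p)) n = (if n \<le> p then of_nat (p choose n) * ?b ^ (p - n) else 0)" .
  show "int p dvd coeff (shift a ([:c, 1:] ^ p)) n"
  proof (cases "n \<le> p")
    case True
    have "n \<noteq> 0" "n \<noteq> p" using n by (auto intro!: Nat.gr0I)
    hence "p dvd (p choose n)" using True assms by (intro dvd_choose_prime) auto
    thus ?thesis unfolding * by simp
  next
    case False
    show ?thesis unfolding * using False by simp
  qed
qed

lemma sparse_one: "prime p \<Longrightarrow> 1 \<in> sparse_polys p 1"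
  by (intro sparse_degree) (auto simp: prime_gt_0_nat)

lemma sparse1_mult: "prime p \<Longrightarrow> F \<in> sparse_polys p A \<Longrightarrow> G \<in> sparse_polys p 1 \<Longrightarrow> 0 < A \<Longrightarrow> A \<le> p \<Longrightarrow>
    F * G \<in> sparse_polys p A"
  using sparse_mult[of F p A G 1] by (auto simp: prime_gt_0_nat)

lemma sparse1_power: "prime p \<Longrightarrow> F \<in> sparse_polys p 1 \<Longrightarrow> F ^ n \<in> sparse_polys p 1"
  by (induction n) (auto simp: sparse_one[simplified] mult.commute Suc_leI prime_gt_0_nat intro!: sparse1_mult[simplified])

lemma sparse1_prod: "prime p \<Longrightarrow> (\<And>i. i \<in> I \<Longrightarrow> F i \<in> sparse_polys p 1) \<Longrightarrow> (\<Prod>i\<in>I. F i) \<in> sparse_polys p 1"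
  by (induction I rule: infinite_finite_induct)
     (auto simp: sparse_one[simplified] Suc_leI prime_gt_0_nat intro!: sparse1_mult[simplified])

text \<open>The lowest surviving coefficient at a has an exponent whose residue modulo p is below A.
  These gaps in the possible orders are what separates the terms of a relation later.\<close>

lemma sparse_pord:
  assumes "F \<in> sparse_polys p A" "\<not> pzero p F"
  shows "\<exists>n w. pord p a F = p * n + w \<and> w < A"
proof -
  have "pord p a F mod p < A" using pord_coeff[OF assms(2)] assms(1)
    by (metis (no_types, lifting) linorder_not_less mem_Collect_eq sparse_polys_def)
  thus ?thesis by (metis mult_div_mod_eq)
qed

section \<open>Stepanov's method\<close>

text \<open>Pigeonhole in place of linear algebra: there are p^|I| vectors of residues but only
  p^|E| vectors of values, and the difference of two colliding vectors solves the system.\<close>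

lemma linear_system_mod_prime:
  fixes a :: "'e \<Rightarrow> 'i \<Rightarrow> int"
  assumes p: "p > 1" and fin: "finite I" "finite E" and card: "card E < card I"
  shows "\<exists>c. (\<forall>e\<in>E. int p dvd (\<Sum>i\<in>I. a e i * c i)) \<and> (\<exists>i\<in>I. \<not> int p dvd c i)"
proof -
  let ?X = "I \<rightarrow>\<^sub>E {0..<int p}" and ?Y = "E \<rightarrow>\<^sub>E {0..<int p}"
  define h where "h c = (\<lambda>e\<in>E. (\<Sum>i\<in>I. a e i * c i) mod int p)" for c
  have "card ?Y < card ?X"
    using p card by (simp add: card_PiE fin)
  moreover have "h ` ?X \<subseteq> ?Y" using p by (auto simp: h_def)
  ultimately have "\<not> inj_on h ?X"
    using card_inj_on_le[of h ?X ?Y] fin by (auto simp: finite_PiE)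
  then obtain c d where cd: "c \<in> ?X" "d \<in> ?X" "h c = h d" "c \<noteq> d"
    by (auto simp: inj_on_def)
  obtain i where i: "i \<in> I" "c i \<noteq> d i" using cd by (meson PiE_ext)
  have "0 \<le> c i" "c i < int p" "0 \<le> d i" "d i < int p" using cd i by (auto simp: PiE_iff)
  hence "\<not> int p dvd c i - d i" using i zdvd_not_zless[of "\<bar>c i - d i\<bar>" "int p"] by auto
  moreover have "int p dvd (\<Sum>i\<in>I. a e i * (c i - d i))" if "e \<in> E" for e
  proof -
    have "h c e = h d e" using cd by simp
    hence "int p dvd (\<Sum>i\<in>I. a e i * c i) - (\<Sum>i\<in>I. a e i * d i)"
      using that by (simp add: h_def mod_eq_dvd_iff)
    thus ?thesis by (simp add: algebra_simps sum_subtractf)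
  qed
  ultimately show ?thesis using i(1) by (intro exI[of _ "\<lambda>i. c i - d i"]) auto
qed

text \<open>F0 d/dx replaces d/dx because it preserves the shape of the auxiliary polynomial; as F0
  is a unit at 0, its iterates control the same Taylor coefficients. The bound M <= p keeps the
  integer factors produced by differentiation invertible.\<close>

lemma coeffs_dvd_if_derivs_vanish:
  assumes p: "prime p" and F0: "\<not> int p dvd poly F0 0" and "M \<le> p"
    and "\<And>l. l < M \<Longrightarrow> int p dvd poly (((\<lambda>G. F0 * pderiv G) ^^ l) G) 0" and "n < M"
  shows "int p dvd coeff G n"
  using assms(3-5)
proof (induction M arbitrary: G n)
  case (Suc M)
  let ?t = "\<lambda>G. F0 * pderiv G"
  show ?case
  proof (cases n)
    case 0
    thus ?thesis using Suc.prems(2)[of 0] by (simp add: poly_0_coeff_0)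
  next
    case (Suc k)
    have IH: "int p dvd coeff (?t G) i" if "i < M" for i
    proof (rule Suc.IH)
      fix l assume "l < M"
      thus "int p dvd poly ((?t ^^ l) (?t G)) 0"
        using Suc.prems(2)[of "Suc l"] \<open>l < M\<close> unfolding funpow_Suc_right by simp
    qed (use Suc.prems that in auto)
    \<comment> \<open>Division by F0, whose constant term is a unit, as for power series.\<close>
    have D: "int p dvd coeff (pderiv G) i" if "i < M" for i
      using that
    proof (induction i rule: less_induct)
      case (less i)
      have "coeff (?t G) i = coeff F0 0 * coeff (pderiv G) i +
              (\<Sum>j\<in>{..i}-{0}. coeff F0 j * coeff (pderiv G) (i - j))"
        unfolding coeff_mult by (subst sum.remove[of _ 0]) auto
      moreover have "int p dvd (\<Sum>j\<in>{..i}-{0}. coeff F0 j * coeff (pderiv G) (i - j))"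
        using less by (intro dvd_sum dvd_mult less.IH) auto
      ultimately have "int p dvd coeff F0 0 * coeff (pderiv G) i"
        using IH[OF less.prems] by (metis dvd_add_left_iff)
      thus ?case using F0 p by (simp add: prime_dvd_mult_iff poly_0_coeff_0)
    qed
    have "int p dvd (int (Suc k)) * coeff G (Suc k)"
      using D[of k] Suc Suc.prems by (simp add: coeff_pderiv)
    moreover have "\<not> int p dvd int (Suc k)"
      using Suc Suc.prems by (simp only: int_dvd_int_iff) (auto dest!: dvd_imp_le)
    ultimately show ?thesis using p Suc by (simp only: prime_dvd_mult_iff prime_nat_int_transfer) simp
  qed
qed simp

lemma shift_funpow_deriv:
  "shift a (((\<lambda>G. F0 * pderiv G) ^^ l) G) = ((\<lambda>G. shift a F0 * pderiv G) ^^ l) (shift a G)"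
  by (induction l) (simp_all add: pderiv_shift[symmetric])

lemma pord_ge_if_derivs_vanish:
  assumes "prime p" "\<not> int p dvd poly F0 a" "M \<le> p" "\<not> pzero p G"
    and "\<And>l. l < M \<Longrightarrow> int p dvd poly (((\<lambda>G. F0 * pderiv G) ^^ l) G) a"
  shows "M \<le> pord p a G"
proof (rule ccontr)
  assume "\<not> ?thesis"
  hence "int p dvd coeff (shift a G) (pord p a G)"
    using assms by (intro coeffs_dvd_if_derivs_vanish[of p "shift a F0" M])
      (auto simp: poly_shift shift_funpow_deriv[symmetric])
  thus False using pord_coeff[OF assms(4)] by simp
qed

text \<open>Degrees cannot be compared directly, since Q may carry high coefficients divisible by p.
  The top index of Q that survives modulo p, added to \<open>degree P\<close>, is an index where Psi
  has a nonzero coefficient.\<close>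

lemma degree_ge_if_monic_factor:
  assumes p: "prime p" and P: "lead_coeff P = 1" and Psi: "pzero p (\<Psi> - P * Q)" "\<not> pzero p \<Psi>"
  shows "degree P \<le> degree \<Psi>"
proof -
  define S where "S = {n. \<not> int p dvd coeff Q n}"
  have "finite S"
    by (rule finite_subset[of _ "{..degree Q}"]) (auto simp: S_def intro: le_degree)
  moreover have "S \<noteq> {}"
  proof
    assume "S = {}"
    hence "pzero p Q" by (auto simp: S_def pzero_def)
    hence "pzero p (\<Psi> - P * Q + P * Q)" using Psi by (intro pzero_add pzero_mult)
    thus False using Psi by simp
  qed
  ultimately have n: "Max S \<in> S" "\<And>k. k > Max S \<Longrightarrow> k \<notin> S"
    using Max_in[of S] Max_ge[of S] by (blast, fastforce)
  let ?n = "Max S" and ?d = "degree P"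
  have "coeff (P * Q) (?d + ?n) = coeff P ?d * coeff Q ?n + (\<Sum>i\<in>{..?d+?n}-{?d}. coeff P i * coeff Q (?d + ?n - i))"
    unfolding coeff_mult by (subst sum.remove[of _ ?d]) auto
  moreover have "int p dvd (\<Sum>i\<in>{..?d+?n}-{?d}. coeff P i * coeff Q (?d + ?n - i))"
  proof (rule dvd_sum)
    fix i assume i: "i \<in> {..?d+?n}-{?d}"
    show "int p dvd coeff P i * coeff Q (?d + ?n - i)"
    proof (cases "i < ?d")
      case True
      hence "?d + ?n - i \<notin> S" by (intro n) auto
      thus ?thesis by (auto simp: S_def)
    next
      case False
      thus ?thesis using i by (simp add: coeff_eq_0)
    qed
  qed
  ultimately have "\<not> int p dvd coeff (P * Q) (?d + ?n)"
    using n(1) P by (simp add: S_def dvd_add_left_iff)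
  moreover have "int p dvd coeff \<Psi> (?d + ?n) - coeff (P * Q) (?d + ?n)"
    using Psi(1) by (simp add: pzero_def)
  ultimately have "coeff \<Psi> (?d + ?n) \<noteq> 0"
    by (metis diff_0 dvd_minus_iff)
  thus ?thesis using le_degree by fastforce
qed

lemma pord_ge_factor:
  assumes "prime p" "pzero p Q \<or> M \<le> pord p a Q"
  shows "\<exists>Q'. pzero p (Q - [:-a, 1:] ^ M * Q')"
proof -
  have *: "int p dvd coeff (shift a Q) n" if "n < M" for n
    using assms that pord_below[of n p a Q] by (metis order_less_le_trans pzero_def pzero_shift)
  let ?G = "shift a Q"
  have "?G = monom 1 M * poly_shift M ?G + poly_cutoff M ?G"
    by (intro poly_eqI) (auto simp: coeff_monom_mult coeff_poly_shift coeff_poly_cutoff not_le)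
  moreover have "pzero p (poly_cutoff M ?G)"
    using * by (auto simp: pzero_def coeff_poly_cutoff)
  ultimately have "pzero p (?G - monom 1 M * poly_shift M ?G)"
    by (metis add_diff_cancel_left')
  hence "pzero p (shift (-a) (?G - monom 1 M * poly_shift M ?G))" by (simp only: pzero_shift)
  moreover have "shift (-a) (monom 1 M) = [:-a, 1:] ^ M"
    by (simp add: monom_altdef shift_linear)
  ultimately show ?thesis by (auto simp: shift_shift)
qed

text \<open>The powers (X - x)^M for distinct residues x are split off one by one: the factors
  already removed are units at the next point, so the whole order there is carried by the
  cofactor.\<close>

lemma card_high_order_zeros:
  assumes p: "prime p" and Psi: "\<not> pzero p \<Psi>" and X: "X \<subseteq> {0..<int p}"
    and ord: "\<And>x. x \<in> X \<Longrightarrow> M \<le> pord p x \<Psi>"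
  shows "card X * M \<le> degree \<Psi>"
proof -
  have "finite X" using X finite_subset by blast
  hence "\<exists>Q. pzero p (\<Psi> - (\<Prod>x\<in>X. [:-x, 1:] ^ M) * Q)"
    using X ord
  proof (induction X rule: finite_induct)
    case empty
    show ?case by (intro exI[of _ \<Psi>]) simp
  next
    case (insert y X)
    then obtain Q where Q: "pzero p (\<Psi> - (\<Prod>x\<in>X. [:-x, 1:] ^ M) * Q)" by auto
    define P where "P = (\<Prod>x\<in>X. [:-x, 1:] ^ M)"
    have Py: "\<not> int p dvd poly P y"
    proof
      assume "int p dvd poly P y"
      hence "int p dvd (\<Prod>x\<in>X. (y - x) ^ M)" by (simp add: P_def poly_prod poly_power)
      then obtain x where x: "x \<in> X" "int p dvd (y - x) ^ M"
        using p insert.hyps by (auto simp: prime_dvd_prod_iff)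
      hence "int p dvd y - x" using p prime_dvd_power[of "int p"] by simp
      moreover have "x \<noteq> y" "0 \<le> x" "x < int p" "0 \<le> y" "y < int p" using insert x by auto
      moreover from this have "\<bar>y - x\<bar> < int p" by linarith
      ultimately show False using zdvd_not_zless[of "\<bar>y - x\<bar>" "int p"] by auto
    qed
    have "\<not> pzero p P" using Py pzero_poly by blast
    have "pord p y P = 0" using Py by (intro pord_eqI) (auto simp: poly_shift simp flip: poly_0_coeff_0)
    have ordQ: "pzero p Q \<or> M \<le> pord p y Q"
    proof (cases "pzero p Q")
      case False
      hence "pord p y \<Psi> = pord p y P + pord p y Q"
        using pord_mult[OF p \<open>\<not> pzero p P\<close> False] pord_cong[OF Q] by (simp add: P_def)
      thus ?thesis using \<open>pord p y P = 0\<close> insert.prems(2)[of y] by simp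
    qed simp
    then obtain Q' where Q': "pzero p (Q - [:-y, 1:] ^ M * Q')" using pord_ge_factor[OF p] by blast
    have "\<Psi> - P * [:-y, 1:] ^ M * Q' = (\<Psi> - P * Q) + P * (Q - [:-y, 1:] ^ M * Q')"
      by (simp add: algebra_simps)
    moreover have "pzero p \<dots>"
      unfolding P_def by (rule pzero_add[OF Q pzero_mult[OF Q']])
    ultimately have "pzero p (\<Psi> - P * [:-y, 1:] ^ M * Q')" by (simp only:)
    thus ?case using insert by (auto simp: P_def mult_ac)
  qed
  then obtain Q where "pzero p (\<Psi> - (\<Prod>x\<in>X. [:-x, 1:] ^ M) * Q)" by blast
  moreover have "lead_coeff (\<Prod>x\<in>X. [:-x, 1:] ^ M) = 1"
    by (simp add: lead_coeff_prod lead_coeff_power)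
  moreover have "degree (\<Prod>x\<in>X. [:-x, 1:] ^ M) = card X * M"
    by (simp add: degree_prod_eq_sum_degree degree_linear_power)
  ultimately show ?thesis using degree_ge_if_monic_factor[OF p _ _ Psi] by metis
qed

lemma smult_sum_right: "smult c (\<Sum>i\<in>I. f i) = (\<Sum>i\<in>I. smult c (f i))"
  by (induction I rule: infinite_finite_induct) (simp_all add: smult_add_right)

lemma pderiv_sum_int: "pderiv (\<Sum>i\<in>I. f i) = (\<Sum>i\<in>I. pderiv (f i :: int poly))"
  by (induction I rule: infinite_finite_induct) (simp_all add: pderiv_add)

text \<open>Stepanov's method: if \<open>H\<^sub>i \<mapsto> \<Sum>\<^sub>i F\<^bsup>gi\<^esup> H\<^sub>i\<close> is injective modulo \<open>p\<close> on sparse polynomials,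
  then a nonzero polynomial of this shape vanishing to order \<open>M\<close> on a level set of \<open>F\<^sup>g\<close>
  is found by counting the linear conditions.  The operator \<open>F\<^sub>0 d/dx\<close> acts on
  \<open>F\<^bsup>gi\<^esup> h x\<^bsup>pj\<^esup>\<close> by \<open>h \<mapsto> F\<^sub>0 h' + g i F\<^sub>1 h\<close>.\<close>

lemma stepanov:
  fixes F F0 F1 :: "int poly"
  assumes p: "prime p" and F1: "F0 * pderiv F = F1 * F"
    and deg: "degree F0 \<le> 4" "degree F1 \<le> 3"
    and indep: "\<And>H. (\<And>i. i < m \<Longrightarrow> H i \<in> sparse_polys p A) \<Longrightarrow> pzero p (\<Sum>i<m. F ^ (g * i) * H i) \<Longrightarrow>
        (\<And>i. i < m \<Longrightarrow> pzero p (H i))"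
    and count: "(\<Sum>l<M. A + 3 * l + J) < m * A * J" and "A \<le> p" "M \<le> p" "0 < A" "0 < J"
    and X: "X \<subseteq> {0..<int p}" "\<And>x. x \<in> X \<Longrightarrow> \<not> int p dvd poly F0 x"
      "\<And>x. x \<in> X \<Longrightarrow> [poly F x ^ g = \<zeta>] (mod int p)"
  shows "card X * M \<le> degree F * (g * (m - 1)) + A + p * (J - 1)"
proof -
  define \<Delta> where "\<Delta> i h = F0 * pderiv h + smult (int (g * i)) (F1 * h)" for i and h :: "int poly"
  have \<Delta>_add: "\<Delta> i (f + h) = \<Delta> i f + \<Delta> i h" and \<Delta>_smult: "\<Delta> i (smult c h) = smult c (\<Delta> i h)"
    and \<Delta>_0: "\<Delta> i 0 = 0" for i f h c
    by (simp_all add: \<Delta>_def pderiv_add pderiv_smult algebra_simps smult_add_right)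
  have \<Delta>l_add: "(\<Delta> i ^^ l) (f + h) = (\<Delta> i ^^ l) f + (\<Delta> i ^^ l) h"
    and \<Delta>l_smult: "(\<Delta> i ^^ l) (smult c h) = smult c ((\<Delta> i ^^ l) h)"
    and \<Delta>l_0: "(\<Delta> i ^^ l) 0 = 0" for i l f h c
    by (induction l) (simp_all add: \<Delta>_add \<Delta>_smult \<Delta>_0)
  have \<Delta>l_sum: "(\<Delta> i ^^ l) (\<Sum>k\<in>K. f k) = (\<Sum>k\<in>K. (\<Delta> i ^^ l) (f k))" for i l f and K :: "nat set"
    by (induction K rule: infinite_finite_induct) (simp_all add: \<Delta>l_add \<Delta>l_0)
  have \<Delta>_deg: "degree (\<Delta> i h) \<le> degree h + 3" for i h
  proof -
    have "degree (F0 * pderiv h) \<le> degree h + 3"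
    proof (cases "degree h = 0")
      case True
      then obtain c where "h = [:c:]" by (rule degree_eq_zeroE)
      thus ?thesis by (simp add: pderiv_pCons)
    next
      case False
      have "degree (F0 * pderiv h) \<le> degree F0 + (degree h - 1)"
        using degree_mult_le[of F0 "pderiv h"] by (simp add: degree_pderiv)
      thus ?thesis using False deg by simp
    qed
    moreover have "degree (smult (int (g * i)) (F1 * h)) \<le> degree h + 3"
      using degree_smult_le[of "int (g*i)" "F1 * h"] degree_mult_le[of F1 h] deg by linarith
    ultimately show ?thesis unfolding \<Delta>_def by (rule degree_add_le)
  qed
  have \<Delta>l_deg: "degree ((\<Delta> i ^^ l) h) \<le> degree h + 3 * l" for i l h
  proof (induction l)
    case (Suc l)
    thus ?case using \<Delta>_deg[of i "(\<Delta> i ^^ l) h"] by simp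
  qed simp
  \<comment> \<open>The unknowns are the coefficients of the polynomials h_ij of degree below A. The
    equations are all coefficients of \<open>R l\<close>, whose degree is below A + 3 l + J because
    each application of \<open>\<Delta>\<close> raises degrees by at most 3.\<close>
  define I where "I = {..<m} \<times> {..<J} \<times> {..<A}"
  define E where "E = Sigma {..<M} (\<lambda>l. {..<A + 3 * l + J})"
  define a where "a = (\<lambda>(l, n) (i, j, k).
    coeff (smult (\<zeta> ^ i) (monom 1 j * (\<Delta> i ^^ l) (monom 1 k))) n)"
  have "card E < card I" using count by (simp add: E_def I_def mult.assoc mult.commute[of J])
  then obtain c where c: "\<And>e. e \<in> E \<Longrightarrow> int p dvd (\<Sum>i\<in>I. a e i * c i)" and c0: "\<exists>i\<in>I. \<not> int p dvd c i"
    using linear_system_mod_prime[of p I E a] prime_gt_1_nat[OF p] by (auto simp: I_def E_def)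
  define h where "h i j = (\<Sum>k<A. monom (c (i, j, k)) k)" for i j
  \<comment> \<open>On the level set, F^(gi) = zeta^i and x^(pj) = x^j. So \<open>\<Theta> l\<close>
    below takes the values of this polynomial of much smaller degree, and asking \<open>R l\<close>
    to vanish identically costs few equations.\<close>
  define R where "R l = (\<Sum>i<m. \<Sum>j<J. smult (\<zeta> ^ i) (monom 1 j * (\<Delta> i ^^ l) (h i j)))" for l
  have h_deg: "degree (h i j) < A" for i j
    unfolding h_def using \<open>0 < A\<close>
    by (intro degree_sum_less) (auto intro: le_less_trans[OF degree_monom_le])
  have \<Delta>l_h: "(\<Delta> i ^^ l) (h i j) = (\<Sum>k<A. smult (c (i, j, k)) ((\<Delta> i ^^ l) (monom 1 k)))" for i l j
    unfolding h_def \<Delta>l_sum by (intro sum.cong refl) (simp flip: \<Delta>l_smult add: smult_monom)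
  have R_coeff: "coeff (R l) n = (\<Sum>i\<in>I. a (l, n) i * c i)" for l n
  proof -
    have "coeff (R l) n = (\<Sum>i<m. \<Sum>j<J. \<Sum>k<A. a (l, n) (i, j, k) * c (i, j, k))"
      unfolding R_def coeff_sum \<Delta>l_h sum_distrib_left
      by (intro sum.cong refl)
         (simp add: sum_distrib_left smult_sum_right coeff_sum a_def mult_ac)
    thus ?thesis by (simp add: I_def sum.cartesian_product)
  qed
  have R_zero: "pzero p (R l)" if l: "l < M" for l
    unfolding pzero_def
  proof
    fix n
    show "int p dvd coeff (R l) n"
    proof (cases "n < A + 3 * l + J")
      case True
      thus ?thesis using c[of "(l, n)"] l by (simp add: R_coeff E_def)
    next
      case False
      have "degree (R l) < A + 3 * l + J" unfolding R_def
      proof (intro degree_sum_less)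
        fix i j assume "j \<in> {..<J}"
        have "degree (smult (\<zeta> ^ i) (monom 1 j * (\<Delta> i ^^ l) (h i j))) \<le> j + (degree (h i j) + 3 * l)"
          by (rule order.trans[OF degree_smult_le]) 
             (metis (no_types, lifting) \<Delta>l_deg add_mono degree_monom_le degree_mult_le order_trans)
        thus "degree (smult (\<zeta> ^ i) (monom 1 j * (\<Delta> i ^^ l) (h i j))) < A + 3 * l + J"
          using \<open>j \<in> {..<J}\<close> h_deg[of i j] by auto
      qed (use \<open>0 < A\<close> in auto)
      thus ?thesis using False by (simp add: coeff_eq_0)
    qed
  qed
  define \<Theta> where "\<Theta> l = (\<Sum>i<m. F ^ (g * i) * (\<Sum>j<J. (\<Delta> i ^^ l) (h i j) * [:0,1:] ^ (p * j)))" for l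
  define H where "H i = (\<Sum>j<J. h i j * [:0,1:] ^ (p * j))" for i
  let ?t = "\<lambda>G. F0 * pderiv G"
  \<comment> \<open>The derivative of x^(pj) is divisible by p, so the operator acts only on F^(gi)
    and on the coefficient polynomial.\<close>
  have theta_step: "pzero p (?t (F ^ (g * i) * (f * [:0,1:] ^ (p * j))) - F ^ (g * i) * (\<Delta> i f * [:0,1:] ^ (p * j)))"
    for i j f
  proof -
    have dF: "F0 * pderiv (F ^ n) = smult (int n) (F1 * F ^ n)" for n
    proof (cases n)
      case (Suc k)
      have "F0 * pderiv (F ^ n) = smult (int n) (F ^ k * (F0 * pderiv F))"
        unfolding Suc pderiv_power_Suc by (simp only: mult_smult_left mult_smult_right mult_ac)
      thus ?thesis by (simp add: F1 Suc algebra_simps)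
    qed (simp add: pderiv_1)
    have dx: "pderiv ([:0,1:] ^ (p * j) :: int poly) = smult (int p) (smult (int j) ([:0,1:] ^ (p * j - 1)))"
    proof (cases "p * j")
      case (Suc k)
      have "int p * int j = int (Suc k)" using Suc by (metis of_nat_mult)
      thus ?thesis unfolding Suc pderiv_power_Suc by (simp add: pderiv_pCons)
    qed (auto simp: pderiv_1)
    define Y Z :: "int poly" where "Y = [:0,1:] ^ (p * j)" and "Z = smult (int j) ([:0,1:] ^ (p * j - 1))"
    have dY: "pderiv Y = smult (int p) Z" unfolding Y_def Z_def by (rule dx)
    have "?t (F ^ (g * i) * (f * Y)) =
       (F0 * pderiv (F ^ (g * i))) * (f * Y) + F ^ (g * i) * (F0 * pderiv f * Y)
       + F0 * F ^ (g * i) * f * pderiv Y"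
      unfolding pderiv_mult by (simp only: algebra_simps)
    also have "\<dots> = F ^ (g * i) * (\<Delta> i f * Y) + smult (int p) (F0 * F ^ (g * i) * f * Z)"
      unfolding dF dY \<Delta>_def
      by (simp only: distrib_left distrib_right mult_smult_left mult_smult_right mult_ac add_ac)
    finally show ?thesis unfolding Y_def[symmetric] by (simp add: pzero_def)
  qed
  have theta: "pzero p ((?t ^^ l) (\<Theta> 0) - \<Theta> l)" for l
  proof (induction l)
    case (Suc l)
    have "pzero p (?t ((?t ^^ l) (\<Theta> 0)) - ?t (\<Theta> l))"
    proof -
      have "pzero p (pderiv ((?t ^^ l) (\<Theta> 0) - \<Theta> l))"
        using Suc by (auto simp: pzero_def coeff_pderiv simp del: coeff_diff)
      hence "pzero p (F0 * pderiv ((?t ^^ l) (\<Theta> 0) - \<Theta> l))" by (rule pzero_mult)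
      thus ?thesis by (simp add: pderiv_diff algebra_simps)
    qed
    moreover have "pzero p (?t (\<Theta> l) - \<Theta> (Suc l))"
    proof -
      have "?t (\<Theta> l) - \<Theta> (Suc l) = (\<Sum>i<m. \<Sum>j<J. ?t (F ^ (g * i) * ((\<Delta> i ^^ l) (h i j) * [:0,1:] ^ (p * j)))
          - F ^ (g * i) * (\<Delta> i ((\<Delta> i ^^ l) (h i j)) * [:0,1:] ^ (p * j)))"
        by (simp add: \<Theta>_def sum_distrib_left pderiv_sum_int sum_subtractf)
      thus ?thesis by (simp only:) (intro pzero_sum theta_step)
    qed
    ultimately have "pzero p ((?t ((?t ^^ l) (\<Theta> 0)) - ?t (\<Theta> l)) + (?t (\<Theta> l) - \<Theta> (Suc l)))"
      by (rule pzero_add)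
    thus ?case by simp
  qed simp
  have \<Theta>0: "\<Theta> 0 = (\<Sum>i<m. F ^ (g * i) * H i)" by (simp add: \<Theta>_def H_def)
  have nz: "\<not> pzero p (\<Theta> 0)"
  proof
    assume Z: "pzero p (\<Theta> 0)"
    have "H i \<in> sparse_polys p A" for i
      unfolding H_def
    proof (rule sparse_sum)
      fix j
      have "h i j \<in> sparse_polys p A"
        using h_deg prime_gt_0_nat[OF p] by (intro sparse_degree) auto
      moreover have "[:0, 1:] ^ (p * j) \<in> sparse_polys p 1"
        unfolding power_mult by (rule sparse1_power[OF p sparse_linear_power_p[OF p]])
      ultimately show "h i j * [:0, 1:] ^ (p * j) \<in> sparse_polys p A"
        using \<open>0 < A\<close> \<open>A \<le> p\<close> by (intro sparse1_mult p)
    qed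
    hence HZ: "pzero p (H i)" if "i < m" for i using indep Z that unfolding \<Theta>0 by blast
    from c0 obtain i j k where ijk: "i < m" "j < J" "k < A" "\<not> int p dvd c (i, j, k)"
      by (auto simp: I_def)
    \<comment> \<open>As A <= p, the blocks h_ij x^(pj) occupy disjoint ranges of exponents, so a
      coefficient that is nonzero modulo p survives in \<open>H i\<close>.\<close>
    have "coeff (H i) (p * j + k) = (\<Sum>j'<J. if j' = j then c (i, j, k) else 0)"
      unfolding H_def coeff_sum
    proof (intro sum.cong refl)
      fix j' assume "j' \<in> {..<J}"
      have e: "h i j' * [:0,1:] ^ (p * j') = monom 1 (p * j') * h i j'" by (simp add: monom_altdef)
      have hc: "coeff (h i j') n = (if n < A then c (i, j', n) else 0)" for n
        by (simp add: h_def coeff_sum)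
      have "k < p" using ijk \<open>A \<le> p\<close> by simp
      show "coeff (h i j' * [:0,1:] ^ (p * j')) (p * j + k) = (if j' = j then c (i, j, k) else 0)"
      proof (cases j' j rule: linorder_cases)
        case less
        then obtain d where d: "j = j' + Suc d" using less_imp_Suc_add by force
        have "A \<le> p * j + k - p * j'" using \<open>A \<le> p\<close> by (simp add: d algebra_simps)
        thus ?thesis using less by (simp add: e coeff_monom_mult hc)
      next
        case greater
        then obtain d where d: "j' = j + Suc d" using less_imp_Suc_add by force
        have "p * j + k < p * j'" using \<open>k < p\<close> by (simp add: d algebra_simps)
        thus ?thesis using greater by (simp add: e coeff_monom_mult)
      next
        case equal
        show ?thesis using ijk unfolding equal e[unfolded equal] by (simp add: coeff_monom_mult hc[unfolded equal])
      qed
    qed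
    hence "coeff (H i) (p * j + k) = c (i, j, k)" using ijk by simp
    thus False using HZ[OF ijk(1)] ijk(4) unfolding pzero_def by metis
  qed
  have van: "int p dvd poly ((?t ^^ l) (\<Theta> 0)) x" if l: "l < M" and x: "x \<in> X" for l x
  proof -
    have xp: "[x ^ (p * j) = x ^ j] (mod int p)" for j
    proof -
      have "[x ^ p = x] (mod int p)"
      proof (cases "int p dvd x")
        case True
        hence "int p dvd x ^ p" using p by (simp add: prime_gt_0_nat dvd_power_same dvd_trans[OF _ dvd_power])
        thus ?thesis using True by (simp add: cong_def)
      next
        case False
        have "[x ^ (p - 1) = 1] (mod int p)"
          using fermat_theorem[of p "nat x"] False X(1) x p by (auto simp: cong_int_iff[symmetric] int_dvd_int_iff[symmetric])
        hence "[x ^ (p - 1) * x = 1 * x] (mod int p)" by (intro cong_mult cong_refl)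
        moreover have "x ^ (p - 1) * x = x ^ p"
          using prime_gt_0_nat[OF p] by (rule power_minus_mult)
        ultimately show ?thesis by simp
      qed
      thus ?thesis by (simp add: power_mult cong_pow)
    qed
    have "[poly (\<Theta> l) x = poly (R l) x] (mod int p)"
    proof -
      have "poly (\<Theta> l) x = (\<Sum>i<m. \<Sum>j<J. (poly F x ^ g) ^ i * (poly ((\<Delta> i ^^ l) (h i j)) x * x ^ (p * j)))"
        by (simp add: \<Theta>_def poly_sum sum_distrib_left poly_power power_mult)
      moreover have "poly (R l) x = (\<Sum>i<m. \<Sum>j<J. \<zeta> ^ i * (poly ((\<Delta> i ^^ l) (h i j)) x * x ^ j))"
        by (simp add: R_def poly_sum poly_monom mult_ac)
      moreover have "[(\<Sum>i<m. \<Sum>j<J. (poly F x ^ g) ^ i * (poly ((\<Delta> i ^^ l) (h i j)) x * x ^ (p * j)))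
         = (\<Sum>i<m. \<Sum>j<J. \<zeta> ^ i * (poly ((\<Delta> i ^^ l) (h i j)) x * x ^ j))] (mod int p)"
        using X(3)[OF x] by (intro cong_sum cong_mult cong_pow cong_refl xp)
      ultimately show ?thesis by simp
    qed
    moreover have "int p dvd poly (R l) x" using R_zero[OF l] by (rule pzero_poly)
    ultimately have "int p dvd poly (\<Theta> l) x" by (simp add: cong_dvd_iff)
    moreover have "int p dvd poly ((?t ^^ l) (\<Theta> 0) - \<Theta> l) x" using theta by (rule pzero_poly)
    ultimately show ?thesis by (simp add: dvd_diff_left_iff)
  qed
  have "card X * M \<le> degree (\<Theta> 0)"
    using p nz X(1)
  proof (rule card_high_order_zeros)
    fix x assume "x \<in> X"
    thus "M \<le> pord p x (\<Theta> 0)"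
      using p nz X van \<open>M \<le> p\<close> by (intro pord_ge_if_derivs_vanish[of p F0]) auto
  qed
  also have "degree (\<Theta> 0) \<le> degree F * (g * (m - 1)) + A + p * (J - 1)"
    unfolding \<Theta>0
  proof (rule degree_sum_le)
    fix i assume i: "i \<in> {..<m}"
    have 1: "degree (F ^ (g * i)) \<le> degree F * (g * (m - 1))"
      using i by (intro order.trans[OF degree_power_le]) (auto intro!: mult_left_mono)
    have 2: "degree (H i) \<le> A + p * (J - 1)" unfolding H_def
    proof (rule degree_sum_le)
      fix j assume "j \<in> {..<J}"
      hence "p * j \<le> p * (J - 1)" by (intro mult_left_mono) auto
      thus "degree (h i j * [:0, 1:] ^ (p * j)) \<le> A + p * (J - 1)"
        using degree_mult_le[of "h i j" "[:0, 1:] ^ (p * j)"] h_deg[of i j]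
          degree_linear_power[of "0::int" "p * j"] by linarith
    qed simp
    show "degree (F ^ (g * i) * H i) \<le> degree F * (g * (m - 1)) + A + p * (J - 1)"
      using degree_mult_le[of "F ^ (g * i)" "H i"] 1 2 by linarith
  qed simp
  finally show ?thesis .
qed

section \<open>Independence of the powers F^(gi) over sparse polynomials\<close>

lemma small_multiple_eq_0: "R = 0" if "int p * K = R" "\<bar>R\<bar> < int p" for R :: int
proof (rule ccontr)
  assume "R \<noteq> 0"
  hence "int p \<le> \<bar>R\<bar>" using dvd_imp_le_int[of R "int p"] that(1) by (metis abs_of_nat dvd_triv_left)
  thus False using that by simp
qed

text \<open>Suppose two terms had the same order. Multiplying by m and using m g = p - 1 gives a
  congruence modulo p between e (i - j) and m (u - u'), where e is the order of F and u, u' < A. The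
  bound makes the two sides too small to differ by a nonzero multiple of p, so m divides e (i - j),
  hence i - j.\<close>

lemma powers_independent_coprime:
  assumes p: "prime p" "p = m * g + 1" and F: "\<not> pzero p F" "coprime (pord p a F) m"
    and bound: "pord p a F * m + m * A < p"
    and H: "\<And>i. i < m \<Longrightarrow> H i \<in> sparse_polys p A" and Z: "pzero p (\<Sum>i<m. F ^ (g * i) * H i)"
    and i: "i < m"
  shows "pzero p (H i)"
proof (rule ccontr)
  assume nz: "\<not> pzero p (H i)"
  let ?e = "pord p a F"
  let ?G = "\<lambda>i. F ^ (g * i) * H i"
  have "\<not> pzero p (\<Sum>i<m. ?G i)"
  proof (rule sum_distinct_pord_nonzero)
    show "\<not> pzero p (?G i)" using nz F p by (simp add: pzero_mult_iff pzero_power_iff)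
    fix i j assume ij: "i \<in> {..<m}" "j \<in> {..<m}" "i \<noteq> j" "\<not> pzero p (?G i)" "\<not> pzero p (?G j)"
    have nzH: "\<not> pzero p (H i)" "\<not> pzero p (H j)" using ij p by (auto simp: pzero_mult_iff)
    obtain n u where nu: "pord p a (H i) = p * n + u" "u < A"
      using sparse_pord[OF H nzH(1)] ij by blast
    obtain n' u' where nu': "pord p a (H j) = p * n' + u'" "u' < A"
      using sparse_pord[OF H nzH(2)] ij by blast
    have nzF: "\<not> pzero p (F ^ k)" for k using F p by (simp add: pzero_power_iff)
    have o: "pord p a (?G i) = g * i * ?e + (p * n + u)" "pord p a (?G j) = g * j * ?e + (p * n' + u')"
      using p(1) F(1) nzH nzF by (simp_all add: pord_mult pord_power nu nu')
    show "pord p a (?G i) \<noteq> pord p a (?G j)"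
    proof
      assume "pord p a (?G i) = pord p a (?G j)"
      hence "int (g * i * ?e + (p * n + u)) = int (g * j * ?e + (p * n' + u'))" using o by simp
      hence "int m * (int g * int i * int ?e + (int p * int n + int u)) =
          int m * (int g * int j * int ?e + (int p * int n' + int u'))" by simp
      moreover have gm: "int m * int g = int p - 1" using p(2) by simp
      ultimately have "(int p - 1) * int i * int ?e + int m * (int p * int n + int u) =
          (int p - 1) * int j * int ?e + int m * (int p * int n' + int u')"
        unfolding gm[symmetric] by (simp add: algebra_simps)
      hence eq: "int p * (int ?e * (int i - int j) + int m * (int n - int n')) =
          int ?e * (int i - int j) - int m * (int u - int u')"
        by (simp add: algebra_simps)
      have "\<bar>int ?e * (int i - int j)\<bar> \<le> int ?e * int m"
        unfolding abs_mult using ij by (intro mult_mono) auto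
      moreover have "\<bar>int m * (int u - int u')\<bar> \<le> int m * int A"
        unfolding abs_mult using nu nu' by (intro mult_mono) auto
      moreover have "int ?e * int m + int m * int A < int p"
        using bound by (metis of_nat_add of_nat_less_iff of_nat_mult)
      ultimately have "\<bar>int ?e * (int i - int j) - int m * (int u - int u')\<bar> < int p" by linarith
      with eq have "int ?e * (int i - int j) = int m * (int u - int u')"
        using small_multiple_eq_0 by fastforce
      hence "int m dvd int ?e * (int i - int j)" by simp
      hence "int m dvd int i - int j" using F(2)
        by (metis coprime_commute coprime_dvd_mult_right_iff coprime_int_iff)
      hence "int i mod int m = int j mod int m" by (simp add: mod_eq_dvd_iff)
      thus False using ij by simp
    qed
  qed (use i in auto)
  thus False using Z by simp
qed

text \<open>If no root of \<open>F\<close> has multiplicity coprime to \<open>6\<close>, the relation is split as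
  \<open>\<Sum>\<^sub>i\<^sub><\<^sub>3 F\<^bsup>gi\<^esup> G\<^sub>i\<close> with \<open>G\<^sub>i = H\<^sub>i + F\<^bsup>3g\<^esup> H\<^sub>i\<^sub>+\<^sub>3\<close>.  The product of \<open>G\<^sub>i\<close> and its conjugate
  \<open>H\<^sub>i - F\<^bsup>3g\<^esup> H\<^sub>i\<^sub>+\<^sub>3\<close> is sparse up to a factor \<open>F\<close>, so the order of \<open>G\<^sub>i\<close> is close to a multiple
  of \<open>p/2\<close>, whereas those of \<open>F\<^bsup>gi\<^esup>\<close> are separated by multiples of \<open>p/3\<close>.\<close>

lemma pord_conjugate_sum:
  assumes p: "prime p" "p = 6 * g + 1" and F: "\<not> pzero p F" "degree F \<le> 20" "F ^ p \<in> sparse_polys p 1"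
    and e: "pord p a F \<le> 5" and A: "36 * A + 600 < p" "0 < A"
    and H: "H \<in> sparse_polys p A" "H' \<in> sparse_polys p A"
    and nz: "\<not> pzero p (H + F ^ (3 * g) * H')"
  shows "\<exists>n u. 2 * int (pord p a (H + F ^ (3 * g) * H')) = int p * n + u \<and> \<bar>u\<bar> \<le> 6 * int A + 80"
proof -
  let ?e = "pord p a F"
  define G where "G = H + F ^ (3 * g) * H'"
  define G' where "G' = H - F ^ (3 * g) * H'"
  have p0: "p > 0" using p by simp
  have two: "\<not> int p dvd 2" using A(1) zdvd_not_zless[of 2 "int p"] by auto
  have "smult 2 H = 2 * H" by (metis mult_2 one_add_one smult_1_left smult_add_left)
  hence sum: "G + G' = smult 2 H" by (simp add: G_def G'_def)
  have H2: "\<exists>n u. pord p a (smult 2 H) = p * n + u \<and> u < A" if "\<not> pzero p (smult 2 H)"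
    using sparse_pord[OF sparse_smult[OF H(1)] that] .
  \<comment> \<open>One additional factor F completes F^(6g) to F^p, which is sparse.\<close>
  have "F * (G * G') = F * (H * H) - F ^ p * (H' * H')"
  proof -
    have "F ^ p = F * F ^ (3 * g) * F ^ (3 * g)" by (simp add: p(2) power_add[symmetric])
    thus ?thesis by (simp add: G_def G'_def algebra_simps)
  qed
  moreover have "F * (H * H) \<in> sparse_polys p (2 * A + 40)"
  proof -
    have "H * H \<in> sparse_polys p (A + A - 1)" using A p0 by (intro sparse_mult H) auto
    moreover have "F \<in> sparse_polys p 21" using F p0 by (intro sparse_degree) auto
    ultimately have "F * (H * H) \<in> sparse_polys p (21 + (A + A - 1) - 1)"
      using sparse_mult[of F p 21 "H * H" "A + A - 1"] A p0 by auto
    moreover have "21 + (A + A - 1) - 1 \<le> 2 * A + 40" by linarith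
    ultimately show ?thesis using sparse_mono by blast
  qed
  moreover have "F ^ p * (H' * H') \<in> sparse_polys p (2 * A + 40)"
  proof -
    have "H' * H' \<in> sparse_polys p (A + A - 1)" using A p0 by (intro sparse_mult H) auto
    hence "F ^ p * (H' * H') \<in> sparse_polys p (1 + (A + A - 1) - 1)"
      using sparse_mult[of "F ^ p" p 1 "H' * H'" "A + A - 1"] A p0 F(3) by auto
    moreover have "1 + (A + A - 1) - 1 \<le> 2 * A + 40" by linarith
    ultimately show ?thesis using sparse_mono by blast
  qed
  ultimately have prod: "F * (G * G') \<in> sparse_polys p (2 * A + 40)" by (simp add: sparse_diff)
  have nzG: "\<not> pzero p G" using nz by (simp add: G_def)
  have "\<exists>n u. 2 * int (pord p a G) = int p * n + u \<and> \<bar>u\<bar> \<le> 6 * int A + 80"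
  proof (cases "pzero p G'")
    case True
    have "\<not> pzero p (smult 2 H)"
    proof
      assume "pzero p (smult 2 H)"
      hence "pzero p (smult 2 H - G')" using True by (rule pzero_diff)
      thus False using nzG by (simp flip: sum)
    qed
    then obtain n u where "pord p a (smult 2 H) = p * n + u" "u < A" using H2 by blast
    moreover have "pord p a G = pord p a (smult 2 H)"
      using True by (intro pord_cong) (simp flip: sum add: pzero_uminus)
    ultimately show ?thesis by - (rule exI[of _ "2 * int n"], rule exI[of _ "2 * int u"], auto)
  next
    case nzG': False
    have "\<not> pzero p (F * (G * G'))" using p nzG nzG' F by (simp add: pzero_mult_iff)
    then obtain k u where ku: "pord p a (F * (G * G')) = p * k + u" "u < 2 * A + 40"
      using sparse_pord[OF prod] by blast
    moreover have "pord p a (F * (G * G')) = ?e + (pord p a G + pord p a G')"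
      using p nzG nzG' F by (simp add: pord_mult pzero_mult_iff)
    ultimately have tot: "int ?e + (int (pord p a G) + int (pord p a G')) = int p * int k + int u"
      by (metis of_nat_add of_nat_mult)
    \<comment> \<open>When the orders of the two summands differ, the smaller one is the order of 2
      H, hence of a sparse polynomial.\<close>
    have lt: "pzero p X \<or> \<not> pord p a X < pord p a Y \<or>
       (\<exists>n u. pord p a X = p * n + u \<and> u < A)" if "X + Y = smult 2 H" for X Y
    proof -
      { assume *: "\<not> pzero p X" "pord p a X < pord p a Y"
        hence o: "pord p a (smult 2 H) = pord p a X" using pord_add_distinct[of p X a Y] that by simp
        have "int p dvd coeff (shift a Y) (pord p a X)" using * by (intro pord_below)
        hence "\<not> int p dvd coeff (shift a (smult 2 H)) (pord p a X)"
          unfolding that[symmetric] using pord_coeff[OF *(1), of a] by (simp add: dvd_add_left_iff)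
        hence "\<not> pzero p (smult 2 H)" by (metis pzero_def pzero_shift)
        from H2[OF this] have "\<exists>n u. pord p a X = p * n + u \<and> u < A" unfolding o . }
      thus ?thesis by blast
    qed
    consider "pord p a G < pord p a G'" | "pord p a G' < pord p a G" | "pord p a G = pord p a G'" by linarith
    thus ?thesis
    proof cases
      case 1
      then obtain n u where "pord p a G = p * n + u" "u < A" using lt[of G G'] sum nzG by blast
      thus ?thesis by - (rule exI[of _ "2 * int n"], rule exI[of _ "2 * int u"], auto)
    next
      case 2
      then obtain n v where nv: "pord p a G' = p * n + v" "v < A"
        using lt[of G' G] sum nzG' by (metis add.commute)
      have "int (pord p a G) = int p * (int k - int n) + (int u - int v - int ?e)"
        using tot unfolding nv by (simp add: algebra_simps)
      thus ?thesis using ku(2) nv(2) e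
        by - (rule exI[of _ "2 * (int k - int n)"], rule exI[of _ "2 * (int u - int v - int ?e)"],
           auto simp: algebra_simps)
    next
      case 3
      \<comment> \<open>Equal orders are known only through their sum, which is why the conclusion
        holds modulo p/2 and not modulo p.\<close>
      have "2 * int (pord p a G) = int p * int k + (int u - int ?e)" using tot 3 by simp
      moreover have "\<bar>int u - int ?e\<bar> \<le> 6 * int A + 80" using ku(2) e by linarith
      ultimately show ?thesis by blast
    qed
  qed
  thus ?thesis by (simp add: G_def)
qed

text \<open>With e the order of F at a, the order of F^(gi) there is close to e i p / 6; since 3
  does not divide e, these values stay apart modulo p/2 for i < 3, so every \<open>G i\<close>
  vanishes. Each such vanishing is a relation between 1 and F^(3g), which the odd multiplicity at b
  excludes by the coprime case with m = 2.\<close>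

lemma powers_independent_six:
  assumes p: "prime p" "p = 6 * g + 1" and F: "\<not> pzero p F" "degree F \<le> 20" "F ^ p \<in> sparse_polys p 1"
    and a: "pord p a F \<le> 5" "\<not> 3 dvd pord p a F" and b: "pord p b F \<le> 5" "odd (pord p b F)"
    and A: "36 * A + 600 < p" "0 < A"
    and H: "\<And>i. i < 6 \<Longrightarrow> H i \<in> sparse_polys p A" and Z: "pzero p (\<Sum>i<6. F ^ (g * i) * H i)"
    and i: "i < 6"
  shows "pzero p (H i)"
proof -
  let ?e = "pord p a F"
  define G where "G i = H i + F ^ (3 * g) * H (i + 3)" for i
  have split: "(\<Sum>i<6. F ^ (g * i) * H i) = (\<Sum>i<3. F ^ (g * i) * G i)"
  proof -
    have "{..<6::nat} = {0,1,2,3,4,5}" "{..<3::nat} = {0,1,2}" by auto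
    moreover have "F ^ (g * 3) = F ^ (3 * g)" "F ^ (g * 4) = F ^ g * F ^ (3 * g)"
      "F ^ (g * 5) = F ^ (g * 2) * F ^ (3 * g)"
      by (simp_all flip: power_add add: algebra_simps)
    ultimately show ?thesis by (simp add: G_def algebra_simps numeral_eq_Suc)
  qed
  have nzF: "\<not> pzero p (F ^ k)" for k using F p by (simp add: pzero_power_iff)
  have G0: "pzero p (G i)" if "i < 3" for i
  proof (rule ccontr)
    assume nz: "\<not> pzero p (G i)"
    have "\<not> pzero p (\<Sum>i<3. F ^ (g * i) * G i)"
    proof (rule sum_distinct_pord_nonzero)
      show "\<not> pzero p (F ^ (g * i) * G i)" using nz nzF p by (simp add: pzero_mult_iff)
      fix i j assume ij: "i \<in> {..<3}" "j \<in> {..<3}" "i \<noteq> j"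
        "\<not> pzero p (F ^ (g * i) * G i)" "\<not> pzero p (F ^ (g * j) * G j)"
      have nzG: "\<not> pzero p (G i)" "\<not> pzero p (G j)" using ij p by (auto simp: pzero_mult_iff)
      have "\<exists>n u. 2 * int (pord p a (G k)) = int p * n + u \<and> \<bar>u\<bar> \<le> 6 * int A + 80"
        if "k < 3" "\<not> pzero p (G k)" for k
        unfolding G_def using that by (intro pord_conjugate_sum p F a A H) (auto simp: G_def)
      with ij nzG obtain n u n' u' where
        nu: "2 * int (pord p a (G i)) = int p * n + u" "\<bar>u\<bar> \<le> 6 * int A + 80" and
        nu': "2 * int (pord p a (G j)) = int p * n' + u'" "\<bar>u'\<bar> \<le> 6 * int A + 80"
        by (metis lessThan_iff)
      have o: "pord p a (F ^ (g * k) * G k) = g * k * ?e + pord p a (G k)" if "\<not> pzero p (G k)" for k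
        using p F that nzF by (simp add: pord_mult pord_power)
      show "pord p a (F ^ (g * i) * G i) \<noteq> pord p a (F ^ (g * j) * G j)"
      proof
        assume "pord p a (F ^ (g * i) * G i) = pord p a (F ^ (g * j) * G j)"
        hence "int (g * i * ?e + pord p a (G i)) = int (g * j * ?e + pord p a (G j))"
          using o nzG by simp
        hence "6 * (int g * int i * int ?e) + 3 * (2 * int (pord p a (G i))) =
            6 * (int g * int j * int ?e) + 3 * (2 * int (pord p a (G j)))" by simp
        hence "(6 * int g) * (int i * int ?e) + 3 * (int p * n + u) =
            (6 * int g) * (int j * int ?e) + 3 * (int p * n' + u')" unfolding nu nu' by simp
        moreover have g6: "6 * int g = int p - 1" using p(2) by simp
        ultimately have "(int p - 1) * (int i * int ?e) + 3 * (int p * n + u) =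
            (int p - 1) * (int j * int ?e) + 3 * (int p * n' + u')" by (simp only:)
        hence eq: "int p * (int ?e * (int i - int j) + 3 * (n - n')) = int ?e * (int i - int j) - 3 * (u - u')"
          by (simp add: algebra_simps)
        \<comment> \<open>The hypothesis 36 A + 600 < p leaves room for 15 + 3 * 2 * (6 A +
          80).\<close>
        have "\<bar>int ?e * (int i - int j)\<bar> \<le> 15"
          using mult_mono[of "\<bar>int ?e\<bar>" 5 "\<bar>int i - int j\<bar>" 3] ij a by (auto simp: abs_mult)
        moreover have "36 * int A + 600 < int p" using A(1) by simp
        moreover have "\<bar>X - 3 * (u - u')\<bar> < int p"
          if "\<bar>X\<bar> \<le> 15" "36 * int A + 600 < int p" for X
          using nu(2) nu'(2) that unfolding right_diff_distrib by linarith
        ultimately have "\<bar>int ?e * (int i - int j) - 3 * (u - u')\<bar> < int p" by blast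
        with eq have "int ?e * (int i - int j) = 3 * (u - u')"
          using small_multiple_eq_0 by fastforce
        hence "3 dvd int ?e * (int i - int j)" by simp
        moreover have "\<not> 3 dvd int ?e" using a(2) by presburger
        moreover have "prime (3::int)" by simp
        ultimately have "3 dvd int i - int j" by (metis prime_dvd_mult_iff)
        thus False using ij by (auto simp: dvd_def) presburger
      qed
    qed (use that in auto)
    thus False using Z unfolding split by simp
  qed
  define k where "k = i mod 3"
  have k: "k < 3" "i = k \<or> i = k + 3" using i unfolding k_def by presburger+
  have "pzero p (if j = 0 then H k else H (k + 3))" if "j < 2" for j :: nat
  proof (rule powers_independent_coprime[OF p(1), where m = 2 and g = "3 * g" and F = F and A = A and a = b
        and H = "\<lambda>j. if j = 0 then H k else H (k + 3)" and i = j])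
    show "pord p b F * 2 + 2 * A < p" using A b by linarith
    show "coprime (pord p b F) 2" using b by simp
    have "{..<2::nat} = {0, 1}" by auto
    thus "pzero p (\<Sum>i<2. F ^ (3 * g * i) * (if i = 0 then H k else H (k + 3)))"
      using G0[OF k(1)] by (simp add: G_def)
  qed (use p F H k that in auto)
  from this[of 0] this[of 1] k show ?thesis by auto
qed

section \<open>Upper bounds for level sets of residue characters\<close>

lemma pord_eq_0: "\<not> int p dvd poly F a \<Longrightarrow> pord p a F = 0"
  by (intro pord_eqI) (simp_all add: poly_shift flip: poly_0_coeff_0)

lemma pord_linear: "prime p \<Longrightarrow> pord p (-a) [:a, 1:] = 1"
  by (intro pord_eqI) (use prime_gt_1_nat in \<open>auto simp: shift_linear\<close>)

lemma not_pzero_monic: "prime p \<Longrightarrow> lead_coeff F = 1 \<Longrightarrow> \<not> pzero p F"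
  using prime_gt_1_nat[of p] unfolding pzero_def by (metis int_dvd_int_iff nat_dvd_1_iff_1 nat_neq_iff of_nat_1)

lemma residues_not_dvd_diff:
  "a \<in> {0..<int p} \<Longrightarrow> b \<in> {0..<int p} \<Longrightarrow> a \<noteq> b \<Longrightarrow> \<not> int p dvd a - b"
  by (metis atLeastLessThan_iff mod_eq_dvd_iff mod_pos_pos_trivial)

lemma pord_prod_linear:
  assumes p: "prime p" and I: "I \<subseteq> {0..<int p}" "a \<in> I"
  shows "pord p (-a) (\<Prod>b\<in>I. [:b, 1:] ^ e b) = e a"
proof -
  have fin: "finite I" using I finite_subset by blast
  let ?R = "\<Prod>b\<in>I-{a}. [:b, 1:] ^ e b"
  have m: "\<not> pzero p ([:a, 1:] ^ e a)" "\<not> pzero p ?R" "\<not> pzero p [:a, 1:]"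
    by ((rule not_pzero_monic[OF p], simp add: lead_coeff_prod lead_coeff_power)+)
  have "\<not> int p dvd poly ?R (-a)"
  proof
    assume "int p dvd poly ?R (-a)"
    hence "int p dvd (\<Prod>b\<in>I-{a}. (b - a) ^ e b)" by (simp add: poly_prod poly_power)
    then obtain b where b: "b \<in> I - {a}" "int p dvd (b - a) ^ e b"
      using p fin by (auto simp: prime_dvd_prod_iff)
    hence "int p dvd b - a" using p prime_dvd_power[of "int p"] by simp
    thus False using b residues_not_dvd_diff[of b p a] subsetD[OF I(1), of a] subsetD[OF I(1), of b] I(2) by blast
  qed
  hence "pord p (-a) ?R = 0" by (rule pord_eq_0)
  moreover have "pord p (-a) ([:a, 1:] ^ e a) = e a"
    using p m by (simp add: pord_power pord_linear)
  moreover have "(\<Prod>b\<in>I. [:b, 1:] ^ e b) = [:a, 1:] ^ e a * ?R" using fin I by (simp add: prod.remove)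
  ultimately show ?thesis using pord_mult[OF p m(1,2)] by simp
qed

text \<open>The logarithmic derivative of F with its denominator cleared. Using only the distinct
  linear factors for F0 keeps the degrees of F0 and F1 bounded by 4 and 3, whatever the
  multiplicities are.\<close>

lemma pderiv_prod_linear:
  assumes "finite I"
  shows "(\<Prod>a\<in>I. [:a, 1:]) * pderiv (\<Prod>a\<in>I. [:a, 1:] ^ e a) =
    (\<Sum>a\<in>I. smult (int (e a)) (\<Prod>b\<in>I-{a}. [:b, 1:])) * (\<Prod>a\<in>I. [:a, 1:] ^ e a)"
proof -
  have lin: "[:a, 1:] * pderiv ([:a, 1:] ^ n) = smult (int n) ([:a, 1:] ^ n)" for a :: int and n
  proof (cases n)
    case (Suc k)
    have "pderiv [:a, 1:] = 1" by (simp add: pderiv_pCons)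
    thus ?thesis unfolding Suc pderiv_power_Suc
      by (simp only: mult_smult_left mult_smult_right mult_1_right power_Suc)
  qed (simp add: pderiv_1)
  have "(\<Prod>a\<in>I. [:a, 1:]) * pderiv (\<Prod>a\<in>I. [:a, 1:] ^ e a) =
     (\<Sum>a\<in>I. (\<Prod>a\<in>I. [:a, 1:]) * ((\<Prod>b\<in>I-{a}. [:b, 1:] ^ e b) * pderiv ([:a, 1:] ^ e a)))"
    unfolding pderiv_prod by (simp only: sum_distrib_left)
  also have "\<dots> = (\<Sum>a\<in>I. smult (int (e a)) (\<Prod>b\<in>I-{a}. [:b, 1:]) * (\<Prod>a\<in>I. [:a, 1:] ^ e a))"
  proof (rule sum.cong[OF refl])
    fix a assume a: "a \<in> I"
    define Y where "Y = [:a, 1::int:]"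
    define U V where "U = (\<Prod>b\<in>I-{a}. [:b, 1:])" and "V = (\<Prod>b\<in>I-{a}. [:b, 1:] ^ e b)"
    have 1: "(\<Prod>a\<in>I. [:a, 1:]) = Y * U" "(\<Prod>a\<in>I. [:a, 1:] ^ e a) = Y ^ e a * V"
      unfolding Y_def U_def V_def by (rule prod.remove[OF assms a])+
    have "Y * pderiv (Y ^ e a) = smult (int (e a)) (Y ^ e a)" unfolding Y_def by (rule lin)
    hence "(U * V) * (Y * pderiv (Y ^ e a)) = smult (int (e a)) (U * V * Y ^ e a)" by simp
    thus "(\<Prod>a\<in>I. [:a, 1:]) * ((\<Prod>b\<in>I-{a}. [:b, 1:] ^ e b) * pderiv ([:a, 1:] ^ e a))
        = smult (int (e a)) (\<Prod>b\<in>I-{a}. [:b, 1:]) * (\<Prod>a\<in>I. [:a, 1:] ^ e a)"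
      unfolding 1 U_def[symmetric] V_def[symmetric] Y_def[symmetric]
      by (simp only: mult_smult_left mult_smult_right mult_ac)
  qed
  finally show ?thesis by (simp only: sum_distrib_right)
qed

text \<open>Stepanov's polynomial has degree about p J and vanishes to order about m J at each point
  of the level set, whence the exact main term p/m. The last hypothesis lists the exponent patterns
  for which one of the two independence lemmas applies.\<close>

lemma level_set_bound:
  assumes p: "prime p" "p = m * g + 1" "p \<ge> 40000" and m: "2 \<le> m" "m \<le> 6"
    and I: "I \<subseteq> {0..<int p}" "card I \<le> 4" and e: "\<And>a. a \<in> I \<Longrightarrow> e a \<le> 5"
    and cases: "(m = 6 \<and> (\<exists>a\<in>I. \<not> 3 dvd e a) \<and> (\<exists>b\<in>I. odd (e b))) \<or> (\<exists>a\<in>I. coprime (e a) m)"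
  shows "real (card {k\<in>{0..<int p}. (\<forall>a\<in>I. \<not> int p dvd k + a) \<and>
      [(\<Prod>a\<in>I. (k + a) ^ e a) ^ g = \<zeta>] (mod int p)}) \<le> real p / real m + 8400 * sqrt (real p)"
    (is "real (card ?X) \<le> _")
proof -
  have fin: "finite I" using I finite_subset by blast
  define F where "F = (\<Prod>a\<in>I. [:a, 1:] ^ e a)"
  define F0 where "F0 = (\<Prod>a\<in>I. [:a, 1::int:])"
  define F1 where "F1 = (\<Sum>a\<in>I. smult (int (e a)) (\<Prod>b\<in>I-{a}. [:b, 1:]))"
  have nzF: "\<not> pzero p F" using p unfolding F_def
    by (intro not_pzero_monic) (simp_all add: lead_coeff_prod lead_coeff_power)
  have degF: "degree F \<le> 20"
  proof -
    have "degree F = (\<Sum>a\<in>I. e a)"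
      by (simp add: F_def degree_prod_eq_sum_degree degree_linear_power)
    also have "\<dots> \<le> card I * 5" using e by (intro sum_bounded_above[of I e 5, simplified]) auto
    finally show ?thesis using I by simp
  qed
  have Fp: "F ^ p \<in> sparse_polys p 1"
  proof -
    have "F ^ p = (\<Prod>a\<in>I. ([:a, 1:] ^ p) ^ e a)"
      by (simp add: F_def prod_power_distrib power_mult[symmetric] mult.commute)
    thus ?thesis using p sparse1_power sparse_linear_power_p by (auto intro!: sparse1_prod simp del: One_nat_def)
  qed
  have ord: "pord p (-a) F = e a" if "a \<in> I" for a
    unfolding F_def using p I that by (intro pord_prod_linear)
  \<comment> \<open>The equations number at most M A + M (3 M + J), the unknowns m J A. With M = m J
    - 1 the surplus A has to exceed 114 J^2, where 114 = 6 * 19 bounds m (3 m + 1). Hence A is a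
    fixed fraction of p and J one of sqrt p, and p >= 40000 ensures J >= 1 and A >= 400.\<close>
  define A where "A = p div 100"
  define J where "J = nat \<lfloor>sqrt (real p) / 200\<rfloor>"
  define M where "M = m * J - 1"
  have s200: "sqrt (real p) \<ge> 200" using p(3) by (intro real_le_rsqrt) simp
  have J1: "J \<ge> 1" using s200 by (simp add: J_def le_nat_floor)
  have Jle: "real J \<le> sqrt (real p) / 200" 
  proof -
    have "real J = of_int \<lfloor>sqrt (real p) / 200\<rfloor>" using s200 by (simp add: J_def)
    thus ?thesis by linarith
  qed
  have Jge: "sqrt (real p) \<le> 400 * real J"
  proof -
    have "sqrt (real p) / 200 < real J + 1" using s200 by (simp add: J_def)
    thus ?thesis using J1 by simp
  qed
  have J2: "40000 * J^2 \<le> p"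
  proof -
    have "(200 * real J)^2 \<le> (sqrt (real p))^2" using Jle by (intro power_mono) auto
    hence "real (40000 * J^2) \<le> real p" by (simp add: power_mult_distrib)
    thus ?thesis by (simp only: of_nat_le_iff)
  qed
  have A1: "A \<ge> 400" "100 * A \<le> p" "p < 100 * A + 100" using p by (auto simp: A_def)
  have AJ: "114 * J^2 < A" using J2 A1 by linarith
  have indep: "pzero p (H i)"
    if "\<And>i. i < m \<Longrightarrow> H i \<in> sparse_polys p A" "pzero p (\<Sum>i<m. F ^ (g * i) * H i)" "i < m" for H i
    using cases
  proof
    assume "m = 6 \<and> (\<exists>a\<in>I. \<not> 3 dvd e a) \<and> (\<exists>b\<in>I. odd (e b))"
    then obtain a b where "m = 6" "a \<in> I" "\<not> 3 dvd e a" "b \<in> I" "odd (e b)" by blast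
    thus ?thesis using p nzF degF Fp A1 that ord e
      by (intro powers_independent_six[of p g F "-a" "-b" A H i]) auto
  next
    assume "\<exists>a\<in>I. coprime (e a) m"
    then obtain a where a: "a \<in> I" "coprime (e a) m" by blast
    have "e a * m \<le> 5 * 6" using e a m by (intro mult_mono) auto
    moreover have "m * A \<le> 6 * A" using m by simp
    ultimately have "e a * m + m * A < p" using A1 by linarith
    thus ?thesis using p nzF that ord a
      by (intro powers_independent_coprime[of p m g F "-a" A H i]) auto
  qed
  have mJ: "m * J \<ge> 2" using m J1 mult_le_mono[of 2 m 1 J] by simp
  have "(\<Sum>l<M. A + 3 * l + J) \<le> M * (A + 3 * M + J)"
    using sum_bounded_above[of "{..<M}" "\<lambda>l. A + 3 * l + J" "A + 3 * M + J"] by auto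
  also have "\<dots> = M * A + M * (3 * M + J)" by (simp add: algebra_simps)
  also have "\<dots> \<le> M * A + (m * J) * (3 * (m * J) + J)" unfolding M_def by (intro add_mono mult_mono) auto
  also have "(m * J) * (3 * (m * J) + J) = (m * (3 * m + 1)) * J^2" by (simp add: power2_eq_square algebra_simps)
  also have "\<dots> \<le> (6 * (3 * 6 + 1)) * J^2" using m by (intro mult_mono) auto
  also have "M * A + (6 * (3 * 6 + 1)) * J^2 < M * A + A" using AJ by simp
  also have "M * A + A = m * A * J"
  proof -
    have "M + 1 = m * J" using mJ by (simp add: M_def)
    thus ?thesis by (metis add.commute mult.assoc mult.commute mult_Suc plus_1_eq_Suc)
  qed
  finally have count: "(\<Sum>l<M. A + 3 * l + J) < m * A * J" by simp
  have "J \<le> J^2" by (simp add: power2_eq_square)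
  have Mp: "M \<le> p"
  proof -
    have "M \<le> 6 * J" using mult_le_mono1[of m 6 J] m(2) unfolding M_def by linarith
    also have "\<dots> \<le> 6 * J^2" using \<open>J \<le> J^2\<close> by simp
    also have "\<dots> \<le> p" using J2 by linarith
    finally show ?thesis .
  qed
  have "card ?X * M \<le> degree F * (g * (m - 1)) + A + p * (J - 1)"
  proof (rule stepanov[where ?F0.0 = F0 and ?F1.0 = F1 and \<zeta> = \<zeta>])
    show "F0 * pderiv F = F1 * F" unfolding F0_def F1_def F_def by (rule pderiv_prod_linear[OF fin])
    show "degree F0 \<le> 4" using I by (simp add: F0_def degree_prod_eq_sum_degree)
    show "degree F1 \<le> 3" unfolding F1_def
    proof (intro degree_sum_le fin)
      fix a assume "a \<in> I"
      thus "degree (smult (int (e a)) (\<Prod>b\<in>I-{a}. [:b, 1:])) \<le> 3"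
        using I fin by (intro order.trans[OF degree_smult_le]) (simp add: degree_prod_eq_sum_degree)
    qed
    fix x assume x: "x \<in> ?X"
    thus "\<not> int p dvd poly F0 x"
      using prime_dvd_prod_iff[OF fin, of "int p" "\<lambda>a. x + a"] p(1)
      by (auto simp: F0_def poly_prod add.commute)
    show "[poly F x ^ g = \<zeta>] (mod int p)" using x by (simp add: F_def poly_prod poly_power add.commute)
  next
    fix H :: "nat \<Rightarrow> int poly" and i
    assume "\<And>i. i < m \<Longrightarrow> H i \<in> sparse_polys p A" "pzero p (\<Sum>i<m. F ^ (g * i) * H i)" "i < m"
    thus "pzero p (H i)" by (rule indep)
  next
    show "A \<le> p" "0 < A" using A1 by auto
    show "0 < J" using J1 by simp
    show "?X \<subseteq> {0..<int p}" by auto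
  qed (fact p(1) count Mp)+
  also have "\<dots> \<le> 20 * p + p + p * (J - 1)"
  proof (intro add_mono order.refl)
    have "g * (m - 1) \<le> p" using p(2) by (simp add: diff_mult_distrib2 mult.commute)
    thus "degree F * (g * (m - 1)) \<le> 20 * p" using degF by (intro mult_mono) auto
  qed (use A1 in simp)
  also have "\<dots> = p * (J + 20)" using J1 by (cases J) (auto simp: algebra_simps)
  finally have "real (card ?X * M) \<le> real (p * (J + 20))" by (simp only: of_nat_le_iff)
  hence "real (card ?X) * real M \<le> real p * (real J + 20)" by (simp only: of_nat_mult of_nat_add of_nat_numeral)
  moreover have Mr: "real M = real m * real J - 1" 
  proof -
    have "M + 1 = m * J" using mJ by (simp add: M_def)
    hence "real (M + 1) = real (m * J)" by (simp only:)
    thus ?thesis by simp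
  qed
  moreover have M0: "real M > 0" using mJ by (simp add: M_def)
  ultimately have "real (card ?X) \<le> real p * (real J + 20) / (real m * real J - 1)"
    by (simp add: pos_le_divide_eq)
  \<comment> \<open>Splitting off the main term of p (J + 20) / (m J - 1). The remainder is at most
    21 p / J, and sqrt p <= 400 J turns 21 into 8400 = 21 * 400.\<close>
  also have "\<dots> = real p / real m + real p * (20 * real m + 1) / (real m * (real m * real J - 1))"
    using M0 Mr m by (simp add: divide_simps) (simp add: algebra_simps)
  also have "real p * (20 * real m + 1) / (real m * (real m * real J - 1)) \<le> real p * (21 * real m) / (real m * real J)"
  proof (rule frac_le)
    have "2 * real J \<le> real m * real J" using m by (intro mult_right_mono) auto
    moreover have "real J \<ge> 1" using J1 by simp
    ultimately have "real J \<le> real m * real J - 1" by linarith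
    thus "real m * real J \<le> real m * (real m * real J - 1)" by (intro mult_left_mono) auto
    show "0 < real m * real J" using m J1 by simp
    show "real p * (20 * real m + 1) \<le> real p * (21 * real m)" using m by (intro mult_left_mono) auto
  qed simp
  also have "real p * (21 * real m) / (real m * real J) = 21 * (real p / real J)" using m by simp
  also have "real p / real J \<le> 400 * sqrt (real p)"
  proof -
    have "sqrt (real p) * sqrt (real p) \<le> sqrt (real p) * (400 * real J)" using Jge by (intro mult_left_mono) auto
    thus ?thesis using J1 by (simp add: divide_simps mult_ac)
  qed
  finally show ?thesis by simp
qed

section \<open>Roots of unity and sums over residues\<close>

definition unity_root :: "nat \<Rightarrow> int \<Rightarrow> complex" where
  "unity_root n x = cis (2 * pi * of_int x / of_nat n)"

lemma unity_root_add: "unity_root n (x + y) = unity_root n x * unity_root n y"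
  by (simp add: unity_root_def cis_mult add_divide_distrib distrib_left)

lemma unity_root_0 [simp]: "unity_root n 0 = 1"
  by (simp add: unity_root_def)

lemma norm_unity_root [simp]: "cmod (unity_root n x) = 1"
  by (simp add: unity_root_def)

lemma unity_root_nonzero [simp]: "unity_root n x \<noteq> 0"
  using norm_unity_root[of n x] by fastforce

lemma cnj_unity_root: "cnj (unity_root n x) = unity_root n (- x)"
  by (simp add: unity_root_def cis_cnj)

lemma unity_root_power: "unity_root n x ^ k = unity_root n (int k * x)"
  by (induction k) (simp_all add: unity_root_add distrib_right)

lemma unity_root_eq_1_iff:
  assumes "n > 0" shows "unity_root n x = 1 \<longleftrightarrow> int n dvd x"
proof -
  have "unity_root n x = 1 \<longleftrightarrow> (\<exists>k::int. 2 * pi * of_int x / of_nat n = of_int (2 * k) * pi)"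
    by (simp add: unity_root_def cis_conv_exp exp_eq_1)
  also have "\<dots> \<longleftrightarrow> (\<exists>k::int. real_of_int x = real_of_int (int n * k))"
    using assms by (simp add: field_simps)
  also have "\<dots> \<longleftrightarrow> int n dvd x" unfolding of_int_eq_iff dvd_def ..
  finally show ?thesis .
qed

lemma unity_root_cong:
  assumes "[x = y] (mod int n)" shows "unity_root n x = unity_root n y"
proof (cases "n = 0")
  case False
  have "unity_root n (x - y) = 1"
    using assms False by (simp add: unity_root_eq_1_iff cong_iff_dvd_diff)
  hence "unity_root n ((x - y) + y) = unity_root n y" unfolding unity_root_add by simp
  thus ?thesis by simp
qed (use assms in \<open>simp add: unity_root_def\<close>)

lemma unity_root_mod [simp]: "unity_root n (x mod int n) = unity_root n x"
  by (rule unity_root_cong) simp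

lemma unity_root_scale: "m > 0 \<Longrightarrow> unity_root (n * m) (x * int m) = unity_root n x"
  by (simp add: unity_root_def field_simps)

lemma sum_unity_root:
  assumes n: "n > 0"
  shows "(\<Sum>k<n. unity_root n (int k * x)) = (if int n dvd x then of_nat n else 0)"
proof -
  let ?z = "unity_root n x"
  have eq: "(\<Sum>k<n. unity_root n (int k * x)) = (\<Sum>k<n. ?z ^ k)" by (simp add: unity_root_power)
  show ?thesis
  proof (cases "int n dvd x")
    case True
    hence "?z = 1" using n by (simp add: unity_root_eq_1_iff)
    thus ?thesis using True unfolding eq by simp
  next
    case False
    hence "?z \<noteq> 1" using n by (simp add: unity_root_eq_1_iff)
    moreover have "?z ^ n = 1" using n by (simp add: unity_root_power unity_root_eq_1_iff)
    ultimately show ?thesis using False unfolding eq by (simp add: geometric_sum)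
  qed
qed

lemma sum_int_interval: "(\<Sum>k\<in>{0..<int n}. f k) = (\<Sum>k<n. f (int k))"
  by (rule sum.reindex_bij_witness[of _ int nat]) auto

lemma sum_unity_root_int:
  "n > 0 \<Longrightarrow> (\<Sum>k\<in>{0..<int n}. unity_root n (k * x)) = (if int n dvd x then of_nat n else 0)"
  by (simp add: sum_int_interval sum_unity_root)

lemma sum_residues_shift:
  fixes f :: "int \<Rightarrow> 'a::comm_monoid_add"
  assumes n: "n > 0" and per: "\<And>x. f (x mod int n) = f x"
  shows "(\<Sum>x\<in>{0..<int n}. f (x + c)) = (\<Sum>x\<in>{0..<int n}. f x)"
proof (rule sum.reindex_bij_witness[of _ "\<lambda>x. (x - c) mod int n" "\<lambda>x. (x + c) mod int n"])
  fix a assume "a \<in> {0..<int n}"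
  thus "((a + c) mod int n - c) mod int n = a" by (simp add: mod_diff_left_eq)
  show "f ((a + c) mod int n) = f (a + c)" by (rule per)
next
  fix b assume "b \<in> {0..<int n}"
  thus "((b - c) mod int n + c) mod int n = b" by (simp add: mod_add_left_eq)
qed (use n in auto)

lemma sum_residues_mult:
  fixes f :: "int \<Rightarrow> 'a::comm_monoid_add"
  assumes n: "n > 0" and per: "\<And>x. f (x mod int n) = f x" and u: "[u * v = 1] (mod int n)"
  shows "(\<Sum>x\<in>{0..<int n}. f (u * x)) = (\<Sum>x\<in>{0..<int n}. f x)"
proof (rule sum.reindex_bij_witness[of _ "\<lambda>x. (v * x) mod int n" "\<lambda>x. (u * x) mod int n"])
  have *: "[u * v * a = a] (mod int n)" for a
    using cong_mult[OF u cong_refl[of a]] by simp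
  fix a assume a: "a \<in> {0..<int n}"
  show "(v * (u * a mod int n)) mod int n = a"
    using *[of a] a by (simp add: mod_mult_right_eq cong_def mult_ac)
  show "f ((u * a) mod int n) = f (u * a)" by (rule per)
next
  have *: "[u * v * a = a] (mod int n)" for a
    using cong_mult[OF u cong_refl[of a]] by simp
  fix b assume "b \<in> {0..<int n}"
  thus "(u * (v * b mod int n)) mod int n = b" using *[of b] by (simp add: mod_mult_right_eq cong_def mult_ac)
qed (use n in auto)

section \<open>Discrete logarithms and the classes of order six\<close>

text \<open>Primitivity is assumed only as surjectivity of the powers of w onto the units;
  \<open>bij_w_power\<close> recovers injectivity on p - 1 exponents by counting.\<close>

locale sextic_residues =
  fixes p g :: nat and w :: int
  assumes prime_p: "prime p" and p_eq: "p = 6 * g + 1"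
    and primitive: "\<And>x. \<not> int p dvd x \<Longrightarrow> \<exists>i. [x = w ^ i] (mod int p)"
begin

lemma p_pos: "p > 0" and p_ge_7: "p \<ge> 7"
  using prime_gt_1_nat[OF prime_p] p_eq by (auto intro: Nat.gr0I)

lemma prime_int_p: "prime (int p)" using prime_p by simp

lemma not_dvd_mult: "\<not> int p dvd x \<Longrightarrow> \<not> int p dvd y \<Longrightarrow> \<not> int p dvd x * y"
  using prime_int_p by (simp add: prime_dvd_mult_iff)

lemma small_not_dvd: "0 < \<bar>x\<bar> \<Longrightarrow> \<bar>x\<bar> < int p \<Longrightarrow> \<not> int p dvd x"
  by (metis abs_0_eq dvd_imp_le_int linorder_not_less abs_of_nat less_irrefl)

lemma w_unit: "\<not> int p dvd w"
proof
  assume w: "int p dvd w"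
  have "\<not> int p dvd 2" using p_ge_7 by (intro small_not_dvd) auto
  then obtain i where i: "[2 = w ^ i] (mod int p)" using primitive by blast
  show False
  proof (cases i)
    case 0
    hence "int p dvd 2 - 1" using i by (simp add: cong_iff_dvd_diff)
    thus False using p_ge_7 by simp
  next
    case (Suc k)
    hence "int p dvd w ^ i" using w by simp
    hence "int p dvd 2" using i by (simp add: cong_dvd_iff)
    thus False using \<open>\<not> int p dvd 2\<close> by simp
  qed
qed

lemma w_power_unit: "\<not> int p dvd w ^ i"
  using w_unit prime_int_p prime_dvd_power by blast

lemma fermat: 
  assumes "\<not> int p dvd x" shows "[x ^ (p - 1) = 1] (mod int p)"
proof -
  have "coprime x (int p)" using assms prime_int_p by (metis coprime_commute prime_imp_coprime)
  hence "[(x mod int p) ^ (p - 1) = 1] (mod int p)"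
    using fermat_theorem[of p "nat (x mod int p)"] prime_p assms p_pos
    by (auto simp: cong_int_iff[symmetric] int_dvd_int_iff[symmetric] dvd_mod_iff)
  thus ?thesis by (simp add: cong_def power_mod)
qed

lemma w_power_mod: "[w ^ i = w ^ (i mod (p - 1))] (mod int p)"
proof -
  have "w ^ i = (w ^ (p - 1)) ^ (i div (p - 1)) * w ^ (i mod (p - 1))"
    by (metis mult_div_mod_eq power_add power_mult)
  moreover have "[(w ^ (p - 1)) ^ (i div (p - 1)) * w ^ (i mod (p - 1)) = 1 ^ (i div (p - 1)) * w ^ (i mod (p - 1))] (mod int p)"
    by (intro cong_mult cong_pow cong_refl fermat w_unit)
  ultimately show ?thesis by simp
qed

lemma bij_w_power: "bij_betw (\<lambda>i. w ^ i mod int p) {..<p - 1} {1..<int p}"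
proof -
  let ?f = "\<lambda>i. w ^ i mod int p"
  have im: "?f ` {..<p - 1} = {1..<int p}"
  proof (intro equalityI subsetI)
    fix y assume "y \<in> ?f ` {..<p - 1}"
    then obtain i where "y = w ^ i mod int p" by blast
    thus "y \<in> {1..<int p}" using w_power_unit[of i] p_pos
      pos_mod_bound[of "int p" "w ^ i"] pos_mod_sign[of "int p" "w ^ i"] by (auto simp: dvd_eq_mod_eq_0 order_le_less)
  next
    fix y assume y: "y \<in> {1..<int p}"
    hence "\<not> int p dvd y" by (intro small_not_dvd) auto
    then obtain i where "[y = w ^ i] (mod int p)" using primitive by blast
    hence "[y = w ^ (i mod (p - 1))] (mod int p)" using w_power_mod cong_trans by blast
    hence "y = ?f (i mod (p - 1))" using y by (simp add: cong_def)
    thus "y \<in> ?f ` {..<p - 1}" using p_ge_7 by auto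
  qed
  moreover have "inj_on ?f {..<p - 1}"
    by (rule eq_card_imp_inj_on) (use p_pos im in auto)
  ultimately show ?thesis by (simp add: bij_betw_def)
qed

lemma w_power_cong_iff: "[w ^ i = w ^ j] (mod int p) \<longleftrightarrow> [i = j] (mod (p - 1))"
proof
  assume "[i = j] (mod (p - 1))"
  thus "[w ^ i = w ^ j] (mod int p)" using w_power_mod[of i] w_power_mod[of j]
    by (metis cong_def)
next
  assume "[w ^ i = w ^ j] (mod int p)"
  hence "w ^ (i mod (p - 1)) mod int p = w ^ (j mod (p - 1)) mod int p"
    using w_power_mod[of i] w_power_mod[of j] by (simp add: cong_def)
  moreover have "i mod (p - 1) < p - 1" "j mod (p - 1) < p - 1" using p_ge_7 by auto
  ultimately show "[i = j] (mod (p - 1))" using bij_w_power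
    unfolding bij_betw_def inj_on_def cong_def by blast
qed

text \<open>The discrete logarithm modulo 6. Any exponent serves, by \<open>cls_eqI\<close>, since 6
  divides p - 1. For x divisible by p the LEAST is unspecified, so the value is junk, though still
  below 6.\<close>

definition cls :: "int \<Rightarrow> nat" where
  "cls x = (LEAST i. [x = w ^ i] (mod int p)) mod 6"

lemma cls_less: "cls x < 6" by (simp add: cls_def)

lemma cls_eqI:
  assumes "[x = w ^ i] (mod int p)" shows "cls x = i mod 6"
proof -
  let ?j = "LEAST i. [x = w ^ i] (mod int p)"
  have "[x = w ^ ?j] (mod int p)" using assms by (rule LeastI)
  hence "[w ^ ?j = w ^ i] (mod int p)" using assms by (metis cong_def)
  hence "[?j = i] (mod (6 * g))" unfolding w_power_cong_iff using p_eq by simp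
  hence "[?j = i] (mod 6)" by (rule cong_modulus_mult_nat)
  thus ?thesis by (simp add: cls_def cong_def)
qed

lemma cls_exists:
  assumes "\<not> int p dvd x" shows "\<exists>i. [x = w ^ i] (mod int p) \<and> i mod 6 = cls x"
  using primitive[OF assms] cls_eqI by metis

lemma cls_cong: "[x = y] (mod int p) \<Longrightarrow> cls x = cls y"
  unfolding cls_def by (simp add: cong_def)

lemma cls_mod [simp]: "cls (x mod int p) = cls x"
  by (rule cls_cong) simp

lemma cls_mult:
  assumes "\<not> int p dvd x" "\<not> int p dvd y" shows "cls (x * y) = (cls x + cls y) mod 6"
proof -
  obtain i j where i: "[x = w ^ i] (mod int p)" "i mod 6 = cls x" and j: "[y = w ^ j] (mod int p)" "j mod 6 = cls y"
    using cls_exists assms by metis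
  have "[x * y = w ^ (i + j)] (mod int p)" unfolding power_add using i j by (intro cong_mult)
  hence "cls (x * y) = (i + j) mod 6" by (rule cls_eqI)
  thus ?thesis using i j by (metis mod_add_eq)
qed

lemma cls_1 [simp]: "cls 1 = 0"
  using cls_eqI[of 1 0] by simp

lemma cls_w: "cls (w ^ i) = i mod 6"
  by (rule cls_eqI) simp

text \<open>Raising to the power (p - 1)/m = d g is the residue character of order m: i d g modulo 6
  g depends only on i modulo 6.\<close>

lemma cls_power_eq_iff:
  assumes "m * d = 6" "\<not> int p dvd x"
  shows "[x ^ (d * g) = w ^ (d * g * cls x)] (mod int p)"
proof -
  obtain i where i: "[x = w ^ i] (mod int p)" "i mod 6 = cls x" using cls_exists assms by metis
  have "[x ^ (d * g) = w ^ (i * (d * g))] (mod int p)" unfolding power_mult using i by (intro cong_pow)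
  moreover have "[i * (d * g) = d * g * cls x] (mod (p - 1))"
  proof -
    have "p - 1 = 6 * g" using p_eq by simp
    moreover have "[i * g = cls x * g] (mod (6 * g))"
      unfolding cong_def mult_mod_left[symmetric] using i(2) by simp
    hence "[i * g * d = cls x * g * d] (mod (6 * g))" by (rule cong_mult[OF _ cong_refl])
    ultimately show ?thesis by (simp only: mult_ac)
  qed
  ultimately show ?thesis using w_power_cong_iff cong_trans by blast
qed

text \<open>w^(3g) is a square root of 1 different from 1, so -1 = w^(3g) and its class is 3 g
  modulo 6.\<close>

lemma cls_minus_1: "cls (-1) = (if even g then 0 else 3)"
proof -
  have "[w ^ (p - 1) = 1] (mod int p)" using fermat w_unit by blast
  hence "int p dvd w ^ (3 * g * 2) - 1" using p_eq by (simp add: cong_iff_dvd_diff mult_ac)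
  also have "w ^ (3 * g * 2) - 1 = (w ^ (3 * g) - 1) * (w ^ (3 * g) + 1)"
    unfolding power_mult[of w "3 * g"] by (simp add: power2_eq_square algebra_simps)
  finally have "int p dvd w ^ (3 * g) - 1 \<or> int p dvd w ^ (3 * g) + 1"
    using prime_int_p by (simp add: prime_dvd_mult_iff)
  moreover have "\<not> int p dvd w ^ (3 * g) - 1"
  proof
    assume "int p dvd w ^ (3 * g) - 1"
    hence "[w ^ (3 * g) = w ^ 0] (mod int p)" by (simp add: cong_iff_dvd_diff)
    hence "[3 * g = 0] (mod (p - 1))" by (simp only: w_power_cong_iff)
    moreover have "g > 0" "p - 1 = 6 * g" using p_ge_7 p_eq by auto
    ultimately show False by (simp add: cong_def)
  qed
  ultimately have "int p dvd (-1) - w ^ (3 * g)" by (metis dvd_minus_iff minus_diff_eq diff_minus_eq_add)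
  hence "cls (-1) = (3 * g) mod 6" by (intro cls_eqI) (simp add: cong_iff_dvd_diff)
  also have "\<dots> = (if even g then 0 else 3)" by (auto elim!: evenE oddE)
  finally show ?thesis .
qed

lemma inverse_exists: "\<not> int p dvd x \<Longrightarrow> \<exists>y. [x * y = 1] (mod int p)"
  using prime_int_p by (metis cong_solve_coprime_int coprime_commute prime_imp_coprime)

lemma sum_over_units: "(\<Sum>x\<in>{1..<int p}. f (cls x)) = of_nat g * (\<Sum>s<6. f s :: 'a::comm_semiring_1)"
proof -
  have "(\<Sum>x\<in>{1..<int p}. f (cls x)) = (\<Sum>i<p - 1. f (cls (w ^ i mod int p)))"
    using bij_w_power by (rule sum.reindex_bij_betw[symmetric])
  also have "\<dots> = (\<Sum>i<p - 1. f (i mod 6))" by (simp add: cls_w)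
  also have "\<dots> = (\<Sum>i<g * 6. f (i mod 6))"
  proof -
    have "p - 1 = g * 6" using p_eq by simp
    thus ?thesis by (simp only:)
  qed
  also have "\<dots> = (\<Sum>j<g. \<Sum>s<6. f s)"
    unfolding sum.nat_group[symmetric]
  proof (rule sum.cong[OF refl])
    fix j
    have "(\<Sum>s\<in>{j * 6..<j * 6 + 6}. f (s mod 6)) = (\<Sum>s\<in>{0..<6}. f ((s + j * 6) mod 6))"
      using sum.shift_bounds_nat_ivl[of "\<lambda>s. f (s mod 6)" 0 "j * 6" 6] by (simp add: add.commute)
    thus "(\<Sum>s\<in>{j * 6..<j * 6 + 6}. f (s mod 6)) = (\<Sum>s<6. f s)" by (simp add: atLeast0LessThan)
  qed
  finally show ?thesis by simp
qed

end

section \<open>Equidistribution of the classes of shifted residues\<close>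

context sextic_residues
begin

definition good :: "int set \<Rightarrow> int set" where
  "good I = {k\<in>{0..<int p}. \<forall>a\<in>I. \<not> int p dvd k + a}"

lemma finite_good [simp]: "finite (good I)"
  by (rule finite_subset[of _ "{0..<int p}"]) (auto simp: good_def)

lemma good_subset: "good I \<subseteq> {0..<int p}"
  by (auto simp: good_def)

lemma card_bad:
  assumes "finite I" shows "card ({0..<int p} - good I) \<le> card I"
proof -
  have "{0..<int p} - good I \<subseteq> (\<lambda>a. (- a) mod int p) ` I"
  proof
    fix k assume "k \<in> {0..<int p} - good I"
    then obtain a where "a \<in> I" "int p dvd k + a" "k \<in> {0..<int p}" by (auto simp: good_def)
    hence "k = (- a) mod int p" by (metis (no_types) add_uminus_conv_diff atLeastLessThan_iff diff_minus_eq_add mod_eq_dvd_iff mod_pos_pos_trivial)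
    thus "k \<in> (\<lambda>a. (- a) mod int p) ` I" using \<open>a \<in> I\<close> by blast
  qed
  thus ?thesis using assms card_image_le[OF assms] card_mono finite_imageI order_trans by meson
qed

lemma card_good_le: "card (good I) \<le> p"
  using card_mono[OF _ good_subset, of I] by simp

lemma card_good_ge: "finite I \<Longrightarrow> real p - real (card I) \<le> real (card (good I))"
proof -
  assume "finite I"
  hence "card ({0..<int p} - good I) \<le> card I" by (rule card_bad)
  moreover have "card ({0..<int p} - good I) = p - card (good I)"
    using card_Diff_subset[OF finite_good good_subset, of I] by simp
  ultimately show ?thesis by linarith
qed

text \<open>A prescribed value of the weighted sum of classes modulo m is a prescribed (d g)-th
  power of the product of the (k + a)^(e a), so \<open>level_set_bound\<close> applies with zeta =
  w^(d g s).\<close>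

lemma class_sum_upper:
  assumes p: "p \<ge> 40000" and md: "m * d = 6" "2 \<le> m" "m \<le> 6"
    and I: "I \<subseteq> {0..<int p}" "card I \<le> 4" and e: "\<And>a. a \<in> I \<Longrightarrow> e a \<le> 5"
    and cases: "(m = 6 \<and> (\<exists>a\<in>I. \<not> 3 dvd e a) \<and> (\<exists>b\<in>I. odd (e b))) \<or> (\<exists>a\<in>I. coprime (e a) m)"
  shows "real (card {k\<in>good I. (\<Sum>a\<in>I. e a * cls (k + a)) mod m = s}) \<le> real p / real m + 8400 * sqrt (real p)"
proof -
  let ?Y = "{k\<in>{0..<int p}. (\<forall>a\<in>I. \<not> int p dvd k + a) \<and>
      [(\<Prod>a\<in>I. (k + a) ^ e a) ^ (d * g) = w ^ (d * g * s)] (mod int p)}"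
  have "{k\<in>good I. (\<Sum>a\<in>I. e a * cls (k + a)) mod m = s} \<subseteq> ?Y"
  proof safe
    fix k assume k: "k \<in> good I" and s: "s = (\<Sum>a\<in>I. e a * cls (k + a)) mod m"
    show "k \<in> {0..<int p}" using k by (simp add: good_def)
    { fix a assume "a \<in> I" "int p dvd k + a" thus False using k by (simp add: good_def) }
    have "(\<Prod>a\<in>I. (k + a) ^ e a) ^ (d * g) = (\<Prod>a\<in>I. ((k + a) ^ (d * g)) ^ e a)"
      unfolding prod_power_distrib
      by (intro prod.cong refl) (simp only: power_mult[symmetric] mult.commute)
    also have "[(\<Prod>a\<in>I. ((k + a) ^ (d * g)) ^ e a) = (\<Prod>a\<in>I. (w ^ (d * g * cls (k + a))) ^ e a)] (mod int p)"
      using k by (intro cong_prod cong_pow cls_power_eq_iff[OF md(1)]) (simp add: good_def)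
    also have "(\<Prod>a\<in>I. (w ^ (d * g * cls (k + a))) ^ e a) = w ^ (d * g * (\<Sum>a\<in>I. e a * cls (k + a)))"
      unfolding sum_distrib_left power_sum
      by (intro prod.cong refl) (simp only: power_mult[symmetric] mult_ac)
    also have "[w ^ (d * g * (\<Sum>a\<in>I. e a * cls (k + a))) = w ^ (d * g * s)] (mod int p)"
      unfolding w_power_cong_iff
    proof -
      have "p - 1 = d * g * m" using p_eq md(1) by (simp add: mult_ac)
      thus "[d * g * (\<Sum>a\<in>I. e a * cls (k + a)) = d * g * s] (mod (p - 1))"
        by (simp only: s cong_def mult_mod_right[symmetric] mod_mod_trivial)
    qed
    finally show "[(\<Prod>a\<in>I. (k + a) ^ e a) ^ (d * g) =
      w ^ (d * g * ((\<Sum>a\<in>I. e a * cls (k + a)) mod m))] (mod int p)" by (simp only: s)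
  qed
  moreover have "finite ?Y" by (rule finite_subset[of _ "{0..<int p}"]) auto
  ultimately have "card {k\<in>good I. (\<Sum>a\<in>I. e a * cls (k + a)) mod m = s} \<le> card ?Y" by (intro card_mono)
  moreover have "real (card ?Y) \<le> real p / real m + 8400 * sqrt (real p)"
    by (rule level_set_bound[of p m "d * g" I e])
       (use prime_p p_eq md I e p cases in \<open>auto simp: mult.assoc[symmetric]\<close>)
  ultimately show ?thesis by linarith
qed

text \<open>The m level sets together contain at least p - 4 residues. Subtracting the upper bounds
  for the others gives a lower bound for each, with deviation at most 5 * 8400 sqrt p + 4. In the
  character sum the common main term p/m is killed because the m-th roots of unity sum to
  zero.\<close>

lemma char_sum_bound_aux:
  assumes p: "p \<ge> 40000" and md: "m * d = 6" "2 \<le> m" "m \<le> 6"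
    and I: "I \<subseteq> {0..<int p}" "card I \<le> 4" and e: "\<And>a. a \<in> I \<Longrightarrow> e a \<le> 5"
    and cases: "(m = 6 \<and> (\<exists>a\<in>I. \<not> 3 dvd e a) \<and> (\<exists>b\<in>I. odd (e b))) \<or> (\<exists>a\<in>I. coprime (e a) m)"
  shows "cmod (\<Sum>k\<in>good I. \<Prod>a\<in>I. unity_root m (int (e a * cls (k + a)))) \<le> 300000 * sqrt (real p)"
proof -
  define N where "N s = real (card {k\<in>good I. (\<Sum>a\<in>I. e a * cls (k + a)) mod m = s})" for s
  have m0: "m > 0" using md by simp
  have s200: "sqrt (real p) \<ge> 200" using p by (intro real_le_rsqrt) simp
  have fin: "finite I" using I finite_subset by blast
  have up: "N s \<le> real p / real m + 8400 * sqrt (real p)" for s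
    unfolding N_def using assms by (intro class_sum_upper) auto
  have tot: "(\<Sum>s<m. N s) = real (card (good I))"
    unfolding N_def of_nat_sum[symmetric]
  proof (rule arg_cong[of _ _ real])
    have "good I = (\<Union>s<m. {k\<in>good I. (\<Sum>a\<in>I. e a * cls (k + a)) mod m = s})" using m0 by auto
    hence "card (good I) = card (\<Union>s<m. {k\<in>good I. (\<Sum>a\<in>I. e a * cls (k + a)) mod m = s})" by simp
    also have "\<dots> = (\<Sum>s<m. card {k\<in>good I. (\<Sum>a\<in>I. e a * cls (k + a)) mod m = s})"
      by (rule card_UN_disjoint) auto
    finally show "(\<Sum>s<m. card {k\<in>good I. (\<Sum>a\<in>I. e a * cls (k + a)) mod m = s}) = card (good I)" ..
  qed
  have dev: "\<bar>N s - real p / real m\<bar> \<le> 50000 * sqrt (real p)" if s: "s < m" for s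
  proof -
    have "real p - 4 \<le> (\<Sum>s<m. N s)" unfolding tot using card_good_ge[OF fin] I(2) by simp
    also have "\<dots> = N s + (\<Sum>s\<in>{..<m}-{s}. N s)" using s by (simp add: sum.remove)
    also have "(\<Sum>s\<in>{..<m}-{s}. N s) \<le> real (card ({..<m}-{s})) * (real p / real m + 8400 * sqrt (real p))"
      by (rule sum_bounded_above) (rule up)
    also have "real (card ({..<m}-{s})) = real m - 1" using s m0 by simp
    finally have "real p - 4 \<le> N s + (real m - 1) * (real p / real m + 8400 * sqrt (real p))" by simp
    also have "(real m - 1) * (real p / real m + 8400 * sqrt (real p)) =
        real p - real p / real m + (real m - 1) * (8400 * sqrt (real p))"
      using m0 by (simp add: field_simps)
    also have "(real m - 1) * (8400 * sqrt (real p)) \<le> 5 * (8400 * sqrt (real p))"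
      using md by (intro mult_right_mono) auto
    finally have "real p / real m - N s \<le> 42000 * sqrt (real p) + 4" by simp
    thus ?thesis using up[of s] s200 unfolding abs_le_iff by auto
  qed
  have "(\<Sum>k\<in>good I. \<Prod>a\<in>I. unity_root m (int (e a * cls (k + a)))) =
     (\<Sum>k\<in>good I. unity_root m (int ((\<Sum>a\<in>I. e a * cls (k + a)) mod m)))"
  proof (rule sum.cong[OF refl])
    fix k
    have "(\<Prod>a\<in>I. unity_root m (int (e a * cls (k + a)))) = unity_root m (\<Sum>a\<in>I. int (e a * cls (k + a)))"
      using fin by (induction I rule: finite_induct) (auto simp: unity_root_add)
    also have "\<dots> = unity_root m (int ((\<Sum>a\<in>I. e a * cls (k + a)) mod m))"
      by (simp only: of_nat_sum[symmetric] of_nat_mod unity_root_mod)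
    finally show "(\<Prod>a\<in>I. unity_root m (int (e a * cls (k + a)))) =
      unity_root m (int ((\<Sum>a\<in>I. e a * cls (k + a)) mod m))" .
  qed
  also have "\<dots> = (\<Sum>s<m. \<Sum>k\<in>{k\<in>good I. (\<Sum>a\<in>I. e a * cls (k + a)) mod m = s}.
      unity_root m (int ((\<Sum>a\<in>I. e a * cls (k + a)) mod m)))"
    using m0 by (intro sum.group[symmetric]) auto
  also have "\<dots> = (\<Sum>s<m. of_real (N s) * unity_root m (int s))"
    by (intro sum.cong refl) (simp add: N_def)
  also have "\<dots> = (\<Sum>s<m. of_real (N s - real p / real m) * unity_root m (int s))"
  proof -
    have "(\<Sum>s<m. unity_root m (int s)) = 0" using sum_unity_root[OF m0, of 1] md by simp
    hence "(\<Sum>s<m. of_real (real p / real m) * unity_root m (int s)) = 0"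
      by (simp only: sum_distrib_left[symmetric]) simp
    thus ?thesis by (simp add: left_diff_distrib sum_subtractf)
  qed
  finally have eq: "(\<Sum>k\<in>good I. \<Prod>a\<in>I. unity_root m (int (e a * cls (k + a)))) =
    (\<Sum>s<m. of_real (N s - real p / real m) * unity_root m (int s))" .
  have "cmod (\<Sum>s<m. of_real (N s - real p / real m) * unity_root m (int s))
     \<le> (\<Sum>s<m. 50000 * sqrt (real p))"
    by (intro sum_norm_le) (simp add: norm_mult dev del: of_real_diff)
  also have "\<dots> \<le> 6 * (50000 * sqrt (real p))"
    using md by (simp only: sum_constant card_lessThan) (intro mult_right_mono, auto)
  finally show ?thesis unfolding eq by simp
qed

text \<open>If 3 (or 2) divides all exponents, the characters really have order 2 (or 3); dividing
  the exponents by it makes a nonzero one coprime to the new order. Otherwise some exponent is prime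
  to 3 and some exponent is odd, possibly at different shifts, which is the sextic case. For p <
  40000 the trivial bound p <= 200 sqrt p suffices.\<close>

lemma char_sum_bound:
  assumes I: "I \<subseteq> {0..<int p}" "card I \<le> 4" and e: "\<And>a. a \<in> I \<Longrightarrow> e a \<le> 5"
    and nz: "\<exists>a\<in>I. e a \<noteq> 0"
  shows "cmod (\<Sum>k\<in>good I. \<Prod>a\<in>I. unity_root 6 (int (e a * cls (k + a)))) \<le> 300000 * sqrt (real p)"
proof (cases "p \<ge> 40000")
  case False
  have "sqrt (real p) \<le> sqrt (200\<^sup>2)" using False by (intro real_sqrt_le_mono) simp
  hence "sqrt (real p) * sqrt (real p) \<le> 200 * sqrt (real p)" by (intro mult_right_mono) auto
  hence *: "real p \<le> 200 * sqrt (real p)" by simp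
  have "cmod (\<Sum>k\<in>good I. \<Prod>a\<in>I. unity_root 6 (int (e a * cls (k + a)))) \<le> (\<Sum>k\<in>good I. 1)"
    by (intro sum_norm_le) (simp add: prod_norm[symmetric])
  also have "\<dots> \<le> real p" using card_good_le[of I] by simp
  finally show ?thesis using * by (simp add: order_trans)
next
  case True
  have scale: "unity_root 6 (int (d * e' * c)) = unity_root m (int (e' * c))" if "m * d = 6" for d m e' c :: nat
  proof -
    have "d > 0" using that by (auto intro!: Nat.gr0I)
    thus ?thesis using unity_root_scale[of d m "int (e' * c)"] that by (simp add: mult_ac)
  qed
  consider "(\<exists>a\<in>I. \<not> 3 dvd e a) \<and> (\<exists>b\<in>I. odd (e b))" | "\<forall>a\<in>I. 3 dvd e a" | "\<forall>a\<in>I. even (e a)" by blast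
  thus ?thesis
  proof cases
    case 1
    thus ?thesis using char_sum_bound_aux[of 6 1 I e] True I e by simp
  next
    case 2
    define e' where "e' a = e a div 3" for a
    have ee: "e a = 3 * e' a" if "a \<in> I" for a using 2 that by (simp add: e'_def)
    have "(\<Sum>k\<in>good I. \<Prod>a\<in>I. unity_root 6 (int (e a * cls (k + a)))) =
      (\<Sum>k\<in>good I. \<Prod>a\<in>I. unity_root 2 (int (e' a * cls (k + a))))"
      by (intro sum.cong prod.cong refl) (simp only: ee scale[of 2 3])
    moreover have "\<exists>a\<in>I. coprime (e' a) 2"
    proof -
      from nz obtain a where "a \<in> I" "e a \<noteq> 0" by blast
      hence "e' a = 1" using ee[of a] e[of a] by auto
      thus ?thesis using \<open>a \<in> I\<close> by (intro bexI[of _ a]) auto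
    qed
    moreover have "e' a \<le> 5" if "a \<in> I" for a using e[OF that] by (simp add: e'_def)
    ultimately show ?thesis using char_sum_bound_aux[of 2 3 I e'] True I by simp
  next
    case 3
    define e' where "e' a = e a div 2" for a
    have ee: "e a = 2 * e' a" if "a \<in> I" for a using 3 that by (simp add: e'_def)
    have "(\<Sum>k\<in>good I. \<Prod>a\<in>I. unity_root 6 (int (e a * cls (k + a)))) =
      (\<Sum>k\<in>good I. \<Prod>a\<in>I. unity_root 3 (int (e' a * cls (k + a))))"
      by (intro sum.cong prod.cong refl) (simp only: ee scale[of 3 2])
    moreover have "\<exists>a\<in>I. coprime (e' a) 3"
    proof -
      from nz obtain a where a: "a \<in> I" "e a \<noteq> 0" by blast
      hence "e' a = 1 \<or> e' a = 2" using ee[of a] e[of a] by auto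
      moreover have "coprime (2::nat) 3" by (rule primes_coprime) auto
      ultimately show ?thesis using a(1) by (metis coprime_1_left)
    qed
    moreover have "e' a \<le> 5" if "a \<in> I" for a using e[OF that] by (simp add: e'_def)
    ultimately show ?thesis using char_sum_bound_aux[of 3 2 I e'] True I by simp
  qed
qed

text \<open>The classes of \<open>k + a\<close> for distinct shifts \<open>a\<close> behave like independent uniform random variables.\<close>

lemma equidistribution:
  fixes \<phi> :: "int \<Rightarrow> nat \<Rightarrow> complex"
  assumes I: "I \<subseteq> {0..<int p}" "card I \<le> 4"
    and B: "\<And>a s. a \<in> I \<Longrightarrow> s < 6 \<Longrightarrow> cmod (\<phi> a s) \<le> B a"
  shows "cmod ((\<Sum>k\<in>good I. \<Prod>a\<in>I. \<phi> a (cls (k + a))) - of_nat p * (\<Prod>a\<in>I. (\<Sum>s<6. \<phi> a s) / 6))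
    \<le> 4 * 10 ^ 8 * sqrt (real p) * (\<Prod>a\<in>I. B a)"
proof -
  have fin: "finite I" using I finite_subset by blast
  \<comment> \<open>Fourier expansion on Z/6: the zero frequency in every coordinate gives the main
    term, and every other frequency vector gives a character sum.\<close>
  define \<psi> where "\<psi> a e = (\<Sum>s<6. \<phi> a s * unity_root 6 (- int (e * s))) / 6" for a e
  have inv: "\<phi> a s = (\<Sum>e<6. \<psi> a e * unity_root 6 (int (e * s)))" if s: "s < 6" for a s
  proof -
    have "(\<Sum>e<6. \<psi> a e * unity_root 6 (int (e * s))) =
        (\<Sum>e<6. \<Sum>s'<6. \<phi> a s' / 6 * unity_root 6 (int e * (int s - int s')))"
      unfolding \<psi>_def sum_divide_distrib sum_distrib_right
    proof (intro sum.cong refl)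
      fix e s' :: nat
      have "unity_root 6 (int e * (int s - int s')) = unity_root 6 (- int (e * s')) * unity_root 6 (int (e * s))"
        unfolding unity_root_add[symmetric] by (simp add: algebra_simps)
      thus "\<phi> a s' * unity_root 6 (- int (e * s')) / 6 * unity_root 6 (int (e * s)) =
        \<phi> a s' / 6 * unity_root 6 (int e * (int s - int s'))" by simp
    qed
    also have "\<dots> = (\<Sum>s'<6. \<phi> a s' / 6 * (\<Sum>e<6. unity_root 6 (int e * (int s - int s'))))"
      by (subst sum.swap) (simp add: sum_distrib_left)
    also have "\<dots> = (\<Sum>s'<6. if s' = s then \<phi> a s' else 0)"
    proof (rule sum.cong[OF refl])
      fix s' :: nat assume "s' \<in> {..<6}"
      hence "s' < 6" by simp
      hence "6 dvd int s - int s' \<longleftrightarrow> s' = s" using s by presburger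
      thus "\<phi> a s' / 6 * (\<Sum>e<6. unity_root 6 (int e * (int s - int s'))) = (if s' = s then \<phi> a s' else 0)"
        using sum_unity_root[of 6 "int s - int s'"] by simp
    qed
    finally show ?thesis using s by simp
  qed
  have B0: "0 \<le> B a" if "a \<in> I" for a by (rule order_trans[OF norm_ge_zero B[OF that, of 0]]) simp
  have \<psi>B: "cmod (\<psi> a e) \<le> B a" if "a \<in> I" for a e
  proof -
    have "cmod (\<Sum>s<6. \<phi> a s * unity_root 6 (- int (e * s))) \<le> (\<Sum>s<(6::nat). B a)"
      using B[OF that] by (intro sum_norm_le) (simp add: norm_mult)
    thus ?thesis by (simp add: \<psi>_def norm_divide)
  qed
  define T where "T E = (\<Sum>k\<in>good I. \<Prod>a\<in>I. unity_root 6 (int (E a * cls (k + a))))" for E :: "int \<Rightarrow> nat"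
  let ?P = "I \<rightarrow>\<^sub>E {..<6::nat}"
  define Z where "Z = (\<lambda>a\<in>I. 0::nat)"
  have finP: "finite ?P" using fin by (intro finite_PiE) auto
  have z: "Z \<in> ?P" by (auto simp: Z_def)
  have "(\<Sum>k\<in>good I. \<Prod>a\<in>I. \<phi> a (cls (k + a))) =
     (\<Sum>k\<in>good I. \<Prod>a\<in>I. \<Sum>e<6. \<psi> a e * unity_root 6 (int (e * cls (k + a))))"
    by (intro sum.cong prod.cong refl inv cls_less)
  also have "\<dots> = (\<Sum>k\<in>good I. \<Sum>E\<in>?P. \<Prod>a\<in>I. \<psi> a (E a) * unity_root 6 (int (E a * cls (k + a))))"
    using fin by (intro sum.cong refl prod_sum_PiE) auto
  also have "\<dots> = (\<Sum>E\<in>?P. (\<Prod>a\<in>I. \<psi> a (E a)) * T E)"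
    by (subst sum.swap) (simp add: T_def prod.distrib sum_distrib_left)
  also have "\<dots> = (\<Prod>a\<in>I. \<psi> a (Z a)) * T Z + (\<Sum>E\<in>?P - {Z}. (\<Prod>a\<in>I. \<psi> a (E a)) * T E)"
    using finP z by (rule sum.remove)
  also have "(\<Prod>a\<in>I. \<psi> a (Z a)) = (\<Prod>a\<in>I. (\<Sum>s<6. \<phi> a s) / 6)"
    by (intro prod.cong refl) (simp add: \<psi>_def Z_def)
  also have "T Z = of_nat (card (good I))" by (simp add: T_def Z_def)
  finally have "(\<Sum>k\<in>good I. \<Prod>a\<in>I. \<phi> a (cls (k + a))) = (\<Prod>a\<in>I. (\<Sum>s<6. \<phi> a s) / 6) *
      of_nat (card (good I)) + (\<Sum>E\<in>?P - {Z}. (\<Prod>a\<in>I. \<psi> a (E a)) * T E)" .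
  moreover have "\<psi> a 0 = (\<Sum>s<6. \<phi> a s) / 6" for a by (simp add: \<psi>_def)
  ultimately have "(\<Sum>k\<in>good I. \<Prod>a\<in>I. \<phi> a (cls (k + a))) - of_nat p * (\<Prod>a\<in>I. (\<Sum>s<6. \<phi> a s) / 6) =
     (\<Prod>a\<in>I. \<psi> a 0) * (of_nat (card (good I)) - of_nat p) + (\<Sum>E\<in>?P - {Z}. (\<Prod>a\<in>I. \<psi> a (E a)) * T E)"
    by (simp only: algebra_simps)
  also have "cmod \<dots> \<le> (\<Prod>a\<in>I. B a) * 4 + (\<Sum>E\<in>?P - {Z}. (\<Prod>a\<in>I. B a) * (300000 * sqrt (real p)))"
  proof (rule norm_triangle_mono)
    have "cmod (of_nat (card (good I)) - of_nat p) = \<bar>real (card (good I)) - real p\<bar>"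
      by (metis norm_of_real of_real_diff of_real_of_nat_eq)
    also have "\<dots> \<le> 4" using card_good_le[of I] card_good_ge[OF fin] I(2) by simp
    finally show "cmod ((\<Prod>a\<in>I. \<psi> a 0) * (of_nat (card (good I)) - of_nat p)) \<le> (\<Prod>a\<in>I. B a) * 4"
      unfolding norm_mult using \<psi>B B0 by (intro mult_mono) (auto simp: prod_norm[symmetric] intro!: prod_mono prod_nonneg)
    show "cmod (\<Sum>E\<in>?P - {Z}. (\<Prod>a\<in>I. \<psi> a (E a)) * T E) \<le> (\<Sum>E\<in>?P - {Z}. (\<Prod>a\<in>I. B a) * (300000 * sqrt (real p)))"
    proof (rule sum_norm_le)
      fix E assume E: "E \<in> ?P - {Z}"
      have "\<exists>a\<in>I. E a \<noteq> 0"
      proof (rule ccontr)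
        assume "\<not> ?thesis"
        hence "E = Z" using E by (intro extensionalityI[of E I]) (auto simp: PiE_def Z_def)
        thus False using E by simp
      qed
      moreover have "E a \<le> 5" if "a \<in> I" for a
      proof -
        have "E a < 6" using E that by (auto dest: PiE_mem)
        thus ?thesis by simp
      qed
      ultimately have "cmod (T E) \<le> 300000 * sqrt (real p)"
        unfolding T_def using I by (intro char_sum_bound) auto
      thus "cmod ((\<Prod>a\<in>I. \<psi> a (E a)) * T E) \<le> (\<Prod>a\<in>I. B a) * (300000 * sqrt (real p))"
        unfolding norm_mult using \<psi>B B0 by (intro mult_mono) (auto simp: prod_norm[symmetric] intro!: prod_mono prod_nonneg)
    qed
  qed
  also have "\<dots> = (\<Prod>a\<in>I. B a) * (4 + real (card (?P - {Z})) * (300000 * sqrt (real p)))"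
    by (simp add: algebra_simps)
  \<comment> \<open>At most 6^4 = 1296 frequency vectors contribute, and 1296 * 300000 + 4 is below
    4 * 10^8.\<close>
  also have "\<dots> \<le> (\<Prod>a\<in>I. B a) * (4 * 10 ^ 8 * sqrt (real p))"
  proof (rule mult_left_mono)
    have "card (?P - {Z}) \<le> card ?P" using finP by (intro card_mono) auto
    also have "card ?P = 6 ^ card I" using fin by (simp add: card_PiE)
    also have "\<dots> \<le> 6 ^ 4" using I(2) by (intro power_increasing) auto
    finally have "real (card (?P - {Z})) \<le> 1296" by simp
    hence "real (card (?P - {Z})) * (300000 * sqrt (real p)) \<le> 1296 * (300000 * sqrt (real p))"
      by (intro mult_right_mono) auto
    moreover have "1 \<le> sqrt (real p)" using p_pos by simp
    moreover have "1296 * (300000 * sqrt (real p)) = 388800000 * sqrt (real p)" by simp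
    moreover have "4 * 10 ^ 8 * sqrt (real p) = 400000000 * sqrt (real p)" by simp
    ultimately show "4 + real (card (?P - {Z})) * (300000 * sqrt (real p)) \<le> 4 * 10 ^ 8 * sqrt (real p)"
      by linarith
  qed (use B0 in \<open>auto intro!: prod_nonneg\<close>)
  finally show ?thesis by (simp add: mult_ac)
qed

end

section \<open>Orbit counting and the form x^2 + 27 y^2\<close>

text \<open>The orbits of T have exactly three elements. It is applied to x -> 1/(1 - x), and the
  companion for involutions to x -> 1 - x.\<close>

lemma three_dvd_card:
  assumes fin: "finite X" and T: "\<And>x. x \<in> X \<Longrightarrow> T x \<in> X" "\<And>x. x \<in> X \<Longrightarrow> T (T (T x)) = x"
    "\<And>x. x \<in> X \<Longrightarrow> T x \<noteq> x"
  shows "3 dvd card X"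
proof -
  define O3 where "O3 x = {x, T x, T (T x)}" for x
  have eq: "O3 y = O3 x" if "x \<in> X" "y \<in> O3 x" for x y
    using that T by (auto simp: O3_def)
  have "\<Union>(O3 ` X) = X" using T by (auto simp: O3_def)
  moreover have "3 dvd card (\<Union>(O3 ` X))"
  proof (rule dvd_partition)
    show "finite (\<Union>(O3 ` X))" using fin \<open>\<Union>(O3 ` X) = X\<close> by simp
    show "\<forall>c\<in>O3 ` X. 3 dvd card c"
    proof safe
      fix x assume x: "x \<in> X"
      have "T (T x) \<noteq> x" using T(2)[of x] T(3)[of x] x by metis
      hence "card (O3 x) = 3" using T x unfolding O3_def by (subst card_3_iff) metis
      thus "3 dvd card (O3 x)" by simp
    qed
    show "\<forall>c1\<in>O3 ` X. \<forall>c2\<in>O3 ` X. c1 \<noteq> c2 \<longrightarrow> c1 \<inter> c2 = {}" using eq by blast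
  qed
  ultimately show ?thesis by simp
qed

lemma two_dvd_card:
  assumes fin: "finite X" and T: "\<And>x. x \<in> X \<Longrightarrow> T x \<in> X" "\<And>x. x \<in> X \<Longrightarrow> T (T x) = x"
    "\<And>x. x \<in> X \<Longrightarrow> T x \<noteq> x"
  shows "2 dvd card X"
proof -
  define O2 where "O2 x = {x, T x}" for x
  have eq: "O2 y = O2 x" if "x \<in> X" "y \<in> O2 x" for x y
    using that T by (auto simp: O2_def)
  have "\<Union>(O2 ` X) = X" using T by (auto simp: O2_def)
  moreover have "2 dvd card (\<Union>(O2 ` X))"
  proof (rule dvd_partition)
    show "finite (\<Union>(O2 ` X))" using fin \<open>\<Union>(O2 ` X) = X\<close> by simp
    show "\<forall>c\<in>O2 ` X. 2 dvd card c"
    proof safe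
      fix x assume x: "x \<in> X"
      have "card (O2 x) = 2" using T(3)[OF x] by (auto simp: O2_def card_insert_if)
      thus "2 dvd card (O2 x)" by simp
    qed
    show "\<forall>c1\<in>O2 ` X. \<forall>c2\<in>O2 ` X. c1 \<noteq> c2 \<longrightarrow> c1 \<inter> c2 = {}" using eq by blast
  qed
  ultimately show ?thesis by simp
qed

text \<open>Compare with 4 p = (2 x)^2 + 27 (2 y)^2. For one choice of the sign of x, p divides the
  determinant L (2 y) - 2 x M; Brahmagupta's identity then gives 27 k^2 <= 16 for the quotient k, so
  the determinant is zero and M = 2 y or M = -2 y.\<close>

lemma quadratic_form_27_unique:
  fixes L M x y :: int
  assumes p: "prime p" and 1: "4 * int p = L\<^sup>2 + 27 * M\<^sup>2" and 2: "int p = x\<^sup>2 + 27 * y\<^sup>2"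
  shows "M\<^sup>2 = (2 * y)\<^sup>2"
proof -
  have key: "M\<^sup>2 = (2 * y)\<^sup>2" if dvd: "int p dvd L * (2 * y) - 2 * x * M" and 2: "int p = x\<^sup>2 + 27 * y\<^sup>2" for x
  proof -
    obtain k where k: "L * (2 * y) - 2 * x * M = int p * k" using dvd by blast
    have "16 * (int p)\<^sup>2 = (4 * int p) * (4 * int p)" by (simp add: power2_eq_square)
    also have "\<dots> = (L\<^sup>2 + 27 * M\<^sup>2) * ((2 * x)\<^sup>2 + 27 * (2 * y)\<^sup>2)"
      by (simp only: 1[symmetric]) (simp add: 2 power2_eq_square algebra_simps)
    also have "\<dots> = (L * (2 * x) + 27 * (M * (2 * y)))\<^sup>2 + 27 * (L * (2 * y) - 2 * x * M)\<^sup>2"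
      by (simp add: power2_eq_square algebra_simps)
    finally have "27 * (int p * k)\<^sup>2 \<le> 16 * (int p)\<^sup>2" unfolding k by simp
    hence "27 * k\<^sup>2 * (int p)\<^sup>2 \<le> 16 * (int p)\<^sup>2" by (simp add: power_mult_distrib mult_ac)
    hence "27 * k\<^sup>2 \<le> 16" using prime_gt_0_nat[OF p] by (simp add: mult_le_cancel_right)
    hence "k\<^sup>2 < 1" by linarith
    hence "k = 0" by (metis less_le_not_le one_le_power int_one_le_iff_zero_less power2_eq_iff_nonneg zero_less_power2)
    hence e: "L * (2 * y) = 2 * x * M" using k by simp
    have "4 * int p * (2 * y)\<^sup>2 = (L * (2 * y))\<^sup>2 + 27 * M\<^sup>2 * (2 * y)\<^sup>2"
      unfolding 1 by (simp add: power2_eq_square algebra_simps)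
    also have "\<dots> = 4 * int p * M\<^sup>2" unfolding e 2 by (simp add: power2_eq_square algebra_simps)
    finally show ?thesis using prime_gt_0_nat[OF p] by simp
  qed
  have "(L * (2 * y) - 2 * x * M) * (L * (2 * y) - 2 * (- x) * M) = L\<^sup>2 * (4 * y\<^sup>2) - 4 * x\<^sup>2 * M\<^sup>2"
    by (simp add: power2_eq_square algebra_simps)
  also have "\<dots> = (4 * int p - 27 * M\<^sup>2) * (4 * y\<^sup>2) - 4 * (int p - 27 * y\<^sup>2) * M\<^sup>2"
    using 1 2 by simp
  also have "\<dots> = int p * (16 * y\<^sup>2 - 4 * M\<^sup>2)" by (simp add: algebra_simps)
  finally have "int p dvd (L * (2 * y) - 2 * x * M) * (L * (2 * y) - 2 * (- x) * M)" by simp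
  hence "int p dvd L * (2 * y) - 2 * x * M \<or> int p dvd L * (2 * y) - 2 * (- x) * M"
    using p by (subst (asm) prime_dvd_mult_iff) auto
  thus ?thesis using key[of x] key[of "-x"] 2 by auto
qed

text \<open>|u^3 - sigma| is the product of the distances from u to the three points sigma omega^i.
  These are sqrt 3 >= 3/2 apart, so two of the distances are at least 3/4, and their product is at
  least 1/2.\<close>

lemma cube_root_near:
  fixes u :: complex
  assumes u: "cmod u = 1" and s: "\<sigma> = 1 \<or> \<sigma> = (-1 :: real)"
  shows "\<exists>i<3. cmod (u - of_real \<sigma> * unity_root 3 (int i)) \<le> 2 * cmod (u ^ 3 - of_real \<sigma>)"
proof -
  define d where "d i = cmod (u - of_real \<sigma> * unity_root 3 (int i))" for i :: nat
  let ?w = "unity_root 3 1"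
  have w: "?w = Complex (-1/2) (sqrt 3 / 2)"
    by (simp add: unity_root_def complex_eq_iff cos_120 sin_120)
  have w2: "unity_root 3 2 = Complex (-1/2) (- sqrt 3 / 2)"
  proof -
    have "unity_root 3 2 = ?w ^ 2" by (simp add: unity_root_power)
    thus ?thesis unfolding w by (simp add: complex_eq_iff power2_eq_square)
  qed
  have fac: "u ^ 3 - of_real \<sigma> = (u - of_real \<sigma> * unity_root 3 0) * (u - of_real \<sigma> * unity_root 3 1) * (u - of_real \<sigma> * unity_root 3 2)"
  proof -
    define x where "x = ?w"
    have x: "unity_root 3 2 = x^2" "x ^ 3 = 1"
      unfolding x_def unity_root_power by (simp_all add: unity_root_eq_1_iff)
    have "(x - 1) * (x\<^sup>2 + x + 1) = x ^ 3 - 1" by (simp add: power2_eq_square power3_eq_cube algebra_simps)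
    moreover have "x \<noteq> 1" by (simp add: x_def unity_root_eq_1_iff)
    ultimately have x3: "x\<^sup>2 + x + 1 = 0" using x by simp
    have "(u - of_real \<sigma>) * (u - of_real \<sigma> * x) * (u - of_real \<sigma> * x\<^sup>2) =
       u^3 - of_real \<sigma> * u\<^sup>2 * (x\<^sup>2 + x + 1) + (of_real \<sigma>)\<^sup>2 * u * x * (x\<^sup>2 + x + 1) - (of_real \<sigma>)^3 * x^3"
      by (simp add: power2_eq_square power3_eq_cube algebra_simps)
    also have "\<dots> = u^3 - of_real \<sigma>" unfolding x3 x(2) using s by auto
    finally show ?thesis using x by (simp add: x_def[symmetric])
  qed
  have prod: "cmod (u ^ 3 - of_real \<sigma>) = d 0 * d 1 * d 2"
    unfolding fac by (simp add: d_def norm_mult)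
  have sep: "3 / 2 \<le> d i + d j" if "i < 3" "j < 3" "i \<noteq> j" for i j
  proof -
    have "cmod (unity_root 3 (int i) - unity_root 3 (int j)) = sqrt 3"
    proof -
      have v: "unity_root 3 (int i) = (if i = 0 then Complex 1 0 else if i = 1 then ?w else unity_root 3 2)"
        if "i < 3" for i
      proof -
        have "i = 0 \<or> i = 1 \<or> i = 2" using that by linarith
        thus ?thesis by (auto simp: complex_eq_iff)
      qed
      have "i = 0 \<or> i = 1 \<or> i = 2" "j = 0 \<or> j = 1 \<or> j = 2" using that by linarith+
      thus ?thesis using that unfolding v[OF that(1)] v[OF that(2)] w w2
        by (elim disjE) (auto simp: cmod_def power2_eq_square)
    qed
    moreover have "cmod (unity_root 3 (int i) - unity_root 3 (int j)) =
      cmod ((u - of_real \<sigma> * unity_root 3 (int j)) - (u - of_real \<sigma> * unity_root 3 (int i)))"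
    proof -
      have "(u - of_real \<sigma> * unity_root 3 (int j)) - (u - of_real \<sigma> * unity_root 3 (int i)) =
         of_real \<sigma> * (unity_root 3 (int i) - unity_root 3 (int j))" by (simp add: algebra_simps)
      moreover have "cmod (of_real \<sigma>) = 1" using s by auto
      ultimately show ?thesis by (simp only: norm_mult)
    qed
    moreover have "\<dots> \<le> d j + d i" unfolding d_def by (rule norm_triangle_ineq4)
    moreover have "3 / 2 \<le> sqrt 3" by (rule real_le_rsqrt) (simp add: power2_eq_square)
    ultimately show ?thesis by linarith
  qed
  have d0: "0 \<le> d i" for i by (simp add: d_def)
  have *: "d a \<le> 2 * (d a * d b * d c)" if "d b \<ge> 3 / 4" "d c \<ge> 3 / 4" for a b c
  proof -
    have "(3/4) * (3/4) \<le> d b * d c" using that by (intro mult_mono) auto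
    hence "1/2 \<le> d b * d c" by simp
    hence "d a * (1/2) \<le> d a * (d b * d c)" by (intro mult_left_mono d0)
    thus ?thesis by (simp add: mult.assoc)
  qed
  have "d 0 \<le> 2 * (d 0 * d 1 * d 2) \<or> d 1 \<le> 2 * (d 0 * d 1 * d 2) \<or> d 2 \<le> 2 * (d 0 * d 1 * d 2)"
  proof -
    have h: "3 / 2 \<le> d 0 + d 1" "3 / 2 \<le> d 0 + d 2" "3 / 2 \<le> d 1 + d 2" by (rule sep; simp)+
    consider "d 1 \<ge> 3/4 \<and> d 2 \<ge> 3/4" | "d 0 \<ge> 3/4 \<and> d 2 \<ge> 3/4" | "d 0 \<ge> 3/4 \<and> d 1 \<ge> 3/4"
      using h by linarith
    thus ?thesis using *[of 1 2 0] *[of 0 2 1] *[of 0 1 2] by cases (auto simp: mult_ac)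
  qed
  hence "\<exists>i<3. d i \<le> 2 * (d 0 * d 1 * d 2)"
    by (elim disjE) (rule exI[of _ 0], simp, rule exI[of _ 1], simp, rule exI[of _ 2], simp)
  thus ?thesis unfolding prod unfolding d_def .
qed

section \<open>Gauss and Jacobi sums of order six\<close>

context sextic_residues
begin

text \<open>The e-th power of a character of order six. The value 0 at multiples of p is kept even
  for e = 0, which gives \<open>gauss 0 = -1\<close> later.\<close>

definition mchar :: "int \<Rightarrow> int \<Rightarrow> complex" where
  "mchar e x = (if int p dvd x then 0 else unity_root 6 (e * int (cls x)))"

definition gauss :: "int \<Rightarrow> complex" where
  "gauss e = (\<Sum>x\<in>{0..<int p}. mchar e x * unity_root p x)"

definition jacobi :: "int \<Rightarrow> int \<Rightarrow> complex" where
  "jacobi e f = (\<Sum>x\<in>{0..<int p}. mchar e x * mchar f (1 - x))"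

lemma mchar_cong: "[x = y] (mod int p) \<Longrightarrow> mchar e x = mchar e y"
  by (simp add: mchar_def cong_dvd_iff cls_cong)

lemma mchar_mod [simp]: "mchar e (x mod int p) = mchar e x"
  by (rule mchar_cong) simp

lemma mchar_mult: "mchar e (x * y) = mchar e x * mchar e y"
proof (cases "int p dvd x \<or> int p dvd y")
  case False
  have "unity_root 6 (e * int (cls (x * y))) = unity_root 6 (e * int (cls x + cls y))"
  proof (rule unity_root_cong)
    have "[int (cls (x * y)) = int (cls x + cls y)] (mod int 6)"
      unfolding cong_int_iff using False by (simp add: cls_mult cong_def)
    thus "[e * int (cls (x * y)) = e * int (cls x + cls y)] (mod int 6)" by (rule cong_scalar_left)
  qed
  thus ?thesis using False not_dvd_mult[of x y]
    by (simp add: mchar_def unity_root_add[symmetric] distrib_left)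
qed (auto simp: mchar_def)

lemma mchar_add_exp: "mchar (e + f) x = mchar e x * mchar f x"
  by (simp add: mchar_def distrib_right unity_root_add)

lemma mchar_exp_cong: "[e = f] (mod 6) \<Longrightarrow> mchar e x = mchar f x"
  unfolding mchar_def by (auto intro!: unity_root_cong cong_scalar_right)

lemma gauss_exp_cong: "[e = f] (mod 6) \<Longrightarrow> gauss e = gauss f"
  unfolding gauss_def using mchar_exp_cong by simp

lemma mchar_1 [simp]: "mchar e 1 = 1"
  using p_ge_7 by (simp add: mchar_def)

lemma mchar_dvd [simp]: "int p dvd x \<Longrightarrow> mchar e x = 0"
  by (simp add: mchar_def)

lemma cnj_chi: "cnj (mchar e x) = mchar (- e) x"
  by (simp add: mchar_def cnj_unity_root)

lemma mchar_minus_1: "mchar e (-1) = unity_root 6 (e * int (cls (-1)))"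
  using p_ge_7 by (simp add: mchar_def)

lemma mchar_unit_cancel: "\<not> int p dvd x \<Longrightarrow> mchar e x * mchar (- e) x = 1"
  by (simp add: mchar_def unity_root_add[symmetric])

lemma sum_residues_mult_unit:
  fixes f :: "int \<Rightarrow> 'a::comm_monoid_add"
  assumes "\<And>x. f (x mod int p) = f x" "\<not> int p dvd u"
  shows "(\<Sum>x\<in>{0..<int p}. f (u * x)) = (\<Sum>x\<in>{0..<int p}. f x)"
proof -
  obtain v where "[u * v = 1] (mod int p)" using inverse_exists assms(2) by blast
  thus ?thesis using sum_residues_mult[of p f u v] p_pos assms(1) by blast
qed

lemma sum_mchar:
  assumes "\<not> 6 dvd e" shows "(\<Sum>x\<in>{0..<int p}. mchar e x) = 0"
proof -
  have "(\<Sum>x\<in>{0..<int p}. mchar e x) = (\<Sum>x\<in>{0..<int p}. mchar e (w * x))"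
    by (rule sum_residues_mult_unit[symmetric]) (use w_unit in auto)
  also have "\<dots> = mchar e w * (\<Sum>x\<in>{0..<int p}. mchar e x)" by (simp add: mchar_mult sum_distrib_left)
  finally have "(1 - mchar e w) * (\<Sum>x\<in>{0..<int p}. mchar e x) = 0" by (simp add: algebra_simps)
  moreover have "mchar e w \<noteq> 1"
    using assms w_unit cls_w[of 1] by (simp add: mchar_def unity_root_eq_1_iff)
  ultimately show ?thesis by simp
qed

lemma gauss_twist_unit:
  assumes "\<not> int p dvd t"
  shows "(\<Sum>x\<in>{0..<int p}. mchar e x * unity_root p (t * x)) = mchar (- e) t * gauss e"
proof -
  have per: "mchar e (x mod int p) * unity_root p (x mod int p) = mchar e x * unity_root p x" for x by simp
  have "mchar e t * (\<Sum>x\<in>{0..<int p}. mchar e x * unity_root p (t * x)) = gauss e"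
    unfolding gauss_def using sum_residues_mult_unit[of "\<lambda>x. mchar e x * unity_root p x" t, OF per assms]
    by (simp add: mchar_mult sum_distrib_left mult.assoc)
  hence "mchar (- e) t * gauss e = (mchar e t * mchar (- e) t) * (\<Sum>x\<in>{0..<int p}. mchar e x * unity_root p (t * x))"
    by (simp add: mult_ac)
  thus ?thesis using mchar_unit_cancel[OF assms] by simp
qed

lemma gauss_twist:
  assumes "\<not> 6 dvd e"
  shows "(\<Sum>x\<in>{0..<int p}. mchar e x * unity_root p (t * x)) = mchar (- e) t * gauss e"
proof (cases "int p dvd t")
  case True
  hence "unity_root p (t * x) = 1" for x using p_pos by (simp add: unity_root_eq_1_iff)
  thus ?thesis using True assms by (simp add: sum_mchar)
qed (rule gauss_twist_unit)

lemma gauss_norm: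
  assumes "\<not> 6 dvd e" shows "gauss e * cnj (gauss e) = of_nat p"
proof -
  have "gauss e * cnj (gauss e) = (\<Sum>y\<in>{0..<int p}. unity_root p (- y) * (mchar (- e) y * gauss e))"
    by (subst (2) gauss_def) (simp add: cnj_chi cnj_unity_root sum_distrib_left mult_ac)
  also have "\<dots> = (\<Sum>y\<in>{0..<int p}. \<Sum>x\<in>{0..<int p}. mchar e x * unity_root p (y * (x - 1)))"
    unfolding gauss_twist[OF assms, symmetric] sum_distrib_left
  proof (intro sum.cong refl)
    fix x y
    have "unity_root p (y * (x - 1)) = unity_root p (y * x) * unity_root p (- y)"
      unfolding unity_root_add[symmetric] by (simp add: algebra_simps)
    thus "unity_root p (- y) * (mchar e x * unity_root p (y * x)) = mchar e x * unity_root p (y * (x - 1))"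
      by simp
  qed
  also have "\<dots> = (\<Sum>x\<in>{0..<int p}. mchar e x * (\<Sum>y\<in>{0..<int p}. unity_root p (y * (x - 1))))"
    by (subst sum.swap) (simp add: sum_distrib_left)
  also have "\<dots> = (\<Sum>x\<in>{0..<int p}. if x = 1 then of_nat p else 0)"
  proof (rule sum.cong[OF refl])
    fix x assume x: "x \<in> {0..<int p}"
    have "int p dvd x - 1 \<longleftrightarrow> x = 1"
      using residues_not_dvd_diff[of x p 1] x p_ge_7 by auto
    thus "mchar e x * (\<Sum>y\<in>{0..<int p}. unity_root p (y * (x - 1))) = (if x = 1 then of_nat p else 0)"
      using p_pos by (simp add: sum_unity_root_int)
  qed
  also have "\<dots> = of_nat p" using p_ge_7 by simp
  finally show ?thesis .
qed

lemma cmod_gauss: "\<not> 6 dvd e \<Longrightarrow> cmod (gauss e) = sqrt (real p)"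
  using gauss_norm[of e] complex_norm_square[of "gauss e"]
  by (metis of_real_eq_iff of_real_of_nat_eq norm_ge_zero real_sqrt_unique)

lemma cnj_gauss: "cnj (gauss e) = mchar e (-1) * gauss (- e)"
proof -
  have per: "mchar (- e) (x mod int p) * unity_root p (- (x mod int p)) = mchar (- e) x * unity_root p (- x)" for x
    by (simp add: unity_root_cong[of "- (x mod int p)" "- x"] cong_minus_minus_iff)
  have "cnj (gauss e) = (\<Sum>x\<in>{0..<int p}. mchar (- e) x * unity_root p (- x))"
    by (simp add: gauss_def cnj_chi cnj_unity_root)
  also have "\<dots> = (\<Sum>x\<in>{0..<int p}. mchar (- e) ((-1) * x) * unity_root p (- ((-1) * x)))"
    using sum_residues_mult_unit[of "\<lambda>x. mchar (- e) x * unity_root p (- x)" "-1", OF per] p_ge_7 by simp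
  also have "\<dots> = mchar (- e) (-1) * gauss (- e)"
    unfolding mchar_mult by (simp add: gauss_def sum_distrib_left mult.assoc)
  also have "mchar (- e) (-1) = mchar e (-1)"
    unfolding mchar_minus_1 by (rule unity_root_cong) (auto simp: cls_minus_1 cong_iff_dvd_diff)
  finally show ?thesis .
qed

text \<open>The convolution of the two characters at t is J(e,f) times the product character at t.
  At t = 0 both sides vanish because the product character is nontrivial.\<close>

lemma gauss_mult:
  assumes ef: "\<not> 6 dvd e + f" shows "gauss e * gauss f = jacobi e f * gauss (e + f)"
proof -
  have inner: "(\<Sum>x\<in>{0..<int p}. mchar e x * mchar f (t - x)) = mchar (e + f) t * jacobi e f" for t
  proof (cases "int p dvd t")
    case True
    have "mchar f (t - x) = mchar f (-1) * mchar f x" for x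
      unfolding mchar_mult[symmetric] using True by (intro mchar_cong) (simp add: cong_iff_dvd_diff)
    hence "(\<Sum>x\<in>{0..<int p}. mchar e x * mchar f (t - x)) = mchar f (-1) * (\<Sum>x\<in>{0..<int p}. mchar (e + f) x)"
      by (simp add: mchar_add_exp sum_distrib_left mult_ac)
    thus ?thesis using ef True by (simp add: sum_mchar)
  next
    case False
    have per: "mchar e (x mod int p) * mchar f (t - x mod int p) = mchar e x * mchar f (t - x)" for x
      using mchar_cong[of "t - x mod int p" "t - x" f] by (simp add: cong_def mod_diff_right_eq)
    have "(\<Sum>x\<in>{0..<int p}. mchar e x * mchar f (t - x)) = (\<Sum>x\<in>{0..<int p}. mchar e (t * x) * mchar f (t - t * x))"
      using sum_residues_mult_unit[of "\<lambda>x. mchar e x * mchar f (t - x)" t, OF per False] by simp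
    also have "\<dots> = (\<Sum>x\<in>{0..<int p}. mchar e (t * x) * mchar f (t * (1 - x)))" by (simp add: right_diff_distrib)
    finally show ?thesis unfolding mchar_mult by (simp add: jacobi_def mchar_add_exp sum_distrib_left mult_ac)
  qed
  have "gauss e * gauss f = (\<Sum>x\<in>{0..<int p}. \<Sum>y\<in>{0..<int p}. mchar e x * (mchar f y * unity_root p (x + y)))"
    by (simp add: gauss_def sum_product unity_root_add mult_ac)
  also have "\<dots> = (\<Sum>x\<in>{0..<int p}. \<Sum>t\<in>{0..<int p}. mchar e x * (mchar f (t - x) * unity_root p t))"
  proof (rule sum.cong[OF refl])
    fix x
    have "mchar f (t mod int p - x) = mchar f (t - x)" for t
      by (rule mchar_cong) (simp add: cong_def mod_diff_left_eq)
    thus "(\<Sum>y\<in>{0..<int p}. mchar e x * (mchar f y * unity_root p (x + y))) =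
      (\<Sum>t\<in>{0..<int p}. mchar e x * (mchar f (t - x) * unity_root p t))"
      using sum_residues_shift[of p "\<lambda>t. mchar e x * (mchar f (t - x) * unity_root p t)" x] p_pos
      by (simp add: add.commute)
  qed
  also have "\<dots> = (\<Sum>t\<in>{0..<int p}. unity_root p t * (\<Sum>x\<in>{0..<int p}. mchar e x * mchar f (t - x)))"
    by (subst sum.swap) (simp add: sum_distrib_left mult_ac)
  also have "\<dots> = jacobi e f * gauss (e + f)"
    unfolding inner by (simp add: gauss_def sum_distrib_left mult_ac)
  finally show ?thesis .
qed

end

text \<open>The arithmetic behind the map x -> y = 1/(1 - x), for which 1 - y = -x/(1 - x): here a,
  b, c, m, x stand for the classes of y, 1 - x, 1 - y, -1 and x.\<close>

lemma mod_3_transfer: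
  fixes a b c m x :: nat
  assumes 1: "(a + b) mod 6 = 0" and 2: "(c + b) mod 6 = (m + x) mod 6" and 3: "m mod 3 = 0"
  shows "(a + c) mod 3 = (x + b) mod 3"
proof -
  have "(6::int) dvd int (a + b)" using 1 by (metis mod_0_imp_dvd int_dvd_int_iff of_nat_numeral)
  then obtain k where k: "int a + int b = 6 * k" by (auto elim: dvdE)
  have "int (c + b) mod 6 = int (m + x) mod 6"
    using arg_cong[OF 2, of int] by (simp add: zmod_int)
  hence "(6::int) dvd int (c + b) - int (m + x)" by (simp only: mod_eq_dvd_iff)
  then obtain l where l: "int c + int b - (int m + int x) = 6 * l" by (auto elim: dvdE)
  obtain n where n: "m = 3 * n" using 3 by auto
  have "int (a + c) - int (x + b) = 3 * (2 * k + 2 * l + int n - int b)" using k l n by simp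
  hence "int (a + c) mod 3 = int (x + b) mod 3" unfolding mod_eq_dvd_iff by (metis dvd_triv_left)
  thus ?thesis by (metis of_nat_eq_iff zmod_int of_nat_numeral)
qed

context sextic_residues
begin

lemma odd_p: "odd p"
  using prime_p p_ge_7 prime_odd_nat[of p] by simp

lemma interval_units: "x \<in> {2..<int p} \<Longrightarrow> \<not> int p dvd x \<and> \<not> int p dvd 1 - x"
  using small_not_dvd[of x] small_not_dvd[of "1 - x"] by auto

lemma unity_root_6_3: "unity_root 6 (3 * int c) = (if even c then 1 else -1)"
proof -
  have m1: "unity_root 6 3 = -1" by (simp add: unity_root_def)
  have "unity_root 6 (3 * int c) = unity_root 6 3 ^ c" by (simp add: unity_root_power mult.commute)
  thus ?thesis unfolding m1 by auto
qed

text \<open>\<open>mchar 3\<close> is the quadratic character, and a unit is a square exactly when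
  its discrete logarithm is even.\<close>

lemma card_square_roots:
  "of_nat (card {y\<in>{0..<int p}. [y * y = u] (mod int p)}) = 1 + mchar 3 u"
proof (cases "int p dvd u")
  case True
  have "{y\<in>{0..<int p}. [y * y = u] (mod int p)} = {0}"
  proof (intro equalityI subsetI)
    fix y assume y: "y \<in> {y\<in>{0..<int p}. [y * y = u] (mod int p)}"
    hence "int p dvd y * y" using True cong_dvd_iff[of "y * y" u "int p"] by blast
    hence "int p dvd y" using not_dvd_mult by blast
    thus "y \<in> {0}" using y zdvd_not_zless[of y "int p"] by force
  qed (use True p_pos in \<open>auto simp: cong_iff_dvd_diff\<close>)
  thus ?thesis using True by simp
next
  case False
  obtain i where i: "[u = w ^ i] (mod int p)" "i mod 6 = cls u" using cls_exists[OF False] by blast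
  have par: "even i \<longleftrightarrow> even (cls u)" unfolding i(2)[symmetric] by presburger
  have chi: "mchar 3 u = (if even (cls u) then 1 else -1)"
    using False unity_root_6_3[of "cls u"] by (simp add: mchar_def)
  show ?thesis
  proof (cases "even (cls u)")
    case True
    then obtain k where k: "i = 2 * k" using par by blast
    define r where "r = w ^ k"
    have ur: "[u = r * r] (mod int p)" using i(1) by (simp add: r_def k power_mult power2_eq_square mult.commute)
    have r: "\<not> int p dvd r" unfolding r_def by (rule w_power_unit)
    have "{y\<in>{0..<int p}. [y * y = u] (mod int p)} = {r mod int p, (- r) mod int p}"
    proof (intro equalityI subsetI)
      fix y assume y: "y \<in> {y\<in>{0..<int p}. [y * y = u] (mod int p)}"
      hence "[y * y = r * r] (mod int p)" using ur cong_trans by blast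
      hence "int p dvd (y - r) * (y + r)" by (simp add: cong_iff_dvd_diff algebra_simps)
      hence "int p dvd y - r \<or> int p dvd y - (- r)" using not_dvd_mult by auto
      hence "y mod int p = r mod int p \<or> y mod int p = (- r) mod int p" by (simp only: mod_eq_dvd_iff)
      thus "y \<in> {r mod int p, (- r) mod int p}" using y by auto
    next
      fix y assume "y \<in> {r mod int p, (- r) mod int p}"
      hence "[y * y = r * r] (mod int p)" "y \<in> {0..<int p}"
        using p_pos by (auto simp: cong_def mod_mult_eq)
      thus "y \<in> {y\<in>{0..<int p}. [y * y = u] (mod int p)}" using ur cong_sym cong_trans by blast
    qed
    moreover have "r mod int p \<noteq> (- r) mod int p"
    proof
      assume "r mod int p = (- r) mod int p"
      hence "int p dvd 2 * r" by (simp add: mod_eq_dvd_iff)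
      moreover have "\<not> int p dvd 2" using p_ge_7 by (intro small_not_dvd) auto
      ultimately show False using not_dvd_mult r by blast
    qed
    ultimately show ?thesis using True by (simp add: chi)
  next
    case odd: False
    have "{y\<in>{0..<int p}. [y * y = u] (mod int p)} = {}"
    proof (rule ccontr)
      assume "\<not> ?thesis"
      then obtain y where y: "[y * y = u] (mod int p)" by blast
      have "\<not> int p dvd y" using y False cong_dvd_iff by (metis dvd_mult)
      hence "cls u = (cls y + cls y) mod 6" using cls_mult[of y y] cls_cong[OF y] by simp
      thus False using odd by presburger
    qed
    thus ?thesis using odd by (simp only:) (simp add: chi)
  qed
qed

lemma sum_residues_reflect:
  fixes f :: "int \<Rightarrow> 'a::comm_monoid_add"
  assumes per: "\<And>x. f (x mod int p) = f x"
  shows "(\<Sum>x\<in>{0..<int p}. f (1 - x)) = (\<Sum>x\<in>{0..<int p}. f x)"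
proof -
  have "f (x mod int p + 1) = f (x + 1)" for x
    using per[of "x mod int p + 1"] per[of "x + 1"] by (simp add: mod_add_left_eq)
  hence "(\<Sum>x\<in>{0..<int p}. f ((-1) * x + 1)) = (\<Sum>x\<in>{0..<int p}. f (x + 1))"
    using p_ge_7 by (intro sum_residues_mult_unit[of "\<lambda>x. f (x + 1)" "-1"]) auto
  also have "\<dots> = (\<Sum>x\<in>{0..<int p}. f x)"
    using p_pos per by (rule sum_residues_shift)
  finally show ?thesis by (simp add: algebra_simps)
qed

lemma mchar_cong_1_minus: "mchar e (1 - x mod int p) = mchar e (1 - x)"
  by (rule mchar_cong) (simp add: cong_def mod_diff_right_eq)

lemma jacobi_commute: "jacobi e f = jacobi f e"
  using sum_residues_reflect[of "\<lambda>x. mchar e x * mchar f (1 - x)"]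
  by (simp add: jacobi_def mchar_cong_1_minus mult.commute)

text \<open>Completing the square, \<open>4x(1-x) = 1 - (2x-1)\<^sup>2\<close>, gives the quadratic Hasse-Davenport relation.\<close>

lemma jacobi_duplication:
  assumes e: "\<not> 6 dvd e" shows "mchar e 4 * jacobi e e = jacobi e 3"
proof -
  define h where "h y = mchar e (1 - y * y)" for y
  have hper: "h (x mod int p + c) = h (x + c)" for x c
    unfolding h_def by (rule mchar_cong) (intro cong_diff cong_mult cong_add cong_refl, simp_all)
  have "mchar e 4 * jacobi e e = (\<Sum>x\<in>{0..<int p}. mchar e (4 * (x * (1 - x))))"
    by (simp add: jacobi_def mchar_mult sum_distrib_left)
  also have "\<dots> = (\<Sum>x\<in>{0..<int p}. h (2 * x + (-1)))"
    unfolding h_def by (intro sum.cong refl arg_cong[of _ _ "mchar e"]) (simp add: algebra_simps)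
  also have "\<dots> = (\<Sum>x\<in>{0..<int p}. h (x + (-1)))"
    using p_ge_7 small_not_dvd[of 2]
    by (intro sum_residues_mult_unit[of "\<lambda>x. h (x + (-1))" 2]) (simp_all only: hper, simp_all)
  also have "\<dots> = (\<Sum>x\<in>{0..<int p}. h x)"
    using p_pos hper[of _ 0] by (intro sum_residues_shift) auto
  also have "\<dots> = (\<Sum>y\<in>{0..<int p}. \<Sum>u\<in>{0..<int p}. if [y * y = u] (mod int p) then mchar e (1 - u) else 0)"
  proof (rule sum.cong[OF refl])
    fix y
    have "(\<Sum>u\<in>{0..<int p}. if [y * y = u] (mod int p) then mchar e (1 - u) else 0) =
        (\<Sum>u\<in>{0..<int p}. if u = y * y mod int p then mchar e (1 - u) else 0)"
      by (intro sum.cong refl) (auto simp: cong_def)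
    also have "\<dots> = h y" using p_pos by (simp add: h_def mchar_cong_1_minus)
    finally show "h y = (\<Sum>u\<in>{0..<int p}. if [y * y = u] (mod int p) then mchar e (1 - u) else 0)" ..
  qed
  also have "\<dots> = (\<Sum>u\<in>{0..<int p}. of_nat (card {y\<in>{0..<int p}. [y * y = u] (mod int p)}) * mchar e (1 - u))"
    by (subst sum.swap) (simp add: sum.If_cases Int_def)
  also have "\<dots> = (\<Sum>u\<in>{0..<int p}. mchar e (1 - u)) + jacobi 3 e"
    unfolding card_square_roots by (simp add: jacobi_def algebra_simps sum.distrib)
  also have "(\<Sum>u\<in>{0..<int p}. mchar e (1 - u)) = 0"
    using sum_residues_reflect[of "mchar e"] sum_mchar[OF e] by simp
  finally show ?thesis by (simp add: jacobi_commute)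
qed

lemma gauss_nonzero: "\<not> 6 dvd e \<Longrightarrow> gauss e \<noteq> 0"
  using cmod_gauss[of e] p_pos by force

text \<open>The hypothesis says that 4 is a cube. Then the duplication formula at the cubic
  character loses its twist, J(4,4) = J(4,3), and the two Gauss sum products for these Jacobi sums
  can be divided by each other.\<close>

lemma gauss_1_4:
  assumes "mchar 2 4 = 1" shows "gauss 1 * gauss 4 = gauss 2 * gauss 3"
proof -
  have "mchar 4 4 = 1" using assms mchar_add_exp[of 2 2 4] by simp
  hence j: "jacobi 4 4 = jacobi 4 3" using jacobi_duplication[of 4] by simp
  have 1: "gauss 4 * gauss 4 = jacobi 4 4 * gauss 2"
    using gauss_mult[of 4 4] gauss_exp_cong[of 8 2] by (simp add: cong_def)
  have 2: "gauss 4 * gauss 3 = jacobi 4 4 * gauss 1"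
    using gauss_mult[of 4 3] gauss_exp_cong[of 7 1] by (simp add: cong_def j)
  have "jacobi 4 4 \<noteq> 0" using 1 gauss_nonzero[of 4] by auto
  moreover have "jacobi 4 4 * (gauss 1 * gauss 4) = jacobi 4 4 * (gauss 2 * gauss 3)"
  proof -
    have "jacobi 4 4 * (gauss 1 * gauss 4) = (jacobi 4 4 * gauss 1) * gauss 4" by (simp only: mult.assoc)
    also have "\<dots> = (gauss 4 * gauss 4) * gauss 3" unfolding 2[symmetric] by (simp only: mult_ac)
    also have "\<dots> = jacobi 4 4 * (gauss 2 * gauss 3)" unfolding 1 by (simp only: mult_ac)
    finally show ?thesis .
  qed
  ultimately show ?thesis by simp
qed

lemma cnj_gauss_2: "cnj (gauss 2) = gauss 4"
proof -
  have "mchar 2 (-1) = 1" unfolding mchar_minus_1 by (simp add: cls_minus_1 unity_root_eq_1_iff)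
  thus ?thesis using cnj_gauss[of 2] gauss_exp_cong[of "-2" 4] by (simp add: cong_def)
qed

lemma gauss_2_cubed: "gauss 2 ^ 3 = of_nat p * jacobi 2 2"
proof -
  have "gauss 2 * gauss 2 = jacobi 2 2 * gauss 4" using gauss_mult[of 2 2] by simp
  moreover have "gauss 2 * gauss 4 = of_nat p" using gauss_norm[of 2] cnj_gauss_2 by simp
  ultimately have "gauss 2 * gauss 2 * gauss 2 = of_nat p * jacobi 2 2"
    by (simp only: mult.assoc mult.commute[of "gauss 4"]) (simp only: mult.commute)
  thus ?thesis by (simp add: power3_eq_cube)
qed

text \<open>The cubic class of x (1 - x): its distribution over x gives the coordinates of J(2,2) in
  the Eisenstein integers.\<close>

definition jclass :: "int \<Rightarrow> nat" where
  "jclass x = (cls x + cls (1 - x)) mod 3"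

lemma jacobi_eq_sum: "jacobi 2 2 = (\<Sum>x\<in>{2..<int p}. unity_root 3 (int (jclass x)))"
proof -
  have *: "unity_root 6 (2 * int c) = unity_root 3 (int c)" for c
    using unity_root_scale[of 2 3 "int c"] by (simp add: mult.commute)
  have "jacobi 2 2 = (\<Sum>x\<in>{2..<int p}. mchar 2 x * mchar 2 (1 - x))"
    unfolding jacobi_def
  proof (rule sum.mono_neutral_right)
    show "\<forall>i\<in>{0..<int p} - {2..<int p}. mchar 2 i * mchar 2 (1 - i) = 0"
    proof
      fix i assume "i \<in> {0..<int p} - {2..<int p}"
      hence "i = 0 \<or> i = 1" by auto
      thus "mchar 2 i * mchar 2 (1 - i) = 0" by auto
    qed
  qed auto
  also have "\<dots> = (\<Sum>x\<in>{2..<int p}. unity_root 3 (int (jclass x)))"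
  proof (rule sum.cong[OF refl])
    fix x assume x: "x \<in> {2..<int p}"
    hence "\<not> int p dvd x" "\<not> int p dvd 1 - x" using interval_units by auto
    hence "mchar 2 x * mchar 2 (1 - x) = unity_root 3 (int (cls x + cls (1 - x)))"
      by (simp add: mchar_def * unity_root_add)
    also have "\<dots> = unity_root 3 (int (jclass x))"
      unfolding jclass_def of_nat_mod by (metis unity_root_mod)
    finally show "mchar 2 x * mchar 2 (1 - x) = unity_root 3 (int (jclass x))" .
  qed
  finally show ?thesis .
qed

text \<open>The map x -> y = 1/(1 - x) has order three, and y (1 - y) = -x (1 - x)/(1 - x)^3 has the
  same cubic class as x (1 - x), as -1 is a cube. At a fixed point x (1 - x) = 1, so fixed points
  lie in class 0, which is excluded.\<close>

lemma three_dvd_jclass: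
  assumes i: "i \<noteq> 0" shows "3 dvd card {x\<in>{2..<int p}. jclass x = i}"
proof -
  have "\<exists>y. y \<in> {0..<int p} \<and> [y * (1 - x) = 1] (mod int p)" if "x \<in> {2..<int p}" for x
  proof -
    have "\<not> int p dvd 1 - x" using that interval_units by blast
    then obtain y where "[(1 - x) * y = 1] (mod int p)" using inverse_exists by blast
    hence "[(y mod int p) * (1 - x) = 1] (mod int p)" by (simp add: cong_def mod_mult_right_eq mult.commute)
    thus ?thesis using p_pos by (intro exI[of _ "y mod int p"]) auto
  qed
  then obtain T where T: "\<And>x. x \<in> {2..<int p} \<Longrightarrow> T x \<in> {0..<int p} \<and> [T x * (1 - x) = 1] (mod int p)"
    by metis
  have dv: "int p dvd T x * (1 - x) - 1" if "x \<in> {2..<int p}" for x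
    using T[OF that] by (simp add: cong_iff_dvd_diff)
  have nd1: "\<not> int p dvd 1" using p_ge_7 by simp
  have TU: "T x \<in> {2..<int p}" if x: "x \<in> {2..<int p}" for x
  proof -
    have "T x \<noteq> 0" using dv[OF x] nd1 by auto
    moreover have "T x \<noteq> 1" using dv[OF x] small_not_dvd[of "x"] x by auto
    ultimately show ?thesis using T[OF x] by auto
  qed
  have Tc: "jclass (T x) = jclass x" if x: "x \<in> {2..<int p}" for x
  proof -
    have u: "\<not> int p dvd x" "\<not> int p dvd 1 - x" "\<not> int p dvd T x" "\<not> int p dvd 1 - T x" "\<not> int p dvd -1"
      using interval_units[OF x] interval_units[OF TU[OF x]] nd1 by auto
    have "cls (T x * (1 - x)) = cls 1" using T[OF x] cls_cong by blast
    hence 1: "(cls (T x) + cls (1 - x)) mod 6 = 0" using u by (simp add: cls_mult)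
    have "(1 - T x) * (1 - x) - (-1) * x = - (T x * (1 - x) - 1)" by (simp add: algebra_simps)
    hence "int p dvd (1 - T x) * (1 - x) - (-1) * x" using dv[OF x] by (metis dvd_minus_iff)
    hence "cls ((1 - T x) * (1 - x)) = cls ((-1) * x)" by (intro cls_cong) (simp only: cong_iff_dvd_diff)
    hence "(cls (1 - T x) + cls (1 - x)) mod 6 = (cls (-1) + cls x) mod 6" 
      unfolding cls_mult[OF u(4) u(2)] cls_mult[OF u(5) u(1)] .
    moreover have "cls (-1) mod 3 = 0" by (simp add: cls_minus_1)
    ultimately show ?thesis unfolding jclass_def by (rule mod_3_transfer[OF 1])
  qed
  show ?thesis
  proof (rule three_dvd_card[where T = T])
    fix x assume "x \<in> {x\<in>{2..<int p}. jclass x = i}"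
    hence x: "x \<in> {2..<int p}" "jclass x = i" by auto
    show "T x \<in> {x\<in>{2..<int p}. jclass x = i}" using TU Tc x by auto
    show "T (T (T x)) = x"
    proof -
      let ?y = "T x" and ?z = "T (T x)" and ?t = "T (T (T x))"
      have A: "int p dvd ?y * (1 - x) - 1" and B: "int p dvd ?z * (1 - ?y) - 1"
        and C: "int p dvd ?t * (1 - ?z) - 1" using dv TU x by auto
      have "x * (1 - ?z) - 1 = (?z * (1 - ?y) - 1) * (1 - x) + ?z * (?y * (1 - x) - 1)"
        by (simp add: algebra_simps)
      hence E: "int p dvd x * (1 - ?z) - 1" using A B by simp
      have "?t - x = (?t * (1 - ?z) - 1) * x - ?t * (x * (1 - ?z) - 1)" by (simp add: algebra_simps)
      hence "int p dvd ?t - x" using C E by simp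
      moreover have "?t \<in> {2..<int p}" by (intro TU x)
      hence "?t \<in> {0..<int p}" "x \<in> {0..<int p}" using x by auto
      ultimately show ?thesis using residues_not_dvd_diff[of ?t p x] by blast
    qed
    show "T x \<noteq> x"
    proof
      assume "T x = x"
      hence "cls (x * (1 - x)) = cls 1" using T[OF x(1)] cls_cong by metis
      moreover have "\<not> int p dvd x" "\<not> int p dvd 1 - x" using x interval_units by auto
      ultimately have "(cls x + cls (1 - x)) mod 6 = 0" by (simp add: cls_mult)
      hence "jclass x = 0" unfolding jclass_def by presburger
      thus False using x i by simp
    qed
  qed (auto intro: finite_subset[of _ "{2..<int p}"])
qed

text \<open>(p + 1)/2 is the residue 1/2, and its \<open>jclass\<close> is the cubic class of
  1/4.\<close>

lemma jclass_half: "jclass ((int p + 1) div 2) = 0 \<Longrightarrow> mchar 2 4 = 1"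
proof -
  define h where "h = (int p + 1) div 2"
  have "even (int p + 1)" using odd_p by simp
  hence h2: "2 * h = int p + 1" unfolding h_def by (rule dvd_mult_div_cancel)
  assume "jclass ((int p + 1) div 2) = 0"
  hence 0: "jclass h = 0" by (simp add: h_def)
  have u: "\<not> int p dvd h" "\<not> int p dvd 2" 
    using h2 p_ge_7 small_not_dvd[of h] small_not_dvd[of 2] by auto
  have "cls (1 - h) = cls h" using h2 by (intro cls_cong) (auto simp: cong_iff_dvd_diff)
  hence "(cls h + cls h) mod 3 = 0" using 0 by (simp add: jclass_def)
  moreover have "cls (2 * h) = cls 1" using h2 by (intro cls_cong) (simp add: cong_iff_dvd_diff)
  hence "(cls 2 + cls h) mod 6 = 0" using u by (simp add: cls_mult)
  moreover have "cls (2 * 2) = (cls 2 + cls 2) mod 6" using u by (intro cls_mult)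
  hence "cls 4 = (cls 2 + cls 2) mod 6" by simp
  ultimately have "3 dvd cls 4" by presburger
  hence "6 dvd 2 * int (cls 4)" by presburger
  moreover have "\<not> int p dvd 4" using p_ge_7 by (intro small_not_dvd) auto
  ultimately show ?thesis by (simp add: mchar_def unity_root_eq_1_iff)
qed

text \<open>The involution x -> 1 - x preserves the class and has the single fixed point
  1/2.\<close>

lemma parity_jclass:
  "even (card {x\<in>{2..<int p}. jclass x = i}) \<longleftrightarrow> jclass ((int p + 1) div 2) \<noteq> i"
proof -
  define h where "h = (int p + 1) div 2"
  have "even (int p + 1)" using odd_p by simp
  hence h2: "2 * h = int p + 1" unfolding h_def by (rule dvd_mult_div_cancel)
  have hU: "h \<in> {2..<int p}" using h2 p_ge_7 by auto
  let ?X = "{x\<in>{2..<int p}. jclass x = i}"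
  have fin: "finite ?X" by (rule finite_subset[of _ "{2..<int p}"]) auto
  have "2 dvd card (?X - {h})"
  proof (rule two_dvd_card[where T = "\<lambda>x. int p + 1 - x"])
    fix x assume x: "x \<in> ?X - {h}"
    have "cls (int p + 1 - x) = cls (1 - x)" "cls (1 - (int p + 1 - x)) = cls x"
      by (intro cls_cong, simp add: cong_iff_dvd_diff)+
    thus "int p + 1 - x \<in> ?X - {h}" using x h2 by (auto simp: jclass_def add.commute)
    show "int p + 1 - x \<noteq> x" using x h2 by auto
  qed (use fin in auto)
  thus ?thesis
  proof (cases "h \<in> ?X")
    case True
    have "card ?X = Suc (card (?X - {h}))" by (rule card_Suc_Diff1[OF fin True, symmetric])
    thus ?thesis using \<open>2 dvd card (?X - {h})\<close> True by (simp add: h_def)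
  next
    case False
    thus ?thesis using \<open>2 dvd card (?X - {h})\<close> hU by (simp add: h_def)
  qed
qed

text \<open>With N_i counting the x of cubic class i, J(2,2) = N_0 + N_1 omega + N_2 omega^2 has
  norm p, and 3 | N_1, 3 | N_2 puts 4 p into the form L^2 + 27 M^2. Uniqueness gives M = 2 y or -2
  y, so N_1 - N_2 is even. If 1/2 were in class 1 or 2, exactly one of N_1 and N_2 would be odd by
  \<open>parity_jclass\<close>; so it is in class 0 and 4 is a cube. The imaginary part is read off
  from M.\<close>

lemma jacobi_arith:
  assumes xy: "int p = x\<^sup>2 + 27 * y\<^sup>2"
  shows "mchar 2 4 = 1" "\<bar>Im (jacobi 2 2)\<bar> \<le> 6 * real_of_int \<bar>y\<bar>" "cmod (jacobi 2 2) = sqrt (real p)"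
proof -
  define N where "N i = int (card {x\<in>{2..<int p}. jclass x = i})" for i
  define A B where "A = N 0 - N 2" and "B = N 1 - N 2"
  have w3: "unity_root 3 1 = Complex (-1/2) (sqrt 3 / 2)"
    by (simp add: unity_root_def complex_eq_iff cos_120 sin_120)
  have w32: "unity_root 3 2 = Complex (-1/2) (- sqrt 3 / 2)"
  proof -
    have "unity_root 3 2 = unity_root 3 1 ^ 2" by (simp add: unity_root_power)
    thus ?thesis unfolding w3 by (simp add: complex_eq_iff power2_eq_square)
  qed
  have "jacobi 2 2 = (\<Sum>i<3. \<Sum>x\<in>{x\<in>{2..<int p}. jclass x = i}. unity_root 3 (int (jclass x)))"
    unfolding jacobi_eq_sum by (intro sum.group[symmetric]) (auto simp: jclass_def)
  also have "\<dots> = (\<Sum>i<3. of_int (N i) * unity_root 3 (int i))"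
    by (intro sum.cong refl) (simp add: N_def)
  also have "\<dots> = of_int (N 0) + of_int (N 1) * unity_root 3 1 + of_int (N 2) * unity_root 3 2"
  proof -
    have "{..<3::nat} = {0, 1, 2}" by auto
    thus ?thesis by simp
  qed
  finally have J: "jacobi 2 2 = Complex (of_int A - of_int B / 2) (of_int B * sqrt 3 / 2)"
    unfolding w3 w32 by (simp add: complex_eq_iff A_def B_def field_simps)
  have "cmod (gauss 2 * gauss 2) = cmod (jacobi 2 2 * gauss 4)" using gauss_mult[of 2 2] by simp
  thus norm: "cmod (jacobi 2 2) = sqrt (real p)"
    using p_pos mult_right_cancel[of "sqrt (real p)" "cmod (jacobi 2 2)" "sqrt (real p)"]
    by (simp add: norm_mult cmod_gauss)
  have "(of_int A - of_int B / 2)\<^sup>2 + (of_int B * sqrt 3 / 2)\<^sup>2 = real p"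
    using norm unfolding J by (simp add: cmod_def)
  hence "real_of_int (4 * int p) = real_of_int ((2 * A - B)\<^sup>2 + 3 * B\<^sup>2)"
    by (simp add: power2_eq_square field_simps)
  hence 4: "4 * int p = (2 * A - B)\<^sup>2 + 3 * B\<^sup>2" by (simp only: of_int_eq_iff)
  have "3 dvd N 1" "3 dvd N 2" using three_dvd_jclass[of 1] three_dvd_jclass[of 2] unfolding N_def by presburger+
  then obtain M where M: "B = 3 * M" unfolding B_def by (metis dvdE dvd_diff)
  have "4 * int p = (2 * A - B)\<^sup>2 + 27 * M\<^sup>2" using 4 unfolding M by (simp add: power2_eq_square)
  hence M2: "M\<^sup>2 = (2 * y)\<^sup>2" using quadratic_form_27_unique[OF prime_p _ xy] by blast
  hence M': "M = 2 * y \<or> M = - (2 * y)" by (simp only: power2_eq_iff)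
  hence "\<bar>M\<bar> = 2 * \<bar>y\<bar>" "even M" by auto
  hence "even (N 1 - N 2)" using M by (simp add: B_def)
  hence "jclass ((int p + 1) div 2) = 0"
  proof -
    have "jclass ((int p + 1) div 2) < 3" by (simp add: jclass_def)
    hence "jclass ((int p + 1) div 2) = 0 \<or> jclass ((int p + 1) div 2) = 1 \<or> jclass ((int p + 1) div 2) = 2"
      by linarith
    thus ?thesis using \<open>even (N 1 - N 2)\<close> parity_jclass[of 1] parity_jclass[of 2] unfolding N_def by auto
  qed
  thus "mchar 2 4 = 1" by (rule jclass_half)
  have "\<bar>Im (jacobi 2 2)\<bar> = real_of_int \<bar>B\<bar> * sqrt 3 / 2" unfolding J by (simp add: abs_mult)
  also have "real_of_int \<bar>B\<bar> = 6 * real_of_int \<bar>y\<bar>" using \<open>\<bar>M\<bar> = 2 * \<bar>y\<bar>\<close> M by simp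
  also have "6 * real_of_int \<bar>y\<bar> * sqrt 3 / 2 \<le> 6 * real_of_int \<bar>y\<bar> * 2 / 2"
    by (intro divide_right_mono mult_left_mono real_le_lsqrt) auto
  finally show "\<bar>Im (jacobi 2 2)\<bar> \<le> 6 * real_of_int \<bar>y\<bar>" by simp
qed

end

section \<open>Flatness of the transform of three classes\<close>

context sextic_residues
begin

text \<open>The Gaussian period of order six, written through Gauss sums by Fourier inversion on
  Z/6; \<open>class_char_sum\<close> identifies it with the exponential sum over a class.\<close>

definition period :: "int \<Rightarrow> complex" where
  "period s = (\<Sum>e<6. unity_root 6 (- int e * s) * gauss (int e)) / 6"

definition fourier_coeff :: "nat set \<Rightarrow> int \<Rightarrow> complex" where
  "fourier_coeff S k = (\<Sum>j\<in>{0..<int p}. (if \<not> int p dvd j \<and> cls j \<in> S then 1 else -1) * unity_root p (j * k))"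

definition fourier_value :: "nat set \<Rightarrow> nat \<Rightarrow> complex" where
  "fourier_value S s = 2 * (\<Sum>r\<in>S. period (int r + int s))"

lemma class_char_sum:
  assumes k: "\<not> int p dvd k" and r: "r < 6"
  shows "(\<Sum>j\<in>{0..<int p}. if \<not> int p dvd j \<and> cls j = r then unity_root p (j * k) else 0) = period (int r + int (cls k))"
proof -
  have ind: "(\<Sum>e<6. unity_root 6 (- int e * int r) * mchar (int e) j) = (if \<not> int p dvd j \<and> cls j = r then 6 else 0)" for j
  proof (cases "int p dvd j")
    case False
    have "(\<Sum>e<6. unity_root 6 (- int e * int r) * mchar (int e) j) = (\<Sum>e<6. unity_root 6 (int e * (int (cls j) - int r)))"
      using False by (intro sum.cong refl) (simp add: mchar_def unity_root_add[symmetric] algebra_simps)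
    also have "\<dots> = (if 6 dvd int (cls j) - int r then 6 else 0)"
      using sum_unity_root[of 6 "int (cls j) - int r"] by simp
    also have "6 dvd int (cls j) - int r \<longleftrightarrow> cls j = r" using r cls_less[of j] by presburger
    finally show ?thesis using False by simp
  qed simp
  have "(\<Sum>j\<in>{0..<int p}. if \<not> int p dvd j \<and> cls j = r then unity_root p (j * k) else 0) =
     (\<Sum>j\<in>{0..<int p}. (\<Sum>e<6. unity_root 6 (- int e * int r) * mchar (int e) j) * unity_root p (k * j)) / 6"
    unfolding ind sum_divide_distrib by (intro sum.cong refl) (simp add: mult.commute)
  also have "(\<Sum>j\<in>{0..<int p}. (\<Sum>e<6. unity_root 6 (- int e * int r) * mchar (int e) j) * unity_root p (k * j)) =
     (\<Sum>e<6. unity_root 6 (- int e * int r) * (\<Sum>j\<in>{0..<int p}. mchar (int e) j * unity_root p (k * j)))"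
    unfolding sum_distrib_right sum_distrib_left by (subst sum.swap) (simp only: mult.assoc)
  also have "\<dots> = (\<Sum>e<6. unity_root 6 (- int e * (int r + int (cls k))) * gauss (int e))"
    unfolding gauss_twist_unit[OF k]
    using k by (intro sum.cong refl) (simp add: mchar_def unity_root_add[symmetric] algebra_simps)
  finally show ?thesis by (simp add: period_def)
qed

lemma fourier_coeff_unit:
  assumes k: "\<not> int p dvd k" and S: "S \<subseteq> {..<6}"
  shows "fourier_coeff S k = fourier_value S (cls k)"
proof -
  have fin: "finite S" using S finite_subset by blast
  have "fourier_coeff S k = (\<Sum>j\<in>{0..<int p}. 2 * (\<Sum>r\<in>S. if \<not> int p dvd j \<and> cls j = r then unity_root p (j * k) else 0)
      - unity_root p (j * k))"
    unfolding fourier_coeff_def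
  proof (rule sum.cong[OF refl])
    fix j
    have "(\<Sum>r\<in>S. if \<not> int p dvd j \<and> cls j = r then unity_root p (j * k) else 0) =
       (if \<not> int p dvd j \<and> cls j \<in> S then unity_root p (j * k) else 0)"
      using fin by (cases "int p dvd j") (simp_all add: sum.delta)
    thus "(if \<not> int p dvd j \<and> cls j \<in> S then 1 else -1) * unity_root p (j * k) =
      2 * (\<Sum>r\<in>S. if \<not> int p dvd j \<and> cls j = r then unity_root p (j * k) else 0) - unity_root p (j * k)"
      by simp
  qed
  also have "\<dots> = 2 * (\<Sum>r\<in>S. \<Sum>j\<in>{0..<int p}. if \<not> int p dvd j \<and> cls j = r then unity_root p (j * k) else 0)
      - (\<Sum>j\<in>{0..<int p}. unity_root p (j * k))"
    unfolding sum_subtractf sum_distrib_left[symmetric] by (subst sum.swap) (rule refl)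
  also have "(\<Sum>j\<in>{0..<int p}. unity_root p (j * k)) = 0"
    using k p_pos by (simp add: sum_unity_root_int)
  finally show ?thesis unfolding fourier_value_def
    using class_char_sum[OF k] S by (simp add: subset_eq cong: sum.cong)
qed

lemma gauss_0: "gauss 0 = -1"
proof -
  have "(\<Sum>x\<in>{0..<int p}. unity_root p x) = 0"
    using sum_unity_root_int[of p 1] p_pos p_ge_7 by simp
  also have "{0..<int p} = insert 0 {1..<int p}" using p_pos by auto
  finally have "(\<Sum>x\<in>{1..<int p}. unity_root p x) = -1" by (simp add: eq_neg_iff_add_eq_0 add.commute)
  moreover have "gauss 0 = (\<Sum>x\<in>{1..<int p}. unity_root p x)"
    unfolding gauss_def
  proof (rule sum.mono_neutral_cong_right)
    fix x assume "x \<in> {1..<int p}"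
    thus "mchar 0 x * unity_root p x = unity_root p x" using small_not_dvd[of x] by (simp add: mchar_def)
  next
    show "\<forall>x\<in>{0..<int p} - {1..<int p}. mchar 0 x * unity_root p x = 0"
    proof
      fix x assume "x \<in> {0..<int p} - {1..<int p}"
      hence "x = 0" by auto
      thus "mchar 0 x * unity_root p x = 0" by simp
    qed
  qed auto
  ultimately show ?thesis by simp
qed

text \<open>The Gauss sums of orders \<open>2\<close> and \<open>3\<close> determine all the others.\<close>

lemma period_model:
  assumes X: "int p = x\<^sup>2 + 27 * y\<^sup>2"
  obtains \<tau> \<sigma> :: complex and i :: int where "cmod \<tau> = 1" "\<sigma> = 1 \<or> \<sigma> = -1"
    "\<And>s. cmod (6 * period s - of_real (sqrt (real p)) * (\<tau> * (unity_root 6 (4 * i - s) + unity_root 6 (- 3 * s) + unity_root 6 (- 4 * i - 5 * s))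
      + \<sigma> * (unity_root 6 (2 * i - 2 * s) + unity_root 6 (- 2 * i - 4 * s)))) \<le> 1 + 144 * real_of_int \<bar>y\<bar>"
proof -
  define q where "q = complex_of_real (sqrt (real p))"
  have q: "q \<noteq> 0" "cmod q = sqrt (real p)" "q * q = of_nat p" "cnj q = q"
    using p_pos by (auto simp: q_def simp flip: of_real_mult)
  \<comment> \<open>The normalized Gauss sums of the cubic and the quadratic character, both on the
    unit circle. The others become u^2 tau, cnj u and (cnj u)^2 tau.\<close>
  define u \<tau> where "u = gauss 2 / q" and "\<tau> = gauss 3 / q"
  have nu: "cmod u = 1" and nt: "cmod \<tau> = 1"
    using p_pos by (simp_all add: u_def \<tau>_def norm_divide q cmod_gauss)
  have g2: "gauss 2 = q * u" and g3: "gauss 3 = q * \<tau>" using q by (simp_all add: u_def \<tau>_def)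
  have g4: "gauss 4 = q * cnj u" unfolding cnj_gauss_2[symmetric] g2 using q by simp
  have uu: "u * cnj u = 1" using nu complex_norm_square[of u] by simp
  have g1: "gauss 1 = q * (u * u * \<tau>)"
  proof -
    have "(gauss 1 * gauss 4) * u = (gauss 2 * gauss 3) * u" using gauss_1_4[OF jacobi_arith(1)[OF X]] by simp
    hence "gauss 1 * q * (u * cnj u) = q * q * (u * u * \<tau>)" unfolding g2 g3 g4 by (simp add: mult_ac)
    hence "q * gauss 1 = q * (q * (u * u * \<tau>))" using uu by (simp add: mult_ac)
    thus ?thesis using q(1) by simp
  qed
  have sgn: "mchar 1 (-1) = mchar 3 (-1)"
    unfolding mchar_minus_1 by (rule unity_root_cong) (auto simp: cls_minus_1 cong_iff_dvd_diff)
  have sgn2: "mchar 3 (-1) * mchar 3 (-1) = 1"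
    unfolding mchar_mult[symmetric] by simp
  have g5: "gauss 5 = q * (cnj u * cnj u * \<tau>)"
  proof -
    have "cnj (gauss 3) = mchar 3 (-1) * gauss 3"
      using cnj_gauss[of 3] gauss_exp_cong[of "-3" 3] by (simp add: cong_def)
    hence "q * cnj \<tau> = q * (mchar 3 (-1) * \<tau>)" unfolding g3 using q by simp
    hence t: "cnj \<tau> = mchar 3 (-1) * \<tau>" using q by simp
    have "cnj (gauss 1) = mchar 3 (-1) * gauss 5"
      using cnj_gauss[of 1] gauss_exp_cong[of "-1" 5] sgn by (simp add: cong_def)
    hence "mchar 3 (-1) * cnj (gauss 1) = (mchar 3 (-1) * mchar 3 (-1)) * gauss 5" by simp
    hence "gauss 5 = mchar 3 (-1) * cnj (gauss 1)" using sgn2 by simp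
    also have "\<dots> = (mchar 3 (-1) * mchar 3 (-1)) * (q * (cnj u * cnj u * \<tau>))"
      unfolding g1 using q t by (simp add: mult_ac)
    finally show ?thesis using sgn2 by simp
  qed
  define j where "j = jacobi 2 2 / q"
  have nj: "cmod j = 1" using jacobi_arith(3)[OF X] p_pos by (simp add: j_def norm_divide q)
  have u3: "u ^ 3 = j"
  proof -
    have "q * q * (q * u ^ 3) = (q * u) ^ 3" by (simp add: power3_eq_cube mult_ac)
    also have "\<dots> = q * q * jacobi 2 2" using gauss_2_cubed unfolding g2 q(3) .
    finally have "q * u ^ 3 = jacobi 2 2" using q(1) by (metis mult_cancel_left no_zero_divisors)
    thus ?thesis using q(1) by (simp add: j_def field_simps)
  qed
  have imj: "\<bar>Im j\<bar> * sqrt (real p) \<le> 6 * real_of_int \<bar>y\<bar>"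
  proof -
    have "Im (jacobi 2 2) = Im j * sqrt (real p)" using q by (simp add: j_def q_def)
    thus ?thesis using jacobi_arith(2)[OF X] p_pos by (simp add: abs_mult)
  qed
  \<comment> \<open>J(2,2)/sqrt p is on the unit circle with imaginary part O(|y|/sqrt p), hence
    close to 1 or to -1, and sigma is the nearer one. As this number is u^3, u itself is close to
    sigma times a cube root of unity.\<close>
  define \<sigma> :: real where "\<sigma> = (if Re j \<ge> 0 then 1 else -1)"
  have s: "\<sigma> = 1 \<or> \<sigma> = -1" by (simp add: \<sigma>_def)
  have js: "cmod (j - of_real \<sigma>) \<le> 2 * \<bar>Im j\<bar>"
  proof -
    have n: "(Re j)\<^sup>2 + (Im j)\<^sup>2 = 1" using nj by (simp add: cmod_def)
    have le1: "\<bar>Re j\<bar> \<le> 1" using abs_Re_le_cmod[of j] nj by simp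
    have "(cmod (j - of_real \<sigma>))\<^sup>2 = (Re j - \<sigma>)\<^sup>2 + (Im j)\<^sup>2" by (simp add: cmod_power2)
    also have "\<dots> = 2 - 2 * \<bar>Re j\<bar>" using n by (auto simp: \<sigma>_def power2_eq_square algebra_simps)
    also have "\<dots> \<le> 2 * (1 - (Re j)\<^sup>2)"
    proof -
      have "\<bar>Re j\<bar> * \<bar>Re j\<bar> \<le> 1 * \<bar>Re j\<bar>" using le1 by (intro mult_right_mono) auto
      thus ?thesis by (simp add: power2_eq_square)
    qed
    also have "\<dots> \<le> (2 * \<bar>Im j\<bar>)\<^sup>2"
    proof -
      have "0 \<le> (Im j)\<^sup>2" by simp
      hence "2 * (1 - (Re j)\<^sup>2) \<le> 4 * (Im j)\<^sup>2" using n unfolding right_diff_distrib by linarith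
      thus ?thesis by (simp add: power_mult_distrib)
    qed
    finally show ?thesis by (rule power2_le_imp_le) simp
  qed
  obtain i :: nat where i: "cmod (u - of_real \<sigma> * unity_root 3 (int i)) \<le> 2 * cmod (j - of_real \<sigma>)"
    using cube_root_near[OF nu s] unfolding u3 by blast
  define v where "v = of_real \<sigma> * unity_root 3 (int i)"
  have v: "v = of_real \<sigma> * unity_root 6 (2 * int i)"
    unfolding v_def using unity_root_scale[of 2 3 "int i"] by (simp add: mult.commute)
  have vv: "v * v = unity_root 6 (4 * int i)" "cnj v = of_real \<sigma> * unity_root 6 (- 2 * int i)"
    "cnj v * cnj v = unity_root 6 (- 4 * int i)"
    unfolding v using s by (auto simp: cnj_unity_root unity_root_add[symmetric])
  have nv: "cmod v = 1" unfolding v using s by (auto simp: norm_mult)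
  define \<delta> where "\<delta> = cmod (u - v)"
  have d: "\<delta> * sqrt (real p) \<le> 24 * real_of_int \<bar>y\<bar>"
  proof -
    have "\<delta> \<le> 4 * \<bar>Im j\<bar>" using i js unfolding \<delta>_def v_def by linarith
    hence "\<delta> * sqrt (real p) \<le> 4 * \<bar>Im j\<bar> * sqrt (real p)" by (intro mult_right_mono) auto
    thus ?thesis using imj by linarith
  qed
  have d1: "cmod (cnj u - cnj v) = \<delta>" unfolding \<delta>_def by (simp only: complex_cnj_diff[symmetric] complex_mod_cnj)
  have sq: "cmod (a * a - b * b) \<le> 2 * cmod (a - b)" if "cmod a = 1" "cmod b = 1" for a b :: complex
  proof -
    have "cmod (a * a - b * b) = cmod (a + b) * cmod (a - b)"
      by (simp add: norm_mult[symmetric] algebra_simps)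
    also have "cmod (a + b) \<le> 2" using norm_triangle_ineq[of a b] that by simp
    finally show ?thesis by (simp add: mult_right_mono)
  qed
  show ?thesis
  proof (rule that[of \<tau> "of_real \<sigma>" "int i"])
    show "cmod \<tau> = 1" by (rule nt)
    show "complex_of_real \<sigma> = 1 \<or> complex_of_real \<sigma> = -1" using s by auto
    fix s :: int
    let ?z = "\<lambda>e. unity_root 6 (- e * s)"
    have "6 * period s = gauss 0 + ?z 1 * gauss 1 + ?z 2 * gauss 2 + ?z 3 * gauss 3 + ?z 4 * gauss 4 + ?z 5 * gauss 5"
    proof -
      have "{..<6::nat} = {0, 1, 2, 3, 4, 5}" by auto
      thus ?thesis by (simp add: period_def)
    qed
    moreover have "unity_root 6 (4 * int i - s) = v * v * ?z 1"
      unfolding vv(1) by (simp add: unity_root_add[symmetric])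
    moreover have "unity_root 6 (- 4 * int i - 5 * s) = cnj v * cnj v * ?z 5"
      unfolding vv(3) by (simp add: unity_root_add[symmetric])
    moreover have "of_real \<sigma> * unity_root 6 (2 * int i - 2 * s) = v * ?z 2"
      unfolding v by (simp add: unity_root_add[symmetric])
    moreover have "of_real \<sigma> * unity_root 6 (- 2 * int i - 4 * s) = cnj v * ?z 4"
      unfolding vv(2) by (simp add: unity_root_add[symmetric])
    ultimately have "6 * period s - q * (\<tau> * (unity_root 6 (4 * int i - s) + unity_root 6 (- 3 * s) + unity_root 6 (- 4 * int i - 5 * s))
      + of_real \<sigma> * (unity_root 6 (2 * int i - 2 * s) + unity_root 6 (- 2 * int i - 4 * s))) =
      gauss 0 + q * (?z 1 * \<tau> * (u * u - v * v) + ?z 2 * (u - v) + ?z 4 * (cnj u - cnj v)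
         + ?z 5 * \<tau> * (cnj u * cnj u - cnj v * cnj v))"
      unfolding g1 g2 g3 g4 g5 distrib_left[of "of_real \<sigma>"] by (simp add: algebra_simps)
    \<comment> \<open>The terms linear in u err by delta, those quadratic in u by 2 delta: in total
      6 delta sqrt p <= 144 |y|. The summand 1 is the size of \<open>gauss 0\<close>.\<close>
    also have "cmod \<dots> \<le> 1 + sqrt (real p) * (2 * \<delta> + \<delta> + \<delta> + 2 * \<delta>)"
    proof (rule norm_triangle_mono)
      show "cmod (gauss 0) \<le> 1" by (simp add: gauss_0)
      have "cmod (?z 1 * \<tau> * (u * u - v * v) + ?z 2 * (u - v) + ?z 4 * (cnj u - cnj v)
         + ?z 5 * \<tau> * (cnj u * cnj u - cnj v * cnj v)) \<le> 2 * \<delta> + \<delta> + \<delta> + 2 * \<delta>"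
        using sq[OF nu nv] sq[of "cnj u" "cnj v"] nu nv nt d1
        by (intro norm_triangle_mono) (simp_all add: norm_mult \<delta>_def)
      thus "cmod (q * (?z 1 * \<tau> * (u * u - v * v) + ?z 2 * (u - v) + ?z 4 * (cnj u - cnj v)
         + ?z 5 * \<tau> * (cnj u * cnj u - cnj v * cnj v))) \<le> sqrt (real p) * (2 * \<delta> + \<delta> + \<delta> + 2 * \<delta>)"
        unfolding norm_mult[of q] q by (intro mult_left_mono) auto
    qed
    also have "\<dots> \<le> 1 + 144 * real_of_int \<bar>y\<bar>" using d by (simp add: algebra_simps)
    finally show "cmod (6 * period s - of_real (sqrt (real p)) * (\<tau> * (unity_root 6 (4 * int i - s) + unity_root 6 (- 3 * s) + unity_root 6 (- 4 * int i - 5 * s))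
      + of_real \<sigma> * (unity_root 6 (2 * int i - 2 * s) + unity_root 6 (- 2 * int i - 4 * s)))) \<le> 1 + 144 * real_of_int \<bar>y\<bar>"
      unfolding q_def .
  qed
qed

text \<open>In the model a period is determined by whether its shifted index is 0, 3 or neither
  modulo 6. Summed over a set of exactly three indices, which meets 0 in alpha <= 1 and 3 in beta <=
  1 elements, it gives tau (alpha - beta) + sigma (alpha + beta - 1). If alpha = beta only sigma
  remains, otherwise only tau; in every case the modulus is 1.\<close>

lemma fourier_value_modulus:
  assumes X: "int p = x\<^sup>2 + 27 * y\<^sup>2" and S: "S \<subseteq> {..<6}" "card S = 3"
  shows "\<bar>cmod (fourier_value S s) - sqrt (real p)\<bar> \<le> 1 + 144 * real_of_int \<bar>y\<bar>"
proof -
  obtain \<tau> \<sigma> :: complex and i :: int where t: "cmod \<tau> = 1" and sg: "\<sigma> = 1 \<or> \<sigma> = -1" and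
    m: "\<And>s. cmod (6 * period s - of_real (sqrt (real p)) * (\<tau> * (unity_root 6 (4 * i - s) + unity_root 6 (- 3 * s) + unity_root 6 (- 4 * i - 5 * s))
      + \<sigma> * (unity_root 6 (2 * i - 2 * s) + unity_root 6 (- 2 * i - 4 * s)))) \<le> 1 + 144 * real_of_int \<bar>y\<bar>"
    by (rule period_model[OF X]) (rule that)
  have fin: "finite S" using S finite_subset by blast
  \<comment> \<open>The shift by 2 i absorbs the unknown cube root of unity into the class
    index.\<close>
  define \<rho> where "\<rho> r = int r + int s + 2 * i" for r :: nat
  define M where "M r = \<tau> * ((if 6 dvd \<rho> r then 3 else 0) - (if 6 dvd \<rho> r - 3 then 3 else 0)) +
     \<sigma> * ((if 6 dvd \<rho> r then 3 else 0) + (if 6 dvd \<rho> r - 3 then 3 else 0) - 1)" for r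
  have M: "\<tau> * (unity_root 6 (4 * i - (int r + int s)) + unity_root 6 (- 3 * (int r + int s)) + unity_root 6 (- 4 * i - 5 * (int r + int s)))
      + \<sigma> * (unity_root 6 (2 * i - 2 * (int r + int s)) + unity_root 6 (- 2 * i - 4 * (int r + int s))) = M r" for r
  proof -
    have e: "unity_root 6 (4 * i - (int r + int s)) = unity_root 6 (1 * (- \<rho> r))"
      "unity_root 6 (- 3 * (int r + int s)) = unity_root 6 (3 * (- \<rho> r))"
      "unity_root 6 (- 4 * i - 5 * (int r + int s)) = unity_root 6 (5 * (- \<rho> r))"
      "unity_root 6 (2 * i - 2 * (int r + int s)) = unity_root 6 (2 * (- \<rho> r))"
      "unity_root 6 (- 2 * i - 4 * (int r + int s)) = unity_root 6 (4 * (- \<rho> r))"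
      by (intro unity_root_cong, simp add: \<rho>_def cong_iff_dvd_diff algebra_simps)+
    have sets: "{..<6::nat} = {0, 1, 2, 3, 4, 5}" "{..<3::nat} = {0, 1, 2}" by auto
    have a: "1 + unity_root 6 (1 * (- \<rho> r)) + unity_root 6 (2 * (- \<rho> r)) + unity_root 6 (3 * (- \<rho> r))
       + unity_root 6 (4 * (- \<rho> r)) + unity_root 6 (5 * (- \<rho> r)) = (if 6 dvd \<rho> r then 6 else 0)"
      using sum_unity_root[of 6 "- \<rho> r"] unfolding sets by (simp add: add.assoc)
    have "unity_root 3 (k * (- \<rho> r)) = unity_root 6 (2 * k * (- \<rho> r))" for k
      using unity_root_scale[of 2 3 "k * (- \<rho> r)"] by (simp add: mult_ac)
    from this[of 1] this[of 2]
    have b: "1 + unity_root 6 (2 * (- \<rho> r)) + unity_root 6 (4 * (- \<rho> r)) = (if 3 dvd \<rho> r then 3 else 0)"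
      using sum_unity_root[of 3 "- \<rho> r"] unfolding sets by (simp add: add.assoc)
    have c: "3 dvd \<rho> r \<longleftrightarrow> 6 dvd \<rho> r \<or> 6 dvd \<rho> r - 3" "\<not> (6 dvd \<rho> r \<and> 6 dvd \<rho> r - 3)" by presburger+
    have E: "unity_root 6 (2 * (- \<rho> r)) + unity_root 6 (4 * (- \<rho> r)) =
      (if 6 dvd \<rho> r then 3 else 0) + (if 6 dvd \<rho> r - 3 then 3 else 0) - 1"
      using b c by (auto simp: algebra_simps split: if_splits)
    have "unity_root 6 (1 * (- \<rho> r)) + unity_root 6 (3 * (- \<rho> r)) + unity_root 6 (5 * (- \<rho> r)) =
      (if 6 dvd \<rho> r then 6 else 0) - (1 + (unity_root 6 (2 * (- \<rho> r)) + unity_root 6 (4 * (- \<rho> r))))"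
      unfolding a[symmetric] by simp
    also have "\<dots> = (if 6 dvd \<rho> r then 3 else 0) - (if 6 dvd \<rho> r - 3 then 3 else 0)"
      unfolding E using c by auto
    finally show ?thesis unfolding e E M_def by (simp only:)
  qed
  define \<alpha> \<beta> where "\<alpha> = card {r\<in>S. 6 dvd \<rho> r}" and "\<beta> = card {r\<in>S. 6 dvd \<rho> r - 3}"
  have "\<alpha> \<le> 1" "\<beta> \<le> 1"
  proof -
    have "r = r'" if "r \<in> S" "r' \<in> S" "6 dvd int r - int r'" for r r'
    proof -
      have "r < 6" "r' < 6" using S that by auto
      thus ?thesis using that(3) by presburger
    qed
    hence "r = r'" if "r \<in> S" "r' \<in> S" "6 dvd \<rho> r - c" "6 dvd \<rho> r' - c" for r r' c
      using that dvd_diff[OF that(3,4)] by (simp add: \<rho>_def)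
    from this[where c = 0] this[where c = 3] show "\<alpha> \<le> 1" "\<beta> \<le> 1"
      unfolding \<alpha>_def \<beta>_def using fin by (simp_all add: card_le_Suc0_iff_eq)
  qed
  hence "\<alpha> = 0 \<or> \<alpha> = 1" "\<beta> = 0 \<or> \<beta> = 1" by auto
  have sumM: "(\<Sum>r\<in>S. M r) = 3 * (\<tau> * (of_nat \<alpha> - of_nat \<beta>) + \<sigma> * (of_nat \<alpha> + of_nat \<beta> - 1))"
  proof -
    have "(\<Sum>r\<in>S. if 6 dvd \<rho> r then 3 else 0) = (3 * of_nat \<alpha> :: complex)"
      "(\<Sum>r\<in>S. if 6 dvd \<rho> r - 3 then 3 else 0) = (3 * of_nat \<beta> :: complex)"
      unfolding \<alpha>_def \<beta>_def using fin by (simp_all add: sum.If_cases Int_def)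
    thus ?thesis unfolding M_def sum.distrib sum_distrib_left[symmetric] sum_subtractf
      using S(2) by (simp add: algebra_simps)
  qed
  have norm1: "cmod (\<tau> * (of_nat \<alpha> - of_nat \<beta>) + \<sigma> * (of_nat \<alpha> + of_nat \<beta> - 1)) = 1"
    using \<open>\<alpha> = 0 \<or> \<alpha> = 1\<close> \<open>\<beta> = 0 \<or> \<beta> = 1\<close> t sg by auto
  let ?q = "complex_of_real (sqrt (real p))"
  have "3 * fourier_value S s - ?q * (\<Sum>r\<in>S. M r) = (\<Sum>r\<in>S. 6 * period (int r + int s) - ?q * M r)"
    by (simp add: fourier_value_def sum_subtractf sum_distrib_left)
  also have "cmod \<dots> \<le> (\<Sum>r\<in>S. 1 + 144 * real_of_int \<bar>y\<bar>)"
    by (rule sum_norm_le) (simp only: M[symmetric] m)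
  finally have "cmod (3 * (fourier_value S s - ?q * (\<tau> * (of_nat \<alpha> - of_nat \<beta>) + \<sigma> * (of_nat \<alpha> + of_nat \<beta> - 1))))
     \<le> 3 * (1 + 144 * real_of_int \<bar>y\<bar>)"
    unfolding sumM using S(2) by (simp add: algebra_simps)
  hence "cmod (fourier_value S s - ?q * (\<tau> * (of_nat \<alpha> - of_nat \<beta>) + \<sigma> * (of_nat \<alpha> + of_nat \<beta> - 1)))
     \<le> 1 + 144 * real_of_int \<bar>y\<bar>"
    unfolding norm_mult by simp
  moreover have "cmod (?q * (\<tau> * (of_nat \<alpha> - of_nat \<beta>) + \<sigma> * (of_nat \<alpha> + of_nat \<beta> - 1))) = sqrt (real p)"
    unfolding norm_mult norm1 by simp
  ultimately show ?thesis using norm_triangle_ineq3 order_trans by metis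
qed

end

section \<open>Total mass of the fourth-moment kernel\<close>

lemma sin_ge_half:
  assumes "0 \<le> u" "u \<le> pi / 2" shows "u / 2 \<le> sin u"
proof (cases "u \<le> pi / 3")
  case True
  have "sin 0 - 0 / 2 \<le> sin u - u / 2"
  proof (rule DERIV_nonneg_imp_nondecreasing[OF assms(1)])
    fix x assume x: "0 \<le> x" "x \<le> u"
    have "cos (pi / 3) \<le> cos x" using x True by (intro cos_monotone_0_pi_le) auto
    hence "0 \<le> cos x - 1 / 2" by (simp add: cos_60)
    moreover have "((\<lambda>u. sin u - u / 2) has_real_derivative cos x - 1 / 2) (at x)"
      by (auto intro!: derivative_eq_intros)
    ultimately show "\<exists>y. ((\<lambda>u. sin u - u / 2) has_real_derivative y) (at x) \<and> 0 \<le> y" by blast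
  qed
  thus ?thesis by simp
next
  case False
  have "sin (pi / 3) \<le> sin u" using False assms by (intro sin_monotone_2pi_le) auto
  moreover have "8 / 5 \<le> sqrt 3" by (rule real_le_rsqrt) (simp add: power2_eq_square)
  hence "4 / 5 \<le> sin (pi / 3)" by (simp add: sin_60)
  moreover have "u / 2 \<le> 4 / 5" using assms pi_less_4 pi_approx by simp
  ultimately show ?thesis by linarith
qed

lemma harm_le_ln: "n > 0 \<Longrightarrow> (\<Sum>k=1..n. 1 / real k) \<le> 1 + ln (real n)"
proof (induction n)
  case (Suc n)
  show ?case
  proof (cases "n = 0")
    case False
    have "ln (real n / real (Suc n)) \<le> real n / real (Suc n) - 1" using False by (intro ln_le_minus_one) simp
    also have "real n / real (Suc n) - 1 = - (1 / real (Suc n))" by (simp add: field_simps)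
    finally have "1 / real (Suc n) \<le> ln (real (Suc n)) - ln (real n)" using False by (simp add: ln_div)
    thus ?thesis using Suc False by simp
  qed simp
qed simp

definition dirichlet :: "nat \<Rightarrow> nat \<Rightarrow> int \<Rightarrow> complex" where
  "dirichlet N t l = (\<Sum>j<t. unity_root N (l * int j))"

lemma dirichlet_le: "cmod (dirichlet N t l) \<le> real t"
  unfolding dirichlet_def by (rule order_trans[OF norm_sum]) simp

lemma dirichlet_cong: "[l = l'] (mod int N) \<Longrightarrow> dirichlet N t l = dirichlet N t l'"
  unfolding dirichlet_def by (intro sum.cong refl unity_root_cong cong_scalar_right)

text \<open>Geometric series: the sum is at most 2/|1 - z|, and |1 - z| = 2 sin(pi l / N), where
  \<open>sin_ge_half\<close> is used for the angle or for its reflection.\<close>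

lemma dirichlet_bound:
  assumes "0 < l" "l < int N"
  shows "cmod (dirichlet N t l) \<le> real N / real_of_int (min l (int N - l))"
proof -
  let ?z = "unity_root N l" and ?m = "real_of_int (min l (int N - l))"
  define u where "u = pi * real_of_int l / real N"
  have N: "0 < real N" using assms by simp
  have u: "0 < u" "u < pi" using assms N by (simp_all add: u_def field_simps)
  have m0: "?m > 0" using assms by simp
  have su: "pi * ?m / (2 * real N) \<le> sin u"
  proof (cases "u \<le> pi / 2")
    case True
    have "pi * ?m / (2 * real N) \<le> u / 2" using N by (simp add: u_def field_simps)
    thus ?thesis using sin_ge_half[of u] u True by simp
  next
    case False
    have "pi * ?m / (2 * real N) \<le> (pi - u) / 2"
    proof -
      have "pi * ?m \<le> pi * (real N - real_of_int l)" by (intro mult_left_mono) auto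
      thus ?thesis using N by (simp add: u_def field_simps)
    qed
    thus ?thesis using sin_ge_half[of "pi - u"] u False by simp
  qed
  have "?z = exp (\<i> * of_real (2 * u))" by (simp add: unity_root_def cis_conv_exp u_def mult_ac)
  hence "cmod (?z - 1) = 2 * \<bar>sin u\<bar>" using dist_exp_i_1[of "2 * u"] by simp
  hence lower: "pi * ?m / real N \<le> cmod (1 - ?z)" using su by (simp add: norm_minus_commute)
  have "dirichlet N t l * (1 - ?z) = 1 - ?z ^ t"
    unfolding dirichlet_def
    by (subst one_diff_power_eq) (simp add: unity_root_power mult.commute)
  hence "cmod (dirichlet N t l) * cmod (1 - ?z) = cmod (1 - ?z ^ t)" by (simp flip: norm_mult)
  also have "\<dots> \<le> 1 + 1" by (rule order_trans[OF norm_triangle_ineq4]) (simp add: norm_power)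
  finally have "cmod (dirichlet N t l) * (pi * ?m / real N) \<le> 2"
    using mult_left_mono[OF lower norm_ge_zero, of "dirichlet N t l"] by linarith
  moreover have "2 * ?m / real N \<le> pi * ?m / real N"
    using pi_ge_two m0 N by (intro divide_right_mono mult_right_mono) auto
  hence "cmod (dirichlet N t l) * (2 * ?m / real N) \<le> cmod (dirichlet N t l) * (pi * ?m / real N)"
    by (rule mult_left_mono) simp
  ultimately have "cmod (dirichlet N t l) * (2 * ?m / real N) \<le> 2" by linarith
  thus ?thesis using m0 N by (simp add: field_simps)
qed

definition dirichlet_mass :: "nat \<Rightarrow> nat \<Rightarrow> real" where
  "dirichlet_mass p t = 2 * real t + 2 * real p * (1 + ln (real p))"

text \<open>After reducing l to [0, m), only x = 0 and x = p - 1 can bring the frequency within m of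
  a multiple of p m; they get the trivial bound t. Elsewhere the distance is at least m min(x, p - 1
  - x), so m cancels and two harmonic sums remain. The bound is therefore uniform in m.\<close>

lemma dirichlet_sum_bound:
  assumes p: "p \<ge> 2" and m: "m > 0"
  shows "(\<Sum>x\<in>{0..<int p}. cmod (dirichlet (p * m) t (l + int m * x))) \<le> dirichlet_mass p t"
proof -
  define l0 q where "l0 = l mod int m" and "q = l div int m"
  have l: "l = l0 + int m * q" by (simp add: l0_def q_def)
  have l0: "0 \<le> l0" "l0 < int m" using m by (simp_all add: l0_def)
  define f where "f x = cmod (dirichlet (p * m) t (l0 + int m * x))" for x
  have per: "f (x mod int p) = f x" for x
    unfolding f_def
  proof (intro arg_cong[of _ _ cmod] dirichlet_cong)
    have "[int m * (x mod int p) = int m * x] (mod int m * int p)"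
      by (simp only: cong_def mult_mod_right[symmetric] mod_mod_trivial)
    thus "[l0 + int m * (x mod int p) = l0 + int m * x] (mod int (p * m))"
      by (intro cong_add cong_refl) (simp add: mult.commute)
  qed
  have "(\<Sum>x\<in>{0..<int p}. cmod (dirichlet (p * m) t (l + int m * x))) = (\<Sum>x\<in>{0..<int p}. f (x + q))"
    by (simp add: f_def l algebra_simps)
  also have "\<dots> = (\<Sum>x\<in>{0..<int p}. f x)" using p per by (intro sum_residues_shift) auto
  also have "\<dots> = (\<Sum>x<p. f (int x))" by (rule sum_int_interval)
  also have "\<dots> \<le> (\<Sum>x<p. (if x = 0 then real t else 0) + (if x = p - 1 then real t else 0)
      + real p / real x + real p / real (p - 1 - x))"
  proof (rule sum_mono)
    fix x assume x: "x \<in> {..<p}"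
    show "f (int x) \<le> (if x = 0 then real t else 0) + (if x = p - 1 then real t else 0)
      + real p / real x + real p / real (p - 1 - x)"
    proof (cases "x = 0 \<or> x = p - 1")
      case True
      hence "real t \<le> (if x = 0 then real t else 0) + (if x = p - 1 then real t else 0)" by auto
      moreover have "f (int x) \<le> real t" unfolding f_def by (rule dirichlet_le)
      ultimately have le: "f (int x) \<le> (if x = 0 then real t else 0) + (if x = p - 1 then real t else 0)"
        by (rule order_trans[rotated])
      have nn: "0 \<le> real p / real x" "0 \<le> real p / real (p - 1 - x)" by simp_all
      show ?thesis by (rule add_increasing2[OF nn(2) add_increasing2[OF nn(1) le]])
    next
      case False
      define k where "k = p - 1 - x"
      have k: "k > 0" "x > 0" "p = x + k + 1" using False x by (auto simp: k_def)
      define c where "c = min x k"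
      let ?l = "l0 + int m * int x" and ?N = "p * m"
      have c0: "c > 0" using k by (simp add: c_def)
      have "int m * int c \<le> int m * int x" "int m * int c \<le> int m * int k"
        unfolding c_def by (rule mult_left_mono; simp)+
      moreover have "int ?N = int m * int x + int m * int k + int m" by (simp add: k(3) algebra_simps)
      moreover have "0 < int m * int x" "0 < int m * int k" using m k by simp_all
      ultimately have l: "0 < ?l" "?l < int ?N" "int m * int c \<le> min ?l (int ?N - ?l)"
        using l0 by linarith+
      have "f (int x) \<le> real ?N / real_of_int (min ?l (int ?N - ?l))"
        unfolding f_def by (rule dirichlet_bound) (use l in auto)
      also have "\<dots> \<le> real ?N / (real m * real c)"
      proof (rule divide_left_mono)
        have "real_of_int (int m * int c) \<le> real_of_int (min ?l (int ?N - ?l))" using l(3) by (simp only: of_int_le_iff)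
        thus "real m * real c \<le> real_of_int (min ?l (int ?N - ?l))" by simp
        show "0 < real_of_int (min ?l (int ?N - ?l)) * (real m * real c)"
          using l c0 m by (intro mult_pos_pos) auto
      qed simp
      also have "\<dots> = real p / real c" using m by simp
      also have "\<dots> \<le> real p / real x + real p / real k" by (auto simp: c_def min_def)
      finally show ?thesis using False by (simp add: k_def)
    qed
  qed
  also have "\<dots> = 2 * real t + (\<Sum>x<p. real p / real x) + (\<Sum>x<p. real p / real (p - 1 - x))"
  proof -
    have "0 < p" "p - 1 < p" using p by auto
    thus ?thesis by (simp add: sum.distrib)
  qed
  also have "(\<Sum>x<p. real p / real (p - 1 - x)) = (\<Sum>x<p. real p / real x)"
    using sum.nat_diff_reindex[of "\<lambda>x. real p / real x" p] by simp
  \<comment> \<open>The term x = 0 is a division by zero with value 0, so it drops out.\<close>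
  also have "(\<Sum>x<p. real p / real x) = real p * (\<Sum>x=1..p - 1. 1 / real x)"
  proof -
    have "(\<Sum>x<p. real p / real x) = (\<Sum>x\<in>{1..p - 1}. real p / real x)"
      by (rule sum.mono_neutral_right) (use p in auto)
    thus ?thesis by (simp add: sum_distrib_left)
  qed
  also have "real p * (\<Sum>x=1..p - 1. 1 / real x) \<le> real p * (1 + ln (real p))"
  proof (rule mult_left_mono)
    have "(\<Sum>x=1..p - 1. 1 / real x) \<le> 1 + ln (real (p - 1))" using p by (intro harm_le_ln) auto
    also have "ln (real (p - 1)) \<le> ln (real p)" using p by simp
    finally show "(\<Sum>x=1..p - 1. 1 / real x) \<le> 1 + ln (real p)" by simp
  qed simp
  finally show ?thesis by (simp add: dirichlet_mass_def)
qed

definition quads :: "nat \<Rightarrow> (nat \<times> nat \<times> nat \<times> nat) set" where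
  "quads t = {(i, j, k, h). i < t \<and> j < t \<and> k < t \<and> h < t \<and> i + j = k + h}"

lemma finite_quads [simp]: "finite (quads t)"
  by (rule finite_subset[of _ "{..<t} \<times> {..<t} \<times> {..<t} \<times> {..<t}"]) (auto simp: quads_def)

lemma sum_quads:
  "(\<Sum>(i, j, k, h)\<in>quads t. f i j k h) =
   (\<Sum>i<t. \<Sum>j<t. \<Sum>k<t. \<Sum>h<t. if i + j = k + h then f i j k h else 0 :: 'a::comm_monoid_add)"
proof -
  have "(\<Sum>(i, j, k, h)\<in>quads t. f i j k h) = (\<Sum>(i, j, k, h)\<in>{..<t} \<times> {..<t} \<times> {..<t} \<times> {..<t}.
     if i + j = k + h then f i j k h else 0)"
    by (rule sum.mono_neutral_cong_left) (auto simp: quads_def split: if_splits)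
  thus ?thesis by (simp add: sum.cartesian_product)
qed

definition quad_kernel :: "nat \<Rightarrow> nat \<Rightarrow> int \<Rightarrow> int \<Rightarrow> int \<Rightarrow> complex" where
  "quad_kernel p t x y z = (\<Sum>(i, j, k, h)\<in>quads t. unity_root p (- (x * int i + y * int j - z * int k)))"

lemma sum_triple_product:
  fixes c :: "'a::comm_semiring_1"
  shows "(\<Sum>x\<in>A. \<Sum>y\<in>B. \<Sum>z\<in>C. f x * g y * h z * c) = sum f A * sum g B * sum h C * c"
  by (simp only: sum_distrib_left[symmetric] sum_distrib_right[symmetric] mult.assoc)

lemma sum_quadruple_product:
  fixes f :: "'a \<Rightarrow> 'b::comm_semiring_1"
  shows "(\<Sum>x\<in>A. \<Sum>y\<in>B. \<Sum>z\<in>C. \<Sum>u\<in>D. f x * g y * h z * e u) = sum f A * sum g B * sum h C * sum e D"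
  by (simp only: sum_distrib_left[symmetric] sum_distrib_right[symmetric] mult.assoc)

text \<open>The condition i + j = k + h is detected by averaging over l modulo p m. The modulus is
  enlarged from p to p m >= 2 t, because t may exceed p and the congruence must imply
  equality.\<close>

lemma quad_kernel_eq:
  assumes m: "m > 0" "p > 0" "2 * t \<le> p * m"
  shows "of_nat (p * m) * quad_kernel p t x y z =
    (\<Sum>l\<in>{0..<int (p * m)}. dirichlet (p * m) t (l - int m * x) * dirichlet (p * m) t (l - int m * y) *
        cnj (dirichlet (p * m) t (l - int m * z)) * cnj (dirichlet (p * m) t l))"
proof -
  let ?N = "p * m"
  let ?R = "unity_root ?N"
  have cD: "cnj (dirichlet ?N t l) = (\<Sum>j<t. ?R (- (l * int j)))" for l
    by (simp add: dirichlet_def cnj_unity_root)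
  have "(\<Sum>l\<in>{0..<int ?N}. dirichlet ?N t (l - int m * x) * dirichlet ?N t (l - int m * y) *
        cnj (dirichlet ?N t (l - int m * z)) * cnj (dirichlet ?N t l)) =
    (\<Sum>l\<in>{0..<int ?N}. \<Sum>i<t. \<Sum>j<t. \<Sum>k<t. \<Sum>h<t. ?R ((l - int m * x) * int i) * ?R ((l - int m * y) * int j)
        * ?R (- ((l - int m * z) * int k)) * ?R (- (l * int h)))"
    unfolding cD unfolding dirichlet_def by (simp only: sum_quadruple_product)
  also have "\<dots> = (\<Sum>i<t. \<Sum>j<t. \<Sum>k<t. \<Sum>h<t. \<Sum>l\<in>{0..<int ?N}. ?R ((l - int m * x) * int i) * ?R ((l - int m * y) * int j)
        * ?R (- ((l - int m * z) * int k)) * ?R (- (l * int h)))"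
    by (simp only: sum.swap[of _ "{..<t}" "{0..<int ?N}"])
  also have "\<dots> = (\<Sum>i<t. \<Sum>j<t. \<Sum>k<t. \<Sum>h<t. if i + j = k + h then
       of_nat ?N * unity_root p (- (x * int i + y * int j - z * int k)) else 0)"
  proof (intro sum.cong refl)
    fix i j k h assume ij: "i \<in> {..<t}" "j \<in> {..<t}" "k \<in> {..<t}" "h \<in> {..<t}"
    let ?d = "int i + int j - int k - int h"
    have "(\<Sum>l\<in>{0..<int ?N}. ?R ((l - int m * x) * int i) * ?R ((l - int m * y) * int j)
        * ?R (- ((l - int m * z) * int k)) * ?R (- (l * int h))) =
      (\<Sum>l\<in>{0..<int ?N}. ?R (- (x * int i + y * int j - z * int k) * int m) * ?R (l * ?d))"
      by (intro sum.cong refl) (simp add: unity_root_add[symmetric] algebra_simps)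
    also have "\<dots> = unity_root p (- (x * int i + y * int j - z * int k)) * (\<Sum>l\<in>{0..<int ?N}. ?R (l * ?d))"
      unfolding sum_distrib_left unity_root_scale[OF m(1)] ..
    also have "(\<Sum>l\<in>{0..<int ?N}. ?R (l * ?d)) = (if int ?N dvd ?d then of_nat ?N else 0)"
      using m by (intro sum_unity_root_int) simp
    also have "int ?N dvd ?d \<longleftrightarrow> i + j = k + h"
    proof
      assume d: "int ?N dvd ?d"
      have "\<bar>?d\<bar> < 2 * int t" using ij by auto
      also have "\<dots> = int (2 * t)" by simp
      also have "\<dots> \<le> int ?N" using m(3) by (simp only: of_nat_le_iff)
      finally have "\<bar>?d\<bar> < int ?N" .
      hence "?d = 0" using dvd_imp_le_int[OF _ d] by (cases "?d = 0") auto
      thus "i + j = k + h" by linarith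
    next
      assume "i + j = k + h"
      hence "?d = 0" by linarith
      thus "int ?N dvd ?d" by simp
    qed
    finally show "(\<Sum>l\<in>{0..<int ?N}. ?R ((l - int m * x) * int i) * ?R ((l - int m * y) * int j)
        * ?R (- ((l - int m * z) * int k)) * ?R (- (l * int h))) = (if i + j = k + h then
       of_nat ?N * unity_root p (- (x * int i + y * int j - z * int k)) else 0)" by simp
  qed
  also have "\<dots> = of_nat ?N * quad_kernel p t x y z"
    unfolding quad_kernel_def sum_quads sum_distrib_left
    by (intro sum.cong refl) auto
  finally show ?thesis ..
qed

text \<open>For fixed l the sums over x, y and z separate into three Dirichlet sums, each at most
  \<open>dirichlet_mass\<close>. The remaining sum over l splits into m progressions with the same
  bound, so the p m in front of the kernel loses its m and one factor 1/p is gained.\<close>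

lemma sum_norm_quad_kernel:
  assumes p: "p \<ge> 2"
  shows "(\<Sum>x\<in>{0..<int p}. \<Sum>y\<in>{0..<int p}. \<Sum>z\<in>{0..<int p}. cmod (quad_kernel p t x y z))
    \<le> dirichlet_mass p t ^ 4 / real p"
proof -
  \<comment> \<open>Any positive m with 2 t <= p m would do; it cancels at the end.\<close>
  define m where "m = 2 * t + 1"
  let ?N = "p * m" and ?U = "dirichlet_mass p t"
  define d where "d l = cmod (dirichlet ?N t l)" for l
  have m: "m > 0" "p > 0" "2 * t \<le> ?N" using p mult_le_mono1[of 1 p m] by (auto simp: m_def)
  have d0: "0 \<le> d l" for l by (simp add: d_def)
  have W: "(\<Sum>x\<in>{0..<int p}. d (l - int m * x)) \<le> ?U" for l
  proof -
    have "d (l + int m * (x mod int p)) = d (l + int m * x)" for x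
      unfolding d_def
    proof (intro arg_cong[of _ _ cmod] dirichlet_cong)
      have "[int m * (x mod int p) = int m * x] (mod int m * int p)"
        by (simp only: cong_def mult_mod_right[symmetric] mod_mod_trivial)
      thus "[l + int m * (x mod int p) = l + int m * x] (mod int (p * m))"
        by (intro cong_add cong_refl) (simp add: mult.commute)
    qed
    hence "(\<Sum>x\<in>{0..<int p}. d (l + int m * ((-1) * x))) = (\<Sum>x\<in>{0..<int p}. d (l + int m * x))"
      using sum_residues_mult[of p "\<lambda>x. d (l + int m * x)" "-1" "-1"] m by simp
    also have "\<dots> \<le> ?U" unfolding d_def by (rule dirichlet_sum_bound[OF p m(1)])
    finally show ?thesis by simp
  qed
  have U0: "0 \<le> ?U" using p by (simp add: dirichlet_mass_def)
  have "real ?N * (\<Sum>x\<in>{0..<int p}. \<Sum>y\<in>{0..<int p}. \<Sum>z\<in>{0..<int p}. cmod (quad_kernel p t x y z)) =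
     (\<Sum>x\<in>{0..<int p}. \<Sum>y\<in>{0..<int p}. \<Sum>z\<in>{0..<int p}. cmod (of_nat ?N * quad_kernel p t x y z))"
    by (simp only: norm_mult norm_of_nat sum_distrib_left)
  also have "\<dots> \<le> (\<Sum>x\<in>{0..<int p}. \<Sum>y\<in>{0..<int p}. \<Sum>z\<in>{0..<int p}. \<Sum>l\<in>{0..<int ?N}.
      d (l - int m * x) * d (l - int m * y) * d (l - int m * z) * d l)"
    unfolding quad_kernel_eq[OF m] d_def
    by (intro sum_mono order_trans[OF norm_sum]) (simp add: norm_mult)
  also have "\<dots> = (\<Sum>l\<in>{0..<int ?N}. (\<Sum>x\<in>{0..<int p}. d (l - int m * x)) * (\<Sum>y\<in>{0..<int p}. d (l - int m * y)) *
      (\<Sum>z\<in>{0..<int p}. d (l - int m * z)) * d l)"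
    unfolding sum_triple_product[symmetric]
    by (simp only: sum.swap[of _ "{0..<int p}" "{0..<int ?N}"])
  also have "\<dots> \<le> (\<Sum>l\<in>{0..<int ?N}. ?U * ?U * ?U * d l)"
    using U0 by (intro sum_mono mult_mono W) (auto intro!: sum_nonneg mult_nonneg_nonneg d0)
  also have "\<dots> = ?U * ?U * ?U * (\<Sum>l\<in>{0..<int ?N}. d l)" by (simp add: sum_distrib_left)
  also have "(\<Sum>l\<in>{0..<int ?N}. d l) \<le> real m * ?U"
  proof -
    have "(\<Sum>l\<in>{0..<int ?N}. d l) = (\<Sum>l<p * m. d (int l))" by (rule sum_int_interval)
    also have "\<dots> = (\<Sum>x<p. \<Sum>l\<in>{x * m..<x * m + m}. d (int l))" by (rule sum.nat_group[symmetric])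
    also have "\<dots> = (\<Sum>x<p. \<Sum>l<m. d (int l + int m * int x))"
    proof (rule sum.cong[OF refl])
      fix x
      have "(\<Sum>l\<in>{0 + x * m..<m + x * m}. d (int l)) = (\<Sum>l\<in>{0..<m}. d (int (l + x * m)))"
        by (rule sum.shift_bounds_nat_ivl)
      thus "(\<Sum>l\<in>{x * m..<x * m + m}. d (int l)) = (\<Sum>l<m. d (int l + int m * int x))"
        by (simp add: add.commute mult.commute atLeast0LessThan)
    qed
    also have "\<dots> = (\<Sum>l<m. \<Sum>x\<in>{0..<int p}. d (int l + int m * x))"
      by (subst sum.swap) (simp add: sum_int_interval)
    also have "\<dots> \<le> (\<Sum>l<m. ?U)"
      unfolding d_def by (intro sum_mono dirichlet_sum_bound p m)
    finally show ?thesis by simp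
  qed
  hence "?U * ?U * ?U * (\<Sum>l\<in>{0..<int ?N}. d l) \<le> ?U * ?U * ?U * (real m * ?U)"
    using U0 by (intro mult_left_mono) auto
  finally have "real p * (real m * (\<Sum>x\<in>{0..<int p}. \<Sum>y\<in>{0..<int p}. \<Sum>z\<in>{0..<int p}. cmod (quad_kernel p t x y z)))
      \<le> real m * ?U ^ 4"
    by (simp add: power4_eq_xxxx mult_ac)
  hence "real m * (real p * (\<Sum>x\<in>{0..<int p}. \<Sum>y\<in>{0..<int p}. \<Sum>z\<in>{0..<int p}. cmod (quad_kernel p t x y z)))
      \<le> real m * ?U ^ 4" by (simp add: mult_ac)
  hence "real p * (\<Sum>x\<in>{0..<int p}. \<Sum>y\<in>{0..<int p}. \<Sum>z\<in>{0..<int p}. cmod (quad_kernel p t x y z)) \<le> ?U ^ 4"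
    using m(1) by (simp add: mult_le_cancel_left_pos)
  thus ?thesis using m by (simp add: field_simps)
qed

section \<open>Sums over additive quadruples\<close>

text \<open>For |d| < t there are t - |d| pairs of indices below t with difference d, and the pairs
  (i, k) and (h, j) are chosen independently once d is fixed.\<close>

lemma sum_quads_difference:
  fixes F :: "int \<Rightarrow> 'a::comm_semiring_1"
  shows "(\<Sum>i<t. \<Sum>j<t. \<Sum>k<t. \<Sum>h<t. if int i - int k = int h - int j then F (int i - int k) else 0) =
    (\<Sum>d\<in>{- int t<..<int t}. F d * of_nat (t - nat \<bar>d\<bar>) ^ 2)"
proof -
  define c where "c d = (\<Sum>i<t. \<Sum>k<t. if int i - int k = d then 1 else 0 :: 'a)" for d
  have c: "c d = of_nat (t - nat \<bar>d\<bar>)" if d: "d \<in> {- int t<..<int t}" for d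
  proof -
    have "c d = (\<Sum>i<t. if 0 \<le> int i - d \<and> int i - d < int t then 1 else 0)"
      unfolding c_def
    proof (rule sum.cong[OF refl])
      fix i
      have "(\<Sum>k<t. if int i - int k = d then 1 else 0 :: 'a) = (\<Sum>k<t. if k = nat (int i - d) \<and> 0 \<le> int i - d then 1 else 0)"
        by (intro sum.cong refl if_cong) auto
      thus "(\<Sum>k<t. if int i - int k = d then 1 else 0 :: 'a) = (if 0 \<le> int i - d \<and> int i - d < int t then 1 else 0)"
        by (cases "0 \<le> int i - d") (auto simp: nat_less_iff)
    qed
    also have "\<dots> = of_nat (card {i\<in>{..<t}. 0 \<le> int i - d \<and> int i - d < int t})"
      by (simp add: sum.If_cases Int_def)
    also have "card {i\<in>{..<t}. 0 \<le> int i - d \<and> int i - d < int t} = t - nat \<bar>d\<bar>"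
    proof (cases "d \<ge> 0")
      case True
      hence "{i\<in>{..<t}. 0 \<le> int i - d \<and> int i - d < int t} = {nat d..<t}" by auto
      thus ?thesis using True by simp
    next
      case False
      hence "{i\<in>{..<t}. 0 \<le> int i - d \<and> int i - d < int t} = {..<t - nat \<bar>d\<bar>}" using d by auto
      thus ?thesis by simp
    qed
    finally show ?thesis .
  qed
  have "(\<Sum>d\<in>{- int t<..<int t}. F d * of_nat (t - nat \<bar>d\<bar>) ^ 2) = (\<Sum>d\<in>{- int t<..<int t}. F d * (c d * c d))"
    using c by (intro sum.cong refl) (simp add: power2_eq_square)
  also have "\<dots> = (\<Sum>d\<in>{- int t<..<int t}. \<Sum>i<t. \<Sum>k<t. \<Sum>h<t. \<Sum>j<t.
      if d = int i - int k \<and> int i - int k = int h - int j then F d else 0)"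
  proof (rule sum.cong[OF refl])
    fix d
    have "(\<Sum>i<t. \<Sum>k<t. \<Sum>h<t. \<Sum>j<t. if d = int i - int k \<and> int i - int k = int h - int j then F d else 0) =
      (\<Sum>i<t. \<Sum>k<t. \<Sum>h<t. \<Sum>j<t. (if int i - int k = d then 1 else 0) * ((if int h - int j = d then 1 else 0) * F d))"
      by (intro sum.cong refl) auto
    also have "\<dots> = c d * (c d * F d)"
      unfolding c_def by (simp only: sum_distrib_left[symmetric] sum_distrib_right[symmetric])
    finally show "F d * (c d * c d) = (\<Sum>i<t. \<Sum>k<t. \<Sum>h<t. \<Sum>j<t.
      if d = int i - int k \<and> int i - int k = int h - int j then F d else 0)" by (simp add: mult_ac)
  qed
  also have "\<dots> = (\<Sum>i<t. \<Sum>k<t. \<Sum>h<t. \<Sum>j<t. \<Sum>d\<in>{- int t<..<int t}.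
      if d = int i - int k \<and> int i - int k = int h - int j then F d else 0)"
    by (simp only: sum.swap[of _ "{..<t}" "{- int t<..<int t}"])
  also have "\<dots> = (\<Sum>i<t. \<Sum>k<t. \<Sum>h<t. \<Sum>j<t. if int i - int k = int h - int j then F (int i - int k) else 0)"
  proof (intro sum.cong refl)
    fix i k h j assume "i \<in> {..<t}" "k \<in> {..<t}" "h \<in> {..<t}" "j \<in> {..<t}"
    thus "(\<Sum>d\<in>{- int t<..<int t}. if d = int i - int k \<and> int i - int k = int h - int j then F d else 0) =
        (if int i - int k = int h - int j then F (int i - int k) else 0)"
      by (cases "int i - int k = int h - int j") auto
  qed
  also have "\<dots> = (\<Sum>i<t. \<Sum>j<t. \<Sum>k<t. \<Sum>h<t. if int i - int k = int h - int j then F (int i - int k) else 0)"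
  proof (rule sum.cong[OF refl])
    fix i
    have "(\<Sum>k<t. \<Sum>h<t. \<Sum>j<t. if int i - int k = int h - int j then F (int i - int k) else 0) =
       (\<Sum>k<t. \<Sum>j<t. \<Sum>h<t. if int i - int k = int h - int j then F (int i - int k) else 0)"
      by (rule sum.cong[OF refl]) (rule sum.swap)
    also have "\<dots> = (\<Sum>j<t. \<Sum>k<t. \<Sum>h<t. if int i - int k = int h - int j then F (int i - int k) else 0)"
      by (rule sum.swap)
    finally show "(\<Sum>k<t. \<Sum>h<t. \<Sum>j<t. if int i - int k = int h - int j then F (int i - int k) else 0) = \<dots>" .
  qed
  finally show ?thesis ..
qed

lemma sum_quads_diff_13:
  fixes F :: "int \<Rightarrow> 'a::comm_semiring_1"
  shows "(\<Sum>(i, j, k, h)\<in>quads t. F (int i - int k)) = (\<Sum>d\<in>{- int t<..<int t}. F d * of_nat (t - nat \<bar>d\<bar>) ^ 2)"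
  unfolding sum_quads_difference[symmetric] sum_quads
  by (intro sum.cong refl if_cong) linarith

lemma sum_quads_diff_23:
  fixes F :: "int \<Rightarrow> 'a::comm_semiring_1"
  shows "(\<Sum>(i, j, k, h)\<in>quads t. F (int j - int k)) = (\<Sum>d\<in>{- int t<..<int t}. F d * of_nat (t - nat \<bar>d\<bar>) ^ 2)"
proof -
  have "(\<Sum>(i, j, k, h)\<in>quads t. F (int j - int k)) = (\<Sum>(i, j, k, h)\<in>quads t. F (int i - int k))"
    by (rule sum.reindex_bij_witness[of _ "\<lambda>(i, j, k, h). (j, i, k, h)" "\<lambda>(i, j, k, h). (j, i, k, h)"])
       (auto simp: quads_def)
  thus ?thesis by (simp add: sum_quads_diff_13)
qed

text \<open>Reversing two of the indices, k -> t - 1 - k and so on, turns a sum of indices into a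
  difference; this is the origin of the offset t - 1.\<close>

lemma sum_quads_sum_12:
  fixes F :: "int \<Rightarrow> 'a::comm_semiring_1"
  shows "(\<Sum>(i, j, k, h)\<in>quads t. F (int i + int j)) =
    (\<Sum>d\<in>{- int t<..<int t}. F (d + int t - 1) * of_nat (t - nat \<bar>d\<bar>) ^ 2)"
proof -
  have "(\<Sum>(i, j, k, h)\<in>quads t. F (int i + int j)) = (\<Sum>(i, j, k, h)\<in>quads t. F (int i - int k + int t - 1))"
    by (rule sum.reindex_bij_witness[of _ "\<lambda>(i, j, k, h). (i, t - 1 - k, h, t - 1 - j)" "\<lambda>(i, j, k, h). (i, t - 1 - h, t - 1 - j, k)"])
       (auto simp: quads_def of_nat_diff)
  thus ?thesis using sum_quads_diff_13[of "\<lambda>d. F (d + int t - 1)" t] by simp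
qed

text \<open>The leading term 2 t^3 / 3 is the source of the terms 2 T / 3 in 1/phi.\<close>

lemma card_quads: "3 * card (quads t) = 2 * t ^ 3 + t"
proof -
  have "card (quads t) = (\<Sum>(i, j, k, h)\<in>quads t. 1)" by simp
  also have "\<dots> = (\<Sum>d\<in>{- int t<..<int t}. (t - nat \<bar>d\<bar>) ^ 2)"
    using sum_quads_diff_13[of "\<lambda>_. 1 :: nat" t] by simp
  finally have eq: "card (quads t) = (\<Sum>d\<in>{- int t<..<int t}. (t - nat \<bar>d\<bar>) ^ 2)" .
  show ?thesis
  proof (cases "t = 0")
    case False
    have "{- int t<..<int t} = {0..<int t} \<union> {- int t<..<0}" using False by auto
    hence "(\<Sum>d\<in>{- int t<..<int t}. (t - nat \<bar>d\<bar>) ^ 2) =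
      (\<Sum>d\<in>{0..<int t}. (t - nat \<bar>d\<bar>) ^ 2) + (\<Sum>d\<in>{- int t<..<0}. (t - nat \<bar>d\<bar>) ^ 2)"
      by (simp only:) (rule sum.union_disjoint, auto)
    also have "(\<Sum>d\<in>{0..<int t}. (t - nat \<bar>d\<bar>) ^ 2) = (\<Sum>s\<in>{1..t}. s ^ 2)"
      by (rule sum.reindex_bij_witness[of _ "\<lambda>s. int t - int s" "\<lambda>d. t - nat d"]) auto
    also have "(\<Sum>d\<in>{- int t<..<0}. (t - nat \<bar>d\<bar>) ^ 2) = (\<Sum>s\<in>{1..<t}. s ^ 2)"
      by (rule sum.reindex_bij_witness[of _ "\<lambda>s. int s - int t" "\<lambda>d. t - nat (- d)"]) auto
    finally have eq2: "card (quads t) = (\<Sum>s\<in>{1..t}. s ^ 2) + (\<Sum>s\<in>{1..<t}. s ^ 2)" unfolding eq .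
    have "3 * ((\<Sum>s\<in>{1..t}. s ^ 2) + (\<Sum>s\<in>{1..<t}. s ^ 2)) = 2 * t ^ 3 + t" for t :: nat
    proof (induction t)
      case (Suc t)
      show ?case
      proof (cases "t = 0")
        case False
        have "(\<Sum>s\<in>{1..<Suc t}. s ^ 2) = (\<Sum>s\<in>{1..<t}. s ^ 2) + t ^ 2" using False by simp
        thus ?thesis using Suc by (simp add: power2_eq_square power3_eq_cube algebra_simps)
      qed simp
    qed simp
    thus ?thesis unfolding eq2 .
  next
    case True
    hence "quads t = {}" by (auto simp: quads_def)
    thus ?thesis using True by simp
  qed
qed

section \<open>The discrete Fourier transform and the fourth moment\<close>

definition dft :: "nat \<Rightarrow> (int \<Rightarrow> complex) \<Rightarrow> int \<Rightarrow> complex" where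
  "dft p a k = (\<Sum>j\<in>{0..<int p}. a j * unity_root p (j * k))"

definition quad_corr :: "nat \<Rightarrow> (int \<Rightarrow> complex) \<Rightarrow> int \<Rightarrow> int \<Rightarrow> int \<Rightarrow> complex" where
  "quad_corr p f x y z = (\<Sum>k\<in>{0..<int p}. f (k + x) * f (k + y) * cnj (f (k + z)) * cnj (f k))"

lemma dft_mod [simp]: "dft p a (k mod int p) = dft p a k"
  unfolding dft_def by (intro sum.cong refl arg_cong2[of _ _ _ _ "(*)"] unity_root_cong cong_scalar_left) simp

lemma dft_inverse:
  assumes p: "p > 0" and per: "\<And>j. a (j mod int p) = a j"
  shows "of_nat p * a j = (\<Sum>k\<in>{0..<int p}. dft p a k * unity_root p (- (j * k)))"
proof -
  have "(\<Sum>k\<in>{0..<int p}. dft p a k * unity_root p (- (j * k))) =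
     (\<Sum>k\<in>{0..<int p}. \<Sum>i\<in>{0..<int p}. a i * unity_root p (k * (i - j)))"
    unfolding dft_def sum_distrib_right
    by (intro sum.cong refl) (simp add: mult.assoc unity_root_add[symmetric] algebra_simps)
  also have "\<dots> = (\<Sum>i\<in>{0..<int p}. a i * (\<Sum>k\<in>{0..<int p}. unity_root p (k * (i - j))))"
    by (subst sum.swap) (simp add: sum_distrib_left)
  also have "\<dots> = (\<Sum>i\<in>{0..<int p}. if i = j mod int p then of_nat p * a i else 0)"
  proof (rule sum.cong[OF refl])
    fix i assume i: "i \<in> {0..<int p}"
    have "int p dvd i - j \<longleftrightarrow> i = j mod int p" using i by (auto simp: mod_eq_dvd_iff[symmetric])
    thus "a i * (\<Sum>k\<in>{0..<int p}. unity_root p (k * (i - j))) = (if i = j mod int p then of_nat p * a i else 0)"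
      using p by (simp add: sum_unity_root_int)
  qed
  also have "\<dots> = of_nat p * a j" using p per by simp
  finally show ?thesis ..
qed

lemma sum_swap_innermost:
  "(\<Sum>l\<in>A. \<Sum>x\<in>B. \<Sum>y\<in>C. \<Sum>z\<in>D. F l x y z) = (\<Sum>x\<in>B. \<Sum>y\<in>C. \<Sum>z\<in>D. \<Sum>l\<in>A. F l x y z)"
proof -
  have "(\<Sum>l\<in>A. \<Sum>x\<in>B. \<Sum>y\<in>C. \<Sum>z\<in>D. F l x y z) = (\<Sum>x\<in>B. \<Sum>l\<in>A. \<Sum>y\<in>C. \<Sum>z\<in>D. F l x y z)"
    by (rule sum.swap)
  also have "\<dots> = (\<Sum>x\<in>B. \<Sum>y\<in>C. \<Sum>l\<in>A. \<Sum>z\<in>D. F l x y z)"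
    by (rule sum.cong[OF refl], rule sum.swap)
  also have "\<dots> = (\<Sum>x\<in>B. \<Sum>y\<in>C. \<Sum>z\<in>D. \<Sum>l\<in>A. F l x y z)"
    by (rule sum.cong[OF refl], rule sum.cong[OF refl], rule sum.swap)
  finally show ?thesis .
qed

text \<open>Each of the four entries is expanded by Fourier inversion, with the first three
  frequencies written relative to the fourth, l. Because i + j = k + h, the phases in l cancel, so
  the sum over l is a pure correlation of the transform and the indices remain only in the
  kernel.\<close>

lemma fourth_moment_formula:
  assumes p: "p > 0" and per: "\<And>j. a (j mod int p) = a j" and real: "\<And>j. cnj (a j) = a j"
  shows "of_nat p ^ 4 * (\<Sum>(i, j, k, h)\<in>quads t. a (int i + r) * a (int j + r) * a (int k + r) * a (int h + r)) =
    (\<Sum>x\<in>{0..<int p}. \<Sum>y\<in>{0..<int p}. \<Sum>z\<in>{0..<int p}.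
      quad_corr p (dft p a) x y z * unity_root p (- (r * (x + y - z))) * quad_kernel p t x y z)"
proof -
  let ?f = "dft p a" and ?e = "unity_root p"
  have inv: "of_nat p * a j = (\<Sum>x\<in>{0..<int p}. ?f (k + x) * ?e (- (j * (k + x))))" for j k
  proof -
    have "?e (- (j * (x mod int p))) = ?e (- (j * x))" for x
      by (rule unity_root_cong) (simp add: cong_minus_minus_iff cong_scalar_left)
    hence "(\<Sum>x\<in>{0..<int p}. ?f (x + k) * ?e (- (j * (x + k)))) = (\<Sum>x\<in>{0..<int p}. ?f x * ?e (- (j * x)))"
      using p by (intro sum_residues_shift) auto
    thus ?thesis using dft_inverse[of p a j] p per by (simp add: add.commute)
  qed
  have invc: "of_nat p * a j = (\<Sum>x\<in>{0..<int p}. cnj (?f (k + x)) * ?e (j * (k + x)))" for j k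
    using arg_cong[OF inv[of j k], of cnj] by (simp add: real cnj_unity_root)
  have main: "of_nat p ^ 4 * (a i * a j * a k * a h) = (\<Sum>x\<in>{0..<int p}. \<Sum>y\<in>{0..<int p}. \<Sum>z\<in>{0..<int p}.
      quad_corr p ?f x y z * ?e (- (x * i + y * j - z * k)))" if ij: "i + j = k + h" for i j k h
  proof -
    have "of_nat p ^ 4 * (a i * a j * a k * a h) = (of_nat p * a i) * (of_nat p * a j) * (of_nat p * a k) * (of_nat p * a h)"
      by (simp add: power4_eq_xxxx mult_ac)
    also have "\<dots> = (\<Sum>l\<in>{0..<int p}. (of_nat p * a i) * (of_nat p * a j) * (of_nat p * a k) * (cnj (?f l) * ?e (h * l)))"
      unfolding sum_distrib_left[symmetric] using invc[of h 0] by simp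
    also have "\<dots> = (\<Sum>l\<in>{0..<int p}. \<Sum>x\<in>{0..<int p}. \<Sum>y\<in>{0..<int p}. \<Sum>z\<in>{0..<int p}.
        (?f (l + x) * ?e (- (i * (l + x)))) * (?f (l + y) * ?e (- (j * (l + y)))) *
        (cnj (?f (l + z)) * ?e (k * (l + z))) * (cnj (?f l) * ?e (h * l)))"
      unfolding sum_triple_product
      by (intro sum.cong refl) (simp only: inv[symmetric] invc[symmetric])
    also have "\<dots> = (\<Sum>l\<in>{0..<int p}. \<Sum>x\<in>{0..<int p}. \<Sum>y\<in>{0..<int p}. \<Sum>z\<in>{0..<int p}.
        (?f (l + x) * ?f (l + y) * cnj (?f (l + z)) * cnj (?f l)) * ?e (- (x * i + y * j - z * k)))"
    proof (intro sum.cong refl)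
      fix l x y z
      have h: "h = i + j - k" using ij by simp
      have "?e (- (x * i + y * j - z * k)) = ?e (- (i * (l + x))) * ?e (- (j * (l + y))) * ?e (k * (l + z)) * ?e (h * l)"
        unfolding unity_root_add[symmetric] h by (simp add: algebra_simps)
      thus "(?f (l + x) * ?e (- (i * (l + x)))) * (?f (l + y) * ?e (- (j * (l + y)))) *
        (cnj (?f (l + z)) * ?e (k * (l + z))) * (cnj (?f l) * ?e (h * l)) =
        (?f (l + x) * ?f (l + y) * cnj (?f (l + z)) * cnj (?f l)) * ?e (- (x * i + y * j - z * k))"
        by (simp only: mult_ac)
    qed
    also have "\<dots> = (\<Sum>x\<in>{0..<int p}. \<Sum>y\<in>{0..<int p}. \<Sum>z\<in>{0..<int p}. \<Sum>l\<in>{0..<int p}.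
        (?f (l + x) * ?f (l + y) * cnj (?f (l + z)) * cnj (?f l)) * ?e (- (x * i + y * j - z * k)))"
      by (rule sum_swap_innermost)
    finally show ?thesis by (simp add: quad_corr_def sum_distrib_right)
  qed
  have "of_nat p ^ 4 * (\<Sum>(i, j, k, h)\<in>quads t. a (int i + r) * a (int j + r) * a (int k + r) * a (int h + r)) =
    (\<Sum>q\<in>quads t. case q of (i, j, k, h) \<Rightarrow> \<Sum>x\<in>{0..<int p}. \<Sum>y\<in>{0..<int p}. \<Sum>z\<in>{0..<int p}.
      quad_corr p ?f x y z * ?e (- (r * (x + y - z))) * ?e (- (x * int i + y * int j - z * int k)))"
    unfolding sum_distrib_left
  proof (rule sum.cong[OF refl])
    fix q assume q: "q \<in> quads t"
    obtain i j k h where ijkh: "q = (i, j, k, h)" by (metis prod_cases4)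
    have ij: "(int i + r) + (int j + r) = (int k + r) + (int h + r)" using q by (simp add: quads_def ijkh)
    have e: "?e (- (x * (int i + r) + y * (int j + r) - z * (int k + r))) =
       ?e (- (r * (x + y - z))) * ?e (- (x * int i + y * int j - z * int k))" for x y z
      unfolding unity_root_add[symmetric] by (simp add: algebra_simps)
    show "of_nat p ^ 4 * (case q of (i, j, k, h) \<Rightarrow> a (int i + r) * a (int j + r) * a (int k + r) * a (int h + r)) =
      (case q of (i, j, k, h) \<Rightarrow> \<Sum>x\<in>{0..<int p}. \<Sum>y\<in>{0..<int p}. \<Sum>z\<in>{0..<int p}.
        quad_corr p ?f x y z * ?e (- (r * (x + y - z))) * ?e (- (x * int i + y * int j - z * int k)))"
      unfolding ijkh prod.case main[OF ij] e by (simp only: mult.assoc)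
  qed
  also have "\<dots> = (\<Sum>x\<in>{0..<int p}. \<Sum>y\<in>{0..<int p}. \<Sum>z\<in>{0..<int p}. \<Sum>q\<in>quads t. case q of (i, j, k, h) \<Rightarrow>
      quad_corr p ?f x y z * ?e (- (r * (x + y - z))) * ?e (- (x * int i + y * int j - z * int k)))"
    unfolding case_prod_beta by (rule sum_swap_innermost)
  finally show ?thesis
    by (simp add: quad_kernel_def sum_distrib_left case_prod_beta)
qed

text \<open>Divided by t^2 this is \<open>window (t / p)\<close> summed over the points m - c / p,
  see \<open>window_sum_eq\<close>: the finite version of the series in 1/phi.\<close>

definition window_sum :: "nat \<Rightarrow> nat \<Rightarrow> int \<Rightarrow> nat" where
  "window_sum p t c = (\<Sum>d\<in>{- int t<..<int t}. if int p dvd d + c then (t - nat \<bar>d\<bar>) ^ 2 else 0)"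

text \<open>Summing the phases over x leaves the quadruples with i congruent to k modulo p, and
  those with difference d have multiplicity (t - |d|)^2.\<close>

lemma sum_kernel_13:
  assumes "p > 0"
  shows "(\<Sum>x\<in>{0..<int p}. quad_kernel p t x 0 x) = of_nat p * of_nat (window_sum p t 0)"
proof -
  have "(\<Sum>x\<in>{0..<int p}. quad_kernel p t x 0 x) = (\<Sum>(i, j, k, h)\<in>quads t. \<Sum>x\<in>{0..<int p}. unity_root p (x * - (int i - int k)))"
    unfolding quad_kernel_def case_prod_beta by (subst sum.swap) (simp add: algebra_simps)
  also have "\<dots> = (\<Sum>(i, j, k, h)\<in>quads t. if int p dvd int i - int k then of_nat p else 0)"
    unfolding sum_unity_root_int[OF assms] dvd_minus_iff ..
  also have "\<dots> = of_nat p * of_nat (window_sum p t 0)"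
    unfolding sum_quads_diff_13[of "\<lambda>d. if int p dvd d then of_nat p else 0"] window_sum_def of_nat_sum sum_distrib_left
    by (intro sum.cong refl) simp
  finally show ?thesis .
qed

lemma sum_kernel_23:
  assumes "p > 0"
  shows "(\<Sum>x\<in>{0..<int p}. quad_kernel p t 0 x x) = of_nat p * of_nat (window_sum p t 0)"
proof -
  have "(\<Sum>x\<in>{0..<int p}. quad_kernel p t 0 x x) = (\<Sum>(i, j, k, h)\<in>quads t. \<Sum>x\<in>{0..<int p}. unity_root p (x * - (int j - int k)))"
    unfolding quad_kernel_def case_prod_beta by (subst sum.swap) (simp add: algebra_simps)
  also have "\<dots> = (\<Sum>(i, j, k, h)\<in>quads t. if int p dvd int j - int k then of_nat p else 0)"
    unfolding sum_unity_root_int[OF assms] dvd_minus_iff ..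
  also have "\<dots> = of_nat p * of_nat (window_sum p t 0)"
    unfolding sum_quads_diff_23[of "\<lambda>d. if int p dvd d then of_nat p else 0"] window_sum_def of_nat_sum sum_distrib_left
    by (intro sum.cong refl) simp
  finally show ?thesis .
qed

text \<open>Here the coincidence selects i + j + 2 r divisible by p, and reversal of the indices
  makes the offset t - 1 + 2 r. This is the only main contribution that depends on the shift
  r.\<close>

lemma sum_kernel_12:
  assumes "p > 0"
  shows "(\<Sum>x\<in>{0..<int p}. unity_root p (- (r * (x + x))) * quad_kernel p t x x 0) =
    of_nat p * of_nat (window_sum p t (int t - 1 + 2 * r))"
proof -
  have "(\<Sum>x\<in>{0..<int p}. unity_root p (- (r * (x + x))) * quad_kernel p t x x 0) =
      (\<Sum>(i, j, k, h)\<in>quads t. \<Sum>x\<in>{0..<int p}. unity_root p (x * - (int i + int j + 2 * r)))"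
    unfolding quad_kernel_def case_prod_beta sum_distrib_left
    by (subst sum.swap) (simp add: unity_root_add[symmetric] algebra_simps)
  also have "\<dots> = (\<Sum>(i, j, k, h)\<in>quads t. if int p dvd int i + int j + 2 * r then of_nat p else 0)"
    unfolding sum_unity_root_int[OF assms] dvd_minus_iff ..
  also have "\<dots> = of_nat p * of_nat (window_sum p t (int t - 1 + 2 * r))"
    unfolding sum_quads_sum_12[of "\<lambda>d. if int p dvd d + 2 * r then of_nat p else 0"] window_sum_def of_nat_sum sum_distrib_left
    by (intro sum.cong refl) (simp add: algebra_simps)
  finally show ?thesis .
qed

lemma quad_kernel_0: "quad_kernel p t 0 0 0 = of_nat (card (quads t))"
  by (simp add: quad_kernel_def case_prod_beta)

lemma sum_dft_mult:
  assumes "p > 0" "\<And>j. b (j mod int p) = b j"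
  shows "(\<Sum>k\<in>{0..<int p}. dft p a k * dft p b k) = of_nat p * (\<Sum>j\<in>{0..<int p}. a j * b (- j))"
proof -
  have "(\<Sum>k\<in>{0..<int p}. dft p a k * dft p b k) = (\<Sum>j\<in>{0..<int p}. a j * (\<Sum>k\<in>{0..<int p}. dft p b k * unity_root p (- ((- j) * k))))"
    unfolding dft_def[of p a] sum_distrib_right sum_distrib_left by (subst sum.swap) (simp add: mult_ac)
  also have "\<dots> = (\<Sum>j\<in>{0..<int p}. a j * (of_nat p * b (- j)))"
    using dft_inverse[of p b] assms by simp
  finally show ?thesis by (simp add: sum_distrib_left mult_ac)
qed

lemma sum_dft_cnj:
  assumes "p > 0" "\<And>j. a (j mod int p) = a j"
  shows "(\<Sum>k\<in>{0..<int p}. dft p a k * cnj (dft p a k)) = of_nat p * (\<Sum>j\<in>{0..<int p}. cnj (a j) * a j)"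
proof -
  have "cnj (dft p a k) = (\<Sum>j\<in>{0..<int p}. cnj (a j) * unity_root p (- (j * k)))" for k
    by (simp add: dft_def cnj_unity_root)
  hence "(\<Sum>k\<in>{0..<int p}. dft p a k * cnj (dft p a k)) = (\<Sum>j\<in>{0..<int p}. cnj (a j) * (\<Sum>k\<in>{0..<int p}. dft p a k * unity_root p (- (j * k))))"
    unfolding sum_distrib_left by (subst sum.swap) (simp add: sum_distrib_left mult_ac)
  also have "\<dots> = (\<Sum>j\<in>{0..<int p}. cnj (a j) * (of_nat p * a j))"
    using dft_inverse[of p a] assms by simp
  finally show ?thesis by (simp add: sum_distrib_left mult_ac)
qed

section \<open>Correlations of the transform\<close>

locale sextic_triple = sextic_residues +
  fixes S :: "nat set"
  assumes S_subset: "S \<subseteq> {..<6}" and card_S: "card S = 3"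
begin

definition sgn_class :: "nat \<Rightarrow> complex" where
  "sgn_class s = (if s \<in> S then 1 else -1)"

definition seq :: "int \<Rightarrow> complex" where
  "seq j = (if \<not> int p dvd j \<and> cls j \<in> S then 1 else -1)"

text \<open>Six times the mean correlation of the sign pattern with its rotation by the class of -1.
  By \<open>sum_V_square\<close>, \<open>\<kappa>\<close> / 6 is the mean of V^2 divided by p, up to
  a lower-order term, so its square weights the coincidence x = y, z = 0.\<close>

definition \<kappa> :: real where
  "\<kappa> = (\<Sum>s<6. Re (sgn_class s * sgn_class ((s + cls (-1)) mod 6)))"

abbreviation fh :: "int \<Rightarrow> complex" where "fh \<equiv> dft p seq"

abbreviation V :: "nat \<Rightarrow> complex" where "V \<equiv> fourier_value S"

lemma finite_S: "finite S" using S_subset finite_subset by blast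

lemma seq_mod [simp]: "seq (j mod int p) = seq j"
  by (simp add: seq_def dvd_mod_iff)

lemma cnj_seq [simp]: "cnj (seq j) = seq j" by (simp add: seq_def)

lemma seq_square: "seq j * seq j = 1" by (simp add: seq_def)

lemma seq_0: "seq 0 = -1" by (simp add: seq_def)

lemma seq_unit: "\<not> int p dvd j \<Longrightarrow> seq j = sgn_class (cls j)"
  by (simp add: seq_def sgn_class_def)

lemma sum_residues_split:
  "(\<Sum>x\<in>{0..<int p}. f x) = f 0 + (\<Sum>x\<in>{1..<int p}. f x :: complex)"
proof -
  have "{0..<int p} = insert 0 {1..<int p}" using p_pos by auto
  thus ?thesis by simp
qed

lemma sum_units_cls:
  assumes "\<And>x. \<not> int p dvd x \<Longrightarrow> f x = h (cls x)"
  shows "(\<Sum>x\<in>{0..<int p}. f x) = f 0 + of_nat g * (\<Sum>s<6. h s :: complex)"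
proof -
  have "(\<Sum>x\<in>{1..<int p}. f x) = (\<Sum>x\<in>{1..<int p}. h (cls x))"
    by (intro sum.cong refl assms small_not_dvd) auto
  thus ?thesis by (simp add: sum_residues_split sum_over_units)
qed

lemma sum_sgn_class: "(\<Sum>s<6. sgn_class s) = 0"
proof -
  have "{..<6} \<inter> S = S" "{..<6} \<inter> - S = {..<6} - S" using S_subset by auto
  moreover have "card ({..<6} - S) = 3" using S_subset card_S finite_S by (subst card_Diff_subset) auto
  ultimately show ?thesis using card_S by (simp add: sgn_class_def sum.If_cases)
qed

lemma fh_0: "int p dvd k \<Longrightarrow> fh k = -1"
proof -
  assume k: "int p dvd k"
  have "fh k = fh (k mod int p)" by simp
  also have "\<dots> = (\<Sum>j\<in>{0..<int p}. seq j)" using k by (simp add: dft_def)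
  also have "\<dots> = -1" using sum_units_cls[of seq sgn_class] by (simp add: seq_unit sum_sgn_class seq_0)
  finally show ?thesis .
qed

lemma fh_unit: "\<not> int p dvd k \<Longrightarrow> fh k = V (cls k)"
  using fourier_coeff_unit[OF _ S_subset, of k]
  by (simp add: fourier_coeff_def dft_def seq_def)

lemma g_pos: "g > 0" using p_eq p_ge_7 by (auto intro!: Nat.gr0I)

lemma g_nz: "(of_nat g :: complex) \<noteq> 0" using g_pos by simp

lemma p_eq_complex: "of_nat p = 6 * of_nat g + (1::complex)" unfolding p_eq by simp

text \<open>This average and the next two are exact. They come from Fourier inversion at 0, from
  Parseval, and from the correlation of \<open>seq\<close> with its reflection, each divided among
  six classes of equal size g.\<close>

lemma sum_V: "(\<Sum>s<6. V s) = -6"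
proof -
  have "of_nat p * seq 0 = (\<Sum>k\<in>{0..<int p}. fh k)"
    using dft_inverse[of p seq 0] p_pos by simp
  also have "\<dots> = -1 + of_nat g * (\<Sum>s<6. V s)"
    using sum_units_cls[of fh V] by (simp add: fh_unit fh_0)
  finally have "of_nat g * (\<Sum>s<6. V s) = of_nat g * (-6)"
    by (simp add: seq_0 p_eq_complex algebra_simps)
  thus ?thesis using g_nz by (auto simp only: mult_cancel_left)
qed

lemma sum_V_cnj: "(\<Sum>s<6. V s * cnj (V s)) = 6 * (of_nat p + 1)"
proof -
  have "of_nat p * of_nat p = (\<Sum>k\<in>{0..<int p}. fh k * cnj (fh k))"
    by (subst sum_dft_cnj) (simp_all add: p_pos seq_square)
  also have "\<dots> = 1 + of_nat g * (\<Sum>s<6. V s * cnj (V s))"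
    using sum_units_cls[of "\<lambda>k. fh k * cnj (fh k)" "\<lambda>s. V s * cnj (V s)"] by (simp add: fh_unit fh_0)
  finally have "of_nat g * (\<Sum>s<6. V s * cnj (V s)) = of_nat p * of_nat p - 1" by simp
  also have "\<dots> = of_nat g * (6 * (of_nat p + 1))" by (simp add: p_eq_complex algebra_simps)
  finally show ?thesis using g_pos by simp
qed

lemma sum_V_square: "(\<Sum>s<6. V s * V s) = 6 + of_nat p * of_real \<kappa>"
proof -
  have k: "of_real \<kappa> = (\<Sum>s<6. sgn_class s * sgn_class ((s + cls (-1)) mod 6))"
    unfolding \<kappa>_def of_real_sum by (intro sum.cong refl) (simp add: sgn_class_def)
  have "(\<Sum>j\<in>{0..<int p}. seq j * seq (- j)) = seq 0 * seq (- 0) +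
      of_nat g * (\<Sum>s<6. sgn_class s * sgn_class ((s + cls (-1)) mod 6))"
  proof (rule sum_units_cls)
    fix j assume j: "\<not> int p dvd j"
    have "cls (- j) = (cls j + cls (-1)) mod 6"
      using cls_mult[of j "-1"] j p_ge_7 by simp
    thus "seq j * seq (- j) = sgn_class (cls j) * sgn_class ((cls j + cls (-1)) mod 6)"
      using j by (simp add: seq_unit)
  qed
  hence "(\<Sum>j\<in>{0..<int p}. seq j * seq (- j)) = 1 + of_nat g * of_real \<kappa>"
    unfolding k by (simp add: seq_0)
  hence "of_nat p * (1 + of_nat g * of_real \<kappa>) = (\<Sum>k\<in>{0..<int p}. fh k * fh k)"
    by (subst sum_dft_mult) (simp_all add: p_pos)
  also have "\<dots> = 1 + of_nat g * (\<Sum>s<6. V s * V s)"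
    using sum_units_cls[of "\<lambda>k. fh k * fh k" "\<lambda>s. V s * V s"] by (simp add: fh_unit fh_0)
  finally have "of_nat g * (\<Sum>s<6. V s * V s) = of_nat p * (1 + of_nat g * of_real \<kappa>) - 1" by simp
  also have "\<dots> = of_nat g * (6 + of_nat p * of_real \<kappa>)" by (simp add: p_eq_complex algebra_simps)
  finally show ?thesis using g_pos by simp
qed

lemma kappa_le: "\<bar>\<kappa>\<bar> \<le> 6"
proof -
  have "\<bar>\<kappa>\<bar> \<le> (\<Sum>s<(6::nat). 1)" unfolding \<kappa>_def
    by (rule order_trans[OF sum_abs], rule sum_mono) (simp add: sgn_class_def)
  thus ?thesis by simp
qed

text \<open>One |V|^2 is at most the sum 6 (p + 1) <= 9 p of all six. A crude bound of the right
  order suffices in the error terms and does not involve y.\<close>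

definition \<beta> :: real where "\<beta> = 3 * sqrt (real p)"

lemma beta_ge_1: "1 \<le> \<beta>"
proof -
  have "1 \<le> sqrt (real p)" using p_pos by simp
  thus ?thesis unfolding \<beta>_def by linarith
qed

lemma V_le: "s < 6 \<Longrightarrow> cmod (V s) \<le> \<beta>"
proof -
  assume s: "s < 6"
  have "complex_of_real (\<Sum>s<6. (cmod (V s))\<^sup>2) = complex_of_real (6 * (real p + 1))"
    unfolding of_real_sum complex_norm_square using sum_V_cnj by simp
  hence "(\<Sum>s<6. (cmod (V s))\<^sup>2) = 6 * (real p + 1)" by (simp only: of_real_eq_iff)
  moreover have "(cmod (V s))\<^sup>2 \<le> (\<Sum>s<6. (cmod (V s))\<^sup>2)"
    using s by (intro member_le_sum) auto
  moreover have "\<beta>\<^sup>2 = 9 * real p" by (simp add: \<beta>_def power_mult_distrib)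
  ultimately have "(cmod (V s))\<^sup>2 \<le> \<beta>\<^sup>2" using p_ge_7 by simp
  thus ?thesis by (rule power2_le_imp_le) (rule order_trans[OF zero_le_one beta_ge_1])
qed

lemma fh_le: "cmod (fh k) \<le> \<beta>"
  using fh_0[of k] fh_unit[of k] V_le[OF cls_less] beta_ge_1 by (cases "int p dvd k") auto

text \<open>Rewrites a product of four transform values as a product over the distinct shifts, as
  \<open>equidistribution\<close> requires: factors whose shifts coincide are collected in one
  function of one class.\<close>

definition weight :: "int \<Rightarrow> int \<Rightarrow> int \<Rightarrow> int \<Rightarrow> nat \<Rightarrow> complex" where
  "weight x y z d s = (if d = x then V s else 1) * (if d = y then V s else 1) *
    (if d = z then cnj (V s) else 1) * (if d = 0 then cnj (V s) else 1)"

definition weight_bound :: "int \<Rightarrow> int \<Rightarrow> int \<Rightarrow> int \<Rightarrow> real" where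
  "weight_bound x y z d = (if d = x then \<beta> else 1) * (if d = y then \<beta> else 1) *
    (if d = z then \<beta> else 1) * (if d = 0 then \<beta> else 1)"

lemma weight_le: "s < 6 \<Longrightarrow> cmod (weight x y z d s) \<le> weight_bound x y z d"
proof -
  assume "s < 6"
  hence h: "cmod (if P then V s else 1) \<le> (if P then \<beta> else 1)"
    "cmod (if P then cnj (V s) else 1) \<le> (if P then \<beta> else 1)" "0 \<le> (if P then \<beta> else 1)" for P
    using V_le[of s] beta_ge_1 by auto
  show ?thesis unfolding weight_def weight_bound_def norm_mult
    by (intro mult_mono mult_nonneg_nonneg norm_ge_zero h)
qed

lemma prod_weight_bound: "(\<Prod>d\<in>{x, y, z, 0}. weight_bound x y z d) = \<beta> ^ 4"
  unfolding weight_bound_def prod.distrib by (simp add: prod.delta power4_eq_xxxx del: prod.insert)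

lemma quad_corr_good:
  "(\<Sum>k\<in>good {x, y, z, 0}. fh (k + x) * fh (k + y) * cnj (fh (k + z)) * cnj (fh k)) =
   (\<Sum>k\<in>good {x, y, z, 0}. \<Prod>d\<in>{x, y, z, 0}. weight x y z d (cls (k + d)))"
proof (rule sum.cong[OF refl])
  fix k assume k: "k \<in> good {x, y, z, 0}"
  hence u: "\<not> int p dvd k + x" "\<not> int p dvd k + y" "\<not> int p dvd k + z" "\<not> int p dvd k" by (auto simp: good_def)
  show "fh (k + x) * fh (k + y) * cnj (fh (k + z)) * cnj (fh k) = (\<Prod>d\<in>{x, y, z, 0}. weight x y z d (cls (k + d)))"
    unfolding weight_def prod.distrib using u by (simp add: prod.delta fh_unit del: prod.insert)
qed

text \<open>Equidistribution on the good residues, plus at most four residues k for which some k + d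
  vanishes, each costing at most \<open>\<beta> ^ 4\<close>.\<close>

lemma quad_corr_approx:
  assumes "x \<in> {0..<int p}" "y \<in> {0..<int p}" "z \<in> {0..<int p}"
  shows "cmod (quad_corr p fh x y z - of_nat p * (\<Prod>d\<in>{x, y, z, 0}. (\<Sum>s<6. weight x y z d s) / 6))
    \<le> 4 * 10 ^ 8 * sqrt (real p) * \<beta> ^ 4 + 4 * \<beta> ^ 4"
proof -
  let ?I = "{x, y, z, 0}" and ?F = "\<lambda>k. fh (k + x) * fh (k + y) * cnj (fh (k + z)) * cnj (fh k)"
  let ?P = "of_nat p * (\<Prod>d\<in>{x, y, z, 0}. (\<Sum>s<6. weight x y z d s) / 6)"
  have I: "?I \<subseteq> {0..<int p}" "card ?I \<le> 4" using assms p_pos by (auto simp: card_insert_if)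
  have "quad_corr p fh x y z = (\<Sum>k\<in>good ?I. ?F k) + (\<Sum>k\<in>{0..<int p} - good ?I. ?F k)"
    unfolding quad_corr_def using good_subset by (subst add.commute) (rule sum.subset_diff, auto)
  hence eq: "quad_corr p fh x y z - ?P = ((\<Sum>k\<in>good ?I. \<Prod>d\<in>?I. weight x y z d (cls (k + d))) - ?P) + (\<Sum>k\<in>{0..<int p} - good ?I. ?F k)"
    using quad_corr_good[of x y z] by (simp only: add_diff_eq diff_add_eq)
  have "cmod (((\<Sum>k\<in>good ?I. \<Prod>d\<in>?I. weight x y z d (cls (k + d))) - ?P) + (\<Sum>k\<in>{0..<int p} - good ?I. ?F k))
     \<le> 4 * 10 ^ 8 * sqrt (real p) * \<beta> ^ 4 + 4 * \<beta> ^ 4"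
  proof (rule norm_triangle_mono)
    show "cmod ((\<Sum>k\<in>good ?I. \<Prod>d\<in>?I. weight x y z d (cls (k + d))) - ?P) \<le> 4 * 10 ^ 8 * sqrt (real p) * \<beta> ^ 4"
    proof -
      have "cmod ((\<Sum>k\<in>good ?I. \<Prod>d\<in>?I. weight x y z d (cls (k + d))) - ?P) \<le>
        4 * 10 ^ 8 * sqrt (real p) * (\<Prod>d\<in>?I. weight_bound x y z d)"
        by (rule equidistribution[OF I weight_le])
      thus ?thesis by (simp only: prod_weight_bound)
    qed
    have each: "cmod (fh (k + x) * fh (k + y) * cnj (fh (k + z)) * cnj (fh k)) \<le> \<beta> * \<beta> * \<beta> * \<beta>" for k
      unfolding norm_mult complex_mod_cnj
      by (intro mult_mono fh_le mult_nonneg_nonneg norm_ge_zero order_trans[OF zero_le_one beta_ge_1])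
    have "cmod (\<Sum>k\<in>{0..<int p} - good ?I. ?F k) \<le> real (card ({0..<int p} - good ?I)) * (\<beta> * \<beta> * \<beta> * \<beta>)"
      by (rule sum_norm_bound) (rule each)
    moreover have "real (card ({0..<int p} - good ?I)) * (\<beta> * \<beta> * \<beta> * \<beta>) \<le> 4 * (\<beta> * \<beta> * \<beta> * \<beta>)"
    proof (rule mult_right_mono)
      have "card ({0..<int p} - good ?I) \<le> 4" using card_bad[of ?I] I(2) by simp
      thus "real (card ({0..<int p} - good ?I)) \<le> 4" by simp
      show "0 \<le> \<beta> * \<beta> * \<beta> * \<beta>" using beta_ge_1 by simp
    qed
    ultimately show "cmod (\<Sum>k\<in>{0..<int p} - good ?I. ?F k) \<le> 4 * \<beta> ^ 4"
      unfolding power4_eq_xxxx by (rule order_trans)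
  qed
  thus ?thesis by (subst eq)
qed

text \<open>One summand for each way of pairing the four frequencies. At the origin all three
  pairings coincide; the last summand corrects their total to 1, the normalized fourth moment of a
  flat spectrum.\<close>

definition main_coeff :: "int \<Rightarrow> int \<Rightarrow> int \<Rightarrow> real" where
  "main_coeff x y z = (if x = z \<and> y = 0 then 1 else 0) + (if y = z \<and> x = 0 then 1 else 0)
     + (if x = y \<and> z = 0 then (\<kappa> / 6)\<^sup>2 else 0) - (if x = 0 \<and> y = 0 \<and> z = 0 then 1 + (\<kappa> / 6)\<^sup>2 else 0)"

text \<open>If the coincidences form two pairs, the average is a product of two second moments.
  Otherwise, away from the origin, some shift carries a single factor; its average has modulus 1
  instead of order sqrt p, and p \<open>\<beta> ^ 3\<close> bounds the whole term.\<close>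

lemma weight_average:
  assumes nz: "\<not> (x = 0 \<and> y = 0 \<and> z = 0)"
  shows "cmod (of_nat p * (\<Prod>d\<in>{x, y, z, 0}. (\<Sum>s<6. weight x y z d s) / 6) - of_real (real p ^ 3 * main_coeff x y z))
    \<le> 3 * (real p)\<^sup>2 + real p * \<beta> ^ 3"
proof -
  have p1: "real p * 1 \<le> real p * real p" using p_pos by (intro mult_left_mono) auto
  have b3: "0 \<le> real p * \<beta> ^ 3" using beta_ge_1 by simp
  have sq: "cmod (of_nat p * ((of_nat p + 1) * (of_nat p + 1)) - of_real (real p ^ 3)) \<le> 3 * (real p)\<^sup>2"
  proof -
    have "of_nat p * ((of_nat p + 1) * (of_nat p + 1)) - of_real (real p ^ 3) = complex_of_real (2 * (real p)\<^sup>2 + real p)"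
      by (simp add: power2_eq_square power3_eq_cube algebra_simps)
    thus ?thesis using p1 by (simp only: norm_of_real) (simp add: power2_eq_square)
  qed
  have avg: "(\<Sum>s<6. V s * cnj (V s)) / 6 = of_nat p + 1" "(\<Sum>s<6. cnj (V s) * V s) / 6 = of_nat p + 1"
    using sum_V_cnj by (simp_all add: mult.commute)
  consider (a) "x = z" "y = 0" "x \<noteq> 0" | (b) "y = z" "x = 0" "y \<noteq> 0" | (c) "x = y" "z = 0" "x \<noteq> 0"
    | (d) "\<not> (x = z \<and> y = 0)" "\<not> (y = z \<and> x = 0)" "\<not> (x = y \<and> z = 0)"
    using nz by blast
  thus ?thesis
  proof cases
    case a
    hence "(\<Prod>d\<in>{x, y, z, 0}. (\<Sum>s<6. weight x y z d s) / 6) = (of_nat p + 1) * (of_nat p + 1)"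
      by (simp add: weight_def avg insert_absorb)
    moreover have "main_coeff x y z = 1" using a by (auto simp: main_coeff_def)
    ultimately show ?thesis using sq b3 by simp
  next
    case b
    hence "(\<Prod>d\<in>{x, y, z, 0}. (\<Sum>s<6. weight x y z d s) / 6) = (of_nat p + 1) * (of_nat p + 1)"
      by (simp add: weight_def avg insert_absorb insert_commute)
    moreover have "main_coeff x y z = 1" using b by (auto simp: main_coeff_def)
    ultimately show ?thesis using sq b3 by simp
  next
    case c
    define A where "A = 1 + real p * (\<kappa> / 6)"
    have V2: "(\<Sum>s<6. V s * V s) / 6 = of_real A"
      unfolding sum_V_square by (simp add: A_def)
    have "(\<Sum>s<6. cnj (V s) * cnj (V s)) = cnj (\<Sum>s<6. V s * V s)" by simp
    hence V2': "(\<Sum>s<6. cnj (V s) * cnj (V s)) / 6 = of_real A"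
      using arg_cong[OF V2, of cnj] by simp
    have "(\<Prod>d\<in>{x, y, z, 0}. (\<Sum>s<6. weight x y z d s) / 6) = of_real A * of_real A"
      using c by (simp add: weight_def V2 V2')
    moreover have "main_coeff x y z = (\<kappa> / 6)\<^sup>2" using c by (auto simp: main_coeff_def)
    moreover have "cmod (of_nat p * (of_real A * of_real A) - of_real (real p ^ 3 * (\<kappa> / 6)\<^sup>2)) \<le> 3 * (real p)\<^sup>2"
    proof -
      have "of_nat p * (of_real A * of_real A) - of_real (real p ^ 3 * (\<kappa> / 6)\<^sup>2) = complex_of_real (real p + (real p)\<^sup>2 * (\<kappa> / 3))"
        by (simp add: A_def power2_eq_square power3_eq_cube algebra_simps)
      hence "cmod (of_nat p * (of_real A * of_real A) - of_real (real p ^ 3 * (\<kappa> / 6)\<^sup>2)) = \<bar>real p + (real p)\<^sup>2 * (\<kappa> / 3)\<bar>"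
        by (simp only: norm_of_real)
      also have "\<dots> \<le> real p + (real p)\<^sup>2 * 2"
      proof -
        have "(real p)\<^sup>2 * \<bar>\<kappa> / 3\<bar> \<le> (real p)\<^sup>2 * 2" using kappa_le by (intro mult_left_mono) auto
        hence "\<bar>(real p)\<^sup>2 * (\<kappa> / 3)\<bar> \<le> (real p)\<^sup>2 * 2" by (simp only: abs_mult abs_power2)
        thus ?thesis by linarith
      qed
      also have "\<dots> \<le> 3 * (real p)\<^sup>2" using p1 by (simp add: power2_eq_square)
      finally show ?thesis .
    qed
    ultimately show ?thesis using b3 by simp
  next
    case d
    let ?I = "{x, y, z, 0}"
    have "\<exists>d0\<in>?I. (d0 = x \<and> d0 \<noteq> y \<and> d0 \<noteq> z \<and> d0 \<noteq> 0) \<or> (d0 \<noteq> x \<and> d0 = y \<and> d0 \<noteq> z \<and> d0 \<noteq> 0) \<or>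
      (d0 \<noteq> x \<and> d0 \<noteq> y \<and> d0 = z \<and> d0 \<noteq> 0) \<or> (d0 \<noteq> x \<and> d0 \<noteq> y \<and> d0 \<noteq> z \<and> d0 = 0)"
      using d by (cases "x = y"; cases "x = z"; cases "y = z"; cases "x = 0"; cases "y = 0"; cases "z = 0") auto
    then obtain d0 where d0: "d0 \<in> ?I" "(d0 = x \<and> d0 \<noteq> y \<and> d0 \<noteq> z \<and> d0 \<noteq> 0) \<or> (d0 \<noteq> x \<and> d0 = y \<and> d0 \<noteq> z \<and> d0 \<noteq> 0) \<or>
      (d0 \<noteq> x \<and> d0 \<noteq> y \<and> d0 = z \<and> d0 \<noteq> 0) \<or> (d0 \<noteq> x \<and> d0 \<noteq> y \<and> d0 \<noteq> z \<and> d0 = 0)" by blast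
    have cV: "(\<Sum>s<6. cnj (V s)) = -6" using arg_cong[OF sum_V, of cnj] by simp
    have w0: "cmod ((\<Sum>s<6. weight x y z d0 s) / 6) = 1"
      using d0(2) sum_V cV by (elim disjE conjE) (simp_all add: weight_def)
    have wb0: "weight_bound x y z d0 = \<beta>"
      using d0(2) by (elim disjE conjE) (simp_all add: weight_bound_def)
    have wle: "cmod ((\<Sum>s<6. weight x y z d s) / 6) \<le> weight_bound x y z d" for d
    proof -
      have "cmod (\<Sum>s<6. weight x y z d s) \<le> (\<Sum>s<(6::nat). weight_bound x y z d)"
        by (intro sum_norm_le weight_le) simp
      thus ?thesis by (simp add: norm_divide)
    qed
    have "cmod (\<Prod>d\<in>?I. (\<Sum>s<6. weight x y z d s) / 6) =
        cmod ((\<Sum>s<6. weight x y z d0 s) / 6) * cmod (\<Prod>d\<in>?I - {d0}. (\<Sum>s<6. weight x y z d s) / 6)"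
      unfolding norm_mult[symmetric] using d0(1) by (subst prod.remove[of ?I d0]) auto
    also have "\<dots> \<le> (\<Prod>d\<in>?I - {d0}. weight_bound x y z d)"
      unfolding w0 prod_norm[symmetric] mult_1_left by (intro prod_mono conjI norm_ge_zero wle)
    also have "\<dots> = \<beta> ^ 3"
    proof -
      have "\<beta> ^ 4 = \<beta> * (\<Prod>d\<in>?I - {d0}. weight_bound x y z d)"
      proof -
        have "(\<Prod>d\<in>?I. weight_bound x y z d) = weight_bound x y z d0 * (\<Prod>d\<in>?I - {d0}. weight_bound x y z d)"
          using d0(1) by (intro prod.remove) auto
        thus ?thesis by (simp only: prod_weight_bound wb0)
      qed
      moreover have "\<beta> ^ 4 = \<beta> * \<beta> ^ 3" by (simp add: eval_nat_numeral)
      ultimately show ?thesis using beta_ge_1 by simp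
    qed
    finally have "cmod (of_nat p * (\<Prod>d\<in>?I. (\<Sum>s<6. weight x y z d s) / 6)) \<le> real p * \<beta> ^ 3"
      unfolding norm_mult norm_of_nat by (intro mult_left_mono) auto
    moreover have "main_coeff x y z = 0" using d nz by (auto simp: main_coeff_def)
    ultimately show ?thesis by (simp add: add_increasing)
  qed
qed

lemma quad_corr_main:
  assumes "x \<in> {0..<int p}" "y \<in> {0..<int p}" "z \<in> {0..<int p}" "\<not> (x = 0 \<and> y = 0 \<and> z = 0)"
  shows "cmod (quad_corr p fh x y z - of_real (real p ^ 3 * main_coeff x y z)) \<le> 10 ^ 11 * (real p)\<^sup>2 * sqrt (real p)"
proof -
  let ?P = "of_nat p * (\<Prod>d\<in>{x, y, z, 0}. (\<Sum>s<6. weight x y z d s) / 6)"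
  let ?q = "sqrt (real p)"
  have q: "1 \<le> ?q" "?q * ?q = real p" using p_pos by simp_all
  have b4: "\<beta> ^ 4 = 81 * (real p)\<^sup>2"
  proof -
    have "\<beta> ^ 4 = 81 * ((?q * ?q) * (?q * ?q))" by (simp only: \<beta>_def power4_eq_xxxx)
    thus ?thesis unfolding q(2) by (simp add: power2_eq_square)
  qed
  have b3: "real p * \<beta> ^ 3 = 27 * (real p)\<^sup>2 * ?q"
  proof -
    have "real p * \<beta> ^ 3 = 27 * real p * (?q * ?q) * ?q" by (simp only: \<beta>_def power3_eq_cube)
    thus ?thesis unfolding q(2) by (simp add: power2_eq_square)
  qed
  have pq: "(real p)\<^sup>2 \<le> (real p)\<^sup>2 * ?q" using q(1) by (simp add: mult_le_cancel_left1)
  have "cmod (quad_corr p fh x y z - of_real (real p ^ 3 * main_coeff x y z)) \<le>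
     cmod (quad_corr p fh x y z - ?P) + cmod (?P - of_real (real p ^ 3 * main_coeff x y z))"
    using norm_triangle_ineq[of "quad_corr p fh x y z - ?P" "?P - of_real (real p ^ 3 * main_coeff x y z)"] by simp
  also have "\<dots> \<le> (4 * 10 ^ 8 * ?q * \<beta> ^ 4 + 4 * \<beta> ^ 4) + (3 * (real p)\<^sup>2 + real p * \<beta> ^ 3)"
    using assms by (intro add_mono quad_corr_approx weight_average)
  also have "\<dots> = 32400000027 * ((real p)\<^sup>2 * ?q) + 327 * (real p)\<^sup>2" unfolding b3 b4 by (simp add: algebra_simps)
  also have "\<dots> \<le> 10 ^ 11 * (real p)\<^sup>2 * ?q"
  proof -
    have "32400000027 * X + 327 * Y \<le> 100000000000 * X" if "Y \<le> X" "0 \<le> X" for X Y :: real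
      using that by linarith
    from this[OF pq] show ?thesis by (simp add: mult.assoc)
  qed
  finally show ?thesis .
qed

text \<open>The second moments do not determine this value, the fourth moment of |V|. It is compared
  with p^2 for each class by factoring a^4 - b^4, at the cost of one factor eta measuring the
  failure of flatness.\<close>

lemma quad_corr_0:
  assumes \<eta>: "\<And>s. s < 6 \<Longrightarrow> \<bar>cmod (V s) - sqrt (real p)\<bar> \<le> \<eta>"
  shows "cmod (quad_corr p fh 0 0 0 - of_real (real p ^ 3)) \<le> 40 * (real p)\<^sup>2 * sqrt (real p) * \<eta> + 2 * (real p)\<^sup>2"
proof -
  let ?q = "sqrt (real p)"
  have q: "1 \<le> ?q" "?q * ?q = real p" using p_pos by simp_all
  have "quad_corr p fh 0 0 0 = (\<Sum>k\<in>{0..<int p}. of_real ((cmod (fh k)) ^ 4))"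
    unfolding quad_corr_def
  proof (rule sum.cong[OF refl])
    fix k
    have "fh (k + 0) * fh (k + 0) * cnj (fh (k + 0)) * cnj (fh k) = (fh k * cnj (fh k)) * (fh k * cnj (fh k))"
      by (simp add: mult_ac)
    also have "\<dots> = of_real ((cmod (fh k))\<^sup>2 * (cmod (fh k))\<^sup>2)"
      unfolding complex_norm_square[symmetric] by simp
    finally show "fh (k + 0) * fh (k + 0) * cnj (fh (k + 0)) * cnj (fh k) = of_real ((cmod (fh k)) ^ 4)"
      by (simp only: power_add[symmetric]) simp
  qed
  also have "\<dots> = 1 + of_nat g * (\<Sum>s<6. of_real ((cmod (V s)) ^ 4))"
    using sum_units_cls[of "\<lambda>k. of_real ((cmod (fh k)) ^ 4)" "\<lambda>s. of_real ((cmod (V s)) ^ 4)"]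
    by (simp add: fh_unit fh_0)
  finally have eq: "quad_corr p fh 0 0 0 - of_real (real p ^ 3) =
      of_real (1 - (real p)\<^sup>2 + real g * (\<Sum>s<6. (cmod (V s)) ^ 4 - (real p)\<^sup>2))"
    by (simp add: sum_subtractf p_eq_complex power2_eq_square power3_eq_cube algebra_simps)
  have each: "\<bar>(cmod (V s)) ^ 4 - (real p)\<^sup>2\<bar> \<le> 40 * real p * ?q * \<eta>" if s: "s < 6" for s
  proof -
    let ?v = "cmod (V s)"
    have v: "?v \<le> 3 * ?q" using V_le[OF s] by (simp add: \<beta>_def)
    have v2: "?v * ?v \<le> 9 * real p"
      using mult_mono[OF v v] q(2) by simp
    define a b where "a = ?v" and "b = ?q"
    have "a ^ 4 - (b * b)\<^sup>2 = (a - b) * ((a + b) * (a * a + b * b))"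
      by (simp add: power4_eq_xxxx power2_eq_square algebra_simps)
    hence "?v ^ 4 - (real p)\<^sup>2 = (?v - ?q) * ((?v + ?q) * (?v * ?v + real p))"
      unfolding a_def b_def q(2) .
    hence "\<bar>?v ^ 4 - (real p)\<^sup>2\<bar> = \<bar>?v - ?q\<bar> * ((?v + ?q) * (?v * ?v + real p))"
      by (simp add: abs_mult)
    also have "\<dots> \<le> \<eta> * ((4 * ?q) * (10 * real p))"
    proof (intro mult_mono \<eta> s)
      show "0 \<le> \<eta>" using \<eta>[OF s] by simp
    qed (use v v2 q in auto)
    finally show ?thesis by (simp add: mult_ac)
  qed
  have "\<bar>\<Sum>s<6. (cmod (V s)) ^ 4 - (real p)\<^sup>2\<bar> \<le> (\<Sum>s<(6::nat). 40 * real p * ?q * \<eta>)"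
    by (rule order_trans[OF sum_abs], rule sum_mono) (use each in simp)
  hence "real g * \<bar>\<Sum>s<6. (cmod (V s)) ^ 4 - (real p)\<^sup>2\<bar> \<le> real g * (240 * (real p * ?q * \<eta>))"
    by (intro mult_left_mono) simp_all
  also have "\<dots> = (6 * real g) * (40 * (real p * ?q * \<eta>))" by simp
  also have "\<dots> \<le> real p * (40 * (real p * ?q * \<eta>))"
  proof (rule mult_right_mono)
    have "0 \<le> \<eta>" using \<eta>[of 0] by simp
    thus "0 \<le> 40 * (real p * ?q * \<eta>)" by simp
  qed (simp add: p_eq)
  finally have 1: "\<bar>real g * (\<Sum>s<6. (cmod (V s)) ^ 4 - (real p)\<^sup>2)\<bar> \<le> 40 * (real p)\<^sup>2 * ?q * \<eta>"
    by (simp add: abs_mult power2_eq_square mult_ac)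
  have p1: "1 \<le> (real p)\<^sup>2" using p_pos by simp
  have "cmod (quad_corr p fh 0 0 0 - of_real (real p ^ 3)) = \<bar>1 - (real p)\<^sup>2 + real g * (\<Sum>s<6. (cmod (V s)) ^ 4 - (real p)\<^sup>2)\<bar>"
    unfolding eq by (simp only: norm_of_real)
  also have "\<dots> \<le> \<bar>1 - (real p)\<^sup>2\<bar> + \<bar>real g * (\<Sum>s<6. (cmod (V s)) ^ 4 - (real p)\<^sup>2)\<bar>"
    by (rule abs_triangle_ineq)
  also have "\<bar>1 - (real p)\<^sup>2\<bar> \<le> 2 * (real p)\<^sup>2" using p1 by simp
  finally show ?thesis using 1 by simp
qed

end

section \<open>Main term and error of the fourth moment\<close>

lemma triple_delta_13:
  assumes "finite A" "(0::int) \<in> A"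
  shows "(\<Sum>x\<in>A. \<Sum>y\<in>A. \<Sum>z\<in>A. if x = z \<and> y = 0 then F x y z else 0) = (\<Sum>x\<in>A. F x 0 x)"
proof (rule sum.cong[OF refl])
  fix x assume "x \<in> A"
  hence "(\<Sum>z\<in>A. if x = z \<and> y = 0 then F x y z else 0) = (if y = 0 then F x y x else 0)" for y
    using assms by (cases "y = 0") simp_all
  thus "(\<Sum>y\<in>A. \<Sum>z\<in>A. if x = z \<and> y = 0 then F x y z else 0) = F x 0 x" using assms by simp
qed

lemma triple_delta_23:
  assumes "finite A" "(0::int) \<in> A"
  shows "(\<Sum>x\<in>A. \<Sum>y\<in>A. \<Sum>z\<in>A. if y = z \<and> x = 0 then F x y z else 0) = (\<Sum>y\<in>A. F 0 y y)"
proof -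
  have "(\<Sum>y\<in>A. \<Sum>z\<in>A. if y = z \<and> x = 0 then F x y z else 0) = (if x = 0 then \<Sum>y\<in>A. F x y y else 0)" for x
    using assms by (cases "x = 0") simp_all
  thus ?thesis using assms by simp
qed

lemma triple_delta_12:
  assumes "finite A" "(0::int) \<in> A"
  shows "(\<Sum>x\<in>A. \<Sum>y\<in>A. \<Sum>z\<in>A. if x = y \<and> z = 0 then F x y z else 0) = (\<Sum>x\<in>A. F x x 0)"
proof (rule sum.cong[OF refl])
  fix x assume "x \<in> A"
  have "(\<Sum>z\<in>A. if x = y \<and> z = 0 then F x y z else 0) = (if x = y then F x y 0 else 0)" for y
    using assms by (cases "x = y") simp_all
  thus "(\<Sum>y\<in>A. \<Sum>z\<in>A. if x = y \<and> z = 0 then F x y z else 0) = F x x 0" using assms \<open>x \<in> A\<close> by simp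
qed

lemma triple_delta_0:
  assumes "finite A" "(0::int) \<in> A"
  shows "(\<Sum>x\<in>A. \<Sum>y\<in>A. \<Sum>z\<in>A. if x = 0 \<and> y = 0 \<and> z = 0 then F x y z else 0) = F 0 0 0"
proof -
  have "(\<Sum>z\<in>A. if x = 0 \<and> y = 0 \<and> z = 0 then F x y z else 0) = (if y = 0 then if x = 0 then F x 0 0 else 0 else 0)" for x y
    using assms by (cases "x = 0 \<and> y = 0") auto
  thus ?thesis using assms by simp
qed

context sextic_triple
begin

definition moment_main :: "nat \<Rightarrow> int \<Rightarrow> real" where
  "moment_main t r = 2 * real (window_sum p t 0) + (\<kappa> / 6)\<^sup>2 * real (window_sum p t (int t - 1 + 2 * r))
     - (1 + (\<kappa> / 6)\<^sup>2) * real (card (quads t)) / real p"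

lemma main_kernel_sum:
  "(\<Sum>x\<in>{0..<int p}. \<Sum>y\<in>{0..<int p}. \<Sum>z\<in>{0..<int p}.
      of_real (real p ^ 3 * main_coeff x y z) * unity_root p (- (r * (x + y - z))) * quad_kernel p t x y z) =
   of_real (real p ^ 4 * moment_main t r)"
proof -
  let ?A = "{0..<int p}" and ?F = "\<lambda>x y z. unity_root p (- (r * (x + y - z))) * quad_kernel p t x y z"
  let ?n = "complex_of_real ((\<kappa> / 6)\<^sup>2)"
  have A: "finite ?A" "0 \<in> ?A" using p_pos by auto
  have "of_real (real p ^ 3 * main_coeff x y z) * unity_root p (- (r * (x + y - z))) * quad_kernel p t x y z =
    of_nat p ^ 3 * ((if x = z \<and> y = 0 then ?F x y z else 0) + (if y = z \<and> x = 0 then ?F x y z else 0)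
     + ?n * (if x = y \<and> z = 0 then ?F x y z else 0) - (1 + ?n) * (if x = 0 \<and> y = 0 \<and> z = 0 then ?F x y z else 0))" for x y z
    by (simp add: main_coeff_def algebra_simps)
  hence "(\<Sum>x\<in>?A. \<Sum>y\<in>?A. \<Sum>z\<in>?A. of_real (real p ^ 3 * main_coeff x y z) * unity_root p (- (r * (x + y - z))) * quad_kernel p t x y z) =
    of_nat p ^ 3 * ((\<Sum>x\<in>?A. ?F x 0 x) + (\<Sum>y\<in>?A. ?F 0 y y) + ?n * (\<Sum>x\<in>?A. ?F x x 0) - (1 + ?n) * ?F 0 0 0)"
    by (simp only: sum_distrib_left[symmetric] sum.distrib sum_subtractf
      triple_delta_13[OF A] triple_delta_23[OF A] triple_delta_12[OF A] triple_delta_0[OF A])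
  also have "(\<Sum>x\<in>?A. ?F x 0 x) = of_nat p * of_nat (window_sum p t 0)"
    using sum_kernel_13[OF p_pos] by simp
  also have "(\<Sum>y\<in>?A. ?F 0 y y) = of_nat p * of_nat (window_sum p t 0)"
    using sum_kernel_23[OF p_pos] by simp
  also have "(\<Sum>x\<in>?A. ?F x x 0) = of_nat p * of_nat (window_sum p t (int t - 1 + 2 * r))"
    using sum_kernel_12[OF p_pos, of r t] by simp
  also have "?F 0 0 0 = of_nat (card (quads t))" by (simp add: quad_kernel_0)
  also have "of_nat p ^ 3 * (of_nat p * of_nat (window_sum p t 0) + of_nat p * of_nat (window_sum p t 0) +
      ?n * (of_nat p * of_nat (window_sum p t (int t - 1 + 2 * r))) - (1 + ?n) * of_nat (card (quads t))) =
      of_real (real p ^ 4 * moment_main t r)"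
  proof -
    have "real p ^ 3 * (real p * a + real p * a + n * (real p * b) - (1 + n) * c) =
        real p ^ 4 * (2 * a + n * b - (1 + n) * c / real p)" for a b c n
      using p_pos by (simp add: eval_nat_numeral field_simps)
    hence "complex_of_real (real p ^ 3 * (real p * a + real p * a + n * (real p * b) - (1 + n) * c)) =
        complex_of_real (real p ^ 4 * (2 * a + n * b - (1 + n) * c / real p))" for a b c n by (simp only:)
    from this[of "real (window_sum p t 0)" "(\<kappa> / 6)\<^sup>2" "real (window_sum p t (int t - 1 + 2 * r))" "real (card (quads t))"]
    show ?thesis by (simp only: moment_main_def of_real_mult of_real_add of_real_diff of_real_power of_real_of_nat_eq of_real_1)
  qed
  finally show ?thesis .
qed

text \<open>The uniform error is paired with the total kernel mass. The larger error at the origin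
  meets only the single kernel value there, the number of additive quadruples.\<close>

lemma fourth_moment_estimate:
  assumes \<eta>: "\<And>s. s < 6 \<Longrightarrow> \<bar>cmod (V s) - sqrt (real p)\<bar> \<le> \<eta>"
  shows "cmod ((\<Sum>(i, j, k, h)\<in>quads t. seq (int i + r) * seq (int j + r) * seq (int k + r) * seq (int h + r))
      - of_real (moment_main t r)) \<le>
    (10 ^ 11 * (real p)\<^sup>2 * sqrt (real p) * (dirichlet_mass p t ^ 4 / real p) +
     (40 * (real p)\<^sup>2 * sqrt (real p) * \<eta> + 2 * (real p)\<^sup>2) * real (card (quads t))) / real p ^ 4"
proof -
  let ?A = "{0..<int p}" and ?e = "\<lambda>x y z. unity_root p (- (r * (x + y - z)))" and ?K = "quad_kernel p t"
  define C where "C = 10 ^ 11 * (real p)\<^sup>2 * sqrt (real p)"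
  define D where "D = 40 * (real p)\<^sup>2 * sqrt (real p) * \<eta> + 2 * (real p)\<^sup>2"
  define Q where "Q = (\<Sum>(i, j, k, h)\<in>quads t. seq (int i + r) * seq (int j + r) * seq (int k + r) * seq (int h + r))"
  define E where "E x y z = quad_corr p fh x y z - of_real (real p ^ 3 * main_coeff x y z)" for x y z
  have A: "finite ?A" "0 \<in> ?A" using p_pos by auto
  have C0: "0 \<le> C" by (simp add: C_def)
  have "0 \<le> \<eta>" by (rule order_trans[OF abs_ge_zero \<eta>[of 0]]) simp
  hence D0: "0 \<le> D" by (simp add: D_def)
  have E: "cmod (E x y z) \<le> C + (if x = 0 \<and> y = 0 \<and> z = 0 then D else 0)" if "x \<in> ?A" "y \<in> ?A" "z \<in> ?A" for x y z
  proof (cases "x = 0 \<and> y = 0 \<and> z = 0")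
    case True
    have "main_coeff 0 0 0 = 1" by (simp add: main_coeff_def)
    thus ?thesis using True quad_corr_0[OF \<eta>] C0 by (simp add: E_def D_def)
  next
    case False
    have "cmod (E x y z) \<le> C" unfolding E_def C_def by (rule quad_corr_main[OF that False])
    thus ?thesis by (simp only: if_not_P[OF False] add_0_right)
  qed
  have "of_nat p ^ 4 * Q - of_real (real p ^ 4 * moment_main t r) =
      (\<Sum>x\<in>?A. \<Sum>y\<in>?A. \<Sum>z\<in>?A. E x y z * ?e x y z * ?K x y z)"
    unfolding Q_def fourth_moment_formula[of p seq, OF p_pos seq_mod cnj_seq] main_kernel_sum[symmetric]
      sum_subtractf[symmetric] E_def by (simp only: left_diff_distrib)
  hence "cmod (of_nat p ^ 4 * Q - of_real (real p ^ 4 * moment_main t r)) \<le>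
      (\<Sum>x\<in>?A. \<Sum>y\<in>?A. \<Sum>z\<in>?A. cmod (E x y z) * cmod (?K x y z))"
    by (simp only:) (intro sum_norm_le order.trans[OF norm_sum] sum_mono, simp add: norm_mult)
  also have "\<dots> \<le> (\<Sum>x\<in>?A. \<Sum>y\<in>?A. \<Sum>z\<in>?A. C * cmod (?K x y z) + (if x = 0 \<and> y = 0 \<and> z = 0 then D * cmod (?K x y z) else 0))"
  proof (intro sum_mono)
    fix x y z assume "x \<in> ?A" "y \<in> ?A" "z \<in> ?A"
    hence *: "cmod (E x y z) * cmod (?K x y z) \<le> (C + (if x = 0 \<and> y = 0 \<and> z = 0 then D else 0)) * cmod (?K x y z)"
      by (intro mult_right_mono E) auto
    show "cmod (E x y z) * cmod (?K x y z) \<le> C * cmod (?K x y z) + (if x = 0 \<and> y = 0 \<and> z = 0 then D * cmod (?K x y z) else 0)"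
    proof (cases "x = 0 \<and> y = 0 \<and> z = 0")
      case True
      show ?thesis using * unfolding if_P[OF True] distrib_right .
    next
      case False
      show ?thesis using * unfolding if_not_P[OF False] by simp
    qed
  qed
  also have "\<dots> = C * (\<Sum>x\<in>?A. \<Sum>y\<in>?A. \<Sum>z\<in>?A. cmod (?K x y z)) + D * cmod (?K 0 0 0)"
    by (simp only: sum.distrib triple_delta_0[OF A] sum_distrib_left)
  also have "\<dots> \<le> C * (dirichlet_mass p t ^ 4 / real p) + D * real (card (quads t))"
    using C0 D0 p_ge_7 by (intro add_mono mult_left_mono sum_norm_quad_kernel) (simp_all add: quad_kernel_0)
  finally have "cmod (of_nat p ^ 4 * Q - of_real (real p ^ 4 * moment_main t r)) \<le>
      C * (dirichlet_mass p t ^ 4 / real p) + D * real (card (quads t))" .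
  moreover have "of_nat p ^ 4 * Q - of_real (real p ^ 4 * moment_main t r) = of_real (real p ^ 4) * (Q - of_real (moment_main t r))"
    by (simp add: right_diff_distrib)
  ultimately have "real p ^ 4 * cmod (Q - of_real (moment_main t r)) \<le> C * (dirichlet_mass p t ^ 4 / real p) + D * real (card (quads t))"
    by (simp only: norm_mult norm_of_real) simp
  thus ?thesis using p_pos unfolding Q_def[symmetric] C_def[symmetric] D_def[symmetric]
    by (simp add: pos_le_divide_eq mult.commute)
qed

end

section \<open>Norms of polynomials on the unit circle\<close>

lemma has_integral_cis:
  "((\<lambda>\<theta>. cis (real_of_int k * \<theta>)) has_integral (if k = 0 then 2 * of_real pi else 0)) {0..2 * pi}"
proof (cases "k = 0")
  case True
  show ?thesis using True has_integral_const_real[of "1::complex" 0 "2 * pi"]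
    by (simp add: scaleR_conv_of_real)
next
  case False
  let ?F = "\<lambda>\<theta>. cis (real_of_int k * \<theta>) / (\<i> * of_int k)"
  have "((\<lambda>\<theta>. cis (real_of_int k * \<theta>)) has_integral (?F (2 * pi) - ?F 0)) {0..2 * pi}"
  proof (rule fundamental_theorem_of_calculus)
    fix x :: real
    have "((\<lambda>\<theta>. exp (\<i> * of_int k * of_real \<theta>) / (\<i> * of_int k)) has_vector_derivative
        (\<i> * of_int k * exp (\<i> * of_int k * of_real x)) / (\<i> * of_int k)) (at x within {0..2 * pi})"
      by (auto intro!: derivative_eq_intros has_vector_derivative_real_field simp: scaleR_conv_of_real)
    thus "(?F has_vector_derivative cis (real_of_int k * x)) (at x within {0..2 * pi})"
      using False by (simp add: cis_conv_exp mult_ac)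
  qed simp
  moreover have "cis (real_of_int k * (2 * pi)) = 1"
    using cis_multiple_2pi[of "real_of_int k"] by (simp add: mult_ac)
  ultimately show ?thesis using False by simp
qed

lemma parseval_poly:
  "(1 / (2 * pi)) * integral {0..2 * pi} (\<lambda>\<theta>. (cmod (poly (\<Sum>n<N. monom (c n) n) (cis \<theta>)))\<^sup>2) = (\<Sum>n<N. (cmod (c n))\<^sup>2)"
proof -
  let ?f = "\<Sum>n<N. monom (c n) n"
  have p: "complex_of_real ((cmod (poly ?f (cis \<theta>)))\<^sup>2) =
      (\<Sum>n<N. \<Sum>m<N. c n * cnj (c m) * cis (real_of_int (int n - int m) * \<theta>))" for \<theta>
  proof -
    have "poly ?f (cis \<theta>) = (\<Sum>n<N. c n * cis (real n * \<theta>))"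
      by (simp add: poly_sum poly_monom Complex.DeMoivre)
    hence "complex_of_real ((cmod (poly ?f (cis \<theta>)))\<^sup>2) = (\<Sum>n<N. c n * cis (real n * \<theta>)) * (\<Sum>m<N. cnj (c m) * cis (- (real m * \<theta>)))"
      unfolding complex_norm_square by (simp add: cis_cnj)
    also have "\<dots> = (\<Sum>n<N. \<Sum>m<N. c n * cnj (c m) * (cis (real n * \<theta>) * cis (- (real m * \<theta>))))"
      by (simp add: sum_product mult_ac)
    finally show ?thesis by (simp add: cis_mult algebra_simps)
  qed
  have "((\<lambda>\<theta>. complex_of_real ((cmod (poly ?f (cis \<theta>)))\<^sup>2)) has_integral
      (\<Sum>n<N. \<Sum>m<N. c n * cnj (c m) * (if int n - int m = 0 then 2 * of_real pi else 0))) {0..2 * pi}"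
    unfolding p by (intro has_integral_sum finite_lessThan has_integral_mult_right has_integral_cis)
  also have "(\<Sum>n<N. \<Sum>m<N. c n * cnj (c m) * (if int n - int m = 0 then 2 * of_real pi else 0)) =
      of_real (2 * pi * (\<Sum>n<N. (cmod (c n))\<^sup>2))"
  proof -
    have "(\<Sum>m<N. c n * cnj (c m) * (if int n - int m = 0 then 2 * of_real pi else 0)) = of_real (2 * pi * (cmod (c n))\<^sup>2)"
      if "n < N" for n
    proof -
      have "(\<Sum>m<N. c n * cnj (c m) * (if int n - int m = 0 then 2 * of_real pi else 0)) =
        (\<Sum>m<N. if m = n then c n * cnj (c n) * (2 * of_real pi) else 0)"
        by (intro sum.cong refl) auto
      thus ?thesis using that by (simp add: complex_norm_square[symmetric] del: of_real_power)
    qed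
    thus ?thesis by (simp add: sum_distrib_left of_real_sum del: of_real_mult of_real_power)
  qed
  finally have "((\<lambda>\<theta>. Re (complex_of_real ((cmod (poly ?f (cis \<theta>)))\<^sup>2))) has_integral
      Re (of_real (2 * pi * (\<Sum>n<N. (cmod (c n))\<^sup>2)))) {0..2 * pi}"
    by (rule has_integral_Re)
  hence "integral {0..2 * pi} (\<lambda>\<theta>. (cmod (poly ?f (cis \<theta>)))\<^sup>2) = 2 * pi * (\<Sum>n<N. (cmod (c n))\<^sup>2)"
    by (simp only: Re_complex_of_real) (rule integral_unique)
  thus ?thesis by simp
qed

lemma L_norm_2:
  "L_norm 2 (\<Sum>n<N. monom (c n) n) ^ 4 = (\<Sum>n<N. (cmod (c n))\<^sup>2)\<^sup>2"
proof -
  have e: "cmod z powr 2 = (cmod z)\<^sup>2" for z by (cases "z = 0") simp_all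
  let ?A = "\<Sum>n<N. (cmod (c n))\<^sup>2"
  have A: "0 \<le> ?A" by (intro sum_nonneg) auto
  have "L_norm 2 (\<Sum>n<N. monom (c n) n) = sqrt ?A"
    unfolding L_norm_def e parseval_poly using A by (simp add: powr_half_sqrt)
  moreover have "sqrt ?A ^ 4 = (sqrt ?A * sqrt ?A)\<^sup>2" by (simp only: power4_eq_xxxx power2_eq_square mult.assoc)
  ultimately show ?thesis using A by simp
qed

lemma square_sum_monom:
  fixes b :: "nat \<Rightarrow> complex"
  shows "(\<Sum>j<t. monom (b j) j)\<^sup>2 = (\<Sum>n<2 * t. monom (\<Sum>i<t. \<Sum>j<t. if i + j = n then b i * b j else 0) n)"
proof -
  have ms: "(\<Sum>i\<in>I. monom (f i) n) = monom (\<Sum>i\<in>I. f i) n" for I :: "nat set" and f :: "nat \<Rightarrow> complex" and n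
    by (induction I rule: infinite_finite_induct) (simp_all add: add_monom)
  have "(\<Sum>j<t. monom (b j) j)\<^sup>2 = (\<Sum>i<t. \<Sum>j<t. monom (b i * b j) (i + j))"
    by (simp add: power2_eq_square sum_product mult_monom)
  also have "\<dots> = (\<Sum>i<t. \<Sum>j<t. \<Sum>n<2 * t. monom (if i + j = n then b i * b j else 0) n)"
  proof (intro sum.cong refl)
    fix i j assume ij: "i \<in> {..<t}" "j \<in> {..<t}"
    have "(\<Sum>n<2 * t. monom (if i + j = n then b i * b j else 0) n) = (\<Sum>n<2 * t. if n = i + j then monom (b i * b j) (i + j) else 0)"
      by (intro sum.cong refl) auto
    thus "monom (b i * b j) (i + j) = (\<Sum>n<2 * t. monom (if i + j = n then b i * b j else 0) n)" using ij by simp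
  qed
  also have "\<dots> = (\<Sum>n<2 * t. \<Sum>i<t. \<Sum>j<t. monom (if i + j = n then b i * b j else 0) n)"
    by (simp only: sum.swap[of _ "{..<t}" "{..<2 * t}"])
  finally show ?thesis by (simp only: ms)
qed

text \<open>The fourth power of the 4-norm of f is the squared 2-norm of f^2, so Parseval is applied
  to the convolution square of the coefficients. Real coefficients make the conjugates
  disappear.\<close>

lemma L_norm_4:
  assumes b: "\<And>j. cnj (b j) = b j"
  shows "complex_of_real (L_norm 4 (\<Sum>j<t. monom (b j) j) ^ 4) = (\<Sum>(i, j, k, h)\<in>quads t. b i * b j * b k * b h)"
proof -
  have e: "cmod (poly f z) powr 4 = (cmod (poly (f\<^sup>2) z))\<^sup>2" for f z
    by (cases "poly f z = 0") (simp_all add: poly_power norm_power flip: power_mult)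
  define c where "c n = (\<Sum>i<t. \<Sum>j<t. if i + j = n then b i * b j else 0)" for n
  let ?A = "\<Sum>n<2 * t. (cmod (c n))\<^sup>2"
  have A: "0 \<le> ?A" by (intro sum_nonneg) auto
  have "L_norm 4 (\<Sum>j<t. monom (b j) j) = ?A powr (1 / 4)"
    unfolding L_norm_def e square_sum_monom c_def[symmetric] parseval_poly ..
  moreover have "(?A powr (1 / 4)) ^ 4 = ?A"
  proof (cases "?A = 0")
    case False
    hence "?A > 0" using A by simp
    thus ?thesis by (simp add: powr_powr flip: powr_realpow)
  qed simp
  ultimately have "complex_of_real (L_norm 4 (\<Sum>j<t. monom (b j) j) ^ 4) = (\<Sum>n<2 * t. c n * cnj (c n))"
    by (simp add: complex_norm_square del: of_real_power)
  also have "\<dots> = (\<Sum>n<2 * t. \<Sum>i<t. \<Sum>j<t. \<Sum>k<t. \<Sum>h<t. if i + j = n \<and> k + h = n then b i * b j * b k * b h else 0)"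
  proof (rule sum.cong[OF refl])
    fix n
    have "cnj (c n) = c n" using b by (simp add: c_def if_distrib[of cnj] cong: if_cong)
    hence "c n * cnj (c n) = c n * c n" by simp
    also have "\<dots> = (\<Sum>i<t. \<Sum>j<t. \<Sum>k<t. \<Sum>h<t. (if i + j = n then b i * b j else 0) * (if k + h = n then b k * b h else 0))"
      unfolding c_def by (simp only: sum_distrib_left[symmetric] sum_distrib_right[symmetric])
    also have "\<dots> = (\<Sum>i<t. \<Sum>j<t. \<Sum>k<t. \<Sum>h<t. if i + j = n \<and> k + h = n then b i * b j * b k * b h else 0)"
      by (intro sum.cong refl) auto
    finally show "c n * cnj (c n) = \<dots>" .
  qed
  also have "\<dots> = (\<Sum>i<t. \<Sum>j<t. \<Sum>k<t. \<Sum>h<t. \<Sum>n<2 * t. if i + j = n \<and> k + h = n then b i * b j * b k * b h else 0)"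
    by (simp only: sum.swap[of _ "{..<t}" "{..<2 * t}"])
  also have "\<dots> = (\<Sum>i<t. \<Sum>j<t. \<Sum>k<t. \<Sum>h<t. if i + j = k + h then b i * b j * b k * b h else 0)"
  proof (intro sum.cong refl)
    fix i j k h assume ij: "i \<in> {..<t}" "j \<in> {..<t}"
    have "(\<Sum>n<2 * t. if i + j = n \<and> k + h = n then b i * b j * b k * b h else 0) =
      (\<Sum>n<2 * t. if n = i + j then (if i + j = k + h then b i * b j * b k * b h else 0) else 0)"
      by (intro sum.cong refl) auto
    thus "(\<Sum>n<2 * t. if i + j = n \<and> k + h = n then b i * b j * b k * b h else 0) =
      (if i + j = k + h then b i * b j * b k * b h else 0)" using ij by simp
  qed
  finally show ?thesis by (simp only: sum_quads)
qed

section \<open>The limit function and positivity of its denominator\<close>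

definition window :: "real \<Rightarrow> real \<Rightarrow> real" where
  "window T x = (max 0 (1 - \<bar>x\<bar> / T))\<^sup>2"

lemma window_0_outside: "T > 0 \<Longrightarrow> T \<le> \<bar>x\<bar> \<Longrightarrow> window T x = 0"
  by (simp add: window_def max_def field_simps)

lemma window_eq_pos_part: "T > 0 \<Longrightarrow> window T x = (max 0 (T - \<bar>x\<bar>))\<^sup>2 / T\<^sup>2"
  by (auto simp: window_def max_def field_simps power2_eq_square)

lemma window_nonneg [simp]: "0 \<le> window T x" by (simp add: window_def)

text \<open>Both series in 1/phi are values of this function: at 0 and at T + 2 R. It has period 1
  in its second argument.\<close>

definition window_total :: "real \<Rightarrow> real \<Rightarrow> real" where
  "window_total T \<gamma> = (\<Sum>\<^sub>\<infinity>m\<in>(UNIV :: int set). window T (real_of_int m - \<gamma>))"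

lemma window_total_finite:
  assumes "T > 0" "T + \<bar>\<gamma>\<bar> \<le> real B"
  shows "window_total T \<gamma> = (\<Sum>m\<in>{- int B..int B}. window T (real_of_int m - \<gamma>))"
proof -
  have "window_total T \<gamma> = (\<Sum>\<^sub>\<infinity>m\<in>{- int B..int B}. window T (real_of_int m - \<gamma>))"
    unfolding window_total_def
  proof (rule infsum_cong_neutral)
    fix m assume "m \<in> UNIV - {- int B..int B}"
    hence "\<bar>m\<bar> > int B" by auto
    hence "\<bar>real_of_int m\<bar> > real B" by linarith
    hence "T \<le> \<bar>real_of_int m - \<gamma>\<bar>" using assms by linarith
    thus "window T (real_of_int m - \<gamma>) = 0" using assms by (intro window_0_outside)
  qed auto
  thus ?thesis by simp
qed

text \<open>By symmetry \<open>window_total T 0\<close> is 1 plus twice the sum over positive m, so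
  2 \<open>window_total T 0\<close> - 1 accounts for both the constant 1 and the factor 4 in front
  of the first series.\<close>

lemma phi_nu_eq:
  assumes T: "T > 0"
  shows "phi_nu \<nu> R T = 1 / (2 * window_total T 0 + \<nu> * window_total T (T + 2 * R) - (1 + \<nu>) * (2 * T / 3) - 1)"
proof -
  obtain B :: nat where B: "T + \<bar>0\<bar> \<le> real B" using real_arch_simple by blast
  have "(\<Sum>\<^sub>\<infinity>m\<in>{1::nat..}. (max 0 (1 - real m / T))\<^sup>2) = (\<Sum>\<^sub>\<infinity>m\<in>{1..B}. (max 0 (1 - real m / T))\<^sup>2)"
  proof (rule infsum_cong_neutral)
    fix m assume "m \<in> {1..} - {1..B}"
    hence "T \<le> real m" using B by auto
    thus "(max 0 (1 - real m / T))\<^sup>2 = 0" using T by (simp add: max_def field_simps)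
  qed auto
  hence 1: "(\<Sum>\<^sub>\<infinity>m\<in>{1::nat..}. (max 0 (1 - real m / T))\<^sup>2) = (\<Sum>m\<in>{1..B}. window T (real m))"
    by (simp add: window_def)
  have "window_total T 0 = (\<Sum>m\<in>{- int B..int B}. window T (real_of_int m))"
    using window_total_finite[OF T B] by simp
  also have "{- int B..int B} = {0} \<union> ({1..int B} \<union> {- int B..-1})" by auto
  also have "(\<Sum>m\<in>\<dots>. window T (real_of_int m)) = window T 0 + ((\<Sum>m\<in>{1..int B}. window T (real_of_int m)) + (\<Sum>m\<in>{- int B..-1}. window T (real_of_int m)))"
    by (subst sum.union_disjoint, simp, simp, force, subst sum.union_disjoint) auto
  also have "(\<Sum>m\<in>{1..int B}. window T (real_of_int m)) = (\<Sum>m\<in>{1..B}. window T (real m))"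
    by (rule sum.reindex_bij_witness[of _ int nat]) auto
  also have "(\<Sum>m\<in>{- int B..-1}. window T (real_of_int m)) = (\<Sum>m\<in>{1..B}. window T (real m))"
    by (rule sum.reindex_bij_witness[of _ "\<lambda>m. - int m" "\<lambda>m. nat (- m)"]) (auto simp: window_def)
  also have "window T 0 = 1" by (simp add: window_def)
  finally have 2: "window_total T 0 = 1 + 2 * (\<Sum>m\<in>{1..B}. window T (real m))" by simp
  have "(\<Sum>\<^sub>\<infinity>m\<in>(UNIV :: int set). (max 0 (1 - \<bar>1 + (2 * R - real_of_int m) / T\<bar>))\<^sup>2) = window_total T (T + 2 * R)"
    unfolding window_total_def
  proof (rule infsum_cong)
    fix m :: int
    have "\<bar>real_of_int m - (T + 2 * R)\<bar> / T = \<bar>(real_of_int m - (T + 2 * R)) / T\<bar>" using T by simp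
    also have "(real_of_int m - (T + 2 * R)) / T = - (1 + (2 * R - real_of_int m) / T)" using T by (simp add: field_simps)
    finally have "\<bar>real_of_int m - (T + 2 * R)\<bar> / T = \<bar>1 + (2 * R - real_of_int m) / T\<bar>" by simp
    thus "(max 0 (1 - \<bar>1 + (2 * R - real_of_int m) / T\<bar>))\<^sup>2 = window T (real_of_int m - (T + 2 * R))"
      by (simp add: window_def)
  qed
  thus ?thesis unfolding phi_nu_def 1 2 by (simp add: algebra_simps)
qed

text \<open>The left side is the integral of the convex function max(0, x)^2 over [u, v], which the
  trapezoidal rule overestimates.\<close>

lemma trapezoid_pos_part:
  fixes u v :: real assumes "u \<le> v"
  shows "((max 0 v) ^ 3 - (max 0 u) ^ 3) / 3 \<le> (v - u) * ((max 0 u)\<^sup>2 + (max 0 v)\<^sup>2) / 2"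
proof -
  consider "0 \<le> u" | "u < 0" "0 \<le> v" | "v < 0" using assms by linarith
  thus ?thesis
  proof cases
    case 1
    have "(v - u) * (u\<^sup>2 + v\<^sup>2) / 2 - (v ^ 3 - u ^ 3) / 3 = (v - u) * (v - u)\<^sup>2 / 6"
      by (simp add: power2_eq_square power3_eq_cube field_simps)
    moreover have "0 \<le> (v - u) * (v - u)\<^sup>2 / 6" using assms by simp
    ultimately have "(v ^ 3 - u ^ 3) / 3 \<le> (v - u) * (u\<^sup>2 + v\<^sup>2) / 2" by linarith
    thus ?thesis using 1 assms by (simp add: max_def)
  next
    case 2
    have "v * v\<^sup>2 \<le> (v - u) * v\<^sup>2" using 2 by (intro mult_right_mono) auto
    moreover have "0 \<le> v * v\<^sup>2" using 2 by simp
    ultimately have "v ^ 3 / 3 \<le> (v - u) * v\<^sup>2 / 2" by (simp add: power2_eq_square power3_eq_cube)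
    thus ?thesis using 2 by (simp add: max_def)
  qed (use assms in \<open>simp add: max_def\<close>)
qed

lemma midpoint_pos_part:
  fixes u v :: real
  shows "2 * (max 0 ((u + v) / 2))\<^sup>2 \<le> (max 0 u)\<^sup>2 + (max 0 v)\<^sup>2"
proof -
  have "max 0 ((u + v) / 2) \<le> (max 0 u + max 0 v) / 2" by (auto simp: max_def)
  hence le: "(max 0 ((u + v) / 2))\<^sup>2 \<le> ((max 0 u + max 0 v) / 2)\<^sup>2" by (intro power_mono) auto
  have eq: "2 * ((a + b) / 2)\<^sup>2 = a\<^sup>2 + b\<^sup>2 - (a - b)\<^sup>2 / 2" for a b :: real
    by (simp add: power2_eq_square field_simps)
  have "x \<le> ((a + b) / 2)\<^sup>2 \<Longrightarrow> 2 * x \<le> a\<^sup>2 + b\<^sup>2" for x a b :: real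
    using eq[of a b] zero_le_power2[of "a - b"] by linarith
  from this[OF le] show ?thesis .
qed

text \<open>On \<open>[0, \<infinity>)\<close> the window is convex, so the trapezoidal rule with nodes \<open>0, 1/2, 1\<close>
  overestimates its integral \<open>T/3\<close>; by convexity again the two outer shifts can replace the midpoint.\<close>

lemma window_interval:
  fixes m s T :: real
  assumes T: "T > 0" and m: "0 \<le> m" and s: "0 \<le> s" "s \<le> 1"
  defines "I x \<equiv> (max 0 (T - x)) ^ 3 / (3 * T\<^sup>2)"
  shows "4 * (I m - I (m + 1)) \<le> window T m + window T (m + s) + window T (m + 1 - s) + window T (m + 1)"
proof -
  let ?f = "\<lambda>x. (max 0 (T - x))\<^sup>2"
  have w: "window T x = ?f x / T\<^sup>2" if "0 \<le> x" for x using window_eq_pos_part[OF T, of x] that by simp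
  have 1: "((max 0 (T - m)) ^ 3 - (max 0 (T - (m + 1/2))) ^ 3) / 3 \<le> (?f (m + 1/2) + ?f m) / 4"
    using trapezoid_pos_part[of "T - (m + 1/2)" "T - m"] by simp
  have 2: "((max 0 (T - (m + 1/2))) ^ 3 - (max 0 (T - (m + 1))) ^ 3) / 3 \<le> (?f (m + 1) + ?f (m + 1/2)) / 4"
    using trapezoid_pos_part[of "T - (m + 1)" "T - (m + 1/2)"] by simp
  have 3: "2 * ?f (m + 1/2) \<le> ?f (m + s) + ?f (m + 1 - s)"
  proof -
    have "((T - (m + s)) + (T - (m + 1 - s))) / 2 = T - (m + 1/2)" by (simp add: field_simps)
    from midpoint_pos_part[of "T - (m + s)" "T - (m + 1 - s)", unfolded this] show ?thesis .
  qed
  have "4 * (((max 0 (T - m)) ^ 3 - (max 0 (T - (m + 1))) ^ 3) / 3) \<le> ?f m + ?f (m + s) + ?f (m + 1 - s) + ?f (m + 1)"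
  proof -
    have "4 * ((a - c) / 3) \<le> f0 + fs + ft + f1"
      if 1: "(a - b) / 3 \<le> (fh + f0) / 4" and 2: "(b - c) / 3 \<le> (f1 + fh) / 4" and 3: "2 * fh \<le> fs + ft"
      for a b c f0 fh f1 fs ft :: real
    proof -
      have "4 * ((a - c) / 3) = 4 * ((a - b) / 3) + 4 * ((b - c) / 3)" by (simp add: field_simps)
      also have "\<dots> \<le> (fh + f0) + (f1 + fh)" 
      proof -
        have "4 * u \<le> v" if "u \<le> v / 4" for u v :: real using that by linarith
        thus ?thesis using 1 2 by (intro add_mono)
      qed
      finally show ?thesis using 3 by linarith
    qed
    from this[OF 1 2 3] show ?thesis .
  qed
  hence "4 * (((max 0 (T - m)) ^ 3 - (max 0 (T - (m + 1))) ^ 3) / 3) / T\<^sup>2 \<le> (?f m + ?f (m + s) + ?f (m + 1 - s) + ?f (m + 1)) / T\<^sup>2"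
    by (intro divide_right_mono) auto
  moreover have "4 * (I m - I (m + 1)) = 4 * (((max 0 (T - m)) ^ 3 - (max 0 (T - (m + 1))) ^ 3) / 3) / T\<^sup>2"
    unfolding I_def using T by (simp add: field_simps)
  moreover have "window T m + window T (m + s) + window T (m + 1 - s) + window T (m + 1) =
      (?f m + ?f (m + s) + ?f (m + 1 - s) + ?f (m + 1)) / T\<^sup>2"
    using m s by (simp add: w add_divide_distrib)
  ultimately show ?thesis by simp
qed

lemma window_total_periodic: "window_total T (\<gamma> + of_int k) = window_total T \<gamma>"
proof -
  have "window_total T (\<gamma> + of_int k) = (\<Sum>\<^sub>\<infinity>m\<in>range (\<lambda>m. m + k). window T (real_of_int m - (\<gamma> + of_int k)))"
    unfolding window_total_def by (simp add: surj_plus_right)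
  also have "\<dots> = window_total T \<gamma>"
    unfolding window_total_def by (subst infsum_reindex) (auto simp: inj_on_def o_def)
  finally show ?thesis .
qed

text \<open>The integers on either side of s lie at the distances m + s and m + 1 - s, so the total
  can be read on the half-line where the window is convex.\<close>

lemma window_total_split:
  assumes T: "T > 0" and s: "0 \<le> s" "s \<le> 1" and B: "T + 1 \<le> real B"
  shows "window_total T s = (\<Sum>m<B. window T (real m + s) + window T (real m + 1 - s))"
proof -
  have "window_total T s = (\<Sum>m\<in>{- int B..int B}. window T (real_of_int m - s))"
    using T s B by (intro window_total_finite) auto
  also have "{- int B..int B} = {- int B} \<union> ({- int B<..0} \<union> {0<..int B})" by auto
  also have "(\<Sum>m\<in>\<dots>. window T (real_of_int m - s)) = window T (- real B - s) +
      ((\<Sum>m\<in>{- int B<..0}. window T (real_of_int m - s)) + (\<Sum>m\<in>{0<..int B}. window T (real_of_int m - s)))"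
    by (subst sum.union_disjoint, simp, simp, force, subst sum.union_disjoint) auto
  also have "window T (- real B - s) = 0" using T s B by (intro window_0_outside) auto
  also have "(\<Sum>m\<in>{- int B<..0}. window T (real_of_int m - s)) = (\<Sum>m<B. window T (real m + s))"
  proof (rule sum.reindex_bij_witness[of _ "\<lambda>m. - int m" "\<lambda>m. nat (- m)"])
    fix m assume "m \<in> {- int B<..0}"
    thus "window T (real (nat (- m)) + s) = window T (real_of_int m - s)"
      using abs_minus_cancel[of "real_of_int m - s"] by (simp add: window_def)
  qed auto
  also have "(\<Sum>m\<in>{0<..int B}. window T (real_of_int m - s)) = (\<Sum>m<B. window T (real m + 1 - s))"
    by (rule sum.reindex_bij_witness[of _ "\<lambda>m. int m + 1" "\<lambda>m. nat (m - 1)"]) (auto simp: add_ac)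
  finally show ?thesis by (simp add: sum.distrib)
qed

text \<open>By periodicity gamma may be taken in [0, 1). Summing \<open>window_interval\<close> over
  the unit intervals makes the integrals telescope to 4 times T/3, the integral of the window over
  the half-line.\<close>

lemma window_total_lower:
  assumes T: "T > 0"
  shows "4 * T / 3 \<le> window_total T 0 + window_total T \<gamma>"
proof -
  obtain B :: nat where B: "T + 1 \<le> real B" using real_arch_simple by blast
  define I where "I x = (max 0 (T - x)) ^ 3 / (3 * T\<^sup>2)" for x
  have "window_total T \<gamma> = window_total T (frac \<gamma>)"
    using window_total_periodic[of T "frac \<gamma>" "\<lfloor>\<gamma>\<rfloor>"] by (simp add: frac_def)
  moreover have "0 \<le> frac \<gamma>" "frac \<gamma> \<le> 1" using frac_lt_1[of \<gamma>] by simp_all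
  ultimately have "window_total T 0 + window_total T \<gamma> = (\<Sum>m<B. window T (real m) + window T (real m + frac \<gamma>) +
      window T (real m + 1 - frac \<gamma>) + window T (real m + 1))"
    using window_total_split[OF T _ _ B, of 0] window_total_split[OF T _ _ B, of "frac \<gamma>"]
    by (simp add: sum.distrib)
  also have "\<dots> \<ge> (\<Sum>m<B. 4 * (I (real m) - I (real m + 1)))"
    unfolding I_def by (intro sum_mono window_interval T) (use frac_lt_1[of \<gamma>] in auto)
  also have "(\<Sum>m<B. 4 * (I (real m) - I (real m + 1))) = 4 * (I 0 - I (real B))"
  proof -
    have "(\<Sum>m<B. I (real m) - I (real (Suc m))) = I (real 0) - I (real B)" by (rule sum_lessThan_telescope')
    hence "(\<Sum>m<B. I (real m) - I (real m + 1)) = I 0 - I (real B)" by (simp add: add.commute)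
    thus ?thesis by (simp only: sum_distrib_left[symmetric])
  qed
  also have "4 * (I 0 - I (real B)) = 4 * T / 3"
    unfolding I_def using T B by (simp add: max_def power2_eq_square power3_eq_cube)
  finally show ?thesis .
qed

lemma window_total_0_gt_1: "1 < T \<Longrightarrow> 1 < window_total T 0"
proof -
  assume T: "1 < T"
  obtain B :: nat where B: "T + \<bar>0\<bar> \<le> real B" using real_arch_simple by blast
  have "window_total T 0 = (\<Sum>m\<in>{- int B..int B}. window T (real_of_int m))"
    using window_total_finite[of T 0 B] T B by simp
  also have "\<dots> \<ge> (\<Sum>m\<in>{0, 1}. window T (real_of_int m))"
    using T B by (intro sum_mono2) auto
  also have "(\<Sum>m\<in>{0, 1}. window T (real_of_int m)) = 1 + (1 - 1 / T)\<^sup>2"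
    using T by (simp add: window_def max_def)
  moreover have "0 < (1 - 1 / T)\<^sup>2" using T by simp
  ultimately show ?thesis by linarith
qed

lemma window_total_0_ge_1: "0 < T \<Longrightarrow> 1 \<le> window_total T 0"
proof -
  assume T: "0 < T"
  obtain B :: nat where B: "T + \<bar>0\<bar> \<le> real B" using real_arch_simple by blast
  have "window_total T 0 = (\<Sum>m\<in>{- int B..int B}. window T (real_of_int m))"
    using window_total_finite[of T 0 B] T B by simp
  also have "\<dots> \<ge> (\<Sum>m\<in>{0}. window T (real_of_int m))"
    by (intro sum_mono2) auto
  finally show ?thesis by (simp add: window_def)
qed

text \<open>The two integers nearest to gamma are at distances s and 1 - s, and convexity lets both
  be replaced by the mean distance 1/2.\<close>

lemma window_total_midpoint:
  assumes T: "T > 0" shows "2 * (max 0 (1 - 1 / (2 * T)))\<^sup>2 \<le> window_total T \<gamma>"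
proof -
  obtain B :: nat where B: "T + 1 \<le> real B" using real_arch_simple by blast
  let ?s = "frac \<gamma>"
  have s: "0 \<le> ?s" "?s \<le> 1" using frac_lt_1[of \<gamma>] by simp_all
  have "window_total T \<gamma> = window_total T ?s"
    using window_total_periodic[of T ?s "\<lfloor>\<gamma>\<rfloor>"] by (simp add: frac_def)
  also have "\<dots> = (\<Sum>m<B. window T (real m + ?s) + window T (real m + 1 - ?s))"
    by (rule window_total_split[OF T s B])
  also have "\<dots> \<ge> (\<Sum>m\<in>{0}. window T (real m + ?s) + window T (real m + 1 - ?s))"
    using B T by (intro sum_mono2) auto
  also have "(\<Sum>m\<in>{0}. window T (real m + ?s) + window T (real m + 1 - ?s)) =
      (max 0 (1 - ?s / T))\<^sup>2 + (max 0 (1 - (1 - ?s) / T))\<^sup>2"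
    using s by (simp add: window_def)
  finally have "(max 0 (1 - ?s / T))\<^sup>2 + (max 0 (1 - (1 - ?s) / T))\<^sup>2 \<le> window_total T \<gamma>" .
  moreover have "((1 - ?s / T) + (1 - (1 - ?s) / T)) / 2 = 1 - 1 / (2 * T)" using T by (simp add: field_simps)
  note midpoint_pos_part[of "1 - ?s / T" "1 - (1 - ?s) / T", unfolded this]
  ultimately show ?thesis by (rule order_trans[rotated])
qed

text \<open>The expression is affine in nu, so positivity at nu = 0 (\<open>a\<close>) and nu = 1
  (\<open>b\<close>) suffices. For T > 1 the lower bounds for the totals are combined with the
  strict bound \<open>window_total_0_gt_1\<close>; for T <= 1 the case nu = 1 is delicate and needs
  the midpoint bound once T >= 3/4. Positivity makes the limit of the merit factors finite.\<close>

lemma phi_denominator_pos: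
  assumes T: "T > 0" and \<nu>: "0 \<le> \<nu>" "\<nu> \<le> 1"
  shows "2 * window_total T 0 + \<nu> * window_total T \<gamma> - (1 + \<nu>) * (2 * T / 3) - 1 > 0"
proof -
  let ?G = "window_total T 0" and ?g = "window_total T \<gamma>"
  define a where "a = 2 * ?G - 1 - 2 * T / 3"
  define b where "b = 2 * ?G - 1 - 4 * T / 3 + ?g"
  have G1: "1 \<le> ?G" by (rule window_total_0_ge_1[OF T])
  have G2: "2 * T / 3 \<le> ?G" using window_total_lower[OF T, of 0] by simp
  have Gg: "4 * T / 3 \<le> ?G + ?g" by (rule window_total_lower[OF T])
  have a: "a > 0"
  proof (cases "T > 1")
    case True
    thus ?thesis using window_total_0_gt_1[OF True] G2 by (simp add: a_def)
  next
    case False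
    thus ?thesis using G1 by (simp add: a_def)
  qed
  have b: "b > 0"
  proof (cases "T > 1")
    case True
    thus ?thesis using window_total_0_gt_1[OF True] Gg by (simp add: b_def)
  next
    case False
    have g: "2 * (max 0 (1 - 1 / (2 * T)))\<^sup>2 \<le> ?g" by (rule window_total_midpoint[OF T])
    show ?thesis
    proof (cases "T < 3 / 4")
      case True
      have "0 \<le> ?g" using g by (rule order_trans[rotated]) simp
      thus ?thesis using True G1 by (simp add: b_def)
    next
      case T34: False
      hence "0 \<le> 1 - 1 / (2 * T)" by (simp add: field_simps)
      hence "2 * (1 - 1 / (2 * T))\<^sup>2 \<le> ?g" using g by (simp add: max_def split: if_splits)
      hence lower: "1 - 4 * T / 3 + 2 * (1 - 1 / (2 * T))\<^sup>2 \<le> b" using G1 by (simp add: b_def)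
      have "0 < 6 * T\<^sup>2 * (1 - 4 * T / 3 + 2 * (1 - 1 / (2 * T))\<^sup>2)"
      proof -
        have eq: "6 * T\<^sup>2 * (1 - 4 * T / 3 + 2 * (1 - 1 / (2 * T))\<^sup>2) = 18 * T\<^sup>2 - 8 * T ^ 3 - 12 * T + 3"
          using T by (simp add: power2_eq_square power3_eq_cube field_simps)
        \<comment> \<open>Centering the cubic at T = 1 removes its linear term; on 0 <= x <= 1/4 the
          quadratic term is at most 6/16.\<close>
        define x where "x = 1 - T"
        have x: "0 \<le> x" "x \<le> 1 / 4" using T34 False by (simp_all add: x_def)
        have "18 * T\<^sup>2 - 8 * T ^ 3 - 12 * T + 3 = 1 - 6 * x\<^sup>2 + 8 * x ^ 3"
          by (simp add: x_def power2_eq_square power3_eq_cube algebra_simps)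
        moreover have "x\<^sup>2 \<le> 1 / 16" using power_mono[of x "1 / 4" 2] x by (simp add: power2_eq_square)
        moreover have "0 \<le> x ^ 3" using x by simp
        ultimately show ?thesis unfolding eq by linarith
      qed
      hence "0 < 1 - 4 * T / 3 + 2 * (1 - 1 / (2 * T))\<^sup>2" using T by (simp add: zero_less_mult_iff)
      thus ?thesis using lower by linarith
    qed
  qed
  have "2 * ?G + \<nu> * ?g - (1 + \<nu>) * (2 * T / 3) - 1 = (1 - \<nu>) * a + \<nu> * b"
  proof -
    define \<tau> where "\<tau> = 2 * T / 3"
    have e: "4 * T / 3 = 2 * \<tau>" by (simp add: \<tau>_def)
    show ?thesis unfolding a_def b_def e \<tau>_def[symmetric] by (simp add: algebra_simps)
  qed
  also have "\<dots> > 0"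
  proof (cases "\<nu> = 1")
    case False
    hence "0 < (1 - \<nu>) * a" using \<nu> a by simp
    moreover have "0 \<le> \<nu> * b" using \<nu> b by simp
    ultimately show ?thesis by linarith
  qed (use b in simp)
  finally show ?thesis .
qed

section \<open>Passage to the limit\<close>

text \<open>The indices d with p dividing d + c are d = m p - c, and dividing by t^2 rescales the
  triangle to height 1. The bound on B makes the range of m cover all of them.\<close>

lemma window_sum_eq:
  assumes p: "p > 0" and t: "t > 0" and B: "real t + \<bar>real_of_int c\<bar> \<le> real B * real p"
  shows "real (window_sum p t c) / (real t)\<^sup>2 =
    (\<Sum>m\<in>{- int B..int B}. window (real t / real p) (real_of_int m - real_of_int c / real p))"
proof -
  have summand: "window (real t / real p) (real_of_int m - real_of_int c / real p) = (max 0 (real t - \<bar>real_of_int (m * int p - c)\<bar>))\<^sup>2 / (real t)\<^sup>2" for m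
  proof -
    have "\<bar>real_of_int m - real_of_int c / real p\<bar> * real p = \<bar>real_of_int (m * int p - c)\<bar>"
      using p by (simp add: abs_mult_pos left_diff_distrib)
    hence "\<bar>real_of_int m - real_of_int c / real p\<bar> / (real t / real p) = \<bar>real_of_int (m * int p - c)\<bar> / real t"
      using p by simp
    moreover have "(max 0 (1 - y / real t))\<^sup>2 = (max 0 (real t - y))\<^sup>2 / (real t)\<^sup>2" for y
      using t by (auto simp: max_def field_simps power2_eq_square)
    ultimately show ?thesis unfolding window_def by (simp only:)
  qed
  let ?D = "{d\<in>{- int t<..<int t}. int p dvd d + c}"
  have "real (window_sum p t c) = (\<Sum>d\<in>?D. (real t - \<bar>real_of_int d\<bar>)\<^sup>2)"
  proof -
    have "window_sum p t c = (\<Sum>d\<in>?D. (t - nat \<bar>d\<bar>) ^ 2)"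
      unfolding window_sum_def by (rule sum.inter_filter[symmetric]) simp
    moreover have "real ((t - nat \<bar>d\<bar>) ^ 2) = (real t - \<bar>real_of_int d\<bar>)\<^sup>2" if "d \<in> ?D" for d
      using that by (auto simp: of_nat_diff)
    ultimately show ?thesis by simp
  qed
  also have "\<dots> = (\<Sum>m\<in>{m\<in>{- int B..int B}. \<bar>m * int p - c\<bar> < int t}. (real t - \<bar>real_of_int (m * int p - c)\<bar>)\<^sup>2)"
  proof (rule sum.reindex_bij_witness[of _ "\<lambda>m. m * int p - c" "\<lambda>d. (d + c) div int p"])
    fix d assume d: "d \<in> ?D"
    hence e: "(d + c) div int p * int p = d + c" by simp
    show "(d + c) div int p * int p - c = d" using e by simp
    show "(real t - \<bar>real_of_int ((d + c) div int p * int p - c)\<bar>)\<^sup>2 = (real t - \<bar>real_of_int d\<bar>)\<^sup>2" unfolding e by simp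
    have "real_of_int (\<bar>(d + c) div int p\<bar> * int p) = \<bar>real_of_int (d + c)\<bar>"
      using e by (metis abs_mult abs_of_nat of_int_abs)
    also have "\<dots> < real t + \<bar>real_of_int c\<bar>" using d by auto
    also have "\<dots> \<le> real B * real p" by (rule B)
    finally have "real_of_int \<bar>(d + c) div int p\<bar> * real p < real B * real p" by simp
    hence "\<bar>(d + c) div int p\<bar> < int B" using p by (simp add: mult_less_cancel_right)
    thus "(d + c) div int p \<in> {m\<in>{- int B..int B}. \<bar>m * int p - c\<bar> < int t}" using d e by auto
  next
    fix m assume m: "m \<in> {m\<in>{- int B..int B}. \<bar>m * int p - c\<bar> < int t}"
    show "(m * int p - c + c) div int p = m" using p by simp
    show "m * int p - c \<in> ?D" using m by auto
  qed
  also have "\<dots> = (\<Sum>m\<in>{- int B..int B}. (max 0 (real t - \<bar>real_of_int (m * int p - c)\<bar>))\<^sup>2)"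
  proof (rule sum.mono_neutral_cong_left)
    show "\<forall>m\<in>{- int B..int B} - {m\<in>{- int B..int B}. \<bar>m * int p - c\<bar> < int t}.
      (max 0 (real t - \<bar>real_of_int (m * int p - c)\<bar>))\<^sup>2 = 0"
    proof
      fix m assume "m \<in> {- int B..int B} - {m\<in>{- int B..int B}. \<bar>m * int p - c\<bar> < int t}"
      hence "int t \<le> \<bar>m * int p - c\<bar>" by auto
      hence "real t \<le> \<bar>real_of_int (m * int p - c)\<bar>" by linarith
      thus "(max 0 (real t - \<bar>real_of_int (m * int p - c)\<bar>))\<^sup>2 = 0" by (simp add: max_def)
    qed
    fix m assume "m \<in> {m\<in>{- int B..int B}. \<bar>m * int p - c\<bar> < int t}"
    hence "real_of_int \<bar>m * int p - c\<bar> < real_of_int (int t)" by (simp only: of_int_less_iff mem_Collect_eq)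
    hence "\<bar>real_of_int (m * int p - c)\<bar> < real t" by (simp only: of_int_abs of_int_of_nat_eq)
    thus "(real t - \<bar>real_of_int (m * int p - c)\<bar>)\<^sup>2 = (max 0 (real t - \<bar>real_of_int (m * int p - c)\<bar>))\<^sup>2" by (simp add: max_def)
  qed auto
  finally show ?thesis unfolding summand by (simp add: sum_divide_distrib)
qed

text \<open>Along the filter one fixed finite range of m contains all nonzero terms, so the limit is
  taken termwise in a sum of fixed length.\<close>

lemma window_sum_limit:
  fixes t :: "nat \<Rightarrow> nat" and c :: "nat \<Rightarrow> int"
  assumes F: "F \<le> at_top" and T: "T > 0"
    and t: "((\<lambda>p. real (t p) / real p) \<longlongrightarrow> T) F" and c: "((\<lambda>p. real_of_int (c p) / real p) \<longlongrightarrow> \<gamma>) F"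
  shows "((\<lambda>p. real (window_sum p (t p) (c p)) / (real (t p))\<^sup>2) \<longlongrightarrow> window_total T \<gamma>) F"
proof -
  obtain B :: nat where B: "T + \<bar>\<gamma>\<bar> + 1 \<le> real B" using real_arch_simple by blast
  have "eventually (\<lambda>p. real (t p) / real p + \<bar>real_of_int (c p) / real p\<bar> < real B) F"
  proof (rule order_tendstoD(2))
    show "((\<lambda>p. real (t p) / real p + \<bar>real_of_int (c p) / real p\<bar>) \<longlongrightarrow> T + \<bar>\<gamma>\<bar>) F"
      using t c by (intro tendsto_intros)
  qed (use B in simp)
  moreover have "eventually (\<lambda>p. 0 < real (t p) / real p) F" by (rule order_tendstoD(1)[OF t T])
  moreover have "eventually (\<lambda>p. p > 0) F" by (rule filter_leD[OF F eventually_gt_at_top])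
  ultimately have "eventually (\<lambda>p. real (window_sum p (t p) (c p)) / (real (t p))\<^sup>2 =
      (\<Sum>m\<in>{- int B..int B}. window (real (t p) / real p) (real_of_int m - real_of_int (c p) / real p))) F"
  proof eventually_elim
    case (elim p)
    have "real (t p) + \<bar>real_of_int (c p)\<bar> \<le> real B * real p"
      using elim by (simp add: field_simps abs_divide)
    moreover have "t p > 0" using elim by (auto intro!: Nat.gr0I)
    ultimately show ?case using elim by (intro window_sum_eq) auto
  qed
  moreover have "((\<lambda>p. \<Sum>m\<in>{- int B..int B}. window (real (t p) / real p) (real_of_int m - real_of_int (c p) / real p))
      \<longlongrightarrow> (\<Sum>m\<in>{- int B..int B}. window T (real_of_int m - \<gamma>))) F"
    unfolding window_def using t c T by (intro tendsto_intros) auto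
  moreover have "(\<Sum>m\<in>{- int B..int B}. window T (real_of_int m - \<gamma>)) = window_total T \<gamma>"
    using T B by (intro window_total_finite[symmetric]) auto
  ultimately show ?thesis by (simp add: tendsto_cong)
qed

text \<open>With t of order p and L = 1 + ln p, the three contributions relative to t^2 have the
  orders L^4 / sqrt p, eta / sqrt p and 1 / p.\<close>

lemma error_limit:
  fixes t :: "nat \<Rightarrow> nat" and \<eta> :: "nat \<Rightarrow> real"
  assumes F: "F \<le> at_top" and T: "T > 0"
    and t: "((\<lambda>p. real (t p) / real p) \<longlongrightarrow> T) F" and \<eta>: "((\<lambda>p. \<eta> p / sqrt (real p)) \<longlongrightarrow> 0) F"
    and \<eta>0: "\<And>p. 0 \<le> \<eta> p"
  shows "((\<lambda>p. ((10 ^ 11 * (real p)\<^sup>2 * sqrt (real p) * (dirichlet_mass p (t p) ^ 4 / real p) +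
     (40 * (real p)\<^sup>2 * sqrt (real p) * \<eta> p + 2 * (real p)\<^sup>2) * real (card (quads (t p)))) / real p ^ 4) / (real (t p))\<^sup>2) \<longlongrightarrow> 0) F"
proof -
  define \<tau> where "\<tau> p = real (t p) / real p" for p
  define g where "g p = 10 ^ 11 * (16 * (\<tau> p + 1) ^ 4) * ((1 + ln (real p)) ^ 4 / sqrt (real p)) / (\<tau> p)\<^sup>2
     + 40 * (\<eta> p / sqrt (real p)) * \<tau> p + 2 * \<tau> p * (1 / real p)" for p
  have lim: "((\<lambda>p::nat. (1 + ln (real p)) ^ 4 / sqrt (real p)) \<longlongrightarrow> 0) F" "((\<lambda>p::nat. 1 / real p) \<longlongrightarrow> 0) F"
    by (rule tendsto_mono[OF F], real_asymp)+
  have "(g \<longlongrightarrow> 10 ^ 11 * (16 * (T + 1) ^ 4) * 0 / T\<^sup>2 + 40 * 0 * T + 2 * T * 0) F"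
    unfolding g_def \<tau>_def using T by (intro tendsto_intros t \<eta> lim) auto
  hence g0: "(g \<longlongrightarrow> 0) F" by simp
  have "eventually (\<lambda>p. 0 < \<tau> p) F" unfolding \<tau>_def by (rule order_tendstoD(1)[OF t T])
  moreover have "eventually (\<lambda>p. p \<ge> 1) F" by (rule filter_leD[OF F eventually_ge_at_top])
  ultimately have "eventually (\<lambda>p. norm (((10 ^ 11 * (real p)\<^sup>2 * sqrt (real p) * (dirichlet_mass p (t p) ^ 4 / real p) +
     (40 * (real p)\<^sup>2 * sqrt (real p) * \<eta> p + 2 * (real p)\<^sup>2) * real (card (quads (t p)))) / real p ^ 4) / (real (t p))\<^sup>2) \<le> g p) F"
  proof eventually_elim
    case (elim p)
    define P q L a where "P = real p" and "q = sqrt P" and "L = 1 + ln P" and "a = \<tau> p"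
    have P: "P \<ge> 1" "q > 0" "q * q = P" "L \<ge> 1" using elim by (simp_all add: P_def q_def L_def)
    have tp: "real (t p) = a * P" using P by (simp add: a_def \<tau>_def P_def)
    have a: "a > 0" using elim by (simp add: a_def)
    have U: "dirichlet_mass p (t p) \<le> 2 * ((a + 1) * L) * P"
    proof -
      have "a * 1 \<le> a * L" using a P by (intro mult_left_mono) auto
      hence "a * P \<le> a * L * P" using P by (intro mult_right_mono) auto
      thus ?thesis unfolding dirichlet_mass_def tp P_def[symmetric] L_def[symmetric] by (simp add: algebra_simps)
    qed
    have U0: "0 \<le> dirichlet_mass p (t p)" using P unfolding dirichlet_mass_def P_def[symmetric] L_def[symmetric] by simp
    have "dirichlet_mass p (t p) ^ 4 \<le> (2 * ((a + 1) * L) * P) ^ 4" by (rule power_mono[OF U U0])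
    hence 1: "dirichlet_mass p (t p) ^ 4 \<le> 16 * (a + 1) ^ 4 * L ^ 4 * P ^ 4" unfolding power_mult_distrib by (simp add: mult_ac)
    have "3 * card (quads (t p)) \<le> 3 * t p ^ 3"
    proof -
      have "t p * 1 \<le> t p * (t p)\<^sup>2" by (cases "t p = 0") (auto intro!: mult_left_mono)
      thus ?thesis unfolding card_quads by (simp add: power2_eq_square power3_eq_cube)
    qed
    hence "card (quads (t p)) \<le> t p ^ 3" by simp
    hence "real (card (quads (t p))) \<le> real (t p ^ 3)" by (simp only: of_nat_le_iff)
    hence 2: "real (card (quads (t p))) \<le> a ^ 3 * P ^ 3" unfolding of_nat_power tp by (simp add: power_mult_distrib)
    have "10 ^ 11 * P\<^sup>2 * q * (dirichlet_mass p (t p) ^ 4 / P) + (40 * P\<^sup>2 * q * \<eta> p + 2 * P\<^sup>2) * real (card (quads (t p)))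
       \<le> 10 ^ 11 * P\<^sup>2 * q * (16 * (a + 1) ^ 4 * L ^ 4 * P ^ 4 / P) + (40 * P\<^sup>2 * q * \<eta> p + 2 * P\<^sup>2) * (a ^ 3 * P ^ 3)"
      using P 1 2 a \<eta>0[of p] by (intro add_mono mult_left_mono divide_right_mono) auto
    hence "((10 ^ 11 * P\<^sup>2 * q * (dirichlet_mass p (t p) ^ 4 / P) + (40 * P\<^sup>2 * q * \<eta> p + 2 * P\<^sup>2) * real (card (quads (t p)))) / P ^ 4) / (a * P)\<^sup>2
       \<le> ((10 ^ 11 * P\<^sup>2 * q * (16 * (a + 1) ^ 4 * L ^ 4 * P ^ 4 / P) + (40 * P\<^sup>2 * q * \<eta> p + 2 * P\<^sup>2) * (a ^ 3 * P ^ 3)) / P ^ 4) / (a * P)\<^sup>2"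
      using P by (intro divide_right_mono) auto
    also have "\<dots> = 10 ^ 11 * (16 * (a + 1) ^ 4) * (L ^ 4 / q) / a\<^sup>2 + 40 * (\<eta> p / q) * a + 2 * a * (1 / P)"
      unfolding P(3)[symmetric] using P(2) a by (simp add: eval_nat_numeral field_simps)
    also have "\<dots> = g p" by (simp add: g_def a_def L_def q_def P_def)
    finally have le: "((10 ^ 11 * P\<^sup>2 * q * (dirichlet_mass p (t p) ^ 4 / P) + (40 * P\<^sup>2 * q * \<eta> p + 2 * P\<^sup>2) * real (card (quads (t p)))) / P ^ 4) / (a * P)\<^sup>2 \<le> g p" .
    have "0 \<le> ((10 ^ 11 * P\<^sup>2 * q * (dirichlet_mass p (t p) ^ 4 / P) + (40 * P\<^sup>2 * q * \<eta> p + 2 * P\<^sup>2) * real (card (quads (t p)))) / P ^ 4) / (a * P)\<^sup>2"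
      using P U0 a \<eta>0[of p] by (intro divide_nonneg_nonneg add_nonneg_nonneg mult_nonneg_nonneg zero_le_power) auto
    thus ?case using le unfolding tp P_def[symmetric] q_def[symmetric] by simp
  qed
  thus ?thesis by (rule Lim_null_comparison[OF _ g0])
qed

definition moment_error :: "nat \<Rightarrow> nat \<Rightarrow> real \<Rightarrow> real" where
  "moment_error p t \<eta> = (10 ^ 11 * (real p)\<^sup>2 * sqrt (real p) * (dirichlet_mass p t ^ 4 / real p) +
     (40 * (real p)\<^sup>2 * sqrt (real p) * \<eta> + 2 * (real p)\<^sup>2) * real (card (quads t))) / real p ^ 4"

lemma merit_factor_limit:
  fixes t :: "nat \<Rightarrow> nat" and y r :: "nat \<Rightarrow> int" and f :: "nat \<Rightarrow> complex poly"
  assumes F: "F \<le> at_top" and T: "T > 0" and \<nu>: "0 \<le> \<nu>" "\<nu> \<le> 1"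
    and y: "((\<lambda>p. (real_of_int (y p))\<^sup>2 * (ln (real p)) ^ 3 / real p) \<longlongrightarrow> 0) F"
    and r: "((\<lambda>p. real_of_int (r p) / real p) \<longlongrightarrow> R) F"
    and t: "((\<lambda>p. real (t p) / real p) \<longlongrightarrow> T) F"
    and L2: "eventually (\<lambda>p. L_norm 2 (f p) ^ 4 = (real (t p))\<^sup>2) F"
    and L4: "eventually (\<lambda>p. \<bar>L_norm 4 (f p) ^ 4 -
        (2 * real (window_sum p (t p) 0) + \<nu> * real (window_sum p (t p) (int (t p) - 1 + 2 * r p))
          - (1 + \<nu>) * real (card (quads (t p))) / real p)\<bar> \<le> moment_error p (t p) (1 + 144 * real_of_int \<bar>y p\<bar>)) F"
  shows "((\<lambda>p. merit_factor (f p)) \<longlongrightarrow> phi_nu \<nu> R T) F"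
proof -
  have pos: "eventually (\<lambda>p. p > 0) F" by (rule filter_leD[OF F eventually_gt_at_top])
  have "eventually (\<lambda>p. 0 < real (t p) / real p) F" by (rule order_tendstoD(1)[OF t T])
  hence tpos: "eventually (\<lambda>p. t p > 0) F"
  proof eventually_elim
    case (elim p)
    thus ?case by (cases "t p = 0") auto
  qed
  have inv: "((\<lambda>p::nat. 1 / real p) \<longlongrightarrow> 0) F" "((\<lambda>p::nat. 1 / sqrt (real p)) \<longlongrightarrow> 0) F"
    by (rule tendsto_mono[OF F], real_asymp)+
  have W0: "((\<lambda>p. real (window_sum p (t p) 0) / (real (t p))\<^sup>2) \<longlongrightarrow> window_total T 0) F"
    by (rule window_sum_limit[OF F T t]) simp
  have "((\<lambda>p. real (t p) / real p - 1 / real p + 2 * (real_of_int (r p) / real p)) \<longlongrightarrow> T - 0 + 2 * R) F"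
    by (intro tendsto_intros t r inv)
  moreover have "(\<lambda>p. real_of_int (int (t p) - 1 + 2 * r p) / real p) =
      (\<lambda>p. real (t p) / real p - 1 / real p + 2 * (real_of_int (r p) / real p))"
    by (simp add: add_divide_distrib diff_divide_distrib)
  ultimately have "((\<lambda>p. real_of_int (int (t p) - 1 + 2 * r p) / real p) \<longlongrightarrow> T + 2 * R) F" by (simp only: diff_zero)
  hence W1: "((\<lambda>p. real (window_sum p (t p) (int (t p) - 1 + 2 * r p)) / (real (t p))\<^sup>2) \<longlongrightarrow> window_total T (T + 2 * R)) F"
    by (rule window_sum_limit[OF F T t])
  have W2: "((\<lambda>p. real (card (quads (t p))) / real p / (real (t p))\<^sup>2) \<longlongrightarrow> 2 * T / 3) F"
  proof -
    have "((\<lambda>p. 2 * (real (t p) / real p) / 3 + (1 / real p)\<^sup>2 / (real (t p) / real p) / 3) \<longlongrightarrow> 2 * T / 3 + 0\<^sup>2 / T / 3) F"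
      using T by (intro tendsto_intros t inv) auto
    moreover have "eventually (\<lambda>p. 2 * (real (t p) / real p) / 3 + (1 / real p)\<^sup>2 / (real (t p) / real p) / 3 =
        real (card (quads (t p))) / real p / (real (t p))\<^sup>2) F"
      using pos tpos
    proof eventually_elim
      case (elim p)
      have "real (3 * card (quads (t p))) = real (2 * t p ^ 3 + t p)" by (simp only: card_quads)
      hence c: "real (card (quads (t p))) = (2 * real (t p) ^ 3 + real (t p)) / 3" by simp
      show ?case unfolding c using elim by (simp add: power2_eq_square power3_eq_cube field_simps)
    qed
    ultimately show ?thesis by (simp add: tendsto_cong)
  qed
  define M where "M p = 2 * real (window_sum p (t p) 0) + \<nu> * real (window_sum p (t p) (int (t p) - 1 + 2 * r p))
          - (1 + \<nu>) * real (card (quads (t p))) / real p" for p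
  define L where "L = 2 * window_total T 0 + \<nu> * window_total T (T + 2 * R) - (1 + \<nu>) * (2 * T / 3)"
  have M: "((\<lambda>p. M p / (real (t p))\<^sup>2) \<longlongrightarrow> L) F"
  proof -
    have "((\<lambda>p. 2 * (real (window_sum p (t p) 0) / (real (t p))\<^sup>2)
        + \<nu> * (real (window_sum p (t p) (int (t p) - 1 + 2 * r p)) / (real (t p))\<^sup>2)
        - (1 + \<nu>) * (real (card (quads (t p))) / real p / (real (t p))\<^sup>2)) \<longlongrightarrow> L) F"
      unfolding L_def by (intro tendsto_intros W0 W1 W2)
    thus ?thesis by (simp add: M_def add_divide_distrib diff_divide_distrib)
  qed
  \<comment> \<open>Once ln p >= 1, y^2 / p is dominated by the quantity assumed to tend to 0; its
    square root controls |y| / sqrt p.\<close>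
  have eta: "((\<lambda>p. (1 + 144 * real_of_int \<bar>y p\<bar>) / sqrt (real p)) \<longlongrightarrow> 0) F"
  proof -
    have "((\<lambda>p. (real_of_int (y p))\<^sup>2 / real p) \<longlongrightarrow> 0) F"
    proof (rule Lim_null_comparison[OF _ y])
      have "eventually (\<lambda>p::nat. ln (real p) \<ge> 1) at_top" by real_asymp
      from filter_leD[OF F this]
      show "eventually (\<lambda>p. norm ((real_of_int (y p))\<^sup>2 / real p) \<le> (real_of_int (y p))\<^sup>2 * (ln (real p)) ^ 3 / real p) F"
      proof eventually_elim
        case (elim p)
        have "(real_of_int (y p))\<^sup>2 * 1 \<le> (real_of_int (y p))\<^sup>2 * (ln (real p)) ^ 3"
          using elim by (intro mult_left_mono one_le_power) auto
        hence "(real_of_int (y p))\<^sup>2 / real p \<le> (real_of_int (y p))\<^sup>2 * (ln (real p)) ^ 3 / real p"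
          by (intro divide_right_mono) auto
        thus ?case by simp
      qed
    qed
    hence "((\<lambda>p. 1 / sqrt (real p) + 144 * sqrt ((real_of_int (y p))\<^sup>2 / real p)) \<longlongrightarrow> 0 + 144 * sqrt 0) F"
      by (intro tendsto_intros inv)
    thus ?thesis by (simp add: real_sqrt_divide add_divide_distrib)
  qed
  have E: "((\<lambda>p. moment_error p (t p) (1 + 144 * real_of_int \<bar>y p\<bar>) / (real (t p))\<^sup>2) \<longlongrightarrow> 0) F"
    unfolding moment_error_def by (rule error_limit[OF F T t eta]) simp
  have "((\<lambda>p. L_norm 4 (f p) ^ 4 / (real (t p))\<^sup>2 - M p / (real (t p))\<^sup>2) \<longlongrightarrow> 0) F"
  proof (rule Lim_null_comparison[OF _ E])
    show "eventually (\<lambda>p. norm (L_norm 4 (f p) ^ 4 / (real (t p))\<^sup>2 - M p / (real (t p))\<^sup>2)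
        \<le> moment_error p (t p) (1 + 144 * real_of_int \<bar>y p\<bar>) / (real (t p))\<^sup>2) F"
      using L4
    proof eventually_elim
      case (elim p)
      have "norm (L_norm 4 (f p) ^ 4 / (real (t p))\<^sup>2 - M p / (real (t p))\<^sup>2) = \<bar>L_norm 4 (f p) ^ 4 - M p\<bar> / (real (t p))\<^sup>2"
        by (simp add: diff_divide_distrib[symmetric] abs_divide)
      thus ?case using elim unfolding M_def by (simp only:) (intro divide_right_mono, auto)
    qed
  qed
  from tendsto_add[OF this M] have Q: "((\<lambda>p. L_norm 4 (f p) ^ 4 / (real (t p))\<^sup>2) \<longlongrightarrow> L) F" by simp
  have "L - 1 > 0" unfolding L_def by (rule phi_denominator_pos[OF T \<nu>])
  hence "((\<lambda>p. 1 / (L_norm 4 (f p) ^ 4 / (real (t p))\<^sup>2 - 1)) \<longlongrightarrow> 1 / (L - 1)) F"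
    by (intro tendsto_intros Q) auto
  moreover have "eventually (\<lambda>p. 1 / (L_norm 4 (f p) ^ 4 / (real (t p))\<^sup>2 - 1) = merit_factor (f p)) F"
    using tpos L2
  proof eventually_elim
    case (elim p)
    have "L_norm 4 (f p) ^ 4 / (real (t p))\<^sup>2 - 1 = (L_norm 4 (f p) ^ 4 - (real (t p))\<^sup>2) / (real (t p))\<^sup>2"
      using elim by (simp add: diff_divide_distrib)
    thus ?case using elim by (simp add: merit_factor_def)
  qed
  moreover have "1 / (L - 1) = phi_nu \<nu> R T" unfolding phi_nu_eq[OF T] L_def ..
  ultimately show ?thesis by (simp add: tendsto_cong)
qed

lemma (in sextic_triple) norm_estimates:
  fixes t :: nat and r :: int
  assumes X: "int p = x\<^sup>2 + 27 * y\<^sup>2"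
  defines "f \<equiv> \<Sum>j<t. monom (seq (int j + r)) j"
  shows "L_norm 2 f ^ 4 = (real t)\<^sup>2"
    and "\<bar>L_norm 4 f ^ 4 - moment_main t r\<bar> \<le> moment_error p t (1 + 144 * real_of_int \<bar>y\<bar>)"
proof -
  have "(cmod (seq j))\<^sup>2 = 1" for j by (simp add: seq_def)
  thus "L_norm 2 f ^ 4 = (real t)\<^sup>2" unfolding f_def L_norm_2 by simp
  have L4: "complex_of_real (L_norm 4 f ^ 4) =
      (\<Sum>(i, j, k, h)\<in>quads t. seq (int i + r) * seq (int j + r) * seq (int k + r) * seq (int h + r))"
    unfolding f_def by (rule L_norm_4) simp
  have "cmod (complex_of_real (L_norm 4 f ^ 4) - of_real (moment_main t r)) \<le> moment_error p t (1 + 144 * real_of_int \<bar>y\<bar>)"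
    unfolding L4 moment_error_def
    by (rule fourth_moment_estimate) (rule fourier_value_modulus[OF X S_subset card_S])
  thus "\<bar>L_norm 4 f ^ 4 - moment_main t r\<bar> \<le> moment_error p t (1 + 144 * real_of_int \<bar>y\<bar>)"
    by (simp only: of_real_diff[symmetric] norm_of_real)
qed

section \<open>Paley and Hall types as subsets of Z/6\<close>

text \<open>The combinatorial form of Paley type: exactly one element of each pair s, s + 3 is
  chosen. For odd g, s + 3 is the class of the negatives of class s, and this makes the correlation
  extreme.\<close>

definition antipodal :: "nat set \<Rightarrow> bool" where
  "antipodal S \<longleftrightarrow> (\<forall>s<6. s \<in> S \<longleftrightarrow> (s + 3) mod 6 \<notin> S)"

lemma all_less_6: "(\<forall>s<6. P s) \<longleftrightarrow> P 0 \<and> P 1 \<and> P 2 \<and> P 3 \<and> P 4 \<and> P (5::nat)"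
proof -
  have "(s < 6) = (s = 0 \<or> s = 1 \<or> s = 2 \<or> s = 3 \<or> s = 4 \<or> s = 5)" for s :: nat by presburger
  thus ?thesis by auto
qed

lemma ex_less_6: "(\<exists>s<6. P s) \<longleftrightarrow> P 0 \<or> P 1 \<or> P 2 \<or> P 3 \<or> P 4 \<or> P (5::nat)"
  using all_less_6[of "\<lambda>s. \<not> P s"] by blast

lemma sum_less_6: "(\<Sum>s<6. f s) = f 0 + (f 1 + (f 2 + (f 3 + (f 4 + f (5::nat)))))"
proof -
  have "{..<6::nat} = {0, 1, 2, 3, 4, 5}" by auto
  thus ?thesis by simp
qed

text \<open>Rotation by 5 k undoes rotation by k modulo 6; natural numbers thereby avoid
  subtraction.\<close>

lemma unshift:
  assumes "u < 6"
  shows "((u + 5 * k) mod 6 + k) mod 6 = (u::nat)" "((u + k) mod 6 + 5 * k) mod 6 = u"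
proof -
  have u: "(u + k * 6) mod 6 = u" using assms by simp
  have e: "u + 5 * k + k = u + k * 6" "u + k + 5 * k = u + k * 6" by simp_all
  show "((u + 5 * k) mod 6 + k) mod 6 = u" unfolding mod_add_left_eq e(1) by (rule u)
  show "((u + k) mod 6 + 5 * k) mod 6 = u" unfolding mod_add_left_eq e(2) by (rule u)
qed

lemma shift_cancel: "(a + k) mod 6 = (b + k) mod 6 \<Longrightarrow> a < 6 \<Longrightarrow> b < 6 \<Longrightarrow> a = (b::nat)"
  by (metis unshift(2))

lemma antipodal_iff: "antipodal S \<longleftrightarrow> (3 \<in> S \<longleftrightarrow> 0 \<notin> S) \<and> (4 \<in> S \<longleftrightarrow> 1 \<notin> S) \<and> (5 \<in> S \<longleftrightarrow> 2 \<notin> S)"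
proof -
  have m: "(0 + 3) mod 6 = (3::nat)" "(1 + 3) mod 6 = (4::nat)" "(2 + 3) mod 6 = (5::nat)"
    "(3 + 3) mod 6 = (0::nat)" "(4 + 3) mod 6 = (1::nat)" "(5 + 3) mod 6 = (2::nat)" by simp_all
  show ?thesis unfolding antipodal_def all_less_6 m by blast
qed

lemma antipodal_shift_aux:
  assumes "antipodal A" "\<And>s. s < 6 \<Longrightarrow> s \<in> S \<longleftrightarrow> (s + k) mod 6 \<in> A"
  shows "antipodal S"
  unfolding antipodal_def
proof (intro allI impI)
  fix s :: nat assume s: "s < 6"
  have "(s + k) mod 6 \<in> A \<longleftrightarrow> ((s + k) mod 6 + 3) mod 6 \<notin> A"
    by (rule assms(1)[unfolded antipodal_def, rule_format]) simp
  moreover have e: "((s + k) mod 6 + 3) mod 6 = ((s + 3) mod 6 + k) mod 6"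
    by (simp only: mod_add_left_eq add.assoc add.commute[of 3 k])
  moreover have "s \<in> S \<longleftrightarrow> (s + k) mod 6 \<in> A" by (rule assms(2)[OF s])
  moreover have "(s + 3) mod 6 \<in> S \<longleftrightarrow> ((s + 3) mod 6 + k) mod 6 \<in> A" by (rule assms(2)) simp
  ultimately show "s \<in> S \<longleftrightarrow> (s + 3) mod 6 \<notin> S" unfolding e by blast
qed

lemma antipodal_shift:
  assumes "\<And>s. s < 6 \<Longrightarrow> s \<in> S \<longleftrightarrow> (s + k) mod 6 \<in> A"
  shows "antipodal S \<longleftrightarrow> antipodal A"
proof
  assume "antipodal A" thus "antipodal S" using assms by (rule antipodal_shift_aux)
next
  assume S: "antipodal S"
  have "u \<in> A \<longleftrightarrow> (u + 5 * k) mod 6 \<in> S" if "u < 6" for u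
  proof -
    have "(u + 5 * k) mod 6 \<in> S \<longleftrightarrow> ((u + 5 * k) mod 6 + k) mod 6 \<in> A" by (rule assms) simp
    thus ?thesis unfolding unshift(1)[OF that] by blast
  qed
  with S show "antipodal A" by (rule antipodal_shift_aux)
qed

text \<open>Of the 8 antipodal sets, 2 are rotations of {0, 2, 4} and 6 are rotations of {0, 1,
  2}.\<close>

lemma antipodal_cases:
  assumes "antipodal S"
  shows "\<exists>k<6. (\<forall>s<6. s \<in> S \<longleftrightarrow> (s + k) mod 6 \<in> {0, 2, 4}) \<or> (\<forall>s<6. s \<in> S \<longleftrightarrow> (s + k) mod 6 \<in> {0, 1, 2})"
proof -
  have S: "3 \<in> S \<longleftrightarrow> 0 \<notin> S" "4 \<in> S \<longleftrightarrow> 1 \<notin> S" "5 \<in> S \<longleftrightarrow> 2 \<notin> S"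
    using assms unfolding antipodal_iff by blast+
  show ?thesis unfolding all_less_6 ex_less_6 S
    by (cases "0 \<in> S"; cases "1 \<in> S"; cases "2 \<in> S") simp_all
qed

lemma antipodal_standard: "antipodal {0, 2, 4}" "antipodal {0, 1, 2}"
  unfolding antipodal_iff by simp_all

text \<open>For even g, -1 has class 0 and \<open>\<kappa>\<close> = 6. For odd g the three pairs s,
  s + 3 count twice each: an antipodal set splits all of them and \<open>\<kappa>\<close> = -6,
  while any other set of three indices contains one pair, misses one and splits one, so
  \<open>\<kappa>\<close> = 2.\<close>

lemma (in sextic_triple) \<kappa>_value:
  "(\<kappa> / 6)\<^sup>2 = (if even g \<or> antipodal S then 1 else 1 / 9)"
proof (cases "even g")
  case True
  hence "\<kappa> = sum (\<lambda>_. 1) {..<6::nat}" unfolding \<kappa>_def by (intro sum.cong) (auto simp: cls_minus_1 sgn_class_def)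
  thus ?thesis using True by simp
next
  case False
  have c: "(\<Sum>s<6. if s \<in> S then 1 else 0) = (3::nat)"
    using S_subset card_S by (simp add: sum.If_cases Int_absorb1)
  have m: "(0 + 3) mod 6 = (3::nat)" "(1 + 3) mod 6 = (4::nat)" "(2 + 3) mod 6 = (5::nat)"
    "(3 + 3) mod 6 = (0::nat)" "(4 + 3) mod 6 = (1::nat)" "(5 + 3) mod 6 = (2::nat)" by simp_all
  have \<kappa>: "\<kappa> = 2 * Re (sgn_class 0 * sgn_class 3) + 2 * Re (sgn_class 1 * sgn_class 4) + 2 * Re (sgn_class 2 * sgn_class 5)"
    unfolding \<kappa>_def cls_minus_1 if_not_P[OF False] sum_less_6 m by (simp add: mult.commute)
  have \<kappa>2: "\<kappa> = (if antipodal S then -6 else 2)"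
    using c unfolding \<kappa> sgn_class_def antipodal_iff sum_less_6
    by (cases "0 \<in> S"; cases "1 \<in> S"; cases "2 \<in> S"; cases "3 \<in> S"; cases "4 \<in> S"; cases "5 \<in> S") simp_all
  show ?thesis using False unfolding \<kappa>2 by (simp add: power2_eq_square)
qed

section \<open>Cyclotomic classes and types inside the residue field\<close>

lemma Fp_star_carrier: "p > 0 \<Longrightarrow> carrier (Fp_star p) = {1..<int p}"
  by (auto simp: residue_ring_def)

lemma Fp_mult: "x \<otimes>\<^bsub>Fp p\<^esub> y = x * y mod int p"
  by (simp add: residue_ring_def)

lemma Fp_one: "\<one>\<^bsub>Fp p\<^esub> = 1" by (simp add: residue_ring_def)

lemma Fp_star_group:
  assumes "prime p" shows "group (Fp_star p)"
proof -
  interpret residues_prime p "residue_ring (int p)" by unfold_locales (use assms in simp_all)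
  show ?thesis by (rule field_mult_group)
qed

lemma Fp_star_pow:
  assumes "prime p" shows "x \<in> {1..<int p} \<Longrightarrow> x [^]\<^bsub>Fp_star p\<^esub> (n::nat) = x ^ n mod int p"
proof -
  assume x: "x \<in> {1..<int p}"
  interpret residues_prime p "residue_ring (int p)" by unfold_locales (use assms in simp_all)
  show ?thesis using pow_cong[of x n] x by (simp add: nat_pow_mult_of)
qed

lemma sextic_residues_primitive_element:
  assumes p: "prime p" "p = 6 * g + 1" and w: "primitive_element p w"
  shows "sextic_residues p g w"
proof (rule sextic_residues.intro[OF p])
  fix x assume x: "\<not> int p dvd x"
  have p0: "p > 0" using p by simp
  have wc: "w \<in> carrier (Fp_star p)" and gen: "generate (Fp_star p) {w} = carrier (Fp_star p)"
    using w by (auto simp: primitive_element_def)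
  have fin: "finite (carrier (Fp_star p))" unfolding Fp_star_carrier[OF p0] by simp
  have "x mod int p \<noteq> 0" using x by (simp add: dvd_eq_mod_eq_0)
  moreover have "0 \<le> x mod int p" "x mod int p < int p" using p0 by simp_all
  ultimately have "x mod int p \<in> carrier (Fp_star p)" unfolding Fp_star_carrier[OF p0] by auto
  also have "carrier (Fp_star p) = {w [^]\<^bsub>Fp_star p\<^esub> k | k. k \<in> (UNIV :: nat set)}"
    unfolding gen[symmetric] by (rule group.generate_pow_on_finite_carrier[OF Fp_star_group[OF p(1)] fin wc])
  finally obtain k :: nat where k: "x mod int p = w [^]\<^bsub>Fp_star p\<^esub> k" by blast
  hence "x mod int p = w ^ k mod int p" using Fp_star_pow[OF p(1)] wc unfolding Fp_star_carrier[OF p0] by simp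
  thus "\<exists>i. [x = w ^ i] (mod int p)" unfolding cong_def by blast
qed

context sextic_residues
begin

definition class_union :: "nat set \<Rightarrow> int set" where
  "class_union A = {x \<in> {1..<int p}. cls x \<in> A}"

lemma unit_range: "x \<in> {1..<int p} \<Longrightarrow> \<not> int p dvd x"
  by (rule small_not_dvd) auto

lemma mod_range: "\<not> int p dvd x \<Longrightarrow> x mod int p \<in> {1..<int p}"
  using p_pos pos_mod_bound[of "int p" x] pos_mod_sign[of "int p" x]
  by (auto simp: dvd_eq_mod_eq_0 order_le_less)

lemma cls_sixth_power: "\<not> int p dvd x \<Longrightarrow> cls (x ^ 6) = 0"
proof -
  assume "\<not> int p dvd x"
  then obtain i where "[x = w ^ i] (mod int p)" using primitive by blast
  hence "[x ^ 6 = w ^ (i * 6)] (mod int p)" unfolding power_mult by (rule cong_pow)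
  thus ?thesis by (simp add: cls_eqI)
qed

text \<open>Cyclotomic classes are indexed by integers, so negative exponents have to be traced
  through the group inverse.\<close>

lemma cls_int_power:
  assumes w: "w \<in> {1..<int p}"
  shows "w [^]\<^bsub>Fp_star p\<^esub> (s::int) \<in> {1..<int p}" "cls (w [^]\<^bsub>Fp_star p\<^esub> s) = nat (s mod 6)"
proof -
  interpret G: group "Fp_star p" by (rule Fp_star_group[OF prime_p])
  let ?u = "w [^]\<^bsub>Fp_star p\<^esub> s"
  note carr = Fp_star_carrier[OF p_pos]
  have wc: "w \<in> carrier (Fp_star p)" using w carr by simp
  have "?u \<in> carrier (Fp_star p)" by (rule G.int_pow_closed[OF wc])
  thus u: "?u \<in> {1..<int p}" unfolding carr .
  show "cls ?u = nat (s mod 6)"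
  proof (cases "s < 0")
    case False
    have "?u = w ^ nat s mod int p"
      unfolding int_pow_def2 using False Fp_star_pow[OF prime_p w, of "nat s"] by simp
    hence "cls ?u = nat s mod 6" by (simp add: cls_w)
    also have "\<dots> = nat (s mod 6)" using False by (simp add: nat_mod_distrib)
    finally show ?thesis .
  next
    case True
    let ?n = "nat (- s)"
    have pw: "w [^]\<^bsub>Fp_star p\<^esub> ?n = w ^ ?n mod int p" by (rule Fp_star_pow[OF prime_p w])
    have "w [^]\<^bsub>Fp_star p\<^esub> ?n \<otimes>\<^bsub>Fp_star p\<^esub> inv\<^bsub>Fp_star p\<^esub> (w [^]\<^bsub>Fp_star p\<^esub> ?n) = \<one>\<^bsub>Fp_star p\<^esub>"
      by (rule G.r_inv[OF G.nat_pow_closed[OF wc]])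
    moreover have "inv\<^bsub>Fp_star p\<^esub> (w [^]\<^bsub>Fp_star p\<^esub> ?n) = ?u" unfolding int_pow_def2 using True by simp
    ultimately have "(w ^ ?n mod int p) * ?u mod int p = 1" by (simp only: pw mult_mult_of one_mult_of Fp_mult Fp_one)
    hence "[w ^ ?n * ?u = 1] (mod int p)" using p_ge_7 by (simp add: cong_def mod_mult_left_eq)
    hence "cls (w ^ ?n * ?u) = cls 1" by (rule cls_cong)
    hence sum: "(?n mod 6 + cls ?u) mod 6 = 0" using cls_mult[OF w_power_unit unit_range[OF u]] by (simp add: cls_w)
    have key: "c = nat (s mod 6)" if c: "(?n mod 6 + c) mod 6 = 0" "c < 6" for c
    proof -
      have "6 dvd ?n + c" using c(1) by (simp only: mod_add_left_eq mod_eq_0_iff_dvd)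
      then obtain q where "?n + c = 6 * q" by blast
      hence "s = int c + (- int q) * 6" using True by linarith
      hence "s mod 6 = int c mod 6" by (simp only: mod_mult_self1)
      thus ?thesis using c(2) by simp
    qed
    show ?thesis by (rule key[OF sum cls_less])
  qed
qed

text \<open>For the inclusion from right to left, z is divided by w^s: the quotient is a unit of
  class 0, hence a power w^(6 m), hence a sixth power.\<close>

lemma cyclotomic_class_eq:
  assumes w: "w \<in> {1..<int p}"
  shows "cyclotomic_class p 6 w s = class_union {nat (s mod 6)}"
proof -
  let ?u = "w [^]\<^bsub>Fp_star p\<^esub> s"
  note u = cls_int_power[OF w, of s]
  have eq: "?u \<otimes>\<^bsub>Fp_star p\<^esub> (x [^]\<^bsub>Fp_star p\<^esub> (6::nat)) = ?u * (x ^ 6 mod int p) mod int p" if "x \<in> {1..<int p}" for x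
    unfolding mult_mult_of Fp_mult Fp_star_pow[OF prime_p that] ..
  have "cyclotomic_class p 6 w s = {?u * (x ^ 6 mod int p) mod int p | x. x \<in> {1..<int p}}"
    unfolding cyclotomic_class_def Fp_star_carrier[OF p_pos] by (rule Collect_cong) (metis eq)
  also have "\<dots> = {?u * x ^ 6 mod int p | x. x \<in> {1..<int p}}" by (simp only: mod_mult_right_eq)
  also have "\<dots> = class_union {cls ?u}"
  proof (intro equalityI subsetI)
    fix z assume "z \<in> {?u * x ^ 6 mod int p | x. x \<in> {1..<int p}}"
    then obtain x where x: "x \<in> {1..<int p}" "z = ?u * x ^ 6 mod int p" by blast
    have x6: "\<not> int p dvd x ^ 6" using unit_range[OF x(1)] prime_int_p prime_dvd_power by blast
    have "cls z = cls ?u" unfolding x(2) cls_mod cls_mult[OF unit_range[OF u(1)] x6]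
      using cls_sixth_power[OF unit_range[OF x(1)]] cls_less[of ?u] by simp
    moreover have "z \<in> {1..<int p}" unfolding x(2) by (rule mod_range[OF not_dvd_mult[OF unit_range[OF u(1)] x6]])
    ultimately show "z \<in> class_union {cls ?u}" by (simp add: class_union_def)
  next
    fix z assume "z \<in> class_union {cls ?u}"
    hence z: "z \<in> {1..<int p}" "cls z = cls ?u" by (auto simp: class_union_def)
    obtain c where c: "[?u * c = 1] (mod int p)" using inverse_exists[OF unit_range[OF u(1)]] by blast
    let ?d = "c * z"
    have "[?u * c * z = 1 * z] (mod int p)" by (rule cong_mult[OF c cong_refl])
    hence ud: "[?u * ?d = z] (mod int p)" by (simp only: mult_1 mult.assoc)
    have nd: "\<not> int p dvd ?d"
    proof
      assume "int p dvd ?d"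
      hence "int p dvd ?u * ?d" by (rule dvd_mult)
      hence "int p dvd z" unfolding cong_dvd_iff[OF ud] .
      thus False by (rule notE[OF unit_range[OF z(1)]])
    qed
    have "(cls ?u + cls ?d) mod 6 = cls (?u * ?d)" by (rule cls_mult[OF unit_range[OF u(1)] nd, symmetric])
    also have "\<dots> = cls z" by (rule cls_cong[OF ud])
    also have "\<dots> = cls ?u" by (rule z(2))
    finally have sum: "(cls ?u + cls ?d) mod 6 = cls ?u" .
    have "b = 0" if "(a + b) mod 6 = a" "a < 6" "b < 6" for a b :: nat using that by presburger
    from this[OF sum cls_less cls_less] have d0: "cls ?d = 0" .
    obtain k where k: "[?d = w ^ k] (mod int p)" "k mod 6 = cls ?d" using cls_exists[OF nd] by blast
    have "6 dvd k" unfolding dvd_eq_mod_eq_0 k(2) by (rule d0)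
    then obtain m where m: "k = 6 * m" by (rule dvdE)
    let ?x = "w ^ m mod int p"
    have "[?u * ?x ^ 6 = ?u * (w ^ m) ^ 6] (mod int p)" by (intro cong_mult cong_pow cong_refl) simp
    also have "?u * (w ^ m) ^ 6 = ?u * w ^ k" by (simp only: m power_mult[symmetric] mult.commute[of 6 m])
    also have "[?u * w ^ k = ?u * ?d] (mod int p)" by (rule cong_mult[OF cong_refl cong_sym[OF k(1)]])
    also have "[?u * ?d = z] (mod int p)" by (rule ud)
    finally have "?u * ?x ^ 6 mod int p = z" using z(1) by (simp add: cong_def)
    moreover have "?x \<in> {1..<int p}" by (rule mod_range[OF w_power_unit])
    ultimately show "z \<in> {?u * x ^ 6 mod int p | x. x \<in> {1..<int p}}" by blast
  qed
  finally show ?thesis unfolding u(2) .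
qed

lemma class_union_inj:
  assumes "A \<subseteq> {..<6}" "B \<subseteq> {..<6}" "class_union A = class_union B" shows "A = B"
proof -
  have "s \<in> A \<longleftrightarrow> w ^ s mod int p \<in> class_union A" if "s < 6" for s A
    using mod_range[OF w_power_unit[of s]] that by (simp add: class_union_def cls_w)
  thus ?thesis using assms by auto
qed

text \<open>A collection of classes is the injective image of a set of indices below 6, so three
  distinct classes give three indices.\<close>

lemma union_of_three_sextic_classes_E:
  assumes w: "w \<in> {1..<int p}" and D: "union_of_three_sextic_classes p w D"
  obtains A where "A \<subseteq> {..<6}" "card A = 3" "D = class_union A"
proof -
  obtain C where C: "C \<subseteq> range (cyclotomic_class p 6 w)" "card C = 3" "D = \<Union>C"
    using D unfolding union_of_three_sextic_classes_def by blast
  have "range (cyclotomic_class p 6 w) \<subseteq> (\<lambda>s. class_union {s}) ` {..<6}"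
    unfolding cyclotomic_class_eq[OF w] by (auto simp: nat_less_iff)
  with C(1) have "C \<subseteq> (\<lambda>s. class_union {s}) ` {..<6}" by (rule order_trans)
  then obtain A where A: "A \<subseteq> {..<6}" "inj_on (\<lambda>s. class_union {s}) A" "C = (\<lambda>s. class_union {s}) ` A"
    unfolding subset_image_inj by blast
  have "card A = 3" using C(2) A card_image by metis
  moreover have "D = class_union A" unfolding C(3) A(3) by (auto simp: class_union_def)
  ultimately show ?thesis using that A(1) by blast
qed

lemma scaled_class_union:
  assumes c: "c \<in> {1..<int p}" and A: "A \<subseteq> {..<6}"
  shows "(\<lambda>d. c \<otimes>\<^bsub>Fp p\<^esub> d) ` class_union A = class_union {s. s < 6 \<and> (\<exists>a\<in>A. s = (a + cls c) mod 6)}"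
    (is "?L = class_union ?B")
proof (intro equalityI subsetI)
  fix z assume "z \<in> ?L"
  then obtain d where d: "d \<in> {1..<int p}" "cls d \<in> A" "z = c * d mod int p" by (auto simp: Fp_mult class_union_def)
  have "cls z = (cls d + cls c) mod 6" unfolding d(3) cls_mod cls_mult[OF unit_range[OF c] unit_range[OF d(1)]] by (simp add: add.commute)
  moreover have "z \<in> {1..<int p}" unfolding d(3) by (rule mod_range[OF not_dvd_mult[OF unit_range[OF c] unit_range[OF d(1)]]])
  ultimately show "z \<in> class_union ?B" using d(2) by (auto simp: class_union_def)
next
  fix z assume "z \<in> class_union ?B"
  then obtain a where z: "z \<in> {1..<int p}" "a \<in> A" "cls z = (a + cls c) mod 6" by (auto simp: class_union_def)
  obtain c' where c': "[c * c' = 1] (mod int p)" using inverse_exists[OF unit_range[OF c]] by blast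
  let ?d = "c' * z mod int p"
  have "[c * ?d = c * (c' * z)] (mod int p)" by (intro cong_mult) simp_all
  also have "c * (c' * z) = c * c' * z" by (simp add: mult.assoc)
  also have "[c * c' * z = 1 * z] (mod int p)" by (intro cong_mult c') simp
  finally have cd: "[c * ?d = z] (mod int p)" by simp
  hence zd: "z = c * ?d mod int p" using z(1) by (simp add: cong_def)
  have nd: "\<not> int p dvd c' * z"
  proof
    assume "int p dvd c' * z"
    hence "?d = 0" by simp
    hence "z = 0" using zd by simp
    thus False using z(1) by simp
  qed
  have d: "?d \<in> {1..<int p}" by (rule mod_range[OF nd])
  have "cls z = (cls c + cls ?d) mod 6"
    using cls_cong[OF cd] cls_mult[OF unit_range[OF c] unit_range[OF d]] by simp
  moreover have "a < 6" using z(2) A by auto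
  moreover have "cls ?d < 6" by (rule cls_less)
  moreover have "e = a" if "(a + b) mod 6 = (b + e) mod 6" "a < 6" "e < 6" for a b e :: nat
    using that shift_cancel[of e b a] by (simp add: add.commute)
  ultimately have "cls ?d = a" using z(3) by metis
  hence "?d \<in> class_union A" using d z(2) by (simp add: class_union_def)
  thus "z \<in> ?L" using zd unfolding Fp_mult by blast
qed

text \<open>Multiplication by gamma rotates the index set by \<open>cls\<close> of gamma, and every
  rotation occurs because w^k has class k. So Paley type says that some rotation of A is one of the
  two standard sets, which antipodality characterizes.\<close>

lemma paley_type_iff:
  assumes w: "w \<in> {1..<int p}" and D: "union_of_three_sextic_classes p w (class_union A)" and A: "A \<subseteq> {..<6}"
  shows "paley_type p w (class_union A) \<longleftrightarrow> antipodal A"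
proof -
  let ?C = "cyclotomic_class p 6 w"
  have C: "?C 0 \<union> ?C 2 \<union> ?C 4 = class_union {0, 2, 4}" "?C 0 \<union> ?C 1 \<union> ?C 2 = class_union {0, 1, 2}"
    unfolding cyclotomic_class_eq[OF w] by (auto simp: class_union_def)
  define B where "B k = {s. s < 6 \<and> (\<exists>a\<in>A. s = (a + k) mod 6)}" for k
  have B: "s \<in> A \<longleftrightarrow> (s + k) mod 6 \<in> B k" if "s < 6" for s k
  proof -
    have "a = s" if "a \<in> A" "(s + k) mod 6 = (a + k) mod 6" for a
    proof -
      have "a < 6" using that A by auto
      thus ?thesis using shift_cancel[OF that(2) \<open>s < 6\<close>] by simp
    qed
    moreover have "(s + k) mod 6 < 6" by simp
    ultimately show ?thesis unfolding B_def mem_Collect_eq by blast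
  qed
  have B_sub: "B k \<subseteq> {..<6}" for k by (auto simp: B_def)
  have B_eq: "B k = X \<longleftrightarrow> (\<forall>s<6. s \<in> A \<longleftrightarrow> (s + k) mod 6 \<in> X)" if "X \<subseteq> {..<6}" for k X
  proof
    assume "\<forall>s<6. s \<in> A \<longleftrightarrow> (s + k) mod 6 \<in> X"
    have key: "u \<in> B k \<longleftrightarrow> u \<in> X" if u: "u < 6" for u
    proof -
      have lt: "(u + 5 * k) mod 6 < 6" by simp
      show ?thesis using B[OF lt, of k] \<open>\<forall>s<6. s \<in> A \<longleftrightarrow> (s + k) mod 6 \<in> X\<close>[rule_format, OF lt]
        unfolding unshift(1)[OF u] by blast
    qed
    show "B k = X"
    proof (rule Set.set_eqI)
      fix u
      show "u \<in> B k \<longleftrightarrow> u \<in> X"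
      proof (cases "u < 6")
        case True
        thus ?thesis by (rule key)
      next
        case False
        hence "u \<notin> {..<6}" by simp
        thus ?thesis using B_sub[of k] that by blast
      qed
    qed
  qed (use B in blast)
  have paley: "paley_type p w (class_union A) \<longleftrightarrow> (\<exists>c\<in>{1..<int p}. B (cls c) = {0, 2, 4} \<or> B (cls c) = {0, 1, 2})"
  proof -
    have e1: "class_union (B k) = class_union X \<longleftrightarrow> B k = X" if "X \<subseteq> {..<6}" for k X
      by (rule iffI, rule class_union_inj[OF B_sub that], assumption, simp only:)
    have e2: "class_union (B k) = class_union {0, 2, 4} \<longleftrightarrow> B k = {0, 2, 4}"
      "class_union (B k) = class_union {0, 1, 2} \<longleftrightarrow> B k = {0, 1, 2}" for k by (rule e1, simp)+
    have e3: "(\<lambda>d. c \<otimes>\<^bsub>Fp p\<^esub> d) ` class_union A = class_union (B (cls c))" if "c \<in> {1..<int p}" for c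
      unfolding B_def by (rule scaled_class_union[OF that A])
    have "(\<exists>c\<in>{1..<int p}. (\<lambda>d. c \<otimes>\<^bsub>Fp p\<^esub> d) ` class_union A = class_union {0, 2, 4} \<or>
        (\<lambda>d. c \<otimes>\<^bsub>Fp p\<^esub> d) ` class_union A = class_union {0, 1, 2}) \<longleftrightarrow>
      (\<exists>c\<in>{1..<int p}. B (cls c) = {0, 2, 4} \<or> B (cls c) = {0, 1, 2})"
      by (intro bex_cong refl) (simp only: e3 e2)
    thus ?thesis unfolding paley_type_def Let_def C Fp_star_carrier[OF p_pos] by (simp only: D simp_thms)
  qed
  show ?thesis
  proof
    assume "paley_type p w (class_union A)"
    then obtain c where "B (cls c) = {0, 2, 4} \<or> B (cls c) = {0, 1, 2}" unfolding paley by (elim bexE) (rule that)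
    hence "antipodal (B (cls c))"
      by (elim disjE) (simp_all only: antipodal_standard)
    moreover have "antipodal A \<longleftrightarrow> antipodal (B (cls c))" by (rule antipodal_shift) (rule B)
    ultimately show "antipodal A" by (simp only:)
  next
    assume "antipodal A"
    from antipodal_cases[OF this] obtain k where k: "k < 6"
      "(\<forall>s<6. s \<in> A \<longleftrightarrow> (s + k) mod 6 \<in> {0, 2, 4}) \<or> (\<forall>s<6. s \<in> A \<longleftrightarrow> (s + k) mod 6 \<in> {0, 1, 2})"
      by (elim exE conjE) (rule that)
    have b: "B k = {0, 2, 4} \<longleftrightarrow> (\<forall>s<6. s \<in> A \<longleftrightarrow> (s + k) mod 6 \<in> {0, 2, 4})"
      "B k = {0, 1, 2} \<longleftrightarrow> (\<forall>s<6. s \<in> A \<longleftrightarrow> (s + k) mod 6 \<in> {0, 1, 2})" by (rule B_eq, simp)+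
    have "B k = {0, 2, 4} \<or> B k = {0, 1, 2}" unfolding b by (rule k(2))
    moreover have "cls (w ^ k mod int p) = k" using k(1) by (simp add: cls_w)
    ultimately have "B (cls (w ^ k mod int p)) = {0, 2, 4} \<or> B (cls (w ^ k mod int p)) = {0, 1, 2}" by (simp only:)
    thus "paley_type p w (class_union A)" 
      unfolding paley by (intro bexI[where x = "w ^ k mod int p"] mod_range w_power_unit)
  qed
qed

end

section \<open>Combination for a single prime and the limit along P\<close>

text \<open>p is odd and prime to 3, and modulo 3 it is the square x^2, hence 1.\<close>

lemma sextic_prime_mod_6:
  assumes p: "prime p" "p > 3" and X: "int p = x\<^sup>2 + 27 * y\<^sup>2"
  shows "p = 6 * ((p - 1) div 6) + 1"
proof -
  have three: "prime (3::nat)" by simp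
  have odd: "odd p" by (rule prime_odd_nat[OF p(1)]) (use p(2) in simp)
  have not3: "\<not> 3 dvd p"
  proof
    assume "3 dvd p"
    hence "3 = p" by (rule primes_dvd_imp_eq[OF three p(1)])
    thus False using p(2) by simp
  qed
  have eq: "int p mod 3 = (x mod 3)\<^sup>2 mod 3"
  proof -
    have "(x\<^sup>2 + 3 * (9 * y\<^sup>2)) mod 3 = x\<^sup>2 mod 3" by (rule mod_mult_self2)
    moreover have "x\<^sup>2 + 3 * (9 * y\<^sup>2) = int p" unfolding X by simp
    ultimately show ?thesis by (simp only: power_mod)
  qed
  have square: "a\<^sup>2 mod 3 = 0 \<or> a\<^sup>2 mod 3 = 1" if "a = 0 \<or> a = 1 \<or> a = 2" for a :: int using that by auto
  have "x mod 3 = 0 \<or> x mod 3 = 1 \<or> x mod 3 = 2" by presburger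
  hence "(x mod 3)\<^sup>2 mod 3 = 0 \<or> (x mod 3)\<^sup>2 mod 3 = 1" by (rule square)
  hence "int p mod 3 = 0 \<or> int p mod 3 = 1" unfolding eq .
  moreover have "int p mod 3 = int (p mod 3)" by (metis of_nat_mod of_nat_numeral)
  ultimately have "p mod 3 = 0 \<or> p mod 3 = 1" by linarith
  with not3 have "p mod 3 = 1" unfolding dvd_eq_mod_eq_0 by (elim disjE) simp_all
  with odd have mod_6: "p mod 6 = 1" by presburger
  have div_6: "p = 6 * (p div 6) + 1" using mult_div_mod_eq[of 6 p] unfolding mod_6 by (rule sym)
  hence "p - 1 = 6 * (p div 6)" by linarith
  hence "(p - 1) div 6 = 6 * (p div 6) div 6" by (simp only:)
  also have "\<dots> = p div 6" by simp
  finally have e: "(p - 1) div 6 = p div 6" .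
  show ?thesis unfolding e by (rule div_6)
qed

lemma sextic_moments:
  fixes p t :: nat and x y w v r :: int and D :: "int set"
  assumes p: "prime p" "p > 3" and X: "int p = x\<^sup>2 + 27 * y\<^sup>2"
    and w: "primitive_element p w" and D: "union_of_three_sextic_classes p w D" and v: "additive_generator p v"
  defines "f \<equiv> shifted_char_poly p D v r t"
    and "\<nu> \<equiv> if paley_type p w D \<or> even ((p - 1) div 6) then 1 else 1 / 9"
  shows "L_norm 2 f ^ 4 = (real t)\<^sup>2"
    and "\<bar>L_norm 4 f ^ 4 - (2 * real (window_sum p t 0) + \<nu> * real (window_sum p t (int t - 1 + 2 * r))
          - (1 + \<nu>) * real (card (quads t)) / real p)\<bar> \<le> moment_error p t (1 + 144 * real_of_int \<bar>y\<bar>)"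
proof -
  define g where "g = (p - 1) div 6"
  have pg: "p = 6 * g + 1" unfolding g_def by (rule sextic_prime_mod_6[OF p X])
  interpret sextic_residues p g w by (rule sextic_residues_primitive_element[OF p(1) pg w])
  have wr: "w \<in> {1..<int p}" using w Fp_star_carrier[OF p_pos] unfolding primitive_element_def by blast
  have vr: "v \<in> {1..<int p}" using v Fp_star_carrier[OF p_pos] unfolding additive_generator_def by blast
  obtain A where A: "A \<subseteq> {..<6}" "card A = 3" "D = class_union A"
    by (rule union_of_three_sextic_classes_E[OF wr D])
  \<comment> \<open>The polynomial samples D at multiples of v, and multiplication by v adds
    \<open>cls v\<close> to the class. So the sign sequence belongs to a rotation of A, which has
    the same size and is antipodal exactly when A is.\<close>
  define S where "S = {s\<in>{..<6}. (s + cls v) mod 6 \<in> A}"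
  have S: "s \<in> S \<longleftrightarrow> (s + cls v) mod 6 \<in> A" if "s < 6" for s using that by (simp add: S_def)
  have cS: "card S = 3"
  proof -
    have "bij_betw (\<lambda>s. (s + cls v) mod 6) S A"
    proof (rule bij_betwI[where g = "\<lambda>u. (u + 5 * cls v) mod 6"])
      have 1: "((u + 5 * cls v) mod 6 + cls v) mod 6 = u" "((u + cls v) mod 6 + 5 * cls v) mod 6 = u" if "u < 6" for u
        by (rule unshift[OF that])+
      show "(\<lambda>s. (s + cls v) mod 6) \<in> S \<rightarrow> A" by (auto simp: S_def)
      show "(\<lambda>u. (u + 5 * cls v) mod 6) \<in> A \<rightarrow> S"
      proof
        fix u assume u: "u \<in> A"
        have e: "((u + 5 * cls v) mod 6 + cls v) mod 6 = u" by (rule 1(1)) (use u A(1) in auto)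
        have "(u + 5 * cls v) mod 6 \<in> {..<6}" by simp
        thus "(u + 5 * cls v) mod 6 \<in> S" unfolding S_def mem_Collect_eq e using u by blast
      qed
      show "((s + cls v) mod 6 + 5 * cls v) mod 6 = s" if "s \<in> S" for s
        by (rule 1(2)) (use that in \<open>simp add: S_def\<close>)
      show "((u + 5 * cls v) mod 6 + cls v) mod 6 = u" if "u \<in> A" for u
        by (rule 1(1)) (use that A(1) in auto)
    qed
    thus ?thesis using A(2) bij_betw_same_card by metis
  qed
  have S_sub: "S \<subseteq> {..<6}" by (auto simp: S_def)
  interpret sextic_triple p g w S by unfold_locales (rule S_sub, rule cS)
  have seq: "sign_indicator D (j * v mod int p) = seq j" for j
  proof (cases "int p dvd j")
    case True
    hence "j * v mod int p = 0" by simp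
    thus ?thesis using True by (simp add: sign_indicator_def seq_def A(3) class_union_def)
  next
    case False
    have "j * v mod int p \<in> {1..<int p}" by (rule mod_range[OF not_dvd_mult[OF False unit_range[OF vr]]])
    moreover have "cls (j * v mod int p) = (cls j + cls v) mod 6"
      unfolding cls_mod by (rule cls_mult[OF False unit_range[OF vr]])
    ultimately have "j * v mod int p \<in> D \<longleftrightarrow> cls j \<in> S" using S[OF cls_less] by (simp add: A(3) class_union_def)
    thus ?thesis using False by (simp add: sign_indicator_def seq_def)
  qed
  have f: "f = (\<Sum>j<t. monom (seq (int j + r)) j)"
    unfolding f_def shifted_char_poly_def seq ..
  show "L_norm 2 f ^ 4 = (real t)\<^sup>2" unfolding f by (rule norm_estimates(1)[OF X])
  have "antipodal S \<longleftrightarrow> antipodal A" using S by (rule antipodal_shift)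
  moreover have "paley_type p w D \<longleftrightarrow> antipodal A"
    using paley_type_iff[OF wr _ A(1)] D unfolding A(3) by blast
  ultimately have "\<nu> = (\<kappa> / 6)\<^sup>2" unfolding \<kappa>_value \<nu>_def g_def[symmetric] by (simp add: disj_commute)
  thus "\<bar>L_norm 4 f ^ 4 - (2 * real (window_sum p t 0) + \<nu> * real (window_sum p t (int t - 1 + 2 * r))
          - (1 + \<nu>) * real (card (quads t)) / real p)\<bar> \<le> moment_error p t (1 + 144 * real_of_int \<bar>y\<bar>)"
    using norm_estimates(2)[OF X, of r t] unfolding f moment_main_def by (simp only:)
qed

theorem corollary2p6:
  fixes P :: "nat set"
    and x y \<omega> v r :: "nat \<Rightarrow> int"
    and D :: "nat \<Rightarrow> int set"
    and t :: "nat \<Rightarrow> nat"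
    and R T :: real
  assumes "infinite P"
    and "\<forall>p\<in>P. prime p"
    and "\<forall>p\<in>P. int p = (x p)\<^sup>2 + 27 * (y p)\<^sup>2"
    and "((\<lambda>p. (real_of_int (y p))\<^sup>2 * (ln (real p)) ^ 3 / real p) \<longlongrightarrow> 0)
           (inf at_top (principal P))"
    and "\<forall>p\<in>P. primitive_element p (\<omega> p)"
    and "\<forall>p\<in>P. union_of_three_sextic_classes p (\<omega> p) (D p)"
    and "\<forall>p\<in>P. additive_generator p (v p)"
    and "T > 0"
    and "((\<lambda>p. real_of_int (r p) / real p) \<longlongrightarrow> R) (inf at_top (principal P))"
    and "((\<lambda>p. real (t p) / real p) \<longlongrightarrow> T) (inf at_top (principal P))"
  shows
    "((\<forall>p\<in>P. paley_type p (\<omega> p) (D p) \<or> even ((p - 1) div 6)) \<longrightarrow>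
        ((\<lambda>p. merit_factor (shifted_char_poly p (D p) (v p) (r p) (t p)))
           \<longlongrightarrow> phi_nu 1 R T) (inf at_top (principal P)))
     \<and>
     ((\<forall>p\<in>P. hall_type p (\<omega> p) (D p) \<and> odd ((p - 1) div 6)) \<longrightarrow>
        ((\<lambda>p. merit_factor (shifted_char_poly p (D p) (v p) (r p) (t p)))
           \<longlongrightarrow> phi_nu (1 / 9) R T) (inf at_top (principal P)))"
proof -
  let ?F = "inf at_top (principal P) :: nat filter"
  have F: "?F \<le> at_top" by simp
  \<comment> \<open>Only p > 3 is considered, so that p = 6 g + 1 is available from
    \<open>sextic_prime_mod_6\<close>.\<close>
  have large: "eventually (\<lambda>p. p \<in> P \<and> p > 3) ?F"
    unfolding eventually_inf_principal using eventually_gt_at_top[of "3::nat"] by eventually_elim simp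
  \<comment> \<open>The two assertions differ only in the constant value of nu, so one limit
    statement serves both.\<close>
  have limit: "((\<lambda>p. merit_factor (shifted_char_poly p (D p) (v p) (r p) (t p))) \<longlongrightarrow> phi_nu \<nu> R T) ?F"
    if \<nu>: "0 \<le> \<nu>" "\<nu> \<le> 1"
      and \<nu>_eq: "\<And>p. p \<in> P \<Longrightarrow> (if paley_type p (\<omega> p) (D p) \<or> even ((p - 1) div 6) then 1 else 1 / 9) = \<nu>" for \<nu>
  proof (rule merit_factor_limit[OF F \<open>T > 0\<close> \<nu> assms(4) assms(9) assms(10)])
    let ?f = "\<lambda>p. shifted_char_poly p (D p) (v p) (r p) (t p)"
    have moments: "L_norm 2 (?f p) ^ 4 = (real (t p))\<^sup>2"
      "\<bar>L_norm 4 (?f p) ^ 4 - (2 * real (window_sum p (t p) 0) + \<nu> * real (window_sum p (t p) (int (t p) - 1 + 2 * r p))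
          - (1 + \<nu>) * real (card (quads (t p))) / real p)\<bar> \<le> moment_error p (t p) (1 + 144 * real_of_int \<bar>y p\<bar>)"
      if "p \<in> P \<and> p > 3" for p
    proof -
      have p: "p \<in> P" "p > 3" using that by simp_all
      note facts = assms(2)[rule_format, OF p(1)] p(2) assms(3)[rule_format, OF p(1)] assms(5)[rule_format, OF p(1)]
        assms(6)[rule_format, OF p(1)] assms(7)[rule_format, OF p(1)]
      show "L_norm 2 (?f p) ^ 4 = (real (t p))\<^sup>2" by (rule sextic_moments(1)[OF facts])
      show "\<bar>L_norm 4 (?f p) ^ 4 - (2 * real (window_sum p (t p) 0) + \<nu> * real (window_sum p (t p) (int (t p) - 1 + 2 * r p))
          - (1 + \<nu>) * real (card (quads (t p))) / real p)\<bar> \<le> moment_error p (t p) (1 + 144 * real_of_int \<bar>y p\<bar>)"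
        by (rule sextic_moments(2)[OF facts, unfolded \<nu>_eq[OF p(1)]])
    qed
    show "eventually (\<lambda>p. L_norm 2 (?f p) ^ 4 = (real (t p))\<^sup>2) ?F"
      using large by (rule eventually_mono) (rule moments(1))
    show "eventually (\<lambda>p. \<bar>L_norm 4 (?f p) ^ 4 - (2 * real (window_sum p (t p) 0)
          + \<nu> * real (window_sum p (t p) (int (t p) - 1 + 2 * r p))
          - (1 + \<nu>) * real (card (quads (t p))) / real p)\<bar> \<le> moment_error p (t p) (1 + 144 * real_of_int \<bar>y p\<bar>)) ?F"
      using large by (rule eventually_mono) (rule moments(2))
  qed
  show ?thesis
  proof (intro conjI impI)
    assume "\<forall>p\<in>P. paley_type p (\<omega> p) (D p) \<or> even ((p - 1) div 6)"
    thus "((\<lambda>p. merit_factor (shifted_char_poly p (D p) (v p) (r p) (t p))) \<longlongrightarrow> phi_nu 1 R T) ?F"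
      by (intro limit) auto
  next
    assume "\<forall>p\<in>P. hall_type p (\<omega> p) (D p) \<and> odd ((p - 1) div 6)"
    thus "((\<lambda>p. merit_factor (shifted_char_poly p (D p) (v p) (r p) (t p))) \<longlongrightarrow> phi_nu (1 / 9) R T) ?F"
      by (intro limit) (auto simp: hall_type_def)
  qed
qed

end
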